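(* Let $D\subset\mathbb C$ be a simply connected bounded domain such that $\partial D$ is of class $C^{1+\alpha}$, $\alpha\in(0,1)$. Let $\Phi(z)=a\bigl(z+\sum_{n\ge0}a_nz^{-n}\bigr)$, $a>0$, be the exterior conformal mapping of $D$, and let $(F_n)_{n\ge0}$ be the Faber polynomials of $D$. Set $$F(z):=a\sum_{n\ge0}\overline{a_n}\,F_n(z),\qquad H(z):=\int_{z_0}^zF(\xi)\,d\xi,$$ so that $H$ is a holomorphic primitive of $F$. Then $\mathbf 1_D$ is rotating around the origin with angular velocity $\Omega$ if and only if there is a constant $\mu\in\mathbb R$ such that $$\frac{2\Omega-1}{2}|z|^2+\operatorname{Re}H(z)=\mu\qquad\text{for all } z\in\partial D .$$
   Context: Let $\mathbb D=\{|z|<1\}$. The exterior conformal mapping is the biholomorphic map $\Phi:\mathbb C\setminus\overline{\mathbb D}\to\mathbb C\setminus\overline D$ with Laurent expansion $\Phi(z)=a\bigl(z+\sum_{n\ge0}a_nz^{-n}\bigr)$ for $|z|>1$, normalized by $a>0$ (and $a_n\in\mathbb C$). The Faber polynomial $F_n$ is the polynomial part (nonnegative powers of $z$) of the Laurent expansion at infinity of $[\Phi^{-1}(z)]^n$. The point $z_0\in D$ is fixed and the integral defining $H$ is along a path in $\overline D$ from $z_0$ to $z$; the series for $F$ is taken on $\overline D$. $\mathbf 1_D$ rotates around the origin with angular velocity $\Omega\in\mathbb R$ if $\omega(t)=\mathbf 1_{e^{i\Omega t}D}$ solves the planar Euler vorticity equation $\partial_t\omega+v\cdot\nabla\omega=0$,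 $v=\nabla^\perp\psi$, $\Delta\psi=\omega$, $\nabla^\perp=(-\partial_2,\partial_1)$; equivalently, with $\psi(z)=\frac1{2\pi}\int_D\log|z-y|\,dA(y)$, the function $\psi(z)-\frac\Omega2|z|^2$ is constant on $\partial D$. *)

theory Defs
  imports "HOL-Complex_Analysis.Complex_Analysis"
begin

section \<open>Domains with boundary of class C^(1 + alpha)\<close>

text \<open>
  The boundary of a bounded simply connected planar domain is connected, so for such a domain
  to have a boundary of class C^(1 + alpha) means that the boundary is a closed Jordan curve with a
  regular parametrization whose derivative is Hoelder continuous of exponent alpha. We take the
  parametrization 1-periodic on the whole real line, which covers the closing point.
\<close>

definition C1_holder_jordan_curve :: "real \<Rightarrow> complex set \<Rightarrow> bool" where
  "C1_holder_jordan_curve \<alpha> J \<longleftrightarrow>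
     (\<exists>g g' :: real \<Rightarrow> complex.
        (\<forall>t. (g has_vector_derivative g' t) (at t)) \<and>
        (\<forall>t. g' t \<noteq> 0) \<and>
        (\<exists>C. \<forall>s t. norm (g' s - g' t) \<le> C * \<bar>s - t\<bar> powr \<alpha>) \<and>
        (\<forall>t. g (t + 1) = g t) \<and>
        inj_on g {0..<1} \<and>
        range g = J)"


section \<open>Exterior conformal map and Faber polynomials\<close>

definition exterior_conformal_map ::
    "complex set \<Rightarrow> (complex \<Rightarrow> complex) \<Rightarrow> real \<Rightarrow> (nat \<Rightarrow> complex) \<Rightarrow> bool" where
  "exterior_conformal_map D \<Phi> a c \<longleftrightarrow>
     \<Phi> holomorphic_on (- cball 0 1) \<and>
     bij_betw \<Phi> (- cball 0 1) (- closure D) \<and>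
     inv_into (- cball 0 1) \<Phi> holomorphic_on (- closure D) \<and>
     a > 0 \<and>
     (\<forall>z. norm z > 1 \<longrightarrow>
        summable (\<lambda>n. c n / z ^ n) \<and>
        \<Phi> z = of_real a * (z + (\<Sum>n. c n / z ^ n)))"

text \<open>
  The Laurent expansion of a function f at infinity is the Laurent expansion of f(1/w) at w = 0:
  the coefficient of z^k in the former is the coefficient of w^(-k) in the latter.
  Since \<^const>\<open>fls_prpart\<close> drops the constant term, the latter is added back.
\<close>

definition polynomial_part_at_infinity :: "(complex \<Rightarrow> complex) \<Rightarrow> complex poly" where
  "polynomial_part_at_infinity f =
     (let L = laurent_expansion (\<lambda>w. f (1 / w)) 0 in fls_prpart L + [:fls_nth L 0:])"

lemma coeff_polynomial_part_at_infinity: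
  "coeff (polynomial_part_at_infinity f) k =
     fls_nth (laurent_expansion (\<lambda>w. f (1 / w)) 0) (- int k)"
  by (simp add: polynomial_part_at_infinity_def Let_def coeff_pCons split: nat.split)

definition faber_poly :: "(complex \<Rightarrow> complex) \<Rightarrow> nat \<Rightarrow> complex poly" where
  "faber_poly \<Phi> n = polynomial_part_at_infinity (\<lambda>z. inv_into (- cball 0 1) \<Phi> z ^ n)"

definition faber_series ::
    "(complex \<Rightarrow> complex) \<Rightarrow> real \<Rightarrow> (nat \<Rightarrow> complex) \<Rightarrow> complex \<Rightarrow> complex" where
  "faber_series \<Phi> a c z = of_real a * (\<Sum>n. cnj (c n) * poly (faber_poly \<Phi> n) z)"

text \<open>
  The integral of f from z0 to z along a piecewise continuously differentiable path in the closure
  of D; the path is an arbitrary one.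
\<close>

definition path_primitive ::
    "complex set \<Rightarrow> complex \<Rightarrow> (complex \<Rightarrow> complex) \<Rightarrow> complex \<Rightarrow> complex" where
  "path_primitive D z0 f z =
     contour_integral
       (SOME p. valid_path p \<and> path_image p \<subseteq> closure D \<and> pathstart p = z0 \<and> pathfinish p = z) f"


section \<open>Rotating vortex patches\<close>

text \<open>
  The plane is identified with the complex numbers. The stream function is the solution of
  \<open>\<Delta>\<psi> = \<omega>\<close> given by the logarithmic potential.
\<close>

definition stream_function :: "(complex \<Rightarrow> real) \<Rightarrow> complex \<Rightarrow> real" where
  "stream_function \<omega> z = 1 / (2 * pi) * (LINT y|lborel. ln (norm (z - y)) * \<omega> y)"

definition perp_gradient :: "(complex \<Rightarrow> real) \<Rightarrow> complex \<Rightarrow> complex" where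
  "perp_gradient \<psi> z =
     Complex (- frechet_derivative \<psi> (at z) \<i>) (frechet_derivative \<psi> (at z) 1)"

definition velocity :: "(complex \<Rightarrow> real) \<Rightarrow> complex \<Rightarrow> complex" where
  "velocity \<omega> = perp_gradient (stream_function \<omega>)"

definition C1_test_function :: "(real \<times> complex \<Rightarrow> real) \<Rightarrow> bool" where
  "C1_test_function \<phi> \<longleftrightarrow>
     (\<exists>\<phi>'. (\<forall>p. (\<phi> has_derivative blinfun_apply (\<phi>' p)) (at p)) \<and> continuous_on UNIV \<phi>') \<and>
     compact (closure {p. \<phi> p \<noteq> 0})"

text \<open>
  Vortex patches are discontinuous, so the vorticity equation
  \<open>\<partial>\<^sub>t \<omega> + v \<cdot> \<nabla>\<omega> = 0\<close> is understood in the usual weak sense: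
  since v is divergence free it reads \<open>\<partial>\<^sub>t \<omega> + div (\<omega> v) = 0\<close>, which
  is tested against continuously differentiable functions \<open>\<phi>\<close> of compact support in
  space-time. The derivative of \<open>\<phi>\<close> at (t, z) in the direction (1, v) is
  \<open>\<partial>\<^sub>t \<phi> + v \<cdot> \<nabla>\<phi>\<close>.
\<close>

definition euler_weak_solution :: "(real \<Rightarrow> complex \<Rightarrow> real) \<Rightarrow> bool" where
  "euler_weak_solution \<omega> \<longleftrightarrow>
     (\<forall>\<phi>. C1_test_function \<phi> \<longrightarrow>
        (LINT t|lborel. LINT z|lborel.
           \<omega> t z * frechet_derivative \<phi> (at (t, z)) (1, velocity (\<omega> t) z)) = 0)"

definition rotating_patch :: "complex set \<Rightarrow> real \<Rightarrow> bool" where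
  "rotating_patch D \<Omega> \<longleftrightarrow>
     euler_weak_solution (\<lambda>t. indicator ((\<lambda>z. cis (\<Omega> * t) * z) ` D))"

end

theory Submission
  imports Defs
begin

text \<open>
  Write W for the Cauchy transform of the indicator function of D. The stream function has gradient
  \<open>\<partial>\<psi> = Re (W dz) / (2\<pi>)\<close>. Applying the Cauchy--Pompeiu formula to \<open>cnj z\<close> and expanding
  \<open>\<Phi>'/(\<Phi> - z)\<close> into Faber polynomials on the exterior gives \<open>F z = cnj z - W z / \<pi>\<close> on the closure
  of D, so \<open>Re H\<close> equals \<open>\<bar>z\<bar>\<^sup>2/2 - 2\<psi>\<close> up to a constant, and the boundary condition of the theorem
  says that \<open>\<Psi> = \<psi> - \<Omega>\<bar>z\<bar>\<^sup>2/2\<close> is constant on the boundary.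

  The Faber series converges uniformly on the closure of D: by Bloch's theorem the Faber polynomials
  grow slowly in the mean over dyadic blocks, while the area theorem bounds the coefficients by the
  area of the image of thin annuli, which decays because near a \<open>C\<^sup>1\<close> boundary \<open>\<bar>\<Phi>\<^sup>-\<^sup>1\<bar> - 1\<close> is bounded below
  by a power of the distance to the boundary.

  In the rotating frame the weak vorticity equation becomes \<open>\<integral>\<^sub>D \<nabla>\<eta> \<cdot> X = 0\<close> for all test functions
  \<open>\<eta>\<close>, where X is the perpendicular gradient of \<open>\<Psi>\<close>. If \<open>\<Psi>\<close> is a constant \<open>\<mu>\<close> on the boundary, this
  holds since \<open>\<Psi> - \<mu>\<close> extended by zero is Lipschitz. Conversely, testing with logarithms
  shows that the Cauchy transform of X on D, divided by \<open>2\<pi>\<i>\<close>, is real; it is holomorphic outside D and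
  differs from \<open>\<Psi>\<close> by a holomorphic function inside D, so it is constant outside and equals
  \<open>\<Psi>\<close> plus a constant inside, and it is continuous.
\<close>

section \<open>Lebesgue measure on the complex plane\<close>

text \<open>The obstacle is the boundary: the hypotheses control \<Phi> only off the closed unit
  disc. All estimates are therefore made on the lines Re s = x of the half-plane coordinate, with x
  tending to 0. The Faber series is decided by a competition between two powers of x. Bloch's
  theorem gives |P s - z| >= const x^48 for z in the closure of D, by integrating the derivative
  bound 48/x. The size of this exponent is harmless: a power b = 1/(16 * 48) of the distance already
  makes |z - y|^(-2) integrable, so the Faber blocks grow at most like 2^(k/16). A regular C^1
  boundary gives dist^4 <= const x, hence images of thin annuli of area O(x^(1/4)) and coefficient
  blocks of size 2^(-k/4), which wins. Green's formula enters on rectangles in exponential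
  coordinates, where the 2 pi periodic sides cancel. Integration by parts over D is replaced by
  translation invariance of Lebesgue measure.\<close>

lemma measurable_Complex [measurable]:
  "(\<lambda>p. Complex (fst p) (snd p)) \<in> borel_measurable (lborel \<Otimes>\<^sub>M lborel)"
proof -
  have "continuous_on UNIV (\<lambda>p. Complex (fst p) (snd p))"
    by (intro continuous_intros)
  then have "(\<lambda>p. Complex (fst p) (snd p)) \<in> borel_measurable borel"
    by (rule borel_measurable_continuous_onI)
  then show ?thesis by (simp add: lborel_prod)
qed

text \<open>Opens the way to iterated integrals over real and imaginary parts. Lebesgue measure is
  determined by its values on boxes, so only the areas of rectangles have to be compared.\<close>

lemma lborel_complex:
  "(lborel :: complex measure) = distr (lborel \<Otimes>\<^sub>M lborel) borel (\<lambda>p. Complex (fst p) (snd p))"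
proof (rule lborel_eqI)
  fix l u :: complex
  assume le: "\<And>b. b \<in> Basis \<Longrightarrow> l \<bullet> b \<le> u \<bullet> b"
  have le': "Re l \<le> Re u" "Im l \<le> Im u"
    using le[of 1] le[of \<i>] by (auto simp: Basis_complex_def)
  have eq: "(\<lambda>p. Complex (fst p) (snd p)) -` box l u = {Re l<..<Re u} \<times> {Im l<..<Im u}"
    by (auto simp: box_def Basis_complex_def)
  have "emeasure (distr (lborel \<Otimes>\<^sub>M lborel) borel (\<lambda>p. Complex (fst p) (snd p))) (box l u) =
    emeasure (lborel \<Otimes>\<^sub>M lborel) ({Re l<..<Re u} \<times> {Im l<..<Im u})"
    by (subst emeasure_distr) (auto simp: eq space_pair_measure)
  also have "\<dots> = ennreal (Re u - Re l) * ennreal (Im u - Im l)"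
    using le' by (subst lborel.emeasure_pair_measure_Times) auto
  also have "\<dots> = ennreal (\<Prod>b\<in>Basis. (u - l) \<bullet> b)"
    using le' by (simp add: Basis_complex_def ennreal_mult)
  finally show "emeasure (distr (lborel \<Otimes>\<^sub>M lborel) borel (\<lambda>p. Complex (fst p) (snd p))) (box l u) =
    ennreal (\<Prod>b\<in>Basis. (u - l) \<bullet> b)" .
qed simp

section \<open>Change of variables for injective holomorphic maps\<close>

definition cplx2 :: "real ^ 2 \<Rightarrow> complex" where "cplx2 v = Complex (v $ 1) (v $ 2)"
definition vec2 :: "complex \<Rightarrow> real ^ 2" where "vec2 z = (\<chi> i. if i = 1 then Re z else Im z)"

lemma cplx2_vec2 [simp]: "cplx2 (vec2 z) = z"
  by (simp add: cplx2_def vec2_def complex_eq_iff)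

lemma vec2_cplx2 [simp]: "vec2 (cplx2 v) = v"
  by (simp add: cplx2_def vec2_def vec_eq_iff forall_2)

lemma bounded_linear_cplx2: "bounded_linear cplx2"
  by (rule linear_conv_bounded_linear[THEN iffD1], rule linearI)
     (auto simp: cplx2_def complex_eq_iff)

lemma bounded_linear_vec2: "bounded_linear vec2"
  by (rule linear_conv_bounded_linear[THEN iffD1], rule linearI)
     (auto simp: vec2_def vec_eq_iff)

lemma measurable_cplx2 [measurable]: "cplx2 \<in> borel_measurable borel"
  by (intro borel_measurable_continuous_onI linear_continuous_on bounded_linear_cplx2)

lemma measurable_vec2 [measurable]: "vec2 \<in> borel_measurable borel"
  by (intro borel_measurable_continuous_onI linear_continuous_on bounded_linear_vec2)

text \<open>The Jacobian formula is applied over \<open>real ^ 2\<close>; this identifies Lebesgue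
  measure there with that of \<open>complex\<close>, again by comparing boxes.\<close>

lemma lborel_cplx2: "(lborel :: complex measure) = distr lborel borel cplx2"
proof (rule lborel_eqI)
  fix l u :: complex
  assume le: "\<And>b. b \<in> Basis \<Longrightarrow> l \<bullet> b \<le> u \<bullet> b"
  have le': "Re l \<le> Re u" "Im l \<le> Im u"
    using le[of 1] le[of \<i>] by (auto simp: Basis_complex_def)
  have eq: "cplx2 -` box l u = box (vec2 l) (vec2 u)"
    by (auto simp: box_def Basis_complex_def cplx2_def vec2_def Basis_vec_def
        cart_eq_inner_axis[symmetric] inner_axis forall_2)
  have le2: "\<forall>b\<in>Basis. vec2 l \<bullet> b \<le> vec2 u \<bullet> b"
    using le' by (auto simp: Basis_vec_def inner_axis vec2_def)
  have inj: "inj (\<lambda>i::2. axis i (1::real))" by (auto simp: inj_on_def axis_eq_axis)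
  have B: "(Basis :: (real^2) set) = (\<lambda>i. axis i 1) ` UNIV" by (auto simp: Basis_vec_def)
  have "(\<Prod>b\<in>(Basis :: (real^2) set). (vec2 u - vec2 l) \<bullet> b) =
    (\<Prod>i\<in>UNIV. (vec2 u - vec2 l) $ i)"
    unfolding B using inj by (subst prod.reindex) (auto simp: inner_axis)
  also have "\<dots> = (\<Prod>b\<in>Basis. (u - l) \<bullet> b)"
    by (simp add: UNIV_2 Basis_complex_def vec2_def)
  finally have P: "(\<Prod>b\<in>(Basis :: (real^2) set). (vec2 u - vec2 l) \<bullet> b) = (\<Prod>b\<in>Basis. (u - l) \<bullet> b)" .
  have "emeasure (distr lborel borel cplx2) (box l u) = emeasure lborel (box (vec2 l) (vec2 u))"
    by (subst emeasure_distr) (auto simp: eq)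
  also have "\<dots> = ennreal (\<Prod>b\<in>Basis. (u - l) \<bullet> b)"
    using le2 by (simp add: emeasure_lborel_box_eq P)
  finally show "emeasure (distr lborel borel cplx2) (box l u) = ennreal (\<Prod>b\<in>Basis. (u - l) \<bullet> b)" .
qed simp

text \<open>With d = p + i q the matrix has rows (p, -q) and (q, p), so the real Jacobian of a
  holomorphic map is the squared modulus of its derivative.\<close>

lemma det_mult_complex:
  "det (matrix (\<lambda>v. vec2 (d * cplx2 v))) = (norm d)\<^sup>2"
  by (simp add: det_2 matrix_def vec2_def cplx2_def axis_def cmod_power2)
     (simp add: power2_eq_square)

text \<open>Integrability and value are both transported by the real Jacobian formula, with the
  complex derivative supplying the determinant. The integrability half matters later: integrals over
  unbounded strips are known to converge only through their images in the plane.\<close>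

theorem
  fixes f h :: "complex \<Rightarrow> complex"
  assumes U: "open U" and hol: "f holomorphic_on U" and inj: "inj_on f U"
    and h [measurable]: "h \<in> borel_measurable borel"
  shows holomorphic_cov_integrable: "set_integrable lborel (f ` U) h \<longleftrightarrow>
      set_integrable lborel U (\<lambda>s. (norm (deriv f s))\<^sup>2 *\<^sub>R h (f s))" (is ?th1)
    and holomorphic_cov_integral: "(LINT y:f ` U|lborel. h y) =
      (LINT s:U|lborel. (norm (deriv f s))\<^sup>2 *\<^sub>R h (f s))" (is ?th2)
proof -
  have ofU: "open (f ` U)" using open_mapping_thm3[OF hol U inj] .
  define V where "V = cplx2 -` U"
  define g where "g v = vec2 (f (cplx2 v))" for v
  define g' where "g' v w = vec2 (deriv f (cplx2 v) * cplx2 w)" for v w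
  define H where "H v = vec2 (h (cplx2 v))" for v
  have oV: "open V" unfolding V_def
    using U linear_continuous_on[OF bounded_linear_cplx2] continuous_open_vimage
    by (metis continuous_on_open_vimage open_UNIV Int_UNIV_right)
  have der: "(g has_derivative g' v) (at v within V)" if "v \<in> V" for v
  proof -
    have "(f has_field_derivative deriv f (cplx2 v)) (at (cplx2 v))"
      using that U hol by (intro holomorphic_derivI) (auto simp: V_def)
    then have 1: "(f has_derivative (\<lambda>w. deriv f (cplx2 v) * w)) (at (cplx2 v))"
      by (simp add: has_field_derivative_def)
    have 2: "(cplx2 has_derivative cplx2) (at v)"
      using bounded_linear_imp_has_derivative[OF bounded_linear_cplx2] .
    have 3: "((\<lambda>v. f (cplx2 v)) has_derivative (\<lambda>w. deriv f (cplx2 v) * cplx2 w)) (at v)"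
      using has_derivative_compose[OF 2 1] by simp
    have "(g has_derivative g' v) (at v)"
      unfolding g_def g'_def by (rule bounded_linear.has_derivative[OF bounded_linear_vec2 3])
    then show ?thesis by (rule has_derivative_at_withinI)
  qed
  have injg: "inj_on g V"
    using inj unfolding inj_on_def g_def V_def by (metis cplx2_vec2 vec2_cplx2 vimageE)
  have gV: "g ` V = cplx2 -` (f ` U)"
  proof -
    have "x \<in> g ` V" if "cplx2 x \<in> f ` U" for x
    proof -
      from that obtain u where "u \<in> U" "cplx2 x = f u" by blast
      then have "vec2 u \<in> V" "x = g (vec2 u)" unfolding V_def g_def
        by (auto simp del: vec2_cplx2) (metis vec2_cplx2)
      then show ?thesis by blast
    qed
    then show ?thesis by (auto simp: g_def V_def)
  qed
  have detg: "\<bar>det (matrix (g' v))\<bar> = (norm (deriv f (cplx2 v)))\<^sup>2" for v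
    unfolding g'_def by (simp add: det_mult_complex)
  have key: "((\<lambda>x. \<bar>det (matrix (g' x))\<bar> *\<^sub>R H (g x)) absolutely_integrable_on V \<and>
      integral V (\<lambda>x. \<bar>det (matrix (g' x))\<bar> *\<^sub>R H (g x)) = b) \<longleftrightarrow>
     (H absolutely_integrable_on (g ` V) \<and> integral (g ` V) H = b)" for b
    using oV der injg by (intro has_absolute_integral_change_of_variables) auto
  have G: "\<bar>det (matrix (g' x))\<bar> *\<^sub>R H (g x) = vec2 ((norm (deriv f (cplx2 x)))\<^sup>2 *\<^sub>R h (f (cplx2 x)))" for x
    unfolding detg H_def g_def
    by (simp add: linear_cmul[OF bounded_linear.linear[OF bounded_linear_vec2]])
  define q where "q s = indicator U s *\<^sub>R ((norm (deriv f s))\<^sup>2 *\<^sub>R h (f s))" for s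
  have qm [measurable]: "q \<in> borel_measurable borel"
  proof -
    have c: "continuous_on U (deriv f)"
      using holomorphic_deriv[OF hol U] by (rule holomorphic_on_imp_continuous_on)
    have cm: "(\<lambda>s. indicator U s *\<^sub>R deriv f s) \<in> borel_measurable borel"
      using borel_measurable_continuous_on_indicator[OF _ c] U by auto
    have fm: "(\<lambda>s. indicator U s *\<^sub>R f s) \<in> borel_measurable borel"
      using borel_measurable_continuous_on_indicator[OF _ holomorphic_on_imp_continuous_on[OF hol]] U by auto
    have Um [measurable]: "U \<in> sets borel" using U by simp
    \<comment> \<open>Cutting \<open>deriv f\<close> and \<open>f\<close> off outside U makes them
      globally Borel and leaves q unchanged, since q carries the same indicator.\<close>
    have "q = (\<lambda>s. indicator U s *\<^sub>R ((norm (indicator U s *\<^sub>R deriv f s))\<^sup>2 *\<^sub>R h (indicator U s *\<^sub>R f s)))"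
      by (auto simp: q_def indicator_def)
    also have "\<dots> \<in> borel_measurable borel" using cm fm by measurable
    finally show ?thesis .
  qed
  define p where "p y = indicator (f ` U) y *\<^sub>R h y" for y
  have pm [measurable]: "p \<in> borel_measurable borel"
  proof -
    have [measurable]: "f ` U \<in> sets borel" using ofU by simp
    show ?thesis unfolding p_def by measurable
  qed
  have l2: "integrable (lborel :: (real^2) measure) (\<lambda>v. vec2 (k (cplx2 v))) \<longleftrightarrow> integrable lborel k"
    (is "?a1 = ?a2")
    and l3: "(\<integral>v. vec2 (k (cplx2 v)) \<partial>lborel) = vec2 (integral\<^sup>L lborel k)"
    if [measurable]: "k \<in> borel_measurable borel" for k :: "complex \<Rightarrow> complex"
  proof -
    have A: "integrable lborel k \<longleftrightarrow> integrable lborel (\<lambda>v. k (cplx2 v))"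
      by (subst lborel_cplx2, subst integrable_distr_eq) auto
    have B: "integrable lborel (\<lambda>v. vec2 (k (cplx2 v))) \<longleftrightarrow> integrable lborel (\<lambda>v. k (cplx2 v))"
    proof
      assume "integrable lborel (\<lambda>v. vec2 (k (cplx2 v)))"
      from integrable_bounded_linear[OF bounded_linear_cplx2 this]
      show "integrable lborel (\<lambda>v. k (cplx2 v))" by simp
    qed (rule integrable_bounded_linear[OF bounded_linear_vec2])
    show "?a1 = ?a2" using A B by simp
    show "(\<integral>v. vec2 (k (cplx2 v)) \<partial>lborel) = vec2 (integral\<^sup>L lborel k)"
    proof (cases "integrable lborel k")
      case True
      have "(\<integral>v. vec2 (k (cplx2 v)) \<partial>lborel) = vec2 (\<integral>v. k (cplx2 v) \<partial>lborel)"
        using True A by (intro integral_bounded_linear[OF bounded_linear_vec2]) auto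
      also have "(\<integral>v. k (cplx2 v) \<partial>lborel) = integral\<^sup>L lborel k"
        by (subst lborel_cplx2, subst integral_distr) auto
      finally show ?thesis .
    next
      case False
      \<comment> \<open>A divergent integral has the default value 0, and \<open>vec2\<close> maps 0
        to 0, so the identity survives.\<close>
      then have "\<not> integrable lborel (\<lambda>v. vec2 (k (cplx2 v)))" using A B by simp
      then have "(\<integral>v. vec2 (k (cplx2 v)) \<partial>lborel) = 0" by (rule not_integrable_integral_eq)
      moreover have "vec2 0 = 0" by (simp add: vec2_def vec_eq_iff)
      ultimately show ?thesis using False by (simp add: not_integrable_integral_eq)
    qed
  qed
  have iV: "indicator V x *\<^sub>R (\<bar>det (matrix (g' x))\<bar> *\<^sub>R H (g x)) = vec2 (q (cplx2 x))" for x
    unfolding G q_def V_def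
    by (auto simp: indicator_def linear_0[OF bounded_linear.linear[OF bounded_linear_vec2]])
  have igV: "indicator (g ` V) x *\<^sub>R H x = vec2 (p (cplx2 x))" for x
    unfolding gV p_def H_def
    by (auto simp: indicator_def linear_0[OF bounded_linear.linear[OF bounded_linear_vec2]])
  have a1: "(\<lambda>x. \<bar>det (matrix (g' x))\<bar> *\<^sub>R H (g x)) absolutely_integrable_on V \<longleftrightarrow> integrable lborel q"
    unfolding set_integrable_def iV l2[OF qm, symmetric] by (subst integrable_completion) auto
  have a2: "H absolutely_integrable_on (g ` V) \<longleftrightarrow> integrable lborel p"
    unfolding set_integrable_def igV l2[OF pm, symmetric] by (subst integrable_completion) auto
  have i1: "integral V (\<lambda>x. \<bar>det (matrix (g' x))\<bar> *\<^sub>R H (g x)) = vec2 (integral\<^sup>L lborel q)"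
    if "integrable lborel q"
  proof -
    have "integral V (\<lambda>x. \<bar>det (matrix (g' x))\<bar> *\<^sub>R H (g x)) =
      (LINT x:V|lebesgue. \<bar>det (matrix (g' x))\<bar> *\<^sub>R H (g x))"
      using set_lebesgue_integral_eq_integral(2) a1 that by (metis (no_types, lifting))
    also have "\<dots> = vec2 (integral\<^sup>L lborel q)"
      unfolding set_lebesgue_integral_def iV l3[OF qm, symmetric] by (subst integral_completion) auto
    finally show ?thesis .
  qed
  have i2: "integral (g ` V) H = vec2 (integral\<^sup>L lborel p)"
    if "integrable lborel p"
  proof -
    have "integral (g ` V) H = (LINT x:g ` V|lebesgue. H x)"
      using set_lebesgue_integral_eq_integral(2) a2 that by (metis (no_types, lifting))
    also have "\<dots> = vec2 (integral\<^sup>L lborel p)"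
      unfolding set_lebesgue_integral_def igV l3[OF pm, symmetric] by (subst integral_completion) auto
    finally show ?thesis .
  qed
  have iff: "integrable lborel p \<longleftrightarrow> integrable lborel q"
    using key a1 a2 by blast
  show ?th1 using iff unfolding set_integrable_def p_def[abs_def] q_def[abs_def] .
  have "integral\<^sup>L lborel p = integral\<^sup>L lborel q"
  proof (cases "integrable lborel q")
    case True
    then have "vec2 (integral\<^sup>L lborel p) = vec2 (integral\<^sup>L lborel q)"
      using key i1 i2 a1 a2 iff by metis
    then show ?thesis by (metis cplx2_vec2)
  next
    case False
    then show ?thesis using iff by (simp add: not_integrable_integral_eq)
  qed
  then show ?th2 unfolding set_lebesgue_integral_def p_def[abs_def] q_def[abs_def] .
qed

section \<open>Cauchy transforms and logarithmic potentials\<close>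

lemma powr_three_half: "x \<ge> 0 \<Longrightarrow> x powr (3/2) = x * sqrt (x::real)"
  using powr_add[of x 1 "1/2"] by (simp add: powr_half_sqrt)

text \<open>On the shell 2^(-k-1) < |y| <= 2^(-k) the kernel is at most 2^(q(k+1)), while the disc
  of radius 2^(-k) has area pi 4^(-k). The products form a geometric series of ratio 2^(q-2),
  convergent because q < 2.\<close>

lemma singular_kernel_unit:
  assumes q: "0 < q" "q < (2::real)"
  shows "(\<integral>\<^sup>+y. ennreal (norm (y::complex) powr (-q)) * indicator (cball 0 1) y \<partial>lborel) < \<infinity>"
proof -
  define t where "t k = ennreal (2 powr (q * (real k + 1)))" for k :: nat
  have pw: "ennreal (norm y powr (-q)) * indicator (cball 0 1) y
      \<le> (\<Sum>k. t k * indicator (cball 0 (2 powr (- real k))) y)" for y :: complex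
  proof (cases "y \<noteq> 0 \<and> norm y \<le> 1")
    case False
    then show ?thesis by (auto simp: indicator_def)
  next
    case True
    define k where "k = nat \<lfloor>- log 2 (norm y)\<rfloor>"
    have l0: "log 2 (norm y) \<le> 0" using True by simp
    have k: "real k \<le> - log 2 (norm y)" "- log 2 (norm y) < real k + 1"
      using l0 unfolding k_def by linarith+
    have ny: "norm y = 2 powr (log 2 (norm y))" using True by simp
    have "norm y \<le> 2 powr (- real k)"
      by (subst ny) (use k in auto)
    then have ind: "indicator (cball 0 (2 powr (- real k))) y = (1::ennreal)" by simp
    have "norm y powr (-q) = 2 powr (log 2 (norm y) * (-q))"
      by (subst ny) (simp only: powr_powr)
    also have "\<dots> \<le> 2 powr (q * (real k + 1))"
    proof -
      have "(- log 2 (norm y)) * q \<le> (real k + 1) * q"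
        using k(2) q by (intro mult_right_mono) auto
      then show ?thesis by (simp add: mult.commute)
    qed
    finally have "ennreal (norm y powr (-q)) \<le> t k" unfolding t_def by (rule ennreal_leI)
    also have "\<dots> = (\<Sum>j\<in>{k}. t j * indicator (cball 0 (2 powr (- real j))) y)" using ind by simp
    also have "\<dots> \<le> (\<Sum>k. t k * indicator (cball 0 (2 powr (- real k))) y)"
      by (rule sum_le_suminf) auto
    finally show ?thesis using True by simp
  qed
  have em: "emeasure lborel (cball (0::complex) (2 powr (- real k))) = ennreal (pi * (2 powr (- real k))\<^sup>2)" for k
    by (subst emeasure_cball) (auto simp: unit_ball_vol_2)
  have "(\<integral>\<^sup>+y. ennreal (norm (y::complex) powr (-q)) * indicator (cball 0 1) y \<partial>lborel)
      \<le> (\<integral>\<^sup>+y. (\<Sum>k. t k * indicator (cball 0 (2 powr (- real k))) (y::complex)) \<partial>lborel)"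
    by (rule nn_integral_mono) (rule pw)
  also have "\<dots> = (\<Sum>k. \<integral>\<^sup>+y. t k * indicator (cball 0 (2 powr (- real k))) (y::complex) \<partial>lborel)"
    by (intro nn_integral_suminf borel_measurable_times_ennreal borel_measurable_const
        borel_measurable_indicator) auto
  also have "\<dots> = (\<Sum>k. t k * ennreal (pi * (2 powr (- real k))\<^sup>2))"
    by (subst nn_integral_cmult_indicator) (auto simp: em)
  also have "\<dots> = (\<Sum>k. ennreal ((pi * 2 powr q) * (2 powr (q - 2)) ^ k))"
  proof (rule suminf_cong)
    fix k
    have "2 powr (q * (real k + 1)) * (pi * (2 powr (- real k))\<^sup>2) = (pi * 2 powr q) * (2 powr (q - 2)) ^ k"
      by (simp add: powr_realpow[symmetric] powr_powr powr_add[symmetric] algebra_simps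
          flip: powr_numeral) (simp add: powr_add[symmetric] algebra_simps powr_minus)?
    then show "t k * ennreal (pi * (2 powr (- real k))\<^sup>2) = ennreal ((pi * 2 powr q) * (2 powr (q - 2)) ^ k)"
      unfolding t_def by (subst ennreal_mult[symmetric]) auto
  qed
  also have "\<dots> = ennreal (\<Sum>k. (pi * 2 powr q) * (2 powr (q - 2)) ^ k)"
  proof (rule suminf_ennreal2)
    have "(2::real) powr (q - 2) < 2 powr 0" using q by (intro powr_less_mono) auto
    then show "summable (\<lambda>k. (pi * 2 powr q) * (2 powr (q - 2)) ^ k)"
      by (intro summable_mult summable_geometric) auto
  qed auto
  also have "\<dots> < \<infinity>" by simp
  finally show ?thesis .
qed

text \<open>One constant serves all centres z: within distance 1 of z the integral is translated to
  the unit disc, and farther out the kernel is at most 1, which contributes at most the measure of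
  E.\<close>

lemma singular_kernel:
  assumes q: "0 < q" "q < (2::real)"
  obtains C where "C \<ge> 0"
    "\<And>z E. E \<in> sets borel \<Longrightarrow> emeasure lborel E < \<infinity> \<Longrightarrow>
       set_integrable lborel E (\<lambda>y. norm (z - y::complex) powr (-q))"
    "\<And>z E. E \<in> sets borel \<Longrightarrow> emeasure lborel E < \<infinity> \<Longrightarrow>
       (LINT y:E|lborel. norm (z - y::complex) powr (-q)) \<le> C + measure lborel E"
proof -
  define A where "A = (\<integral>\<^sup>+y. ennreal (norm (y::complex) powr (-q)) * indicator (cball 0 1) y \<partial>lborel)"
  have Af: "A < \<infinity>" unfolding A_def by (rule singular_kernel_unit[OF q])
  have [measurable]: "cball (0::complex) 1 \<in> sets borel" by simp
  have bd: "(\<integral>\<^sup>+y. ennreal (indicator E y *\<^sub>R norm (z - y::complex) powr (-q)) \<partial>lborel) \<le> A + emeasure lborel E"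
    if E [measurable]: "E \<in> sets borel" for z E
  proof -
    have "ennreal (indicator E y *\<^sub>R norm (z - y) powr (-q)) \<le>
      ennreal (norm (z - y) powr (-q)) * indicator (cball 0 1) (z - y) + indicator E y" for y
    proof (cases "norm (z - y) \<le> 1")
      case False
      then have "1 \<le> norm (z - y) powr q" using q by (intro ge_one_powr_ge_zero) auto
      then have "norm (z - y) powr (-q) \<le> 1" by (simp add: powr_minus inverse_le_1_iff)
      then have "ennreal (norm (z - y) powr (-q)) \<le> 1" by (simp add: ennreal_le_1)
      then show ?thesis using False by (auto simp: indicator_def)
    qed (auto simp: indicator_def)
    then have "(\<integral>\<^sup>+y. ennreal (indicator E y *\<^sub>R norm (z - y) powr (-q)) \<partial>lborel) \<le>
      (\<integral>\<^sup>+y. ennreal (norm (z - y) powr (-q)) * indicator (cball 0 1) (z - y) + indicator E y \<partial>lborel)"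
      by (intro nn_integral_mono)
    also have "\<dots> = (\<integral>\<^sup>+y. ennreal (norm (z - y) powr (-q)) * indicator (cball 0 1) (z - y) \<partial>lborel)
        + emeasure lborel E"
      by (subst nn_integral_add) auto
    also have "(\<integral>\<^sup>+y. ennreal (norm (z - y) powr (-q)) * indicator (cball 0 1) (z - y) \<partial>lborel) = A"
    proof -
      have L: "(lborel :: complex measure) = distr lborel borel (\<lambda>y. z - y)"
        using lborel_affine[of "-1::real" z] by (simp add: density_1)
      show ?thesis unfolding A_def by (subst (2) L, subst nn_integral_distr) auto
    qed
    finally show ?thesis .
  qed
  show ?thesis
  proof (rule that[of "enn2real A"])
    fix z :: complex and E :: "complex set"
    assume E [measurable]: "E \<in> sets borel" and fin: "emeasure lborel E < \<infinity>"
    have lt: "(\<integral>\<^sup>+y. ennreal (indicator E y *\<^sub>R norm (z - y::complex) powr (-q)) \<partial>lborel) < \<infinity>"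
    proof -
      have "A + emeasure lborel E < \<infinity>" using Af fin by (simp add: less_top)
      then show ?thesis using bd[OF E, of z] by (rule order.strict_trans1[rotated])
    qed
    show int: "set_integrable lborel E (\<lambda>y. norm (z - y::complex) powr (-q))"
      unfolding set_integrable_def by (rule integrableI_nonneg) (use lt in auto)
    have "ennreal (LINT y:E|lborel. norm (z - y) powr (-q)) \<le> A + emeasure lborel E"
      unfolding set_lebesgue_integral_def
      using nn_integral_eq_integral[OF int[unfolded set_integrable_def]] bd[OF E, of z] by auto
    also have "\<dots> = ennreal (enn2real A + measure lborel E)"
      using Af fin by (auto simp: measure_def ennreal_enn2real_if top.not_eq_extremum)
    finally show "(LINT y:E|lborel. norm (z - y) powr (-q)) \<le> enn2real A + measure lborel E"
      by (subst (asm) ennreal_le_iff) (auto intro!: add_nonneg_nonneg)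
  qed auto
qed

text \<open>One square root of |a - b| is kept and the other is spent on lowering the singularity:
  with A = |a|^(-1/2) and B = |b|^(-1/2) the left side is at most sqrt|a - b| (A B^2 + A^2 B). The
  exponent 3/2 is still below 2, so the right side can be integrated.\<close>

lemma inverse_diff_bound:
  fixes a b :: complex
  assumes "a \<noteq> 0" "b \<noteq> 0"
  shows "norm (1 / a - 1 / b) \<le> sqrt (norm (a - b)) * (norm a powr (-(3/2)) + norm b powr (-(3/2)))"
proof -
  define A where "A = 1 / sqrt (norm a)"
  define B where "B = 1 / sqrt (norm b)"
  have pos: "A > 0" "B > 0" using assms by (auto simp: A_def B_def)
  have A2: "A\<^sup>2 = 1 / norm a" "B\<^sup>2 = 1 / norm b" by (auto simp: A_def B_def power_divide)
  have p: "norm x powr (-(3/2)) = (1 / sqrt (norm x)) ^ 3" if "x \<noteq> 0" for x :: complex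
  proof -
    have "norm x powr (-(3/2)) = 1 / (norm x * sqrt (norm x))"
      using powr_three_half[of "norm x"] powr_minus[of "norm x" "3/2"] by (simp add: field_simps)
    also have "\<dots> = (1 / sqrt (norm x)) ^ 3"
      by (simp add: power3_eq_cube field_simps)
    finally show ?thesis .
  qed
  have h: "sqrt (norm (a - b)) \<le> sqrt (norm a) + sqrt (norm b)"
  proof (rule real_le_lsqrt)
    have "norm (a - b) \<le> norm a + norm b" by (rule norm_triangle_ineq4)
    also have "\<dots> \<le> (sqrt (norm a) + sqrt (norm b))\<^sup>2" by (simp add: power2_sum)
    finally show "norm (a - b) \<le> (sqrt (norm a) + sqrt (norm b))\<^sup>2" .
  qed auto
  have "norm (1 / a - 1 / b) = norm (a - b) * (A\<^sup>2 * B\<^sup>2)"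
    using assms by (simp add: A2 diff_frac_eq norm_divide norm_mult norm_minus_commute)
  also have "norm (a - b) = sqrt (norm (a - b)) * sqrt (norm (a - b))" by simp
  also have "\<dots> * (A\<^sup>2 * B\<^sup>2) \<le> sqrt (norm (a - b)) * (sqrt (norm a) + sqrt (norm b)) * (A\<^sup>2 * B\<^sup>2)"
    using h by (intro mult_right_mono mult_left_mono) auto
  also have "\<dots> = sqrt (norm (a - b)) * (A * B\<^sup>2 + A\<^sup>2 * B)"
  proof -
    have e: "sqrt (norm a) * A = 1" "sqrt (norm b) * B = 1" using assms by (auto simp: A_def B_def)
    have "(sqrt (norm a) + sqrt (norm b)) * (A\<^sup>2 * B\<^sup>2) =
        (sqrt (norm a) * A) * A * B\<^sup>2 + A\<^sup>2 * B * (sqrt (norm b) * B)"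
      by (simp add: power2_eq_square algebra_simps)
    also have "\<dots> = A * B\<^sup>2 + A\<^sup>2 * B" by (simp only: e mult_1_left mult_1_right)
    finally show ?thesis by (simp only: mult.assoc)
  qed
  also have "\<dots> \<le> sqrt (norm (a - b)) * (A ^ 3 + B ^ 3)"
  proof (rule mult_left_mono)
    \<comment> \<open>Expanding this product gives A^3 + B^3 - A^2 B - A B^2.\<close>
    have "0 \<le> (A + B) * (A - B)\<^sup>2" using pos by simp
    then show "A * B\<^sup>2 + A\<^sup>2 * B \<le> A ^ 3 + B ^ 3"
      by (simp add: power2_eq_square power3_eq_cube algebra_simps)
  qed auto
  finally show ?thesis unfolding p[OF assms(1)] p[OF assms(2)] A_def B_def .
qed

text \<open>This is ln x <= x - 1 at x = |1 + w|^2, halved.\<close>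

lemma ln_norm_one_plus_le:
  assumes "1 + w \<noteq> (0::complex)"
  shows "ln (norm (1 + w)) \<le> Re w + (norm w)\<^sup>2 / 2"
proof -
  have "2 * ln (norm (1 + w)) = ln ((norm (1 + w))\<^sup>2)" using assms by (simp add: ln_realpow)
  also have "\<dots> \<le> (norm (1 + w))\<^sup>2 - 1" using assms by (intro ln_le_minus_one) auto
  also have "\<dots> = 2 * Re w + (norm w)\<^sup>2" by (simp only: cmod_power2) (simp add: power2_eq_square algebra_simps)
  finally show ?thesis by simp
qed

text \<open>A first-order expansion whose remainder stays integrable in a even when h is comparable
  to a: the singularities at a = 0 and a + h = 0 have exponent 3/2 < 2, while |h|^(3/2) is still
  o(|h|).\<close>

lemma ln_norm_expansion:
  fixes a h :: complex
  assumes a: "a \<noteq> 0" and b: "a + h \<noteq> 0"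
  shows "\<bar>ln (norm (a + h)) - ln (norm a) - Re (h / a)\<bar> \<le>
    4 * norm h powr (3/2) * (norm a powr (-(3/2)) + norm (a + h) powr (-(3/2)))"
proof -
  define w where "w = h / a"
  define t where "t = norm w"
  define s where "s = norm h / norm (a + h)"
  have t0: "t \<ge> 0" and s0: "s \<ge> 0" by (auto simp: t_def s_def)
  have ts: "norm h powr (3/2) * (norm a powr (-(3/2)) + norm (a + h) powr (-(3/2))) = t * sqrt t + s * sqrt s"
  proof -
    have "norm h powr (3/2) * norm a powr (-(3/2)) = t powr (3/2)"
      using a by (simp add: t_def w_def norm_divide powr_divide powr_minus field_simps)
    moreover have "norm h powr (3/2) * norm (a + h) powr (-(3/2)) = s powr (3/2)"
      using b by (simp add: s_def powr_divide powr_minus field_simps)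
    ultimately show ?thesis using powr_three_half t0 s0 by (simp add: algebra_simps)
  qed
  have w1: "1 + w = (a + h) / a" "1 + w \<noteq> 0" using a b by (auto simp: w_def field_simps)
  have eq: "ln (norm (a + h)) - ln (norm a) = ln (norm (1 + w))"
    using a b by (simp add: w1 norm_divide ln_div)
  have Rw: "\<bar>Re w\<bar> \<le> t" unfolding t_def by (rule abs_Re_le_cmod)
  have main: "\<bar>ln (norm (1 + w)) - Re w\<bar> \<le> 4 * (t * sqrt t + s * sqrt s)"
  proof (cases "t \<le> 1/2")
    case True
    have up: "ln (norm (1 + w)) \<le> Re w + t\<^sup>2 / 2" unfolding t_def by (rule ln_norm_one_plus_le[OF w1(2)])
    \<comment> \<open>Since 1 + v = 1/(1 + w), the upper estimate at v is a lower estimate of ln|1 +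
      w|.\<close>
    define v where "v = - w / (1 + w)"
    have v1: "1 + v = 1 / (1 + w)" using w1(2) by (simp add: v_def field_simps)
    have n1: "norm (1 + w) \<ge> 1/2"
    proof -
      have "norm (1::complex) \<le> norm (1 + w) + norm w"
        using norm_triangle_ineq4[of "1 + w" w] by simp
      then show ?thesis using True by (simp add: t_def)
    qed
    then have "0 < norm (1 + w)" by linarith
    with n1 have n2: "1 / norm (1 + w) \<le> 2" by (simp add: field_simps)
    have "- ln (norm (1 + w)) = ln (norm (1 + v))" using w1(2) by (simp add: v1 norm_divide ln_div)
    also have "\<dots> \<le> Re v + (norm v)\<^sup>2 / 2" using v1 w1(2) by (intro ln_norm_one_plus_le) auto
    also have "Re v = - Re w + Re (w * w / (1 + w))"
    proof -
      have "v = - w + w * w / (1 + w)" using w1(2) by (simp add: v_def field_simps)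
      then show ?thesis by simp
    qed
    also have "Re (w * w / (1 + w)) \<le> norm (w * w / (1 + w))" by (rule complex_Re_le_cmod)
    also have "\<dots> \<le> t\<^sup>2 * 2"
    proof -
      have "norm (w * w / (1 + w)) = t\<^sup>2 * (1 / norm (1 + w))"
        by (simp add: norm_divide norm_mult t_def power2_eq_square)
      also have "\<dots> \<le> t\<^sup>2 * 2" using n2 by (intro mult_left_mono) auto
      finally show ?thesis .
    qed
    also have "(norm v)\<^sup>2 \<le> (t * 2)\<^sup>2"
    proof (rule power_mono)
      have "norm v = t * (1 / norm (1 + w))" by (simp add: norm_divide v_def t_def)
      also have "\<dots> \<le> t * 2" using n2 t0 by (intro mult_left_mono) auto
      finally show "norm v \<le> t * 2" .
    qed simp
    finally have lo: "- ln (norm (1 + w)) \<le> - Re w + t\<^sup>2 * 2 + (t * 2)\<^sup>2 / 2"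
      by simp
    have "\<bar>ln (norm (1 + w)) - Re w\<bar> \<le> 4 * t\<^sup>2" using up lo by (simp add: power_mult_distrib)
    also have "t\<^sup>2 \<le> t * sqrt t"
    proof -
      have "t \<le> sqrt t" using t0 True by (intro real_le_rsqrt) (auto simp: power2_eq_square mult_left_le)
      then show ?thesis using t0 by (auto simp: power2_eq_square intro!: mult_left_mono)
    qed
    finally show ?thesis using s0 by (simp add: add_increasing2)
  next
    case False
    \<comment> \<open>Here h is not small against a or a + h: t > 1/2 and s >= 1/4. So t and s are
      bounded by twice their powers 3/2, and crude bounds for the logarithm suffice.\<close>
    have "1/2 \<le> sqrt t" using False by (intro real_le_rsqrt) (auto simp: power2_eq_square)
    then have tt: "t \<le> 2 * (t * sqrt t)" using t0 mult_left_mono[of "1/2" "sqrt t" t] by simp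
    have "norm (a + h) \<le> norm a + norm h" by (rule norm_triangle_ineq)
    also have "norm a \<le> 2 * norm h" using False a by (simp add: t_def w_def norm_divide field_simps)
    finally have "norm (a + h) \<le> 4 * norm h" using norm_ge_zero[of h] by linarith
    then have "s \<ge> 1/4" using b by (simp add: s_def field_simps)
    then have "1/2 \<le> sqrt s" by (intro real_le_rsqrt) (auto simp: power2_eq_square)
    then have ss: "s \<le> 2 * (s * sqrt s)" using s0 mult_left_mono[of "1/2" "sqrt s" s] by simp
    have "ln (norm (1 + w)) \<le> norm (1 + w) - 1" using w1(2) by (intro ln_le_minus_one) auto
    also have "\<dots> \<le> t" using norm_triangle_ineq[of 1 w] by (simp add: t_def)
    finally have up: "ln (norm (1 + w)) \<le> t" .
    have "- ln (norm (1 + w)) = ln (norm (a / (a + h)))" using a b by (simp add: w1 norm_divide ln_div)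
    also have "\<dots> \<le> norm (a / (a + h)) - 1" using a b by (intro ln_le_minus_one) auto
    also have "\<dots> \<le> s"
    proof -
      have "a / (a + h) = 1 - h / (a + h)" using b by (simp add: field_simps)
      then show ?thesis using norm_triangle_ineq4[of 1 "h / (a + h)"] by (simp add: s_def norm_divide)
    qed
    finally have lo: "- ln (norm (1 + w)) \<le> s" .
    show ?thesis using up lo tt ss Rw t0 s0 by (simp add: abs_le_iff)
  qed
  then show ?thesis using ts eq by (simp add: w_def mult.assoc)
qed

text \<open>The quotient of the remainder by |h| is O(sqrt |h|). The exponent 3/2 is the one that
  the kernel estimates produce.\<close>

lemma has_derivative_from_bound:
  fixes f :: "'a::real_normed_vector \<Rightarrow> 'b::real_normed_vector"
  assumes L: "bounded_linear L" and r: "r > 0"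
    and b: "\<And>h. norm h < r \<Longrightarrow> norm (f (z + h) - f z - L h) \<le> C * norm h powr (3/2)"
  shows "(f has_derivative L) (at z)"
  unfolding has_derivative_at
proof (intro conjI L)
  have lim: "((\<lambda>h::'a. C * sqrt (norm h)) \<longlongrightarrow> C * sqrt (norm (0::'a))) (at 0)"
    by (intro tendsto_intros)
  show "(\<lambda>h. norm (f (z + h) - f z - L h) / norm h) \<midarrow>0\<rightarrow> 0"
  proof (rule Lim_null_comparison)
    show "((\<lambda>h::'a. C * sqrt (norm h)) \<longlongrightarrow> 0) (at 0)" using lim by simp
    show "\<forall>\<^sub>F h in at 0. norm (norm (f (z + h) - f z - L h) / norm h) \<le> C * sqrt (norm h)"
      unfolding eventually_at
    proof (intro exI[of _ r] conjI ballI impI r)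
      fix h :: 'a assume "h \<noteq> 0 \<and> dist h 0 < r"
      then have "norm (f (z + h) - f z - L h) \<le> C * (norm h * sqrt (norm h))" "norm h > 0"
        using b[of h] by (auto simp: powr_three_half)
      then show "norm (norm (f (z + h) - f z - L h) / norm h) \<le> C * sqrt (norm h)"
        by (simp add: field_simps)
    qed
  qed
qed

section \<open>Cauchy transform and logarithmic potential of a bounded density\<close>

lemma norm_integral_le_AE:
  fixes f :: "'a \<Rightarrow> 'b::{banach, second_countable_topology}"
  assumes "integrable M f" "integrable M g" "AE x in M. norm (f x) \<le> g x"
  shows "norm (integral\<^sup>L M f) \<le> integral\<^sup>L M g"
  using integral_norm_bound[of M f] integral_mono_AE[OF integrable_norm[OF assms(1)] assms(2,3)]
  by linarith

text \<open>A class of densities against which every kernel |z - y|^(-q) with 0 < q < 2 is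
  integrable, with a bound uniform in z.\<close>

definition bdd_density :: "(complex \<Rightarrow> complex) \<Rightarrow> bool" where
  "bdd_density f \<longleftrightarrow> f \<in> borel_measurable borel \<and>
     (\<exists>M R. \<forall>y. norm (f y) \<le> M \<and> (norm y > R \<longrightarrow> f y = 0))"

text \<open>Convolution with 1/z, that is, with pi times the fundamental solution of the dbar
  operator; hence the factors pi in what follows.\<close>

definition cauchy_transform :: "(complex \<Rightarrow> complex) \<Rightarrow> complex \<Rightarrow> complex" where
  "cauchy_transform f z = (LINT y|lborel. f y / (z - y))"

lemma norm_powr_minus_one: "norm x powr (-1) = 1 / norm (x::'a::real_normed_vector)"
  by (cases "x = 0") (auto simp: powr_minus_divide)

lemma bdd_density_measurable: "bdd_density f \<Longrightarrow> f \<in> borel_measurable borel"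
  by (simp add: bdd_density_def)

lemma bdd_density_integrable:
  assumes f: "bdd_density f"
  shows "integrable lborel f"
proof -
  have [measurable]: "f \<in> borel_measurable borel" using f by (rule bdd_density_measurable)
  obtain M R where MR: "\<And>y. norm (f y) \<le> M" "\<And>y. norm y > R \<Longrightarrow> f y = 0"
    using f unfolding bdd_density_def by blast
  have fin: "emeasure lborel (cball (0::complex) R) < \<infinity>"
    using emeasure_bounded_finite[of "cball (0::complex) R"] by simp
  have "integrable lborel (\<lambda>y::complex. M * indicator (cball 0 R) y)"
    using fin by (intro integrable_mult_right integrable_real_indicator) auto
  then show ?thesis
  proof (rule Bochner_Integration.integrable_bound)
    show "AE x in lborel. norm (f x) \<le> norm (M * indicator (cball 0 R) x)"
      using MR order_trans[OF norm_ge_zero MR(1)]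
      by (intro always_eventually) (auto simp: indicator_def abs_of_nonneg)
  qed auto
qed

lemma bdd_density_kernel:
  assumes f: "bdd_density f" and q: "0 < q" "q < (2::real)"
  shows "\<exists>C\<ge>0. \<forall>z. integrable lborel (\<lambda>y. norm (f y) * norm (z - y) powr (-q)) \<and>
    (LINT y|lborel. norm (f y) * norm (z - y) powr (-q)) \<le> C"
proof -
  have [measurable]: "f \<in> borel_measurable borel" using f by (rule bdd_density_measurable)
  obtain M R where MR: "\<And>y. norm (f y) \<le> M" "\<And>y. norm y > R \<Longrightarrow> f y = 0"
    using f unfolding bdd_density_def by blast
  obtain C where C: "C \<ge> 0"
    "\<And>z E. E \<in> sets borel \<Longrightarrow> emeasure lborel E < \<infinity> \<Longrightarrow>
       set_integrable lborel E (\<lambda>y. norm (z - y::complex) powr (-q))"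
    "\<And>z E. E \<in> sets borel \<Longrightarrow> emeasure lborel E < \<infinity> \<Longrightarrow>
       (LINT y:E|lborel. norm (z - y::complex) powr (-q)) \<le> C + measure lborel E"
    using singular_kernel[OF q] by blast
  define E where "E = cball (0::complex) R"
  have E: "E \<in> sets borel" "emeasure lborel E < \<infinity>"
    unfolding E_def using emeasure_bounded_finite[of "cball (0::complex) R"] by auto
  have M0: "M \<ge> 0" using order_trans[OF norm_ge_zero MR(1)] .
  have i1: "integrable lborel (\<lambda>y. M * (indicator E y *\<^sub>R norm (z - y) powr (-q)))" for z
    using C(2)[OF E, of z] unfolding set_integrable_def by (rule integrable_mult_right)
  have le: "norm (f y) * norm (z - y) powr (-q) \<le> M * (indicator E y *\<^sub>R norm (z - y) powr (-q))" for z y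
    using MR[of y] by (auto simp: indicator_def E_def intro!: mult_right_mono)
  have i2: "integrable lborel (\<lambda>y. norm (f y) * norm (z - y) powr (-q))" for z
  proof (rule Bochner_Integration.integrable_bound[OF i1[of z]])
    show "AE x in lborel. norm (norm (f x) * norm (z - x) powr - q)
           \<le> norm (M * (indicator E x *\<^sub>R norm (z - x) powr - q))"
      using le[of _ z] M0 by (intro always_eventually) (auto simp: abs_mult indicator_def)
  qed auto
  show ?thesis
  proof (intro exI[of _ "M * (C + measure lborel E)"] conjI allI)
    fix z
    show "(LINT y|lborel. norm (f y) * norm (z - y) powr (-q)) \<le> M * (C + measure lborel E)"
    proof -
      have "(LINT y|lborel. norm (f y) * norm (z - y) powr (-q)) \<le>
         (LINT y|lborel. M * (indicator E y *\<^sub>R norm (z - y) powr (-q)))"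
        by (rule integral_mono[OF i2 i1 le])
      also have "\<dots> = M * (LINT y:E|lborel. norm (z - y) powr (-q))"
        unfolding set_lebesgue_integral_def by simp
      also have "\<dots> \<le> M * (C + measure lborel E)"
        using C(3)[OF E, of z] M0 by (intro mult_left_mono) auto
      finally show ?thesis .
    qed
  qed (use M0 C(1) i2 in auto)
qed

lemma bdd_density_kernel_1:
  assumes "bdd_density f"
  shows "\<exists>C\<ge>0. \<forall>z. integrable lborel (\<lambda>y. norm (f y) * norm (z - y) powr (-1)) \<and>
    (LINT y|lborel. norm (f y) * norm (z - y) powr (-1)) \<le> C"
  by (rule bdd_density_kernel[OF assms]) auto

lemma bdd_density_kernel_3_2:
  assumes "bdd_density f"
  shows "\<exists>C\<ge>0. \<forall>z. integrable lborel (\<lambda>y. norm (f y) * norm (z - y) powr (-(3/2))) \<and>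
    (LINT y|lborel. norm (f y) * norm (z - y) powr (-(3/2))) \<le> C"
  by (rule bdd_density_kernel[OF assms]) auto

lemma cauchy_transform_integrable:
  assumes f: "bdd_density f"
  shows "integrable lborel (\<lambda>y. f y / (z - y))"
proof -
  have [measurable]: "f \<in> borel_measurable borel" using f by (rule bdd_density_measurable)
  obtain C where "integrable lborel (\<lambda>y. norm (f y) * norm (z - y) powr (-1))"
    using bdd_density_kernel_1[OF f] by blast
  then show ?thesis
    by (rule Bochner_Integration.integrable_bound) (auto simp: norm_divide norm_powr_minus_one)
qed

text \<open>The exceptional points y = z and y = w, where division by zero returns 0, form a null
  set. Elsewhere the bound for differences of reciprocals applies, and its kernels of exponent 3/2
  have integrals bounded independently of z and w.\<close>

lemma cauchy_transform_hoelder: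
  assumes f: "bdd_density f"
  shows "\<exists>C. \<forall>z w. norm (cauchy_transform f z - cauchy_transform f w) \<le> C * sqrt (norm (z - w))"
proof -
  have [measurable]: "f \<in> borel_measurable borel" using f by (rule bdd_density_measurable)
  obtain C where C: "\<And>z. integrable lborel (\<lambda>y. norm (f y) * norm (z - y) powr (-(3/2)))"
    "\<And>z. (LINT y|lborel. norm (f y) * norm (z - y) powr (-(3/2))) \<le> C"
    using bdd_density_kernel_3_2[OF f] by blast
  have "norm (cauchy_transform f z - cauchy_transform f w) \<le> (2 * C) * sqrt (norm (z - w))" for z w
  proof -
    have "norm (cauchy_transform f z - cauchy_transform f w) =
        norm (LINT y|lborel. f y / (z - y) - f y / (w - y))"
      unfolding cauchy_transform_def
      by (subst Bochner_Integration.integral_diff) (auto intro: cauchy_transform_integrable f)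
    also have "\<dots> \<le> (LINT y|lborel. sqrt (norm (z - w)) *
        (norm (f y) * norm (z - y) powr (-(3/2)) + norm (f y) * norm (w - y) powr (-(3/2))))"
    proof (rule norm_integral_le_AE)
      show "integrable lborel (\<lambda>y. f y / (z - y) - f y / (w - y))"
        by (intro Bochner_Integration.integrable_diff cauchy_transform_integrable f)
      show "integrable lborel (\<lambda>y. sqrt (norm (z - w)) *
        (norm (f y) * norm (z - y) powr (-(3/2)) + norm (f y) * norm (w - y) powr (-(3/2))))"
        by (intro integrable_mult_right Bochner_Integration.integrable_add C)
      show "AE y in lborel. norm (f y / (z - y) - f y / (w - y)) \<le> sqrt (norm (z - w)) *
        (norm (f y) * norm (z - y) powr (-(3/2)) + norm (f y) * norm (w - y) powr (-(3/2)))"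
        using AE_lborel_singleton[of z] AE_lborel_singleton[of w]
      proof eventually_elim
        case (elim y)
        have "norm (1 / (z - y) - 1 / (w - y)) \<le> sqrt (norm (z - w)) * (norm (z - y) powr (-(3/2)) + norm (w - y) powr (-(3/2)))"
          using inverse_diff_bound[of "z - y" "w - y"] elim by simp
        then have "norm (f y) * norm (1 / (z - y) - 1 / (w - y)) \<le>
            norm (f y) * (sqrt (norm (z - w)) * (norm (z - y) powr (-(3/2)) + norm (w - y) powr (-(3/2))))"
          by (rule mult_left_mono) simp
        also have "\<dots> = sqrt (norm (z - w)) *
            (norm (f y) * norm (z - y) powr (-(3/2)) + norm (f y) * norm (w - y) powr (-(3/2)))"
          by (simp add: distrib_left mult.left_commute)
        also have "norm (f y) * norm (1 / (z - y) - 1 / (w - y)) = norm (f y / (z - y) - f y / (w - y))"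
          by (simp add: right_diff_distrib flip: norm_mult)
        finally show ?case .
      qed
    qed
    also have "\<dots> = sqrt (norm (z - w)) * ((LINT y|lborel. norm (f y) * norm (z - y) powr (-(3/2)))
        + (LINT y|lborel. norm (f y) * norm (w - y) powr (-(3/2))))"
      using C(1) by simp
    also have "\<dots> \<le> sqrt (norm (z - w)) * (C + C)"
      by (intro mult_left_mono add_mono C) auto
    finally show ?thesis by (simp add: mult.commute)
  qed
  then show ?thesis by blast
qed

lemma cauchy_transform_continuous:
  assumes f: "bdd_density f"
  shows "continuous_on S (cauchy_transform f)"
proof -
  obtain C where C: "\<And>z w. norm (cauchy_transform f z - cauchy_transform f w) \<le> C * sqrt (norm (z - w))"
    using cauchy_transform_hoelder[OF f] by blast
  have "(cauchy_transform f \<longlongrightarrow> cauchy_transform f w) (at w)" for w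
  proof (rule LIM_zero_cancel, rule Lim_null_comparison)
    show "\<forall>\<^sub>F z in at w. norm (cauchy_transform f z - cauchy_transform f w) \<le> C * sqrt (norm (z - w))"
      using C by (intro always_eventually) auto
    have "((\<lambda>z. C * sqrt (norm (z - w))) \<longlongrightarrow> C * sqrt (norm (w - w))) (at w)"
      by (intro tendsto_intros)
    then show "((\<lambda>z. C * sqrt (norm (z - w))) \<longlongrightarrow> 0) (at w)" by simp
  qed
  then show ?thesis
    by (intro continuous_at_imp_continuous_on) (auto simp: isCont_def)
qed

text \<open>Off the support one may differentiate under the integral. Points y with f y nonzero have
  |z - y| >= 2 r, so for |h| < r the remainder h^2 / (a^2 (a + h)) with a = z - y is at most |h|^2 /
  (4 r^3) in modulus.\<close>

lemma cauchy_transform_holomorphic: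
  assumes f: "bdd_density f" and U: "open U" and z: "\<And>y. y \<in> U \<Longrightarrow> f y = 0"
  shows "cauchy_transform f holomorphic_on U"
proof -
  have [measurable]: "f \<in> borel_measurable borel" using f by (rule bdd_density_measurable)
  have fi: "integrable lborel f" by (rule bdd_density_integrable[OF f])
  have "\<exists>D. (cauchy_transform f has_field_derivative D) (at z)" if "z \<in> U" for z
  proof -
    from U that obtain e where e: "e > 0" "ball z e \<subseteq> U" by (meson openE)
    define r where "r = e / 2"
    have r: "r > 0" using e by (simp add: r_def)
    have far: "2 * r \<le> norm (z - y)" if "f y \<noteq> 0" for y
      using that e z[of y] by (force simp: r_def dist_norm)
    define D where "D = - (LINT y|lborel. f y / (z - y)\<^sup>2)"
    have i2: "integrable lborel (\<lambda>y. f y / (z - y)\<^sup>2)"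
    proof (rule Bochner_Integration.integrable_bound)
      show "integrable lborel (\<lambda>y. (1 / (2 * r)\<^sup>2) * norm (f y))"
        using fi by (intro integrable_mult_right integrable_norm)
      show "AE y in lborel. norm (f y / (z - y)\<^sup>2) \<le> norm ((1 / (2 * r)\<^sup>2) * norm (f y))"
      proof (intro always_eventually allI)
        fix y
        show "norm (f y / (z - y)\<^sup>2) \<le> norm ((1 / (2 * r)\<^sup>2) * norm (f y))"
        proof (cases "f y = 0")
          case False
          have "(2 * r)\<^sup>2 \<le> (norm (z - y))\<^sup>2" using far[OF False] r by (intro power_mono) auto
          then have "norm (f y) / (norm (z - y))\<^sup>2 \<le> norm (f y) / (2 * r)\<^sup>2"
            using r by (intro divide_left_mono) (auto intro!: mult_pos_pos)
          then show ?thesis by (simp add: norm_divide norm_power)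
        qed simp
      qed
    qed auto
    have "(cauchy_transform f has_derivative (\<lambda>h. D * h)) (at z)"
    proof (rule has_derivative_from_bound[OF _ r])
      show "bounded_linear (\<lambda>h. D * h)" by (rule bounded_linear_mult_right)
      fix h :: complex assume h: "norm h < r"
      have "cauchy_transform f (z + h) - cauchy_transform f z - D * h =
         (LINT y|lborel. f y / (z + h - y) - f y / (z - y) + f y / (z - y)\<^sup>2 * h)"
        unfolding cauchy_transform_def D_def using i2
        by (simp add: cauchy_transform_integrable f integrable_mult_left del: times_divide_eq_left)
      also have "norm \<dots> \<le> (LINT y|lborel. (norm h)\<^sup>2 / (4 * r ^ 3) * norm (f y))"
      proof (rule norm_integral_le_AE)
        show "integrable lborel (\<lambda>y. f y / (z + h - y) - f y / (z - y) + f y / (z - y)\<^sup>2 * h)"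
          using i2 by (intro Bochner_Integration.integrable_add Bochner_Integration.integrable_diff
             cauchy_transform_integrable f integrable_mult_left)
        show "integrable lborel (\<lambda>y. (norm h)\<^sup>2 / (4 * r ^ 3) * norm (f y))"
          using fi by (intro integrable_mult_right integrable_norm)
        show "AE y in lborel. norm (f y / (z + h - y) - f y / (z - y) + f y / (z - y)\<^sup>2 * h)
          \<le> (norm h)\<^sup>2 / (4 * r ^ 3) * norm (f y)"
        proof (intro always_eventually allI)
          fix y
          show "norm (f y / (z + h - y) - f y / (z - y) + f y / (z - y)\<^sup>2 * h)
            \<le> (norm h)\<^sup>2 / (4 * r ^ 3) * norm (f y)"
          proof (cases "f y = 0")
            case False
            define a where "a = z - y"
            have a: "2 * r \<le> norm a" using far[OF False] by (simp add: a_def)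
            have b: "r \<le> norm (a + h)"
              using a h norm_triangle_ineq4[of "a + h" h] by simp
            have ah: "z + h - y = a + h" by (simp add: a_def)
            have nz: "a \<noteq> 0" "a + h \<noteq> 0" using a b r by auto
            have "f y / (a + h) - f y / a + f y / a\<^sup>2 * h = f y * h\<^sup>2 / (a\<^sup>2 * (a + h))"
              using nz by (simp add: divide_simps power2_eq_square) (simp add: algebra_simps)
            then have "norm (f y / (z + h - y) - f y / (z - y) + f y / (z - y)\<^sup>2 * h) =
               norm (f y) * (norm h)\<^sup>2 / ((norm a)\<^sup>2 * norm (a + h))"
              using ah by (simp only: a_def[symmetric] norm_divide norm_mult norm_power)
            also have "\<dots> \<le> norm (f y) * (norm h)\<^sup>2 / ((2 * r)\<^sup>2 * r)"
              using a b r by (intro divide_left_mono mult_mono power_mono) (auto intro!: mult_pos_pos simp: nz)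
            also have "\<dots> = (norm h)\<^sup>2 / (4 * r ^ 3) * norm (f y)"
            proof -
              have e: "(2 * r)\<^sup>2 * r = 4 * r ^ 3" by (simp add: power2_eq_square power3_eq_cube)
              show ?thesis unfolding e by simp
            qed
            finally show ?thesis .
          qed simp
        qed
      qed
      also have "\<dots> = (norm h)\<^sup>2 * ((LINT y|lborel. norm (f y)) / (4 * r ^ 3))" by simp
      \<comment> \<open>The quadratic remainder is weakened to the exponent 3/2 only to match the
        common differentiability criterion.\<close>
      also have "\<dots> \<le> (sqrt r * norm h powr (3/2)) * ((LINT y|lborel. norm (f y)) / (4 * r ^ 3))"
      proof (rule mult_right_mono)
        have "(norm h)\<^sup>2 = norm h * sqrt (norm h) * sqrt (norm h)" by (simp add: power2_eq_square)
        also have "\<dots> \<le> norm h * sqrt (norm h) * sqrt r" using h by (intro mult_left_mono) auto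
        finally show "(norm h)\<^sup>2 \<le> sqrt r * norm h powr (3/2)"
          by (simp add: powr_three_half mult_ac)
        show "0 \<le> (LINT y|lborel. norm (f y)) / (4 * r ^ 3)"
          using r by (intro divide_nonneg_pos) auto
      qed
      finally show "norm (cauchy_transform f (z + h) - cauchy_transform f z - D * h) \<le>
         (sqrt r * ((LINT y|lborel. norm (f y)) / (4 * r ^ 3))) * norm h powr (3/2)"
        by (simp add: mult_ac)
    qed
    then show ?thesis by (auto simp: has_field_derivative_def)
  qed
  then show ?thesis using U by (auto simp: holomorphic_on_open)
qed

text \<open>Uses |ln t| <= 1/t + t: the first term is an integrable kernel, and t is bounded on the
  support of f.\<close>

lemma log_potential_integrable:
  fixes f :: "complex \<Rightarrow> real"
  assumes f: "bdd_density (\<lambda>y. of_real (f y))"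
  shows "integrable lborel (\<lambda>y. ln (norm (z - y)) * f y)"
proof -
  define g where "g y = complex_of_real (f y)" for y
  have g: "bdd_density g" using f by (simp add: g_def[abs_def])
  have "(\<lambda>y. Re (g y)) \<in> borel_measurable borel" using bdd_density_measurable[OF g] by measurable
  then have [measurable]: "f \<in> borel_measurable borel" by (simp add: g_def)
  obtain M R where MR: "\<And>y. norm (g y) \<le> M" "\<And>y. norm y > R \<Longrightarrow> g y = 0"
    using g unfolding bdd_density_def by blast
  obtain C where C: "\<And>z. integrable lborel (\<lambda>y. norm (g y) * norm (z - y) powr (-1))"
    using bdd_density_kernel_1[OF g] by blast
  have "integrable lborel (\<lambda>y. norm (g y) * norm (z - y) powr (-1) + (norm z + \<bar>R\<bar>) * norm (g y))"
    by (intro Bochner_Integration.integrable_add C integrable_mult_right integrable_norm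
       bdd_density_integrable g)
  then show ?thesis
  proof (rule Bochner_Integration.integrable_bound)
    show "AE y in lborel. norm (ln (norm (z - y)) * f y) \<le>
       norm (norm (g y) * norm (z - y) powr (-1) + (norm z + \<bar>R\<bar>) * norm (g y))"
      using AE_lborel_singleton[of z]
    proof eventually_elim
      case (elim y)
      define t where "t = norm (z - y)"
      have t: "t > 0" using elim by (simp add: t_def)
      have "\<bar>ln t\<bar> \<le> 1 / t + t"

      proof -
        have "ln t \<le> t - 1" "- ln t \<le> 1 / t - 1" "1 / t > 0"
          using ln_le_minus_one[OF t] ln_le_minus_one[of "1 / t"] t by (auto simp: ln_div)
        then show ?thesis using t by linarith
      qed
      then have "\<bar>ln t\<bar> * norm (g y) \<le> (1 / t + t) * norm (g y)" by (rule mult_right_mono) simp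
      also have "\<dots> = norm (g y) / t + t * norm (g y)" by (simp add: algebra_simps)
      also have "t * norm (g y) \<le> (norm z + \<bar>R\<bar>) * norm (g y)"
      proof (cases "g y = 0")
        case False
        then have "norm y \<le> R" using MR(2)[of y] by force
        then have "t \<le> norm z + \<bar>R\<bar>" unfolding t_def using norm_triangle_ineq4[of z y] by linarith
        then show ?thesis by (rule mult_right_mono) simp
      qed simp
      finally have le: "\<bar>ln t\<bar> * norm (g y) \<le> norm (g y) / t + (norm z + \<bar>R\<bar>) * norm (g y)" by simp
      have e1: "norm (ln (norm (z - y)) * f y) = \<bar>ln t\<bar> * norm (g y)"
        by (simp only: real_norm_def abs_mult g_def norm_of_real t_def)
      have e2: "norm (g y) * norm (z - y) powr (-1) = norm (g y) / t"
        by (simp only: norm_powr_minus_one t_def times_divide_eq_right mult_1_right)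
      have "norm (g y) / t + (norm z + \<bar>R\<bar>) * norm (g y) \<le> norm (norm (g y) / t + (norm z + \<bar>R\<bar>) * norm (g y))"
        by simp
      with le show ?case unfolding e1 e2 by (rule order_trans)
    qed
  qed auto
qed

text \<open>The derivative exists at every z, also where f jumps, so the stream function of a patch
  is differentiable across its boundary. The kernels centred at z and z + h have a common bound,
  which makes the integrated remainder O(|h|^(3/2)).\<close>

lemma log_potential_has_derivative:
  fixes f :: "complex \<Rightarrow> real"
  assumes f: "bdd_density (\<lambda>y. of_real (f y))"
  shows "((\<lambda>z. LINT y|lborel. ln (norm (z - y)) * f y) has_derivative
    (\<lambda>h. Re (h * cauchy_transform (\<lambda>y. of_real (f y)) z))) (at z)"
proof -
  define g where "g y = complex_of_real (f y)" for y
  have g: "bdd_density g" using f by (simp add: g_def[abs_def])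
  have "(\<lambda>y. Re (g y)) \<in> borel_measurable borel" using bdd_density_measurable[OF g] by measurable
  then have [measurable]: "f \<in> borel_measurable borel" by (simp add: g_def)
  obtain C where C: "\<And>z. integrable lborel (\<lambda>y. norm (g y) * norm (z - y) powr (-(3/2)))"
    "\<And>z. (LINT y|lborel. norm (g y) * norm (z - y) powr (-(3/2))) \<le> C"
    using bdd_density_kernel_3_2[OF g] by blast
  define W where "W = cauchy_transform g z"
  define p where "p z = (LINT y|lborel. ln (norm (z - y)) * f y)" for z
  have rW: "Re (h * W) = (LINT y|lborel. Re (h / (z - y)) * f y)"
    and riW: "integrable lborel (\<lambda>y. Re (h / (z - y)) * f y)" for h
  proof -
    have i: "integrable lborel (\<lambda>y. h * (g y / (z - y)))"
      by (intro integrable_mult_right cauchy_transform_integrable g)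
    have e: "Re (h * (g y / (z - y))) = Re (h / (z - y)) * f y" for y
    proof -
      have e0: "h * (g y / (z - y)) = f y *\<^sub>R (h / (z - y))" by (simp add: g_def scaleR_conv_of_real)
      show ?thesis unfolding e0 scaleR_complex.sel by (rule mult.commute)
    qed
    show "integrable lborel (\<lambda>y. Re (h / (z - y)) * f y)"
      using integrable_Re[OF i] by (simp only: e)
    have "Re (h * W) = Re (LINT y|lborel. h * (g y / (z - y)))"
      unfolding W_def cauchy_transform_def by (simp only: integral_mult_right_zero)
    also have "\<dots> = (LINT y|lborel. Re (h * (g y / (z - y))))"
      using i by (rule integral_Re[symmetric])
    finally show "Re (h * W) = (LINT y|lborel. Re (h / (z - y)) * f y)" by (simp only: e)
  qed
  have "(p has_derivative (\<lambda>h. Re (h * W))) (at z)"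
  proof (rule has_derivative_from_bound[of _ 1])
    show "bounded_linear (\<lambda>h. Re (h * W))"
      by (intro bounded_linear_compose[OF bounded_linear_Re] bounded_linear_mult_left)
    fix h :: complex
    have pe: "p (z + h) - p z - Re (h * W) =
      (LINT y|lborel. ln (norm (z + h - y)) * f y - ln (norm (z - y)) * f y - Re (h / (z - y)) * f y)"
      unfolding p_def rW
      by (subst Bochner_Integration.integral_diff, intro Bochner_Integration.integrable_diff
           log_potential_integrable f, rule riW,
          subst Bochner_Integration.integral_diff, intro log_potential_integrable f,
          intro log_potential_integrable f, rule refl)
    have "norm (p (z + h) - p z - Re (h * W)) \<le> (LINT y|lborel. 4 * norm h powr (3/2) *
         (norm (g y) * norm (z - y) powr (-(3/2)) + norm (g y) * norm (z + h - y) powr (-(3/2))))"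
      unfolding pe
    proof (rule norm_integral_le_AE)
      show "integrable lborel (\<lambda>y. ln (norm (z + h - y)) * f y - ln (norm (z - y)) * f y - Re (h / (z - y)) * f y)"
        by (intro Bochner_Integration.integrable_diff log_potential_integrable f riW)
      show "integrable lborel (\<lambda>y. 4 * norm h powr (3/2) *
         (norm (g y) * norm (z - y) powr (-(3/2)) + norm (g y) * norm (z + h - y) powr (-(3/2))))"
        by (intro integrable_mult_right Bochner_Integration.integrable_add C)
      show "AE y in lborel. norm (ln (norm (z + h - y)) * f y - ln (norm (z - y)) * f y - Re (h / (z - y)) * f y)
        \<le> 4 * norm h powr (3/2) *
         (norm (g y) * norm (z - y) powr (-(3/2)) + norm (g y) * norm (z + h - y) powr (-(3/2)))"
        using AE_lborel_singleton[of z] AE_lborel_singleton[of "z + h"]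
      proof eventually_elim
        case (elim y)
        have "\<bar>ln (norm (z + h - y)) - ln (norm (z - y)) - Re (h / (z - y))\<bar> \<le>
           4 * norm h powr (3/2) * (norm (z - y) powr (-(3/2)) + norm (z + h - y) powr (-(3/2)))"
        proof -
          have e: "z - y + h = z + h - y" by simp
          have nz: "z - y \<noteq> 0" "z + h - y \<noteq> 0" using elim by auto
          show ?thesis by (rule ln_norm_expansion[of "z - y" h, unfolded e, OF nz])
        qed
        then have le: "\<bar>ln (norm (z + h - y)) - ln (norm (z - y)) - Re (h / (z - y))\<bar> * norm (g y) \<le>
           4 * norm h powr (3/2) * (norm (z - y) powr (-(3/2)) + norm (z + h - y) powr (-(3/2))) * norm (g y)"
          by (rule mult_right_mono) simp
        have alg: "4 * H * (a + b) * c = 4 * H * (c * a + c * b)" for H a b c :: real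
          by (simp add: algebra_simps)
        have "ln (norm (z + h - y)) * f y - ln (norm (z - y)) * f y - Re (h / (z - y)) * f y =
             (ln (norm (z + h - y)) - ln (norm (z - y)) - Re (h / (z - y))) * f y"
          by (simp only: left_diff_distrib)
        then have "norm (ln (norm (z + h - y)) * f y - ln (norm (z - y)) * f y - Re (h / (z - y)) * f y)
          = \<bar>ln (norm (z + h - y)) - ln (norm (z - y)) - Re (h / (z - y))\<bar> * norm (g y)"
          by (simp only: real_norm_def abs_mult g_def norm_of_real)
        also note le
        also have "4 * norm h powr (3/2) * (norm (z - y) powr (-(3/2)) + norm (z + h - y) powr (-(3/2))) * norm (g y)
          = 4 * norm h powr (3/2) *
         (norm (g y) * norm (z - y) powr (-(3/2)) + norm (g y) * norm (z + h - y) powr (-(3/2)))"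
          by (rule alg)
        finally show ?case .
      qed
    qed
    also have "\<dots> = 4 * norm h powr (3/2) * ((LINT y|lborel. norm (g y) * norm (z - y) powr (-(3/2)))
        + (LINT y|lborel. norm (g y) * norm (z + h - y) powr (-(3/2))))"
      using C(1) by simp
    also have "\<dots> \<le> 4 * norm h powr (3/2) * (C + C)"
      by (intro mult_left_mono add_mono C) auto
    also have "\<dots> = (8 * C) * norm h powr (3/2)" by simp
    finally show "norm (p (z + h) - p z - Re (h * W)) \<le> (8 * C) * norm h powr (3/2)" .
  qed auto
  then show ?thesis by (simp add: p_def[abs_def] W_def g_def[abs_def])
qed

section \<open>The Cauchy--Pompeiu formula\<close>

lemma indicator_cbox_Complex:
  "indicator (cbox p q) (Complex x y) = (indicator {Re p..Re q} x * indicator {Im p..Im q} y :: real)"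
  by (auto simp: indicator_def in_cbox_complex_iff)

lemma set_integrable_continuous_cbox:
  fixes f :: "complex \<Rightarrow> complex"
  assumes "continuous_on (cbox p q) f"
  shows "set_integrable lborel (cbox p q) f"
  unfolding set_integrable_def using borel_integrable_compact[OF _ assms] by simp

text \<open>Both orders are recorded so that each partial derivative can be integrated in its own
  variable first.\<close>

lemma cbox_fubini:
  fixes f :: "complex \<Rightarrow> complex"
  assumes f: "continuous_on (cbox p q) f"
  shows "(LINT s:cbox p q|lborel. f s) =
      integral {Re p..Re q} (\<lambda>x. integral {Im p..Im q} (\<lambda>y. f (Complex x y)))" (is ?th1)
    and "(LINT s:cbox p q|lborel. f s) =
      integral {Im p..Im q} (\<lambda>y. integral {Re p..Re q} (\<lambda>x. f (Complex x y)))" (is ?th2)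
    and "(\<lambda>x. integral {Im p..Im q} (\<lambda>y. f (Complex x y))) integrable_on {Re p..Re q}" (is ?th3)
proof -
  define g where "g s = indicator (cbox p q) s *\<^sub>R f s" for s
  have gi: "integrable lborel g"
    using set_integrable_continuous_cbox[OF f] by (simp add: set_integrable_def g_def[abs_def])
  then have gm [measurable]: "g \<in> borel_measurable borel" by auto
  have gc: "g (Complex x y) = indicator {Re p..Re q} x *\<^sub>R (indicator {Im p..Im q} y *\<^sub>R f (Complex x y))" for x y
    unfolding g_def by (simp add: indicator_cbox_Complex)
  have gi2: "integrable (lborel \<Otimes>\<^sub>M lborel) (\<lambda>(x, y). g (Complex x y))"
    using gi by (subst (asm) lborel_complex, subst (asm) integrable_distr_eq) (auto simp: split_beta')
  have eq: "integral\<^sup>L lborel g = (\<integral>(x, y). g (Complex x y) \<partial>(lborel \<Otimes>\<^sub>M lborel))"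
    by (subst lborel_complex, subst integral_distr) (auto simp: split_beta')
  have ci: "integral {Im p..Im q} (\<lambda>y. f (Complex x y)) = (LINT y:{Im p..Im q}|lborel. f (Complex x y))"
    if "x \<in> {Re p..Re q}" for x
  proof (rule set_borel_integral_eq_integral(2)[symmetric])
    have "continuous_on {Im p..Im q} (\<lambda>y. f (Complex x y))"
      using that by (intro continuous_on_compose2[OF f] continuous_intros) (auto simp: in_cbox_complex_iff)
    then show "set_integrable lborel {Im p..Im q} (\<lambda>y. f (Complex x y))"
      unfolding set_integrable_def by (rule borel_integrable_compact[OF compact_Icc])
  qed
  have ci': "integral {Re p..Re q} (\<lambda>x. f (Complex x y)) = (LINT x:{Re p..Re q}|lborel. f (Complex x y))"
    if "y \<in> {Im p..Im q}" for y
  proof (rule set_borel_integral_eq_integral(2)[symmetric])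
    have "continuous_on {Re p..Re q} (\<lambda>x. f (Complex x y))"
      using that by (intro continuous_on_compose2[OF f] continuous_intros) (auto simp: in_cbox_complex_iff)
    then show "set_integrable lborel {Re p..Re q} (\<lambda>x. f (Complex x y))"
      unfolding set_integrable_def by (rule borel_integrable_compact[OF compact_Icc])
  qed
  have in1: "(\<integral>y. g (Complex x y) \<partial>lborel) = indicator {Re p..Re q} x *\<^sub>R (LINT y:{Im p..Im q}|lborel. f (Complex x y))" for x
    unfolding gc set_lebesgue_integral_def by (cases "x \<in> {Re p..Re q}") auto
  have in2: "(\<integral>x. g (Complex x y) \<partial>lborel) = indicator {Im p..Im q} y *\<^sub>R (LINT x:{Re p..Re q}|lborel. f (Complex x y))" for y
  proof -
    have "g (Complex x y) = indicator {Im p..Im q} y *\<^sub>R (indicator {Re p..Re q} x *\<^sub>R f (Complex x y))" for x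
      unfolding gc by simp
    then show ?thesis unfolding set_lebesgue_integral_def by (cases "y \<in> {Im p..Im q}") auto
  qed
  have "(LINT s:cbox p q|lborel. f s) = integral\<^sup>L lborel g"
    by (simp add: set_lebesgue_integral_def g_def[abs_def])
  also have "\<dots> = (LINT x:{Re p..Re q}|lborel. (LINT y:{Im p..Im q}|lborel. f (Complex x y)))"
    unfolding eq lborel_pair.integral_fst[OF gi2, symmetric] in1 by (simp add: set_lebesgue_integral_def)
  also have "\<dots> = integral {Re p..Re q} (\<lambda>x. LINT y:{Im p..Im q}|lborel. f (Complex x y))"
    using lborel_pair.integrable_fst[OF gi2]
    by (intro set_borel_integral_eq_integral(2)) (simp add: set_integrable_def in1)
  also have "\<dots> = integral {Re p..Re q} (\<lambda>x. integral {Im p..Im q} (\<lambda>y. f (Complex x y)))"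
    by (intro integral_cong) (simp add: ci)
  finally show ?th1 .
  have "(\<lambda>x. LINT y:{Im p..Im q}|lborel. f (Complex x y)) integrable_on {Re p..Re q}"
    using lborel_pair.integrable_fst[OF gi2]
    by (intro set_borel_integral_eq_integral(1)) (simp add: set_integrable_def in1)
  then show ?th3 by (rule integrable_eq) (simp add: ci)
  have "(LINT s:cbox p q|lborel. f s) = integral\<^sup>L lborel g"
    by (simp add: set_lebesgue_integral_def g_def[abs_def])
  also have "\<dots> = (LINT y:{Im p..Im q}|lborel. (LINT x:{Re p..Re q}|lborel. f (Complex x y)))"
    unfolding eq lborel_pair.integral_snd[OF gi2, symmetric] in2 by (simp add: set_lebesgue_integral_def)
  also have "\<dots> = integral {Im p..Im q} (\<lambda>y. LINT x:{Re p..Re q}|lborel. f (Complex x y))"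
    using lborel_pair.integrable_snd[OF gi2]
    by (intro set_borel_integral_eq_integral(2)) (simp add: set_integrable_def in2)
  also have "\<dots> = integral {Im p..Im q} (\<lambda>y. integral {Re p..Re q} (\<lambda>x. f (Complex x y)))"
    by (intro integral_cong) (simp add: ci')
  finally show ?th2 .
qed

text \<open>Injectivity of the exponential coordinates holds on open boxes of height 2 pi, whereas
  Fubini is applied to continuous functions on closed ones; this passes between them.\<close>

lemma set_integral_box_eq_cbox:
  fixes f :: "complex \<Rightarrow> complex"
  assumes f: "continuous_on (cbox p q) f"
  shows "(LINT s:box p q|lborel. f s) = (LINT s:cbox p q|lborel. f s)"
proof -
  have "cbox p q - box p q \<in> null_sets lebesgue"
    using negligible_frontier_interval negligible_iff_null_sets by blast
  then have "AE x in lebesgue. x \<notin> cbox p q - box p q" by (rule AE_not_in)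
  then have "AE x in lborel. x \<notin> cbox p q - box p q" by (simp add: AE_completion_iff)
  then have ae: "AE x in lborel. indicator (box p q) x *\<^sub>R f x = indicator (cbox p q) x *\<^sub>R f x"
    by eventually_elim (use box_subset_cbox[of p q] in \<open>auto simp: indicator_def\<close>)
  show ?thesis unfolding set_lebesgue_integral_def
    by (intro integral_cong_AE ae)
      (use f continuous_on_subset[OF f box_subset_cbox] in
        \<open>auto intro!: borel_measurable_continuous_on_indicator\<close>)
qed

lemma has_vector_derivative_compose_linear:
  assumes g: "(g has_vector_derivative v) (at t within S)" and k: "(k has_derivative K) (at (g t))"
  shows "((\<lambda>t. k (g t)) has_vector_derivative K v) (at t within S)"
proof -
  have lin: "linear K" using k by (rule has_derivative_linear)
  have "((\<lambda>t. k (g t)) has_derivative (\<lambda>x. K (x *\<^sub>R v))) (at t within S)"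
    using has_derivative_compose[OF g[unfolded has_vector_derivative_def] k] .
  then show ?thesis unfolding has_vector_derivative_def by (simp add: linear_cmul[OF lin])
qed

text \<open>Green's formula on a rectangle for a function that is periodic in the vertical direction and
  vanishes on the right side.\<close>
lemma cbox_periodic_dbar_integral:
  fixes G Gx Gy :: "complex \<Rightarrow> complex"
  assumes ab: "a \<le> b" and T: "0 \<le> T"
    and cx: "continuous_on (cbox (Complex a 0) (Complex b T)) Gx"
    and cy: "continuous_on (cbox (Complex a 0) (Complex b T)) Gy"
    and dx: "\<And>x y. x \<in> {a..b} \<Longrightarrow> y \<in> {0..T} \<Longrightarrow>
      ((\<lambda>x. G (Complex x y)) has_vector_derivative Gx (Complex x y)) (at x within {a..b})"
    and dy: "\<And>x y. x \<in> {a..b} \<Longrightarrow> y \<in> {0..T} \<Longrightarrow>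
      ((\<lambda>y. G (Complex x y)) has_vector_derivative Gy (Complex x y)) (at y within {0..T})"
    and zero: "\<And>y. y \<in> {0..T} \<Longrightarrow> G (Complex b y) = 0"
    and per: "\<And>x. x \<in> {a..b} \<Longrightarrow> G (Complex x T) = G (Complex x 0)"
  shows "(LINT s:cbox (Complex a 0) (Complex b T)|lborel. Gx s + \<i> * Gy s) =
    - integral {0..T} (\<lambda>y. G (Complex a y))"
proof -
  define B where "B = cbox (Complex a 0) (Complex b T)"
  have i: "set_integrable lborel B Gx" "set_integrable lborel B (\<lambda>s. \<i> * Gy s)"
    unfolding B_def by (intro set_integrable_continuous_cbox continuous_intros cx cy)+
  have "(LINT s:B|lborel. Gx s + \<i> * Gy s) = (LINT s:B|lborel. Gx s) + (LINT s:B|lborel. \<i> * Gy s)"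
    by (rule set_integral_add(2)[OF i])
  also have "(LINT s:B|lborel. \<i> * Gy s) = \<i> * (LINT s:B|lborel. Gy s)" by simp
  also have "(LINT s:B|lborel. Gy s) = integral {a..b} (\<lambda>x. integral {0..T} (\<lambda>y. Gy (Complex x y)))"
    unfolding B_def using cbox_fubini(1)[OF cy] by simp
  also have "\<dots> = integral {a..b} (\<lambda>x. 0)"
  proof (rule integral_cong)
    fix x assume x: "x \<in> {a..b}"
    have "((\<lambda>y. Gy (Complex x y)) has_integral (G (Complex x T) - G (Complex x 0))) {0..T}"
      by (rule fundamental_theorem_of_calculus[OF T]) (use dy x in auto)
    then show "integral {0..T} (\<lambda>y. Gy (Complex x y)) = 0" using per[OF x] by (simp add: integral_unique)
  qed
  also have "(LINT s:B|lborel. Gx s) = integral {0..T} (\<lambda>y. integral {a..b} (\<lambda>x. Gx (Complex x y)))"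
    unfolding B_def using cbox_fubini(2)[OF cx] by simp
  also have "\<dots> = integral {0..T} (\<lambda>y. - G (Complex a y))"
  proof (rule integral_cong)
    fix y assume y: "y \<in> {0..T}"
    have "((\<lambda>x. Gx (Complex x y)) has_integral (G (Complex b y) - G (Complex a y))) {a..b}"
      by (rule fundamental_theorem_of_calculus[OF ab]) (use dx y in auto)
    then show "integral {a..b} (\<lambda>x. Gx (Complex x y)) = - G (Complex a y)"
      using zero[OF y] by (simp add: integral_unique)
  qed
  finally show ?thesis unfolding B_def by simp
qed

section \<open>The Cauchy--Pompeiu formula in exponential coordinates\<close>

definition C1_plane :: "(complex \<Rightarrow> 'a::real_normed_vector) \<Rightarrow> (complex \<Rightarrow> 'a) \<Rightarrow> (complex \<Rightarrow> 'a) \<Rightarrow> bool" where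
  "C1_plane k kx ky \<longleftrightarrow> (\<forall>z. (k has_derivative (\<lambda>h. Re h *\<^sub>R kx z + Im h *\<^sub>R ky z)) (at z)) \<and>
     continuous_on UNIV kx \<and> continuous_on UNIV ky"

lemma C1_plane_continuous: "C1_plane k kx ky \<Longrightarrow> continuous_on UNIV k"
  unfolding C1_plane_def
  by (meson continuous_at_imp_continuous_on has_derivative_continuous)

lemma C1_plane_derivative_zero:
  assumes C: "C1_plane k kx ky" and R: "\<And>z. norm z \<ge> R \<Longrightarrow> k z = 0" and z: "norm z > R"
  shows "kx z = 0" "ky z = 0"
proof -
  have "(k has_derivative (\<lambda>h. Re h *\<^sub>R kx z + Im h *\<^sub>R ky z)) (at z)"
    using C unfolding C1_plane_def by blast
  moreover have "(k has_derivative (\<lambda>h. 0)) (at z)"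
  proof (rule has_derivative_transform_within_open[of "\<lambda>_. 0"])
    show "open (- cball (0::complex) R)" by (intro open_Compl closed_cball)
  qed (use z R in auto)
  ultimately have "(\<lambda>h. Re h *\<^sub>R kx z + Im h *\<^sub>R ky z) = (\<lambda>h. 0)" by (rule has_derivative_unique)
  from fun_cong[OF this, of 1] fun_cong[OF this, of \<i>] show "kx z = 0" "ky z = 0" by auto
qed

lemma bdd_density_continuous:
  assumes c: "continuous_on UNIV f" and R: "\<And>z. norm z > R \<Longrightarrow> f z = 0"
  shows "bdd_density f"
proof -
  have "compact (f ` cball 0 R)"
    by (intro compact_continuous_image continuous_on_subset[OF c]) auto
  then obtain M where M: "\<And>y. y \<in> cball 0 R \<Longrightarrow> norm (f y) \<le> M"
    by (meson bounded_iff compact_imp_bounded imageI)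
  have "norm (f y) \<le> \<bar>M\<bar>" for y
    using M[of y] R[of y] by (cases "norm y > R") auto
  moreover have "f \<in> borel_measurable borel" by (rule borel_measurable_continuous_onI[OF c])
  ultimately show ?thesis unfolding bdd_density_def using R by blast
qed

text \<open>The plane cut along the horizontal ray from z to the right: Im s is the argument of the
  point seen from z, taken in (0, 2 pi).\<close>

definition slit_plane :: "complex \<Rightarrow> complex set" where
  "slit_plane z = (\<lambda>s. z + exp s) ` {s. 0 < Im s \<and> Im s < 2 * pi}"

lemma strip_open: "open {s. 0 < Im s \<and> Im s < b}"
  by (intro open_Collect_conj open_Collect_less continuous_intros)

lemma exp_inj_strip: "inj_on (\<lambda>s. z + exp s) {s. 0 < Im s \<and> Im s < 2 * pi}"
proof (rule inj_onI)
  fix s t assume st: "s \<in> {s. 0 < Im s \<and> Im s < 2 * pi}" "t \<in> {s. 0 < Im s \<and> Im s < 2 * pi}" "z + exp s = z + exp t"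
  then have "exp s = exp t" by simp
  show "s = t" by (rule exp_complex_eqI[OF _ \<open>exp s = exp t\<close>]) (use st in auto)
qed

lemma slit_plane_complement_null: "- slit_plane z \<in> null_sets lborel"
proof -
  have sub: "- slit_plane z \<subseteq> {w. Im w = Im z}"
  proof
    fix w assume w: "w \<in> - slit_plane z"
    show "w \<in> {w. Im w = Im z}"
    proof (rule ccontr)
      assume "w \<notin> {w. Im w = Im z}"
      then have n: "Im (w - z) \<noteq> 0" by simp
      then have nz: "w - z \<noteq> 0" by auto
      \<comment> \<open>The principal argument lies in (-pi, pi]; a shift by 2 pi moves its negative
        half into (pi, 2 pi).\<close>
      define t where "t = (if Im (Ln (w - z)) > 0 then Ln (w - z) else Ln (w - z) + of_real (2 * pi) * \<i>)"
      have e: "exp t = w - z" using nz unfolding t_def by (simp add: exp_add)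
      have "Im (Ln (w - z)) \<noteq> 0" using n nz Im_Ln_eq_0[OF nz] by auto
      moreover have "-pi < Im (Ln (w - z))" "Im (Ln (w - z)) \<le> pi" using mpi_less_Im_Ln[OF nz] Im_Ln_le_pi[OF nz] by auto
      ultimately have "0 < Im t" "Im t < 2 * pi" using pi_gt_zero unfolding t_def by (auto split: if_splits)
      then have "w \<in> slit_plane z" unfolding slit_plane_def using e by (auto intro!: image_eqI[of _ _ t])
      then show False using w by simp
    qed
  qed
  have "negligible {w::complex. w \<bullet> \<i> = Im z}"
    by (rule negligible_standard_hyperplane) (simp add: Basis_complex_def)
  then have "{w::complex. Im w = Im z} \<in> null_sets lebesgue"
    by (simp add: negligible_iff_null_sets inner_complex_def)
  moreover have "closed {w::complex. Im w = Im z}"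
    by (intro closed_Collect_eq continuous_intros)
  ultimately have N: "{w::complex. Im w = Im z} \<in> null_sets lborel"
    by (auto simp: null_sets_def)
  have "open (slit_plane z)"
    unfolding slit_plane_def
    by (intro open_mapping_thm3[OF _ strip_open exp_inj_strip] holomorphic_intros)
  then have "- slit_plane z \<in> sets lborel" by auto
  then show ?thesis using null_sets_subset[OF N _ sub] by simp
qed

text \<open>Polar coordinates about z in the form y = z + exp s remove the singularity: the
  integrand becomes - (Gx + \<i> Gy)/2 for G s = k (z + exp s). Green's formula on the rectangle X -
  n <= Re s <= X leaves half the integral of k over the angle on the circle of radius exp (X - n),
  which tends to pi k z.\<close>

theorem cauchy_pompeiu_compact_support:
  fixes k kx ky :: "complex \<Rightarrow> complex"
  assumes C: "C1_plane k kx ky" and R: "\<And>z. norm z \<ge> R \<Longrightarrow> k z = 0"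
  shows "cauchy_transform (\<lambda>y. (kx y + \<i> * ky y) / 2) z = of_real pi * k z"
proof -
  define Dk where "Dk y = (kx y + \<i> * ky y) / 2" for y
  have ck: "continuous_on UNIV kx" "continuous_on UNIV ky" using C by (auto simp: C1_plane_def)
  have cD: "continuous_on UNIV Dk" unfolding Dk_def using ck by (intro continuous_intros) auto
  have D0: "Dk y = 0" if "norm y > R" for y
    using C1_plane_derivative_zero[OF C R that] by (simp add: Dk_def)
  have dD: "bdd_density Dk" by (rule bdd_density_continuous[OF cD D0])
  have [measurable]: "Dk \<in> borel_measurable borel" using dD by (rule bdd_density_measurable)
  define U where "U = {s. 0 < Im s \<and> Im s < 2 * pi}"
  define f where "f s = z + exp s" for s
  define G where "G s = k (f s)" for s
  define Gx where "Gx s = Re (exp s) *\<^sub>R kx (f s) + Im (exp s) *\<^sub>R ky (f s)" for s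
  define Gy where "Gy s = Re (\<i> * exp s) *\<^sub>R kx (f s) + Im (\<i> * exp s) *\<^sub>R ky (f s)" for s
  have cf: "continuous_on UNIV f" unfolding f_def by (intro continuous_intros)
  have cG: "continuous_on UNIV Gx" "continuous_on UNIV Gy"
    unfolding Gx_def Gy_def
    by (intro continuous_intros continuous_on_compose2[OF ck(1) cf] continuous_on_compose2[OF ck(2) cf]; simp)+
  define h where "h y = Dk y / (z - y)" for y
  have [measurable]: "h \<in> borel_measurable borel" unfolding h_def by measurable
  have hi: "integrable lborel h" unfolding h_def by (rule cauchy_transform_integrable[OF dD])
  have fU: "f ` U = slit_plane z" by (simp add: f_def[abs_def] U_def slit_plane_def)
  have holf: "f holomorphic_on U" unfolding f_def by (intro holomorphic_intros)
  have injf: "inj_on f U" using exp_inj_strip by (simp add: f_def[abs_def] U_def)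
  have oU: "open U" unfolding U_def by (rule strip_open)
  have df: "deriv f s = exp s" for s unfolding f_def
    by (rule DERIV_imp_deriv) (auto intro!: derivative_eq_intros)
  have sp: "slit_plane z \<in> sets borel"
    using slit_plane_complement_null[of z] by (metis null_setsD2 sets_lborel borel_comp double_complement)
  have eq1: "(LINT y:slit_plane z|lborel. h y) = integral\<^sup>L lborel h"
    unfolding set_lebesgue_integral_def
  proof (rule integral_cong_AE)
    show "AE y in lborel. indicator (slit_plane z) y *\<^sub>R h y = h y"
      using AE_not_in[OF slit_plane_complement_null[of z]] by eventually_elim auto
  qed (use sp in auto)
  have hsi: "set_integrable lborel (f ` U) h"
    unfolding set_integrable_def fU using sp by (intro integrable_mult_indicator hi) auto
  have integrand: "(norm (deriv f s))\<^sup>2 *\<^sub>R h (f s) = - (Gx s + \<i> * Gy s) / 2" for s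
  proof -
    \<comment> \<open>The Jacobian |exp s|^2 loses one factor to the denominator z - f s = - exp s.
      The conjugate factor that remains is the one produced by the chain rule for dbar.\<close>
    have "(complex_of_real (norm (exp s)))\<^sup>2 = exp s * cnj (exp s)"
      by (metis complex_norm_square of_real_power)
    then have "(norm (deriv f s))\<^sup>2 *\<^sub>R h (f s) = - (cnj (exp s) * Dk (f s))"
      unfolding df h_def f_def scaleR_conv_of_real by (simp add: field_simps)
    also have "\<dots> = - (Gx s + \<i> * Gy s) / 2"
    proof -
      have "cnj (exp s) * (kx (f s) + \<i> * ky (f s)) = Gx s + \<i> * Gy s"
        unfolding Gx_def Gy_def by (simp add: complex_eq_iff algebra_simps)
      then show ?thesis unfolding Dk_def by (simp only: times_divide_eq_right minus_divide_left)
    qed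
    finally show ?thesis .
  qed
  define q where "q s = - (Gx s + \<i> * Gy s) / 2" for s
  have qi: "set_integrable lborel U q"
    using holomorphic_cov_integrable[OF oU holf injf, of h] hsi integrand by (simp add: q_def[abs_def])
  have main: "integral\<^sup>L lborel h = (LINT s:U|lborel. q s)"
    using holomorphic_cov_integral[OF oU holf injf, of h] integrand by (simp add: q_def[abs_def] fU eq1)
  \<comment> \<open>For Re s >= X the modulus of exp s is at least |R| + |z| + 1, so z + exp s lies
    outside the support of k.\<close>
  define X where "X = ln (\<bar>R\<bar> + norm z + 1)"
  have farz: "G s = 0" "Gx s = 0" "Gy s = 0" if "Re s \<ge> X" for s
  proof -
    have "norm (exp s) \<ge> exp X" using that by simp
    then have "norm (exp s) \<ge> \<bar>R\<bar> + norm z + 1" unfolding X_def by (simp add: add_nonneg_pos)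
    moreover have "norm (exp s) \<le> norm (f s) + norm z" unfolding f_def using norm_triangle_ineq4[of "z + exp s" z] by simp
    ultimately have "norm (f s) > R" by linarith
    then show "G s = 0" "Gx s = 0" "Gy s = 0" using R C1_plane_derivative_zero[OF C R]
      by (auto simp: G_def Gx_def Gy_def)
  qed
  \<comment> \<open>The boxes exhaust the relevant half-strip towards Re s = - infinity, which is
    the approach to z.\<close>
  define E where "E n = box (Complex (X - real n) 0) (Complex X (2 * pi))" for n :: nat
  have lim1: "(\<lambda>n. LINT s:E n|lborel. q s) \<longlonglongrightarrow> (LINT s:(\<Union>n. E n)|lborel. q s)"
  proof (rule set_integral_cont_up)
    show "incseq E" unfolding E_def incseq_def by (auto simp: in_box_complex_iff)
    show "set_integrable lborel (\<Union>n. E n) q"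
      by (rule set_integrable_subset[OF qi]) (auto simp: E_def U_def in_box_complex_iff)
  qed (auto simp: E_def)
  have E: "(\<Union>n. E n) = U \<inter> {s. Re s < X}"
  proof (intro equalityI subsetI)
    fix s assume s: "s \<in> U \<inter> {s. Re s < X}"
    obtain n where "X - Re s < real n" using reals_Archimedean2 by blast
    then have "s \<in> E n" using s by (auto simp: E_def U_def in_box_complex_iff)
    then show "s \<in> (\<Union>n. E n)" by blast
  qed (auto simp: E_def U_def in_box_complex_iff)
  have lim2: "(LINT s:(\<Union>n. E n)|lborel. q s) = (LINT s:U|lborel. q s)"
  proof -
    have q0: "q s = 0" if "\<not> Re s < X" for s using farz(2,3)[of s] that by (simp add: q_def)
    show ?thesis unfolding set_lebesgue_integral_def E
      by (intro Bochner_Integration.integral_cong refl) (use q0 in \<open>auto simp: indicator_def\<close>)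
  qed
  have En: "(LINT s:E n|lborel. q s) = integral {0..2*pi} (\<lambda>y. G (Complex (X - real n) y)) / 2" for n
  proof -
    define p1 where "p1 = Complex (X - real n) 0"
    define p2 where "p2 = Complex X (2 * pi)"
    have cq: "continuous_on A q" for A unfolding q_def using cG
      by (intro continuous_intros continuous_on_subset[OF cG(1)] continuous_on_subset[OF cG(2)]) auto
    have "(LINT s:E n|lborel. q s) = (LINT s:cbox p1 p2|lborel. q s)"
      unfolding E_def p1_def p2_def by (rule set_integral_box_eq_cbox[OF cq])
    also have "\<dots> = (LINT s:cbox p1 p2|lborel. (- 1 / 2) * (Gx s + \<i> * Gy s))"
    proof -
      have qe: "q = (\<lambda>s. (- 1 / 2) * (Gx s + \<i> * Gy s))" by (simp add: q_def fun_eq_iff field_simps)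
      show ?thesis by (simp only: qe)
    qed
    also have "\<dots> = (- 1 / 2) * (LINT s:cbox p1 p2|lborel. Gx s + \<i> * Gy s)"
      by (rule set_integral_mult_right)
    also have "(LINT s:cbox p1 p2|lborel. Gx s + \<i> * Gy s) = - integral {0..2*pi} (\<lambda>y. G (Complex (X - real n) y))"
      unfolding p1_def p2_def
    proof (rule cbox_periodic_dbar_integral)
      show "((\<lambda>x. G (Complex x y)) has_vector_derivative Gx (Complex x y)) (at x within {X - real n..X})" for x y
      proof -
        have "((\<lambda>x. f (Complex x y)) has_vector_derivative exp (Complex x y)) (at x within {X - real n..X})"
        proof -
          have c: "((\<lambda>x. Complex x y) has_vector_derivative 1) (at x within {X - real n..X})"
            unfolding Complex_eq by (auto intro!: derivative_eq_intros)
          have "(f has_derivative (\<lambda>h. exp (Complex x y) * h)) (at (Complex x y))"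
            unfolding f_def by (auto intro!: derivative_eq_intros simp: mult.commute)
          from has_vector_derivative_compose_linear[OF c this] show ?thesis by simp
        qed
        moreover have "(k has_derivative (\<lambda>h. Re h *\<^sub>R kx (f (Complex x y)) + Im h *\<^sub>R ky (f (Complex x y)))) (at (f (Complex x y)))"
          using C by (simp add: C1_plane_def)
        ultimately show ?thesis unfolding G_def Gx_def by (rule has_vector_derivative_compose_linear)
      qed
      show "((\<lambda>y. G (Complex x y)) has_vector_derivative Gy (Complex x y)) (at y within {0..2 * pi})" for x y
      proof -
        have "((\<lambda>y. f (Complex x y)) has_vector_derivative \<i> * exp (Complex x y)) (at y within {0..2 * pi})"
        proof -
          have c: "((\<lambda>y. Complex x y) has_vector_derivative \<i>) (at y within {0..2 * pi})"
            unfolding Complex_eq by (auto intro!: derivative_eq_intros)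
          have "(f has_derivative (\<lambda>h. exp (Complex x y) * h)) (at (Complex x y))"
            unfolding f_def by (auto intro!: derivative_eq_intros simp: mult.commute)
          from has_vector_derivative_compose_linear[OF c this] show ?thesis by (simp add: mult.commute)
        qed
        moreover have "(k has_derivative (\<lambda>h. Re h *\<^sub>R kx (f (Complex x y)) + Im h *\<^sub>R ky (f (Complex x y)))) (at (f (Complex x y)))"
          using C by (simp add: C1_plane_def)
        ultimately show ?thesis unfolding G_def Gy_def by (rule has_vector_derivative_compose_linear)
      qed
      show "G (Complex X y) = 0" for y using farz[of "Complex X y"] by simp
      show "G (Complex x (2 * pi)) = G (Complex x 0)" for x
        unfolding G_def f_def by (simp add: exp_eq_polar cis_conv_exp[symmetric])
    qed (use cG continuous_on_subset in auto)
    finally show ?thesis by simp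
  qed
  have kc: "continuous_on UNIV k" using C by (rule C1_plane_continuous)
  have lim3: "(\<lambda>n. integral {0..2*pi} (\<lambda>y. G (Complex (X - real n) y))) \<longlonglongrightarrow> integral {0..2*pi} (\<lambda>y. k z)"
  proof -
    have u: "uniform_limit {0..2*pi} (\<lambda>n y. G (Complex (X - real n) y)) (\<lambda>y. k z) sequentially"
    proof (rule uniform_limitI)
      fix e :: real assume "e > 0"
      then obtain d where d: "d > 0" "\<And>w. dist w z < d \<Longrightarrow> dist (k w) (k z) < e"
        using kc unfolding continuous_on_iff by (metis UNIV_I)
      have "(\<lambda>n. exp (X - real n)) \<longlonglongrightarrow> 0" by real_asymp
      then have "\<forall>\<^sub>F n in sequentially. exp (X - real n) < d" using d(1) by (rule order_tendstoD(2))
      then show "\<forall>\<^sub>F n in sequentially. \<forall>y\<in>{0..2*pi}. dist (G (Complex (X - real n) y)) (k z) < e"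
        by eventually_elim (auto simp: G_def f_def dist_norm intro!: d(2)[unfolded dist_norm])
    qed
    have c: "continuous_on {0..2*pi} (\<lambda>y. G (Complex (X - real n) y))" for n
      unfolding G_def by (intro continuous_on_compose2[OF kc] continuous_on_compose2[OF cf] continuous_intros) auto
    from uniform_limit_integral[OF u c] obtain I J where I:
      "\<And>n. ((\<lambda>y. G (Complex (X - real n) y)) has_integral I n) {0..2*pi}"
      and J: "((\<lambda>y. k z) has_integral J) {0..2*pi}" and "I \<longlonglongrightarrow> J" by auto
    then show ?thesis by (simp only: integral_unique[OF I] integral_unique[OF J])
  qed
  have "(\<lambda>n. LINT s:E n|lborel. q s) \<longlonglongrightarrow> integral {0..2*pi} (\<lambda>y. k z) / 2"
    unfolding En by (intro tendsto_intros lim3) auto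
  then have "(LINT s:U|lborel. q s) = integral {0..2*pi} (\<lambda>y. k z) / 2"
    using lim1 lim2 LIMSEQ_unique by metis
  also have "\<dots> = of_real pi * k z" by (simp add: scaleR_conv_of_real)
  finally show ?thesis using main unfolding cauchy_transform_def h_def Dk_def by simp
qed

section \<open>Regular Jordan curves\<close>

text \<open>\<open>unif\<close> is the form in which the Hoelder bound enters: a modulus of
  continuity for g' on the whole line.\<close>

locale periodic_C1_curve =
  fixes g g' :: "real \<Rightarrow> complex" and J :: "complex set"
  assumes der: "\<And>t. (g has_vector_derivative g' t) (at t)"
    and nz: "\<And>t. g' t \<noteq> 0"
    and unif: "\<And>e. e > 0 \<Longrightarrow> \<exists>d>0. \<forall>s t. \<bar>s - t\<bar> < d \<longrightarrow> norm (g' s - g' t) < e"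
    and per: "\<And>t. g (t + 1) = g t"
    and inj: "inj_on g {0..<1}"
    and J: "range g = J"
begin

lemma per_nat: "g (t + real n) = g t"
proof (induction n)
  case (Suc n)
  then show ?case using per[of "t + real n"] by (simp add: algebra_simps)
qed simp

lemma per_int: "g (t + of_int n) = g t"
proof (cases "n \<ge> 0")
  case True
  then show ?thesis using per_nat[of t "nat n"] by simp
next
  case False
  then show ?thesis using per_nat[of "t + of_int n" "nat (-n)"] by simp
qed

lemma g_frac: "g (frac t) = g t"
  using per_int[of "frac t" "\<lfloor>t\<rfloor>"] by (simp add: frac_def)

lemma g'_cont: "continuous_on UNIV g'"
  unfolding continuous_on_iff dist_norm using unif by (metis real_norm_def)

lemma g_cont: "continuous_on A g"
  by (rule continuous_at_imp_continuous_on)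
     (meson der has_derivative_continuous has_vector_derivative_def)

lemma g'_per: "g' (t + 1) = g' t"
proof -
  have 1: "((\<lambda>t. t + 1) has_vector_derivative 1) (at t)"
    by (auto intro!: derivative_eq_intros)
  have "((\<lambda>t. g (t + 1)) has_vector_derivative 1 *\<^sub>R g' (t + 1)) (at t)"
    using vector_diff_chain_at[OF 1 der[of "t + 1"]] by (simp add: o_def)
  then have "(g has_vector_derivative g' (t + 1)) (at t)" by (simp add: per)
  then show ?thesis using der[of t] vector_derivative_unique_at by blast
qed

lemma g'_per_nat: "g' (t + real n) = g' t"
proof (induction n)
  case (Suc n)
  then show ?case using g'_per[of "t + real n"] by (simp add: algebra_simps)
qed simp

lemma g'_frac: "g' (frac t) = g' t"
proof (cases "t \<ge> 0")
  case True
  then have "t = frac t + real (nat \<lfloor>t\<rfloor>)" by (simp add: frac_def)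
  then show ?thesis using g'_per_nat[of "frac t" "nat \<lfloor>t\<rfloor>"] by simp
next
  case False
  then have "frac t = t + real (nat (- \<lfloor>t\<rfloor>))" by (simp add: frac_def)
  then show ?thesis using g'_per_nat[of t "nat (- \<lfloor>t\<rfloor>)"] by simp
qed

lemma J_compact: "compact J" and J_image: "J = g ` {0..<1}"
proof -
  have "range g \<subseteq> g ` {0..<1}"
  proof
    fix w assume "w \<in> range g"
    then obtain t where "w = g (frac t)" by (auto simp: g_frac)
    then show "w \<in> g ` {0..<1}" by (auto simp: frac_lt_1)
  qed
  then show im: "J = g ` {0..<1}" using J by blast
  then have "J = g ` {0..1}" using J by (metis atLeastLessThan_subseteq_atLeastAtMost_iff image_mono
        dual_order.refl order_antisym subset_UNIV)
  then show "compact J" using compact_continuous_image[OF g_cont compact_Icc] by simp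
qed

lemma J_nonempty: "J \<noteq> {}" using J by blast

lemma speed_bounds:
  obtains m M where "0 < m" "m \<le> M" "\<And>t. m \<le> norm (g' t)" "\<And>t. norm (g' t) \<le> M"
proof -
  have c: "continuous_on {0..1} (\<lambda>t. norm (g' t))"
    by (intro continuous_intros continuous_on_subset[OF g'_cont]) auto
  obtain t0 where t0: "t0 \<in> {0..1}" "\<And>t. t \<in> {0..1} \<Longrightarrow> norm (g' t0) \<le> norm (g' t)"
    using continuous_attains_inf[OF compact_Icc _ c] by auto
  obtain t1 where t1: "t1 \<in> {0..1}" "\<And>t. t \<in> {0..1} \<Longrightarrow> norm (g' t) \<le> norm (g' t1)"
    using continuous_attains_sup[OF compact_Icc _ c] by auto
  have fr: "frac t \<in> {0..1}" for t :: real using frac_lt_1[of t] by (auto simp: less_imp_le)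
  have "norm (g' t0) \<le> norm (g' t)" "norm (g' t) \<le> norm (g' t1)" for t
    using t0(2)[OF fr[of t]] t1(2)[OF fr[of t]] by (auto simp: g'_frac)
  then show ?thesis using that[of "norm (g' t0)" "norm (g' t1)"] nz by auto
qed

lemma curve_lipschitz:
  assumes "\<And>t. norm (g' t) \<le> M"
  shows "norm (g s - g t) \<le> M * \<bar>s - t\<bar>"
proof -
  have *: "norm (g y - g x) \<le> M * (y - x)" if xy: "x < y" for x y
  proof -
    obtain u where "norm (g y - g x) \<le> norm ((y - x) *\<^sub>R g' u)"
      using mvt_general[OF xy g_cont, of "\<lambda>u h. h *\<^sub>R g' u"] der
      unfolding has_vector_derivative_def by blast
    also have "\<dots> \<le> (y - x) * M" using xy assms[of u] by simp
    finally show ?thesis by (simp add: mult.commute)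
  qed
  show ?thesis
    using *[of s t] *[of t s] by (cases s t rule: linorder_cases) (auto simp: norm_minus_commute)
qed

text \<open>The mean value inequality is applied to g u - u g'(t), whose derivative g'(u) - g'(t) is
  below e as long as u stays within the modulus of continuity.\<close>

lemma local_linear:
  assumes "e > 0"
  obtains d where "d > 0" "\<And>s t. \<bar>s - t\<bar> \<le> d \<Longrightarrow> norm (g s - g t - (s - t) *\<^sub>R g' t) \<le> e * \<bar>s - t\<bar>"
proof -
  obtain d where d: "d > 0" "\<And>s t. \<bar>s - t\<bar> < d \<Longrightarrow> norm (g' s - g' t) < e"
    using unif[OF assms] by blast
  have "norm (g s - g t - (s - t) *\<^sub>R g' t) \<le> e * \<bar>s - t\<bar>" if st: "\<bar>s - t\<bar> \<le> d / 2" for s t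
  proof -
    define h where "h u = g u - u *\<^sub>R g' t" for u
    have hd: "(h has_derivative (\<lambda>x. x *\<^sub>R (g' u - g' t))) (at u)" for u
      unfolding h_def using der[of u] unfolding has_vector_derivative_def
      by (auto intro!: derivative_eq_intros simp: algebra_simps)
    have hc: "continuous_on A h" for A unfolding h_def by (intro continuous_intros g_cont)
    have *: "norm (h y - h x) \<le> e * (y - x)" if xy: "x < y" "y - t \<le> d/2" "t - x \<le> d/2" "x \<le> t" "t \<le> y" for x y
    proof -
      obtain u where u: "u \<in> {x<..<y}" "norm (h y - h x) \<le> norm ((y - x) *\<^sub>R (g' u - g' t))"
        using mvt_general[OF xy(1) hc, of "\<lambda>u h. h *\<^sub>R (g' u - g' t)"] hd by blast
      have "\<bar>u - t\<bar> < d" using u(1) xy d(1) by auto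
      then have "norm (g' u - g' t) < e" by (rule d(2))
      then have "(y - x) * norm (g' u - g' t) \<le> (y - x) * e" using xy(1) by (intro mult_left_mono) auto
      moreover have "norm ((y - x) *\<^sub>R (g' u - g' t)) = (y - x) * norm (g' u - g' t)"
        using xy(1) by simp
      ultimately show ?thesis using u(2) unfolding mult.commute[of e] by linarith
    qed
    have e: "g s - g t - (s - t) *\<^sub>R g' t = h s - h t" by (simp add: h_def algebra_simps)
    show ?thesis unfolding e
      using *[of s t] *[of t s] st d(1) by (cases s t rule: linorder_cases) (auto simp: norm_minus_commute)
  qed
  then show ?thesis using that[of "d / 2"] d(1) by auto
qed

lemma no_repeat:
  assumes "g (s + u) = g s" "0 < u" "u < 1"
  shows False
proof -
  have "g (frac (s + u)) = g (frac s)" using assms by (simp add: g_frac)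
  then have "frac (s + u) = frac s"
    using inj by (auto simp: inj_on_def frac_lt_1)
  then have "u = of_int (\<lfloor>s + u\<rfloor> - \<lfloor>s\<rfloor>)" by (simp add: frac_def)
  then have "\<exists>n::int. u = of_int n" by blast
  then show False using assms by (metis less_irrefl of_int_0_less_iff of_int_less_1_iff zless_imp_add1_zle
        add_0 not_less of_int_1)
qed

text \<open>Injectivity modulo 1 and compactness: |g (s + u) - g s| has a positive minimum over s in
  [0, 1] and d <= u <= 1 - d, and periodicity extends it to all s.\<close>

lemma far_apart:
  assumes d: "0 < d" "d \<le> 1/2"
  obtains m where "m > 0" "\<And>s u. d \<le> u \<Longrightarrow> u \<le> 1 - d \<Longrightarrow> m \<le> norm (g (s + u) - g s)"
proof -
  define K where "K = {0..1::real} \<times> {d..1-d}"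
  have K: "compact K" "K \<noteq> {}" using d unfolding K_def by (auto intro!: compact_Times)
  have c: "continuous_on K (\<lambda>p. norm (g (fst p + snd p) - g (fst p)))"
    by (intro continuous_intros continuous_on_compose2[OF g_cont[of UNIV]]) auto
  obtain p where p: "p \<in> K" "\<And>q. q \<in> K \<Longrightarrow> norm (g (fst p + snd p) - g (fst p)) \<le> norm (g (fst q + snd q) - g (fst q))"
    using continuous_attains_inf[OF K c] by blast
  define m where "m = norm (g (fst p + snd p) - g (fst p))"
  have "m > 0"
  proof (rule ccontr)
    assume "\<not> m > 0"
    then have "g (fst p + snd p) = g (fst p)" by (simp add: m_def)
    moreover have "0 < snd p" "snd p < 1" using p(1) d by (auto simp: K_def)
    ultimately show False by (rule no_repeat)
  qed
  moreover have "m \<le> norm (g (s + u) - g s)" if "d \<le> u" "u \<le> 1 - d" for s u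
  proof -
    have "(frac s, u) \<in> K" using that frac_lt_1[of s] by (auto simp: K_def less_imp_le)
    from p(2)[OF this] have "m \<le> norm (g (frac s + u) - g (frac s))" by (simp add: m_def)
    moreover have "g (s + u) = g (frac s + u)"
      using per_int[of "frac s + u" "\<lfloor>s\<rfloor>"] by (simp add: frac_def algebra_simps)
    ultimately show ?thesis by (simp add: g_frac)
  qed
  ultimately show ?thesis by (rule that)
qed

text \<open>Along a normal line the distance to the curve grows at least like half the distance to the
  foot point. This replaces an exterior cone condition.\<close>
lemma normal_escape:
  obtains r0 where "r0 > 0"
    "\<And>s t \<nu> r. norm \<nu> = 1 \<Longrightarrow> \<nu> \<bullet> g' t = 0 \<Longrightarrow> 0 < r \<Longrightarrow> r \<le> r0 \<Longrightarrow> r / 2 \<le> norm (g t + r *\<^sub>R \<nu> - g s)"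
proof -
  obtain m M where m: "0 < m" "\<And>t. m \<le> norm (g' t)" using speed_bounds by metis
  obtain d0 where d0: "d0 > 0" "\<And>s t. \<bar>s - t\<bar> \<le> d0 \<Longrightarrow> norm (g s - g t - (s - t) *\<^sub>R g' t) \<le> m / 4 * \<bar>s - t\<bar>"
    using local_linear[of "m / 4"] m by auto
  define d where "d = min d0 (1/2)"
  have d: "0 < d" "d \<le> 1/2" "d \<le> d0" using d0 by (auto simp: d_def)
  obtain m2 where m2: "m2 > 0" "\<And>s u. d \<le> u \<Longrightarrow> u \<le> 1 - d \<Longrightarrow> m2 \<le> norm (g (s + u) - g s)"
    using far_apart[OF d(1,2)] by blast
  have near: "r / 2 \<le> norm (g t + r *\<^sub>R \<nu> - g s)"
    if "norm \<nu> = 1" "\<nu> \<bullet> g' t = 0" "0 < r" "\<bar>s - t\<bar> \<le> d" for s t r \<nu>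
  proof -
    define h where "h = (s - t) *\<^sub>R g' t"
    \<comment> \<open>Pythagoras: as \<nu> is normal to h, both r and |h| are at most |r \<nu> - h|.
      Replacing g s - g t by h costs at most |h|/4, so at least three quarters of r remain.\<close>
    have orth: "(norm (r *\<^sub>R \<nu> - h))\<^sup>2 = r\<^sup>2 + (norm h)\<^sup>2"
    proof -
      have "\<nu> \<bullet> \<nu> = 1" "\<nu> \<bullet> h = 0" "h \<bullet> \<nu> = 0"
        using that by (simp_all add: dot_square_norm h_def inner_commute)
      then show ?thesis unfolding power2_norm_eq_inner
        by (simp add: inner_diff_left inner_diff_right power2_eq_square)
    qed
    have "r\<^sup>2 \<le> (norm (r *\<^sub>R \<nu> - h))\<^sup>2" "(norm h)\<^sup>2 \<le> (norm (r *\<^sub>R \<nu> - h))\<^sup>2"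
      unfolding orth by auto
    then have b: "r \<le> norm (r *\<^sub>R \<nu> - h)" "norm h \<le> norm (r *\<^sub>R \<nu> - h)"
      by (auto intro: power2_le_imp_le)
    have nh: "m * \<bar>s - t\<bar> \<le> norm h" unfolding h_def using m(2)[of t]
      by (simp add: mult.commute mult_right_mono)
    have "norm (g s - g t - h) \<le> m / 4 * \<bar>s - t\<bar>" unfolding h_def using d0(2)[of s t] that d by auto
    also have "\<dots> \<le> norm h / 4" using nh by simp
    finally have err: "norm (g s - g t - h) \<le> norm h / 4" .
    have "norm (r *\<^sub>R \<nu> - h) \<le> norm (g t + r *\<^sub>R \<nu> - g s) + norm (g s - g t - h)"
      using norm_triangle_ineq[of "g t + r *\<^sub>R \<nu> - g s" "g s - g t - h"] by simp
    then show ?thesis using b err that(3) by linarith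
  qed
  show ?thesis
  proof (rule that[of "m2 / 2"])
    fix s t \<nu> r assume *: "norm \<nu> = 1" "\<nu> \<bullet> g' t = 0" "0 < r" "r \<le> m2 / 2"
    \<comment> \<open>The parameter matters only modulo 1. For u near 0 or 1 the tangent estimate
      applies, in the latter case after subtracting a period; in between |g (t + u) - g t| >= m2 >=
      2 r.\<close>
    define u where "u = frac (s - t)"
    have u: "0 \<le> u" "u < 1" by (auto simp: u_def frac_lt_1)
    have gs: "g s = g (t + u)"
      using per_int[of "t + u" "\<lfloor>s - t\<rfloor>"] by (simp add: u_def frac_def)
    consider "u \<le> d" | "d \<le> u" "u \<le> 1 - d" | "1 - d \<le> u" using d by linarith
    then show "r / 2 \<le> norm (g t + r *\<^sub>R \<nu> - g s)"
    proof cases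
      case 1
      then show ?thesis unfolding gs using near[OF *(1-3), of "t + u"] u by auto
    next
      case 2
      have "norm (g (t + u) - g t) \<le> norm (g t + r *\<^sub>R \<nu> - g (t + u)) + norm (r *\<^sub>R \<nu>)"
        using norm_triangle_ineq4[of "r *\<^sub>R \<nu>" "g t + r *\<^sub>R \<nu> - g (t + u)"] by simp
      then show ?thesis unfolding gs using m2(2)[OF 2, of t] * by simp
    next
      case 3
      have "g (t + u) = g (t + u - 1)" using per[of "t + u - 1"] by simp
      then show ?thesis unfolding gs using near[OF *(1-3), of "t + u - 1"] u 3 by auto
    qed
  qed (use m2 in auto)
qed

text \<open>The squared distance from z to g s is minimal at s = t, so its derivative vanishes
  there.\<close>

lemma foot_point_orthogonal:
  assumes "infdist z J = dist z (g t)"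
  shows "(z - g t) \<bullet> g' t = 0"
proof -
  define q where "q s = (g s - z) \<bullet> (g s - z)" for s
  have dq: "(q has_real_derivative 2 * ((g t - z) \<bullet> g' t)) (at t)"
  proof -
    have "((\<lambda>s. g s - z) has_vector_derivative g' t) (at t)"
      using has_vector_derivative_diff[OF der[of t] has_vector_derivative_const[of z]] by simp
    then have d: "((\<lambda>s. g s - z) has_derivative (\<lambda>h. h *\<^sub>R g' t)) (at t)"
      by (simp add: has_vector_derivative_def)
    have "(q has_derivative (\<lambda>h. (g t - z) \<bullet> (h *\<^sub>R g' t) + (h *\<^sub>R g' t) \<bullet> (g t - z))) (at t)"
      unfolding q_def by (rule has_derivative_inner[OF d d])
    then show ?thesis unfolding has_field_derivative_def
      by (rule has_derivative_eq_rhs) (auto simp: inner_commute algebra_simps)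
  qed
  have "q t \<le> q s" for s
  proof -
    have "infdist z J \<le> dist z (g s)" using J by (intro infdist_le) auto
    then have "norm (g t - z) \<le> norm (g s - z)" using assms by (simp add: dist_norm norm_minus_commute)
    then show ?thesis unfolding q_def dot_square_norm by (intro power_mono) auto
  qed
  then have "2 * ((g t - z) \<bullet> g' t) = 0" using DERIV_local_min[OF dq, of 1] by auto
  then show ?thesis by (simp add: inner_diff_left)
qed

section \<open>Area of neighbourhoods of the curve\<close>

lemma nearest_point:
  obtains t where "infdist z J = dist z (g t)"
proof -
  obtain w where "w \<in> J" "infdist z J = dist z w"
    using infdist_attains_inf[OF compact_imp_closed[OF J_compact] J_nonempty] by blast
  then show ?thesis using J that by blast
qed

text \<open>At most 2/d sample points on the curve, each with a disc of radius (1 + M) d, cover the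
  neighbourhood; discs of area O(d^2) in this number have total area O(d).\<close>

lemma neighbourhood_area:
  obtains C where "C \<ge> 0" "\<And>d. 0 < d \<Longrightarrow> d \<le> 1 \<Longrightarrow> measure lborel {z. infdist z J \<le> d} \<le> C * d"
proof -
  obtain m M where M: "0 < m" "m \<le> M" "\<And>t. norm (g' t) \<le> M" using speed_bounds by metis
  have M0: "M > 0" using M by linarith
  show ?thesis
  proof (rule that[of "2 * pi * (1 + M)\<^sup>2"])
    fix d :: real assume d: "0 < d" "d \<le> 1"
    define N where "N = nat \<lceil>1 / d\<rceil>"
    have N: "1 / d \<le> real N" "real N \<le> 2 / d" "N > 0"
    proof -
      have d1: "1 / d \<ge> 1" using d by simp
      show "1 / d \<le> real N" unfolding N_def by linarith
      have "real N \<le> 1 / d + 1" unfolding N_def using d1 by linarith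
      also have "\<dots> \<le> 2 / d" using d1 by simp
      finally show "real N \<le> 2 / d" .
      show "N > 0" using d by (simp add: N_def)
    qed
    define B where "B i = cball (g (real i / real N)) ((1 + M) * d)" for i
    have sub: "{z. infdist z J \<le> d} \<subseteq> (\<Union>i<N. B i)"
    proof
      fix z assume "z \<in> {z. infdist z J \<le> d}"
      then obtain t0 where t0: "dist z (g t0) \<le> d" using nearest_point[of z] by (metis mem_Collect_eq)
      define t where "t = frac t0"
      have t: "dist z (g t) \<le> d" "0 \<le> t" "t < 1" using t0 by (auto simp: t_def g_frac frac_lt_1)
      define i where "i = nat \<lfloor>t * real N\<rfloor>"
      have i: "real i \<le> t * real N" "t * real N < real i + 1"
        using t unfolding i_def by (auto simp: of_nat_floor)
      have "real i < real N" using i(1) t N by (smt (verit, best) mult_less_cancel_right2 of_nat_0_less_iff)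
      then have iN: "i < N" by simp
      have "\<bar>real i / real N - t\<bar> \<le> 1 / real N"
      proof -
        have "real i / real N - t = (real i - t * real N) / real N" using N(3) by (simp add: diff_divide_distrib)
        moreover have "\<bar>real i - t * real N\<bar> / real N \<le> 1 / real N" using i by (intro divide_right_mono) auto
        ultimately show ?thesis by (simp only: abs_divide abs_of_nat)
      qed
      also have "\<dots> \<le> d" using N d by (simp add: field_simps)
      finally have "M * \<bar>real i / real N - t\<bar> \<le> M * d" using M0 by (intro mult_left_mono) auto
      then have "dist (g (real i / real N)) (g t) \<le> M * d"
        using curve_lipschitz[OF M(3), of "real i / real N" t] by (simp add: dist_norm)
      then have "dist (g (real i / real N)) z \<le> (1 + M) * d"
        using t(1) dist_triangle2[of "g (real i / real N)" z "g t"] by (simp add: algebra_simps)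
      then show "z \<in> (\<Union>i<N. B i)" using iN unfolding B_def by auto
    qed
    have Bm: "measure lborel (B i) = pi * ((1 + M) * d)\<^sup>2" for i
      unfolding B_def using d M0 by (subst content_cball) (auto simp: unit_ball_vol_2)
    have fm: "B i \<in> fmeasurable lborel" for i
      unfolding B_def fmeasurable_def using emeasure_bounded_finite[OF bounded_cball] by auto
    have "measure lborel {z. infdist z J \<le> d} \<le> measure lborel (\<Union>i<N. B i)"
    proof (rule measure_mono_fmeasurable[OF sub])
      have "closed {z. infdist z J \<le> d}" by (intro closed_Collect_le continuous_intros)
      then show "{z. infdist z J \<le> d} \<in> sets lborel" by simp
      show "(\<Union>i<N. B i) \<in> fmeasurable lborel" using fm by (intro fmeasurable.finite_UN) auto
    qed
    also have "\<dots> \<le> (\<Sum>i<N. measure lborel (B i))"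
      using fm by (intro measure_UNION_le) (auto simp: fmeasurable_def)
    also have "\<dots> = real N * (pi * ((1 + M) * d)\<^sup>2)" by (simp add: Bm)
    also have "\<dots> \<le> (2 / d) * (pi * ((1 + M) * d)\<^sup>2)"
      using N by (intro mult_right_mono) auto
    also have "\<dots> = 2 * pi * (1 + M)\<^sup>2 * d"
      using d by (simp add: power_mult_distrib power2_eq_square)
    finally show "measure lborel {z. infdist z J \<le> d} \<le> 2 * pi * (1 + M)\<^sup>2 * d" .
  qed auto
qed

lemma neighbourhood_fmeasurable: "{z. infdist z J \<le> d} \<in> fmeasurable lborel"
proof -
  have "closed {z. infdist z J \<le> d}" by (intro closed_Collect_le continuous_intros)
  moreover have "bounded {z. infdist z J \<le> d}"
  proof -
    obtain B where B: "\<And>w. w \<in> J \<Longrightarrow> norm w \<le> B" using J_compact compact_imp_bounded bounded_iff by metis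
    have "norm z \<le> B + d" if z: "infdist z J \<le> d" for z
    proof -
      obtain t where "dist z (g t) \<le> d" using nearest_point[of z] z by metis
      then show ?thesis using B[of "g t"] J norm_triangle_sub[of z "g t"] by (auto simp: dist_norm)
    qed
    then show ?thesis by (auto simp: bounded_iff)
  qed
  ultimately show ?thesis using emeasure_bounded_finite by (auto simp: fmeasurable_def)
qed

lemma J_null: "J \<in> null_sets lborel"
proof -
  have Jc: "closed J" using J_compact by (rule compact_imp_closed)
  obtain C where C: "C \<ge> 0" "\<And>d. 0 < d \<Longrightarrow> d \<le> 1 \<Longrightarrow> measure lborel {z. infdist z J \<le> d} \<le> C * d"
    using neighbourhood_area by blast
  have fin: "emeasure lborel J < \<infinity>" using J_compact by (intro emeasure_bounded_finite compact_imp_bounded)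
  have le: "measure lborel J \<le> C * d" if d: "0 < d" "d \<le> 1" for d
  proof -
    have "measure lborel J \<le> measure lborel {z. infdist z J \<le> d}"
      using Jc d neighbourhood_fmeasurable by (intro measure_mono_fmeasurable) auto
    then show ?thesis using C(2)[OF d] by linarith
  qed
  have "measure lborel J \<le> 0"
  proof (rule field_le_epsilon)
    fix e :: real assume e: "e > 0"
    define d where "d = min 1 (e / (C + 1))"
    have d: "0 < d" "d \<le> 1" using e C by (auto simp: d_def)
    have "C * d \<le> (C + 1) * (e / (C + 1))" using C e d by (intro mult_mono) (auto simp: d_def)
    also have "\<dots> = e" using C by simp
    finally show "measure lborel J \<le> 0 + e" using le[OF d] by simp
  qed
  then have "measure lborel J = 0" by (simp add: measure_le_0_iff)
  then have "emeasure lborel J = 0" using fin by (simp add: emeasure_eq_ennreal_measure)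
  then show ?thesis using Jc by auto
qed

section \<open>Position of a domain relative to its boundary curve\<close>

lemma simple_closed_path: "simple_path g" "pathfinish g = pathstart g" "path_image g = J"
proof -
  show "pathfinish g = pathstart g" using per[of 0] by (simp add: pathfinish_def pathstart_def)
  have "x = y \<or> x = 0 \<and> y = 1 \<or> x = 1 \<and> y = 0" if "x \<in> {0..1}" "y \<in> {0..1}" "g x = g y" for x y
  proof -
    have g1: "g 1 = g 0" using per[of 0] by simp
    show ?thesis
      using that inj g1 unfolding inj_on_def
      by (metis atLeastAtMost_iff atLeastLessThan_iff less_eq_real_def zero_less_one)
  qed
  then show "simple_path g" unfolding simple_path_def loop_free_def path_def using g_cont by blast
  show "path_image g = J" unfolding path_image_def J_image
    using per[of 0] J J_image by (metis atLeastLessThan_subseteq_atLeastAtMost_iff image_mono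
        dual_order.refl order_antisym subset_UNIV)
qed

text \<open>Says that no boundary point is hidden from the exterior. By the Jordan curve theorem J
  is the frontier of its unbounded complementary component, and this component misses D: being
  connected and disjoint from J it would otherwise lie inside the bounded set D.\<close>

lemma jordan_domain:
  assumes D: "open D" "connected D" "bounded D" "D \<noteq> {}" and fr: "frontier D = J"
  shows "J \<subseteq> closure (- closure D)"
proof -
  have jio: "open (inside J)" "connected (inside J)" "open (outside J)" "connected (outside J)"
    "\<not> bounded (outside J)" "inside J \<inter> outside J = {}" "inside J \<union> outside J = - J" "frontier (outside J) = J"
    using Jordan_inside_outside[OF simple_closed_path(1,2)] unfolding simple_closed_path(3) by auto
  have DJ: "D \<inter> J = {}" using D(1) fr frontier_disjoint_eq by blast
  have cl: "T \<subseteq> D" if T: "connected T" "T \<inter> J = {}" "T \<inter> D \<noteq> {}" for T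
    using connected_Int_frontier[of T D] T fr by blast
  have "outside J \<inter> D = {}"
  proof (rule ccontr)
    assume "outside J \<inter> D \<noteq> {}"
    then have "outside J \<subseteq> D" using jio by (intro cl) auto
    then show False using jio(5) D(3) bounded_subset by blast
  qed
  then have "outside J \<subseteq> - closure D"
    using jio(7) closure_Un_frontier[of D] fr by blast
  then have "closure (outside J) \<subseteq> closure (- closure D)" by (rule closure_mono)
  moreover have "J \<subseteq> closure (outside J)" using jio(8) by (auto simp: frontier_def)
  ultimately show ?thesis by blast
qed

end

section \<open>The exterior map and the Faber polynomials\<close>

text \<open>The polynomial takes away all coefficients of index at most 0 in w = 1/z, so the rest
  vanishes at w = 0. The residue computation for Faber polynomials works with this limit rather than
  with coefficients.\<close>

lemma laurent_minus_polynomial_part_tendsto_0: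
  assumes L: "f has_laurent_expansion L"
  shows "((\<lambda>w. f w - poly (fls_prpart L + [:fls_nth L 0:]) (1 / w)) \<longlongrightarrow> 0) (at 0)"
proof -
  define p where "p = fls_prpart L + [:fls_nth L 0:]"
  have pc: "coeff p k = fls_nth L (- int k)" for k
    unfolding p_def by (simp add: coeff_pCons split: nat.split)
  define S where "S = (\<Sum>i\<le>degree p. fls_const (coeff p i) * fls_X_intpow (- int i))"
  have "(\<lambda>w. \<Sum>i\<le>degree p. coeff p i * w powi (- int i)) has_laurent_expansion S"
    unfolding S_def by (intro laurent_expansion_intros)
  moreover have "(\<Sum>i\<le>degree p. coeff p i * w powi (- int i)) = poly p (1 / w)" for w
    unfolding poly_altdef by (simp add: power_int_minus power_one_over inverse_eq_divide)
  ultimately have "(\<lambda>w. poly p (1 / w)) has_laurent_expansion S" by simp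
  then have M: "(\<lambda>w. f w - poly p (1 / w)) has_laurent_expansion (L - S)"
    by (intro has_laurent_expansion_diff L)
  have S: "fls_nth S (- int k) = coeff p k" for k
  proof -
    have "fls_nth S (- int k) = (\<Sum>i\<le>degree p. if i = k then coeff p i else 0)"
      unfolding S_def fls_nth_sum by (intro sum.cong) auto
    also have "\<dots> = coeff p k" by (simp only: sum.delta finite_atMost) (auto simp: coeff_eq_0)
    finally show ?thesis .
  qed
  have z: "fls_nth (L - S) m = 0" if "m \<le> 0" for m
  proof -
    define k where "k = nat (- m)"
    have "m = - int k" using that by (simp add: k_def)
    then show ?thesis using S[of k] pc[of k] by simp
  qed
  have "fls_subdegree (L - S) \<ge> 0" by (rule fls_subdegree_ge0I) (use z in auto)
  from has_laurent_expansion_imp_tendsto_0[OF M this] show ?thesis using z[of 0] by (simp add: p_def)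
qed

text \<open>A branch of \<open>ln (f - z)\<close> cannot cover a disc of radius larger than \<open>\<pi>\<close>, as f is injective;
  so Bloch's theorem bounds its derivative.\<close>
lemma log_derivative_bloch:
  assumes hol: "f holomorphic_on ball s0 r" and inj: "inj_on f (ball s0 r)" and r: "r > 0"
    and z: "z \<notin> f ` ball s0 r"
  shows "norm (deriv f s0 / (f s0 - z)) \<le> 48 / r"
proof -
  have "(\<lambda>s. f s - z) holomorphic_on ball s0 r" by (intro holomorphic_intros hol)
  moreover have "contractible (ball s0 r)" by (intro convex_imp_contractible convex_ball)
  moreover have "f s - z \<noteq> 0" if "s \<in> ball s0 r" for s using z that by auto
  ultimately obtain L where L: "L holomorphic_on ball s0 r" "\<And>s. s \<in> ball s0 r \<Longrightarrow> f s - z = exp (L s)"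
    using contractible_imp_holomorphic_log[of "\<lambda>s. f s - z" "ball s0 r"] by blast
  have s0: "s0 \<in> ball s0 r" using r by simp
  have "((\<lambda>s. exp (L s) + z) has_field_derivative exp (L s0) * deriv L s0) (at s0)"
    using holomorphic_derivI[OF L(1) open_ball s0] by (auto intro!: derivative_eq_intros)
  then have "(f has_field_derivative exp (L s0) * deriv L s0) (at s0)"
    by (rule has_field_derivative_transform_within_open[OF _ open_ball s0])
       (use L(2) in \<open>auto simp: algebra_simps\<close>)
  then have d: "deriv f s0 / (f s0 - z) = deriv L s0"
    using L(2)[OF s0] by (simp add: DERIV_imp_deriv)
  show ?thesis
  proof (rule ccontr)
    assume "\<not> ?thesis"
    then have "48 / r < norm (deriv L s0)" by (simp add: d)
    \<comment> \<open>Bloch's theorem with constant 1/12 yields a disc of radius 4 > pi in the image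
      of L; this is the origin of 48 = 4 * 12. The points b - \<i> pi and b + \<i> pi of that disc
      have the same exponential.\<close>
    then have "4 \<le> r * norm (deriv L s0) / 12" using r by (simp add: field_simps)
    from Bloch[OF L(1) r this] obtain b where b: "ball b 4 \<subseteq> L ` ball s0 r" .
    have "b - of_real pi * \<i> \<in> ball b 4" "b + of_real pi * \<i> \<in> ball b 4"
      using pi_less_4 by (auto simp: dist_norm norm_mult)
    then have "b - of_real pi * \<i> \<in> L ` ball s0 r" "b + of_real pi * \<i> \<in> L ` ball s0 r"
      using b by (auto dest: subsetD)
    then obtain s1 s2 where s1: "s1 \<in> ball s0 r" "b - of_real pi * \<i> = L s1"
      and s2: "s2 \<in> ball s0 r" "b + of_real pi * \<i> = L s2" by (elim imageE)
    note s = s1(1) s2(1) s1(2)[symmetric] s2(2)[symmetric]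
    have "exp (L s2) = exp (L s1 + 2 * of_real pi * \<i>)" unfolding s by (simp add: algebra_simps)
    also have "\<dots> = exp (L s1)" by (simp add: exp_add)
    finally have "f s1 = f s2" using L(2)[OF s(1)] L(2)[OF s(2)] by (simp add: algebra_simps)
    then have "s1 = s2" using inj s by (auto dest: inj_onD)
    then show False using s by simp
  qed
qed

text \<open>Composition with the Cayley map that sends the half-plane to the disc and L z to 0 gives
  a self-map of the disc fixing 0, to which the Schwarz lemma applies. This is the infinitesimal
  Harnack inequality.\<close>

lemma half_plane_schwarz:
  assumes hol: "L holomorphic_on ball z r" and r: "r > 0" and pos: "\<And>w. w \<in> ball z r \<Longrightarrow> Re (L w) > 0"
  shows "norm (deriv L z) \<le> 2 * Re (L z) / r"
proof -
  define f where "f w = (L (z + of_real r * w) - L z) / (L (z + of_real r * w) + cnj (L z))" for w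
  have in_ball: "z + of_real r * w \<in> ball z r" if "norm w < 1" for w
    using that r by (simp add: dist_norm norm_mult)
  have zin: "z \<in> ball z r" using r by simp
  have den: "L (z + of_real r * w) + cnj (L z) \<noteq> 0" if "norm w < 1" for w
  proof -
    have "Re (L (z + of_real r * w) + cnj (L z)) > 0" using pos[OF in_ball[OF that]] pos[OF zin] by simp
    then show ?thesis by (metis less_irrefl zero_complex.sel(1))
  qed
  have comp: "(\<lambda>w. L (z + of_real r * w)) holomorphic_on ball 0 1"
    by (rule holomorphic_on_compose_gen[OF _ hol, unfolded o_def]) (use in_ball in \<open>auto intro!: holomorphic_intros\<close>)
  have fh: "f holomorphic_on ball 0 1" unfolding f_def
    using den by (intro holomorphic_intros comp) auto
  have f0: "f 0 = 0" by (simp add: f_def)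
  have f1: "norm (f w) < 1" if w: "norm w < 1" for w
  proof -
    have p: "Re (L (z + of_real r * w)) > 0" "Re (L z) > 0" using pos[OF in_ball[OF w]] pos[OF zin] by auto
    have "(norm (L (z + of_real r * w) - L z))\<^sup>2 < (norm (L (z + of_real r * w) + cnj (L z)))\<^sup>2"
    proof -
      have "0 < 4 * (Re (L (z + of_real r * w)) * Re (L z))" using p by simp
      then show ?thesis unfolding cmod_power2 by (simp add: power2_eq_square algebra_simps)
    qed
    then have "norm (L (z + of_real r * w) - L z) < norm (L (z + of_real r * w) + cnj (L z))"
      by (rule power2_less_imp_less) simp
    then show ?thesis using den[OF w] unfolding f_def norm_divide by (subst divide_less_eq_1_pos) auto
  qed
  have "norm (deriv f 0) \<le> 1" by (rule Schwarz_Lemma(2)[OF fh f0 f1, of 0]) auto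
  moreover have "deriv f 0 = of_real r * deriv L z / (2 * of_real (Re (L z)))"
  proof (rule DERIV_imp_deriv)
    have dL: "(L has_field_derivative deriv L z) (at (z + of_real r * 0))"
      using holomorphic_derivI[OF hol open_ball zin] by simp
    have inner: "((\<lambda>w. z + of_real r * w) has_field_derivative of_real r) (at 0)"
      by (auto intro!: derivative_eq_intros)
    have d: "((\<lambda>w. L (z + of_real r * w)) has_field_derivative deriv L z * of_real r) (at 0)"
      by (rule DERIV_chain2[OF dL inner])
    have s: "L z + cnj (L z) = 2 * of_real (Re (L z))" by (simp add: complex_add_cnj)
    have n0: "L z + cnj (L z) \<noteq> 0" using den[of 0] by simp
    have "(f has_field_derivative ((deriv L z * of_real r) * (L z + cnj (L z)) - (L z - L z) * (deriv L z * of_real r)) / ((L z + cnj (L z)) * (L z + cnj (L z)))) (at 0)"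
      unfolding f_def using n0 by (auto intro!: derivative_eq_intros d)
    then show "(f has_field_derivative of_real r * deriv L z / (2 * of_real (Re (L z)))) (at 0)"
      using n0 by (simp add: s mult.commute)
  qed
  ultimately have "r * norm (deriv L z) / (2 * Re (L z)) \<le> 1"
    using r pos[OF zin] by (simp add: norm_divide norm_mult)
  then show ?thesis using r pos[OF zin] by (simp add: field_simps)
qed

section \<open>The exterior map in the coordinates q and s\<close>

locale exterior_map =
  fixes D :: "complex set" and \<Phi> :: "complex \<Rightarrow> complex" and a :: real and c :: "nat \<Rightarrow> complex"
  assumes D_open: "open D" and D_bounded: "bounded D" and D_nonempty: "D \<noteq> {}"
    and ext: "exterior_conformal_map D \<Phi> a c"
begin

definition \<phi> where "\<phi> = inv_into (- cball 0 1) \<Phi>"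
text \<open>In the coordinate q = 1/w the exterior map is \<open>\<Phi> (1/q) = a B(q) / q\<close>; in the coordinate
  s = ln w it is P, and the exterior domain becomes the half-plane Re s > 0.\<close>
definition Bc where "Bc n = (case n of 0 \<Rightarrow> 1 | Suc m \<Rightarrow> c m)"
definition B where "B q = (\<Sum>n. Bc n * q ^ n)"
definition P where "P s = \<Phi> (exp s)"

lemma a_pos: "a > 0"
  and \<Phi>_hol: "\<Phi> holomorphic_on (- cball 0 1)"
  and \<Phi>_bij: "bij_betw \<Phi> (- cball 0 1) (- closure D)"
  and \<phi>_hol: "\<phi> holomorphic_on (- closure D)"
  and \<Phi>_sum: "norm z > 1 \<Longrightarrow> summable (\<lambda>n. c n / z ^ n)"
  and \<Phi>_eq: "norm z > 1 \<Longrightarrow> \<Phi> z = of_real a * (z + (\<Sum>n. c n / z ^ n))"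
  using ext unfolding exterior_conformal_map_def \<phi>_def by auto

lemma \<Phi>_inj: "inj_on \<Phi> (- cball 0 1)" and \<Phi>_image: "\<Phi> ` (- cball 0 1) = - closure D"
  using \<Phi>_bij by (auto simp: bij_betw_def)

lemma \<phi>_\<Phi>: "norm w > 1 \<Longrightarrow> \<phi> (\<Phi> w) = w"
  unfolding \<phi>_def by (rule inv_into_f_f[OF \<Phi>_inj]) auto

lemma \<Phi>_\<phi>: "\<zeta> \<notin> closure D \<Longrightarrow> \<Phi> (\<phi> \<zeta>) = \<zeta>" and norm_\<phi>: "\<zeta> \<notin> closure D \<Longrightarrow> norm (\<phi> \<zeta>) > 1"
  unfolding \<phi>_def using f_inv_into_f[of \<zeta> \<Phi> "- cball 0 1"] inv_into_into[of \<zeta> \<Phi> "- cball 0 1"] \<Phi>_image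
  by auto

lemma \<Phi>_ext: "norm w > 1 \<Longrightarrow> \<Phi> w \<notin> closure D"
  using \<Phi>_image by (metis ComplD ComplI imageI mem_cball_0 not_less)

lemma Bc_summable:
  assumes "norm q < 1"
  shows "summable (\<lambda>n. Bc n * q ^ n)"
proof (cases "q = 0")
  case True
  then show ?thesis by simp
next
  case False
  then have "norm (1 / q) > 1" using assms by (simp add: norm_divide)
  from \<Phi>_sum[OF this] have "summable (\<lambda>n. c n * q ^ n)" by (simp add: power_one_over)
  then have "summable (\<lambda>n. q * (c n * q ^ n))" by (rule summable_mult)
  then have "summable (\<lambda>n. Bc (Suc n) * q ^ Suc n)" by (simp add: Bc_def mult_ac)
  then show ?thesis by (subst (asm) summable_Suc_iff)
qed

lemma \<Phi>_B:
  assumes "norm q < 1" "q \<noteq> 0"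
  shows "\<Phi> (1 / q) = of_real a * B q / q"
proof -
  have n: "norm (1 / q) > 1" using assms by (simp add: norm_divide)
  have "B q = Bc 0 * q ^ 0 + (\<Sum>n. Bc (Suc n) * q ^ Suc n)"
    unfolding B_def using suminf_split_head[OF Bc_summable[OF assms(1)]] by simp
  also have "(\<Sum>n. Bc (Suc n) * q ^ Suc n) = (\<Sum>n. q * (c n * q ^ n))"
    by (simp add: Bc_def mult_ac)
  also have "\<dots> = q * (\<Sum>n. c n * q ^ n)"
    using \<Phi>_sum[OF n] by (intro suminf_mult) (simp add: power_one_over)
  finally have "B q = 1 + q * (\<Sum>n. c n * q ^ n)" by (simp add: Bc_def)
  then show ?thesis using \<Phi>_eq[OF n] assms by (simp add: power_one_over field_simps)
qed

lemma B_hol: "B holomorphic_on ball 0 1"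
proof -
  have "(B has_field_derivative (\<Sum>n. diffs Bc n * q ^ n)) (at q)" if "norm q < 1" for q
    unfolding B_def by (rule termdiffs_strong'[OF Bc_summable that])
  then show ?thesis unfolding holomorphic_on_open[OF open_ball] by (metis mem_ball_0)
qed

lemma B_0: "B 0 = 1" unfolding B_def by (simp add: Bc_def)

lemma exp_minus_in_ball: "Re s > 0 \<Longrightarrow> exp (- s) \<in> ball 0 1" by simp

lemma P_B:
  assumes "Re s > 0"
  shows "P s = of_real a * exp s * B (exp (- s))"
proof -
  have e: "1 / exp (- s) = exp s" by (simp add: exp_minus inverse_eq_divide)
  have "\<Phi> (1 / exp (- s)) = of_real a * B (exp (- s)) / exp (- s)"
    using assms by (intro \<Phi>_B) auto
  also have "\<dots> = of_real a * B (exp (- s)) * (1 / exp (- s))" by simp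
  finally show ?thesis unfolding e P_def by (simp only: mult_ac)
qed

lemma P_deriv:
  assumes s: "Re s > 0"
  shows "(P has_field_derivative of_real a * exp s * (B (exp (- s)) - exp (- s) * deriv B (exp (- s)))) (at s)"
proof -
  have dB: "(B has_field_derivative deriv B (exp (- s))) (at (exp (- s)))"
    by (rule holomorphic_derivI[OF B_hol open_ball exp_minus_in_ball[OF s]])
  have de: "((\<lambda>s. exp (- s)) has_field_derivative - exp (- s)) (at s)"
    by (auto intro!: derivative_eq_intros)
  have dc: "((\<lambda>s. B (exp (- s))) has_field_derivative deriv B (exp (- s)) * - exp (- s)) (at s)"
    by (rule DERIV_chain2[OF dB de])
  have "((\<lambda>s. of_real a * exp s * B (exp (- s))) has_field_derivative
      of_real a * exp s * (B (exp (- s)) - exp (- s) * deriv B (exp (- s)))) (at s)"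
    by (rule derivative_eq_intros dc refl | simp add: algebra_simps)+
  moreover have "open {s. Re s > 0}" by (rule open_halfspace_Re_gt)
  ultimately show ?thesis
    by (rule has_field_derivative_transform_within_open) (use s P_B in auto)
qed

lemma P_hol: "P holomorphic_on {s. Re s > 0}"
  using P_deriv by (auto simp: holomorphic_on_open open_halfspace_Re_gt)

lemma P_ext: "Re s > 0 \<Longrightarrow> P s \<notin> closure D"
  unfolding P_def by (rule \<Phi>_ext) simp

lemma P_inj:
  assumes "Re s > 0" "Re t > 0" "P s = P t" "\<bar>Im s - Im t\<bar> < 2 * pi"
  shows "s = t"
proof -
  have "exp s = exp t"
  proof -
    have "\<phi> (\<Phi> (exp s)) = exp s" "\<phi> (\<Phi> (exp t)) = exp t" using assms(1,2) by (auto intro!: \<phi>_\<Phi>)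
    then show ?thesis using assms(3) unfolding P_def by argo
  qed
  then show ?thesis by (rule exp_complex_eqI[OF assms(4)])
qed

text \<open>The generating function \<open>w \<Phi>'(w) / (\<Phi>(w) - z)\<close> of the Faber polynomials in q = 1/w; its Taylor
  coefficients are called Fab.\<close>
definition U where
  "U z q = of_real a * (B q - q * deriv B q) / (of_real a * B q - z * q)"

lemma U_denominator:
  assumes "z \<in> closure D" "norm q < 1" shows "of_real a * B q - z * q \<noteq> 0"
proof (cases "q = 0")
  case True
  then show ?thesis using a_pos by (simp add: B_0)
next
  case False
  have "\<Phi> (1 / q) \<noteq> z" using \<Phi>_ext[of "1 / q"] assms False by (auto simp: norm_divide)
  then show ?thesis using \<Phi>_B[OF assms(2) False] False by (simp add: field_simps)
qed

lemma U_hol: "z \<in> closure D \<Longrightarrow> U z holomorphic_on ball 0 1"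
  unfolding U_def using U_denominator
  by (intro holomorphic_intros B_hol holomorphic_deriv) auto

lemma U_0: "U z 0 = 1" unfolding U_def using a_pos by (simp add: B_0)

text \<open>P'(s) is w \<Phi>'(w) at w = exp s, so the logarithmic derivative of P - z is the
  generating function itself.\<close>

lemma P_log_deriv:
  assumes "z \<in> closure D" "Re s > 0"
  shows "deriv P s / (P s - z) = U z (exp (- s))"
proof -
  define q where "q = exp (- s)"
  have q: "exp s * q = 1" by (simp add: q_def exp_minus)
  have e: "exp s \<noteq> 0" by simp
  have "P s - z = exp s * (of_real a * B q - z * q)"
    using P_B[OF assms(2)] q by (simp add: q_def[symmetric] algebra_simps)
  moreover have "deriv P s = exp s * (of_real a * (B q - q * deriv B q))"
    using DERIV_imp_deriv[OF P_deriv[OF assms(2)]] by (simp add: q_def)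
  ultimately show ?thesis unfolding U_def q_def[symmetric] by (metis mult_divide_mult_cancel_left e)
qed

definition Fab where "Fab z n = (deriv ^^ n) (U z) 0 / fact n"

lemma Fab_sums:
  assumes "z \<in> closure D" "norm q < 1" shows "(\<lambda>n. Fab z n * q ^ n) sums U z q"
  using holomorphic_power_series[OF U_hol[OF assms(1)], of q] assms(2) by (simp add: Fab_def)

text \<open>The function 1/\<phi>(1/w) is bounded by 1 near w = 0, so its singularity is removable.
  The value 0 is found by letting w = 1/\<Phi>(1/q) with q tending to 0, where the function equals
  q.\<close>

lemma \<phi>_pole_inverse:
  obtains e k where "e > 0" "k holomorphic_on ball 0 e" "k 0 = 0"
    "\<And>w. w \<in> ball 0 e - {0} \<Longrightarrow> 1 / w \<notin> closure D \<and> k w = 1 / \<phi> (1 / w)"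
proof -
  obtain R where R: "R > 0" "\<And>z. z \<in> closure D \<Longrightarrow> norm z \<le> R"
    using D_bounded bounded_closure bounded_pos by metis
  define e where "e = 1 / R"
  have e: "e > 0" using R by (simp add: e_def)
  have nin: "1 / w \<notin> closure D" if "w \<in> ball 0 e - {0}" for w
  proof
    assume "1 / w \<in> closure D"
    then have "1 / norm w \<le> R" using R(2) by (metis norm_divide norm_one)
    moreover have "norm w < 1 / R" "norm w > 0" using that by (auto simp: e_def)
    ultimately show False using R(1) by (simp add: field_simps)
  qed
  have h: "(\<lambda>w. 1 / \<phi> (1 / w)) holomorphic_on ball 0 e - {0}"
  proof -
    have "(\<lambda>w. \<phi> (1 / w)) holomorphic_on ball 0 e - {0}"
      by (rule holomorphic_on_compose_gen[OF _ \<phi>_hol, unfolded o_def]) (use nin in \<open>auto intro!: holomorphic_intros\<close>)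
    moreover have "\<phi> (1 / w) \<noteq> 0" if "w \<in> ball 0 e - {0}" for w using norm_\<phi>[OF nin[OF that]] by auto
    ultimately show ?thesis by (intro holomorphic_intros) auto
  qed
  have "\<forall>\<^sub>F w in at 0. norm (1 / \<phi> (1 / w)) \<le> 1"
    unfolding eventually_at
  proof (intro exI[of _ e] conjI ballI impI e)
    fix w :: complex assume "w \<noteq> 0 \<and> dist w 0 < e"
    then have "norm (\<phi> (1 / w)) > 1" by (intro norm_\<phi> nin) (auto simp: dist_commute)
    then show "norm (1 / \<phi> (1 / w)) \<le> 1" by (auto simp: norm_divide divide_le_eq_1)
  qed
  then obtain k where k: "k holomorphic_on ball 0 e" "\<And>w. w \<in> ball 0 e - {0} \<Longrightarrow> k w = 1 / \<phi> (1 / w)"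
    using holomorphic_on_extend_bounded[OF h] e by auto
  define h where "h q = q / (of_real a * B q)" for q
  have Bc0: "isCont B 0"
    using holomorphic_on_imp_continuous_on[OF B_hol] continuous_on_interior by fastforce
  have Bt: "(B \<longlongrightarrow> 1) (at 0)" using Bc0 by (simp add: isCont_def B_0)
  have ht: "(h \<longlongrightarrow> 0) (at 0)"
    unfolding h_def using a_pos by (auto intro!: tendsto_eq_intros Bt)
  have kc: "isCont k 0" using holomorphic_on_imp_continuous_on[OF k(1)] e continuous_on_interior[of "ball 0 e" k 0] by auto
  have "((\<lambda>q. k (h q)) \<longlongrightarrow> k 0) (at 0)" using isCont_tendsto_compose[OF kc ht] .
  moreover have "\<forall>\<^sub>F q in at 0. k (h q) = q"
  proof -
    have "\<forall>\<^sub>F q in at 0. B q \<noteq> 0" using tendsto_imp_eventually_ne[OF Bt] by simp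
    moreover have "\<forall>\<^sub>F q in at 0. norm (h q) < e" using order_tendstoD(2)[OF tendsto_norm[OF ht]] e by simp
    moreover have "\<forall>\<^sub>F q in at 0. q \<in> ball 0 1 - {0::complex}"
      by (rule eventually_at_in_open) auto
    ultimately show ?thesis
    proof eventually_elim
      case (elim q)
      then have "h q \<noteq> 0" using a_pos by (simp add: h_def)
      then have "k (h q) = 1 / \<phi> (1 / h q)" using elim by (intro k) auto
      also have "1 / h q = \<Phi> (1 / q)" using \<Phi>_B[of q] elim by (simp add: h_def)
      also have "\<phi> (\<Phi> (1 / q)) = 1 / q" using elim by (intro \<phi>_\<Phi>) (simp add: norm_divide)
      finally show ?case by simp
    qed
  qed
  ultimately have "((\<lambda>q. q) \<longlongrightarrow> k 0) (at 0)" by (simp add: tendsto_cong)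
  then have "k 0 = 0" using tendsto_unique[OF _ _ tendsto_ident_at] by (metis at_neq_bot tendsto_unique tendsto_ident_at)
  then show ?thesis using that[OF e k(1)] k(2) nin by blast
qed

text \<open>If |P s| were large, then k at 1/P s, which is exp (- s), would be close to k 0 = 0;
  this contradicts Re s <= X. The bound holds uniformly as Re s tends to 0.\<close>

lemma P_bounded:
  assumes "0 < X"
  obtains R where "\<And>s. 0 < Re s \<Longrightarrow> Re s \<le> X \<Longrightarrow> norm (P s) \<le> R"
proof -
  obtain e k where k: "e > 0" "k holomorphic_on ball 0 e" "k 0 = 0"
    "\<And>w. w \<in> ball 0 e - {0} \<Longrightarrow> 1 / w \<notin> closure D \<and> k w = 1 / \<phi> (1 / w)"
    using \<phi>_pole_inverse by metis
  have "isCont k 0"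
    using holomorphic_on_imp_continuous_on[OF k(2)] k(1) continuous_on_interior[of "ball 0 e" k 0] by auto
  then obtain d where d: "d > 0" "\<And>w. dist w 0 < d \<Longrightarrow> dist (k w) (k 0) < exp (- X)"
    unfolding continuous_at_eps_delta by (metis exp_gt_zero)
  define r where "r = min e d"
  have r: "r > 0" using k d by (simp add: r_def)
  have "norm (P s) \<le> 1 / r" if s: "0 < Re s" "Re s \<le> X" for s
  proof (rule ccontr)
    assume n: "\<not> ?thesis"
    then have gt: "norm (P s) > 1 / r" by simp
    have nz: "P s \<noteq> 0" using gt r by auto
    define w where "w = 1 / P s"
    have nw: "norm w < r" using gt r nz by (simp add: w_def norm_divide field_simps)
    have "k w = 1 / \<phi> (P s)" using k(4)[of w] nz nw by (auto simp: w_def r_def)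
    also have "\<phi> (P s) = exp s" unfolding P_def using s by (intro \<phi>_\<Phi>) simp
    finally have "norm (k w) = exp (- Re s)" by (simp add: norm_divide exp_minus inverse_eq_divide)
    moreover have "norm (k w) < exp (- X)" using d(2)[of w] nw k(3) by (auto simp: r_def)
    ultimately show False using s by simp
  qed
  then show ?thesis by (rule that)
qed

text \<open>A residue computation on |q| = 1/2. In Cauchy's formula for the n-th Taylor coefficient
  of U the factor 1/q^n is replaced by E q + p (T q). Since E is holomorphic with E 0 = 0 it
  contributes nothing; p (T q) splits into the constant p z, which U z 0 = 1 reproduces, and a
  multiple of T q - z, which becomes an exact derivative.\<close>

theorem faber_poly_Fab:
  assumes z: "z \<in> closure D"
  shows "poly (faber_poly \<Phi> n) z = Fab z n"
proof -
  obtain e k where k: "e > 0" "k holomorphic_on ball 0 e" "k 0 = 0"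
    "\<And>w. w \<in> ball 0 e - {0} \<Longrightarrow> 1 / w \<notin> closure D \<and> k w = 1 / \<phi> (1 / w)"
    using \<phi>_pole_inverse by metis
  have "k analytic_on {0}" using k(1,2) unfolding analytic_at by (intro exI[of _ "ball 0 e"]) auto
  then have "k has_laurent_expansion laurent_expansion k 0"
    by (intro not_essential_has_laurent_expansion_0 isolated_singularity_at_analytic not_essential_analytic) auto
  then have "(\<lambda>w. inverse (k w)) has_laurent_expansion inverse (laurent_expansion k 0)"
    by (rule has_laurent_expansion_inverse)
  moreover have "\<forall>\<^sub>F w in at 0. inverse (k w) = \<phi> (1 / w)"
  proof -
    have "\<forall>\<^sub>F w in at 0. w \<in> ball 0 e - {0}" using k(1) by (intro eventually_at_in_open) auto
    then show ?thesis by eventually_elim (use k(4) in simp)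
  qed
  ultimately have "(\<lambda>w. \<phi> (1 / w)) has_laurent_expansion inverse (laurent_expansion k 0)"
    by (subst (asm) has_laurent_expansion_cong[OF _ refl]) auto
  then have "(\<lambda>w. \<phi> (1 / w) ^ n) has_laurent_expansion inverse (laurent_expansion k 0) ^ n"
    by (intro laurent_expansion_intros)
  then have LE: "(\<lambda>w. \<phi> (1 / w) ^ n) has_laurent_expansion laurent_expansion (\<lambda>w. \<phi> (1 / w) ^ n) 0"
    by (simp add: laurent_expansion_0_eqI)
  define p where "p = faber_poly \<Phi> n"
  have lim: "((\<lambda>w. \<phi> (1 / w) ^ n - poly p (1 / w)) \<longlongrightarrow> 0) (at 0)"
    using laurent_minus_polynomial_part_tendsto_0[OF LE]
    by (simp add: p_def faber_poly_def polynomial_part_at_infinity_def Let_def \<phi>_def)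
  define T where "T q = of_real a * B q / q" for q
  \<comment> \<open>In the coordinate q the function T is \<Phi>(1/q) and 1/q^n is \<phi>^n, so E is
    the difference between \<phi>^n and its polynomial part; the value 0 at q = 0 is its
    limit.\<close>
  define E where "E q = (if q = 0 then 0 else 1 / q ^ n - poly p (T q))" for q
  have Bcont: "isCont B 0"
    using holomorphic_on_imp_continuous_on[OF B_hol] continuous_on_interior by fastforce
  have Bt: "(B \<longlongrightarrow> 1) (at 0)" using Bcont by (simp add: isCont_def B_0)
  have Et: "(E \<longlongrightarrow> 0) (at 0)"
  proof -
    define h where "h q = q / (of_real a * B q)" for q
    have ht: "(h \<longlongrightarrow> 0) (at 0)"
      unfolding h_def using a_pos by (auto intro!: tendsto_eq_intros Bt)
    have evB: "\<forall>\<^sub>F q in at 0. B q \<noteq> 0" using tendsto_imp_eventually_ne[OF Bt] by simp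
    have evb: "\<forall>\<^sub>F q in at 0. q \<in> ball 0 1 - {0::complex}"
      by (rule eventually_at_in_open) auto
    have "\<forall>\<^sub>F q in at 0. h q \<noteq> 0" using evB evb by eventually_elim (use a_pos in \<open>auto simp: h_def\<close>)
    then have hf: "filterlim h (at 0) (at 0)" using ht by (intro filterlim_atI) auto
    have "((\<lambda>q. \<phi> (1 / h q) ^ n - poly p (1 / h q)) \<longlongrightarrow> 0) (at 0)"
      using filterlim_compose[OF lim hf] .
    moreover have "\<forall>\<^sub>F q in at 0. \<phi> (1 / h q) ^ n - poly p (1 / h q) = E q"
      using evB evb
    proof eventually_elim
      case (elim q)
      have "1 / h q = T q" by (simp add: h_def T_def)
      moreover have "T q = \<Phi> (1 / q)" using \<Phi>_B[of q] elim by (simp add: T_def)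
      moreover have "\<phi> (\<Phi> (1 / q)) = 1 / q" using elim by (intro \<phi>_\<Phi>) (simp add: norm_divide)
      ultimately show ?case using elim by (simp add: E_def power_one_over)
    qed
    ultimately show ?thesis by (simp add: tendsto_cong)
  qed
  have Thol: "T holomorphic_on ball 0 1 - {0}"
    unfolding T_def by (intro holomorphic_intros holomorphic_on_subset[OF B_hol]) auto
  have phol: "poly r holomorphic_on S" for r S
    unfolding holomorphic_on_def field_differentiable_def using poly_DERIV has_field_derivative_at_within by blast
  have Eh: "E holomorphic_on ball 0 1"
  proof (rule no_isolated_singularity)
    have h: "(\<lambda>q. 1 / q ^ n - poly p (T q)) holomorphic_on ball 0 1 - {0}"
      by (intro holomorphic_intros holomorphic_on_compose_gen[OF Thol phol, unfolded o_def]) auto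
    then show h': "E holomorphic_on ball 0 1 - {0}"
      by (rule holomorphic_transform) (auto simp: E_def)
    show "continuous_on (ball 0 1) E"
    proof (rule continuous_at_imp_continuous_on, rule ballI)
      fix q :: complex assume q: "q \<in> ball 0 1"
      show "isCont E q"
      proof (cases "q = 0")
        case True
        then show ?thesis using Et by (simp add: isCont_def E_def)
      next
        case False
        have "open (ball (0::complex) 1 - {0})" by auto
        then show ?thesis using False q continuous_on_eq_continuous_at holomorphic_on_imp_continuous_on[OF h'] by blast
      qed
    qed
  qed auto
  define r :: real where "r = 1/2"
  have r: "0 < r" "r < 1" by (auto simp: r_def)
  have circ: "path_image (circlepath 0 r) \<subseteq> ball 0 1 - {0}" using r by (auto simp: path_image_circlepath sphere_def)
  have cb: "cball 0 r \<subseteq> ball (0::complex) 1" using r by auto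
  have Uc: "continuous_on (cball 0 r) (U z)" "U z holomorphic_on ball 0 r"
    using holomorphic_on_subset[OF U_hol[OF z] cb] holomorphic_on_subset[OF U_hol[OF z], of "ball 0 r"] r
    by (auto intro: holomorphic_on_imp_continuous_on)
  have I1: "((\<lambda>q. U z q / (q - 0) ^ Suc n) has_contour_integral (2 * pi * \<i> / fact n * (deriv ^^ n) (U z) 0)) (circlepath 0 r)"
    using Cauchy_has_contour_integral_higher_derivative_circlepath[OF Uc, of 0 n] r by simp
  have I2: "((\<lambda>q. U z q * E q / (q - 0)) has_contour_integral 2 * of_real pi * \<i> * (U z 0 * E 0)) (circlepath 0 r)"
    by (rule Cauchy_integral_circlepath_simple[where f = "\<lambda>q. U z q * E q"])
       (use r U_hol[OF z] Eh cb in \<open>auto intro!: holomorphic_intros intro: holomorphic_on_subset\<close>)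
  have I3: "((\<lambda>q. U z q / (q - 0)) has_contour_integral 2 * of_real pi * \<i> * U z 0) (circlepath 0 r)"
    by (rule Cauchy_integral_circlepath_simple[where f = "U z"]) (use r U_hol[OF z] cb in \<open>auto intro: holomorphic_on_subset\<close>)
  \<comment> \<open>The quotient Q enters the integral as Q(T) T', the derivative of a primitive
    along a closed loop.\<close>
  define Q where "Q = synthetic_div p z"
  have pQ: "poly p x = poly p z + (x - z) * poly Q x" for x
  proof -
    have "poly p x = poly ([:- z, 1:] * Q + [:poly p z:]) x" unfolding Q_def by (simp only: synthetic_div_correct')
    then show ?thesis by (simp add: algebra_simps)
  qed
  obtain G where G: "\<And>x. (G has_field_derivative poly Q x) (at x)"
    using holomorphic_convex_primitive'[of UNIV "poly Q"] phol by auto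
  define T' where "T' q = of_real a * (deriv B q * q - B q) / q\<^sup>2" for q
  have dT: "(T has_field_derivative T' q) (at q)" if "q \<in> ball 0 1 - {0}" for q
    unfolding T_def T'_def using that holomorphic_derivI[OF B_hol open_ball, of q]
    by (auto intro!: derivative_eq_intros simp: power2_eq_square algebra_simps)
  have I4: "((\<lambda>q. poly Q (T q) * T' q) has_contour_integral 0) (circlepath 0 r)"
  proof -
    have "((\<lambda>q. G (T q)) has_field_derivative poly Q (T q) * T' q) (at q within ball 0 1 - {0})"
      if "q \<in> ball 0 1 - {0}" for q
      using DERIV_chain2[OF G dT[OF that]] by (rule has_field_derivative_at_within)
    from contour_integral_primitive[OF this valid_path_circlepath circ]
    show ?thesis by simp
  qed
  \<comment> \<open>This says that U z q dq/q is minus the differential of log (T q - z).\<close>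
  have UT: "U z q / q = - T' q / (T q - z)" and Tz: "T q - z \<noteq> 0" if q: "q \<in> ball 0 1 - {0}" for q
  proof -
    have d: "of_real a * B q - z * q \<noteq> 0" using U_denominator[OF z] q by auto
    have Te: "T q - z = (of_real a * B q - z * q) / q" using q by (simp add: T_def field_simps)
    then show "T q - z \<noteq> 0" using d q by simp
    show "U z q / q = - T' q / (T q - z)"
      unfolding Te T'_def U_def using d q by (simp add: divide_simps power2_eq_square) (simp add: algebra_simps)
  qed
  have eq: "U z q / (q - 0) ^ Suc n = U z q * E q / (q - 0) + (poly p z * (U z q / (q - 0)) - poly Q (T q) * T' q)"
    if q: "q \<in> path_image (circlepath 0 r)" for q
  proof -
    have qq: "q \<in> ball 0 1 - {0}" using q circ by blast
    have "U z q / q * poly p (T q) = poly p z * (U z q / q) + (U z q / q) * (T q - z) * poly Q (T q)"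
    proof -
      have alg: "A * (p + B * C) = p * A + A * B * C" for A p B C :: complex by (simp add: algebra_simps)
      show ?thesis by (subst pQ[of "T q"]) (rule alg)
    qed
    also have "(U z q / q) * (T q - z) = - T' q" using UT[OF qq] Tz[OF qq] by simp
    finally have "U z q / q * poly p (T q) = poly p z * (U z q / q) - poly Q (T q) * T' q" by (simp add: mult.commute)
    moreover have "U z q / q ^ Suc n = U z q * E q / q + U z q / q * poly p (T q)"
      using qq by (simp add: E_def field_simps)
    ultimately show ?thesis by simp
  qed
  have "((\<lambda>q. U z q * E q / (q - 0) + (poly p z * (U z q / (q - 0)) - poly Q (T q) * T' q)) has_contour_integral
     2 * of_real pi * \<i> * (U z 0 * E 0) + (poly p z * (2 * of_real pi * \<i> * U z 0) - 0)) (circlepath 0 r)"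
    by (intro has_contour_integral_add has_contour_integral_diff has_contour_integral_lmul I2 I3 I4)
  then have "((\<lambda>q. U z q / (q - 0) ^ Suc n) has_contour_integral
     2 * of_real pi * \<i> * (U z 0 * E 0) + (poly p z * (2 * of_real pi * \<i> * U z 0) - 0)) (circlepath 0 r)"
    by (rule has_contour_integral_eq) (use eq in simp)
  from has_contour_integral_unique[OF I1 this]
  have "2 * pi * \<i> * Fab z n = 2 * pi * \<i> * poly p z" by (simp add: E_def U_0 Fab_def)
  then show ?thesis by (simp add: p_def)
qed

end

section \<open>Growth of coefficients and convergence of the Faber series\<close>

lemma integral_series_uniform:
  fixes h :: "nat \<Rightarrow> real \<Rightarrow> complex"
  assumes c: "\<And>n. continuous_on {a..b} (h n)" and M: "\<And>n y. y \<in> {a..b} \<Longrightarrow> norm (h n y) \<le> M n" "summable M"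
  shows "(\<lambda>n. integral {a..b} (h n)) sums integral {a..b} (\<lambda>y. \<Sum>n. h n y)"
proof -
  have u: "uniform_limit {a..b} (\<lambda>n y. \<Sum>i<n. h i y) (\<lambda>y. \<Sum>n. h n y) sequentially"
    by (rule Weierstrass_m_test[OF M])
  have c': "continuous_on {a..b} (\<lambda>y. \<Sum>i<n. h i y)" for n by (intro continuous_intros c)
  from uniform_limit_integral[OF u c'] obtain I J where
    I: "\<And>n. ((\<lambda>y. \<Sum>i<n. h i y) has_integral I n) {a..b}"
    and J: "((\<lambda>y. \<Sum>n. h n y) has_integral J) {a..b}" and lim: "I \<longlonglongrightarrow> J" by auto
  have "I n = (\<Sum>i<n. integral {a..b} (h i))" for n
    using integral_unique[OF I[of n]] by (simp add: integral_sum integrable_continuous_interval c)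
  then have "I = (\<lambda>n. \<Sum>i<n. integral {a..b} (h i))" by (rule ext)
  then show ?thesis using lim integral_unique[OF J] by (simp add: sums_def)
qed

lemma integral_cis:
  "integral {0..2*pi} (\<lambda>y. cis (of_int k * y)) = (if k = 0 then 2 * pi else 0)"
proof (cases "k = 0")
  case False
  define G where "G y = cis (of_int k * y) / (\<i> * of_int k)" for y :: real
  have d: "(G has_vector_derivative cis (of_int k * y)) (at y within {0..2*pi})" for y
  proof -
    have "((\<lambda>y. exp (\<i> * of_int k * of_real y) / (\<i> * of_int k)) has_vector_derivative
        exp (\<i> * of_int k * of_real y)) (at y within {0..2*pi})"
    proof (rule has_vector_derivative_real_field)
      show "((\<lambda>w. exp (\<i> * of_int k * w) / (\<i> * of_int k)) has_field_derivative
          exp (\<i> * of_int k * of_real y)) (at (of_real y))"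
        using False by (auto intro!: derivative_eq_intros)
    qed
    then show ?thesis unfolding G_def by (simp add: cis_conv_exp mult_ac)
  qed
  have "((\<lambda>y. cis (of_int k * y)) has_integral (G (2 * pi) - G 0)) {0..2*pi}"
    by (rule fundamental_theorem_of_calculus) (use d in auto)
  moreover have "G (2 * pi) = G 0"
  proof -
    have "cis (2 * pi * of_int k) = 1" by (rule cis_multiple_2pi) simp
    then have "cis (of_int k * (2 * pi)) = 1" by (simp only: mult.commute)
    then show ?thesis by (simp only: G_def mult_zero_right cis_zero)
  qed
  ultimately show ?thesis using False by (simp add: integral_unique)
qed (simp add: scaleR_conv_of_real)

lemma exp_minus_Complex_power: "exp (- Complex x y) ^ n = of_real (exp (- x) ^ n) * cis (- (real n * y))"
proof -
  have "exp (- Complex x y) = of_real (exp (- x)) * cis (- y)"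
    by (simp add: exp_eq_polar)
  then show ?thesis using Complex.DeMoivre[of "- y" n] by (simp only: power_mult_distrib of_real_power mult_minus_right)
qed

text \<open>The functions exp (- n s) are orthogonal on a vertical segment of length 2 pi. Two
  different series are allowed because the boundary term for the Faber series pairs the conjugate of
  P with U.\<close>

lemma parseval_exp:
  fixes p q :: "nat \<Rightarrow> complex"
  defines "f \<equiv> \<lambda>s. \<Sum>n. p n * exp (- s) ^ n" and "g \<equiv> \<lambda>s. \<Sum>n. q n * exp (- s) ^ n"
  assumes p: "summable (\<lambda>n. norm (p n) * exp (- x) ^ n)" and q: "summable (\<lambda>n. norm (q n) * exp (- x) ^ n)"
  shows "(\<lambda>n. 2 * pi * (cnj (p n) * q n * of_real (exp (- x) ^ (2 * n)))) sums
     integral {0..2*pi} (\<lambda>y. cnj (f (Complex x y)) * g (Complex x y))"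
proof -
  define r where "r = exp (- x)"
  have r0: "r > 0" by (simp add: r_def)
  have tn: "norm (w * exp (- Complex x y) ^ n) = norm w * r ^ n" for w y n
    by (simp add: exp_minus_Complex_power norm_mult norm_power r_def)
  have gc: "continuous_on {0..2*pi} (\<lambda>y. g (Complex x y))"
    unfolding g_def
  proof (rule uniform_limit_theorem)
    show "uniform_limit {0..2*pi} (\<lambda>n y. \<Sum>i<n. q i * exp (- Complex x y) ^ i) (\<lambda>y. \<Sum>n. q n * exp (- Complex x y) ^ n) sequentially"
      by (rule Weierstrass_m_test[OF _ q]) (simp only: tn r_def order_refl)
  qed (auto intro!: continuous_intros always_eventually)
  \<comment> \<open>These are the Fourier coefficients of g. Only one series is expanded at a time,
    so no double sum has to be rearranged.\<close>
  have inner: "integral {0..2*pi} (\<lambda>y. cis (real m * y) * g (Complex x y)) = 2 * pi * (q m * of_real (r ^ m))" for m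
  proof -
    have S: "(\<lambda>n. integral {0..2*pi} (\<lambda>y. cis (real m * y) * (q n * exp (- Complex x y) ^ n))) sums
      integral {0..2*pi} (\<lambda>y. \<Sum>n. cis (real m * y) * (q n * exp (- Complex x y) ^ n))"
    proof (rule integral_series_uniform)
      show "summable (\<lambda>n. norm (q n) * r ^ n)" using q by (simp add: r_def)
      show "norm (cis (real m * y) * (q n * exp (- Complex x y) ^ n)) \<le> norm (q n) * r ^ n" for n y
        unfolding norm_mult[of "cis _"] tn by simp
    qed (intro continuous_intros)
    have sm: "summable (\<lambda>n. q n * exp (- Complex x y) ^ n)" for y
      by (rule summable_norm_cancel) (use q in \<open>simp only: tn r_def\<close>)
    have e1: "(\<Sum>n. cis (real m * y) * (q n * exp (- Complex x y) ^ n)) = cis (real m * y) * g (Complex x y)" for y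
      unfolding g_def by (rule suminf_mult[OF sm])
    have e2: "integral {0..2*pi} (\<lambda>y. cis (real m * y) * (q n * exp (- Complex x y) ^ n)) =
       (if n = m then 2 * pi * (q m * of_real (r ^ m)) else 0)" for n
    proof -
      have e: "cis (real m * y) * (q n * exp (- Complex x y) ^ n) = (q n * of_real (r ^ n)) * cis (of_int (int m - int n) * y)" for y
      proof -
        have "cis (real m * y) * cis (- (real n * y)) = cis (of_int (int m - int n) * y)"
          by (simp add: cis_mult algebra_simps)
        then show ?thesis unfolding exp_minus_Complex_power r_def[symmetric]
          by (simp add: mult.left_commute mult.assoc)
      qed
      show ?thesis unfolding e integral_mult_right integral_cis by simp
    qed
    have "(\<lambda>n. if n = m then 2 * pi * (q m * of_real (r ^ m)) else 0) sums (2 * pi * (q m * of_real (r ^ m)))"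
      by (rule sums_single)
    then show ?thesis using sums_unique2[OF S] unfolding e1 e2 by blast
  qed
  have gb: "norm (g (Complex x y)) \<le> (\<Sum>n. norm (q n) * r ^ n)" for y
  proof -
    have "norm (g (Complex x y)) \<le> (\<Sum>n. norm (q n * exp (- Complex x y) ^ n))"
      unfolding g_def by (rule summable_norm) (use q in \<open>simp only: tn r_def\<close>)
    then show ?thesis by (simp only: tn)
  qed
  have S: "(\<lambda>n. integral {0..2*pi} (\<lambda>y. cnj (p n * exp (- Complex x y) ^ n) * g (Complex x y))) sums
      integral {0..2*pi} (\<lambda>y. \<Sum>n. cnj (p n * exp (- Complex x y) ^ n) * g (Complex x y))"
  proof (rule integral_series_uniform)
    show "summable (\<lambda>n. norm (p n) * r ^ n * (\<Sum>n. norm (q n) * r ^ n))"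
      using p by (intro summable_mult2) (simp add: r_def)
    show "norm (cnj (p n * exp (- Complex x y) ^ n) * g (Complex x y)) \<le> norm (p n) * r ^ n * (\<Sum>n. norm (q n) * r ^ n)" for n y
      unfolding norm_mult[of "cnj _"] complex_mod_cnj tn using r0 by (intro mult_left_mono gb) auto
  qed (intro continuous_intros gc)
  have e1: "(\<Sum>n. cnj (p n * exp (- Complex x y) ^ n) * g (Complex x y)) = cnj (f (Complex x y)) * g (Complex x y)" for y
  proof -
    have "(\<lambda>n. p n * exp (- Complex x y) ^ n) sums f (Complex x y)"
      unfolding f_def by (rule summable_sums, rule summable_norm_cancel) (use p in \<open>simp only: tn r_def\<close>)
    then have "(\<lambda>n. cnj (p n * exp (- Complex x y) ^ n) * g (Complex x y)) sums (cnj (f (Complex x y)) * g (Complex x y))"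
      by (intro sums_mult2) (simp only: sums_cnj)
    then show ?thesis by (rule sums_unique[symmetric])
  qed
  have e2: "integral {0..2*pi} (\<lambda>y. cnj (p n * exp (- Complex x y) ^ n) * g (Complex x y)) =
     2 * pi * (cnj (p n) * q n * of_real (exp (- x) ^ (2 * n)))" for n
  proof -
    have e: "cnj (p n * exp (- Complex x y) ^ n) * g (Complex x y) = (cnj (p n) * of_real (r ^ n)) * (cis (real n * y) * g (Complex x y))" for y
      unfolding exp_minus_Complex_power r_def[symmetric] by (simp add: cis_cnj mult.assoc)
    have e': "exp (- x) ^ (2 * n) = r ^ n * r ^ n" by (simp add: r_def mult_2 power_add)
    show ?thesis unfolding e integral_mult_right inner e' by simp
  qed
  show ?thesis using S unfolding e1 e2 .
qed

lemma power_series_abs_summable: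
  fixes p :: "nat \<Rightarrow> complex"
  assumes p: "\<And>q. norm q < 1 \<Longrightarrow> summable (\<lambda>n. p n * q ^ n)" and x: "x > 0"
  shows "summable (\<lambda>n. norm (p n) * exp (- x) ^ n)"
proof -
  have "norm (of_real (exp (- x / 2)) :: complex) < 1" using x by simp
  from powser_insidea[OF p[OF this], of "of_real (exp (- x))"] x show ?thesis
    by (simp add: norm_mult norm_power)
qed

lemma power_series_exp_continuous:
  fixes p :: "nat \<Rightarrow> complex"
  assumes p: "\<And>q. norm q < 1 \<Longrightarrow> summable (\<lambda>n. p n * q ^ n)"
  shows "continuous_on {s. Re s > 0} (\<lambda>s. \<Sum>n. p n * exp (- s) ^ n)"
proof -
  have "((\<lambda>q. \<Sum>n. p n * q ^ n) has_field_derivative (\<Sum>n. diffs p n * q ^ n)) (at q)" if "norm q < 1" for q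
    by (rule termdiffs_strong'[OF p that])
  then have "continuous_on (ball 0 1) (\<lambda>q. \<Sum>n. p n * q ^ n)"
    by (intro continuous_at_imp_continuous_on ballI) (meson DERIV_isCont mem_ball_0)
  then show ?thesis by (rule continuous_on_compose2) (auto intro!: continuous_intros)
qed

text \<open>For d/2 <= x <= d and n d <= 2 the weight exp (- 2 n x) is at least exp (-4), so every n
  in A survives in Parseval's identity with a fixed factor. Integrating 2 pi over a width d/2 gives
  pi d.\<close>

lemma bessel_block:
  fixes p :: "nat \<Rightarrow> complex"
  assumes p: "\<And>q. norm q < 1 \<Longrightarrow> summable (\<lambda>n. p n * q ^ n)" and d: "d > 0"
    and A: "finite A" "\<And>n. n \<in> A \<Longrightarrow> real n * d \<le> 2"
    and h: "\<And>s. Re s > 0 \<Longrightarrow> h s = (\<Sum>n. p n * exp (- s) ^ n)"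
  shows "pi * exp (-4) * d * (\<Sum>n\<in>A. (norm (p n))\<^sup>2) \<le>
    Re (LINT s:cbox (Complex (d/2) 0) (Complex d (2*pi))|lborel. of_real ((norm (h s))\<^sup>2))"
proof -
  define f where "f s = (\<Sum>n. p n * exp (- s) ^ n)" for s
  define Q where "Q = cbox (Complex (d/2) 0) (Complex d (2*pi))"
  have Qpos: "Re s > 0" if "s \<in> Q" for s using that d by (auto simp: Q_def in_cbox_complex_iff)
  have cf: "continuous_on Q f"
    unfolding f_def by (rule continuous_on_subset[OF power_series_exp_continuous[OF p]]) (use Qpos in auto)
  have c2: "continuous_on Q (\<lambda>s. cnj (f s) * f s)" by (intro continuous_intros cf)
  define I where "I x = integral {0..2*pi} (\<lambda>y. cnj (f (Complex x y)) * f (Complex x y))" for x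
  have "(LINT s:Q|lborel. of_real ((norm (h s))\<^sup>2)) = (LINT s:Q|lborel. cnj (f s) * f s)"
  proof (rule set_lebesgue_integral_cong)
    show "\<forall>s. s \<in> Q \<longrightarrow> complex_of_real ((norm (h s))\<^sup>2) = cnj (f s) * f s"
    proof (intro allI impI)
      fix s assume "s \<in> Q"
      then have hf: "h s = f s" unfolding f_def by (intro h Qpos)
      show "complex_of_real ((norm (h s))\<^sup>2) = cnj (f s) * f s"
        unfolding hf complex_norm_square by (rule mult.commute)
    qed
  qed (simp add: Q_def)
  also have "\<dots> = integral {d/2..d} I"
    unfolding I_def using cbox_fubini(1)[OF c2[unfolded Q_def]] by (simp add: Q_def)
  finally have eq: "Re (LINT s:Q|lborel. of_real ((norm (h s))\<^sup>2)) = Re (integral {d/2..d} I)" by simp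
  have Iint: "I integrable_on {d/2..d}"
    unfolding I_def using cbox_fubini(3)[OF c2[unfolded Q_def]] by simp
  have lower: "2 * pi * exp (-4) * (\<Sum>n\<in>A. (norm (p n))\<^sup>2) \<le> Re (I x)" if x: "x \<in> {d/2..d}" for x
  proof -
    have x0: "x > 0" using x d by auto
    have "(\<lambda>n. 2 * pi * (cnj (p n) * p n * of_real (exp (- x) ^ (2 * n)))) sums I x"
      unfolding I_def f_def by (rule parseval_exp) (use power_series_abs_summable[OF p x0] in auto)
    from sums_Re[OF this] have S: "(\<lambda>n. 2 * pi * ((norm (p n))\<^sup>2 * exp (- x) ^ (2 * n))) sums Re (I x)"
    proof (rule back_subst[of "\<lambda>f. f sums Re (I x)"])
      have "Re (2 * pi * (cnj (p n) * p n * of_real (exp (- x) ^ (2 * n)))) = 2 * pi * ((norm (p n))\<^sup>2 * exp (- x) ^ (2 * n))" for n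
      proof -
        have "cnj (p n) * p n = of_real ((norm (p n))\<^sup>2)" by (simp only: complex_norm_square mult.commute)
        then have "2 * pi * (cnj (p n) * p n * of_real (exp (- x) ^ (2 * n))) =
           complex_of_real (2 * pi * ((norm (p n))\<^sup>2 * exp (- x) ^ (2 * n)))" by simp
        then show ?thesis by (simp only: Re_complex_of_real)
      qed
      then show "(\<lambda>n. Re (2 * pi * (cnj (p n) * p n * of_real (exp (- x) ^ (2 * n))))) = (\<lambda>n. 2 * pi * ((norm (p n))\<^sup>2 * exp (- x) ^ (2 * n)))"
        by blast
    qed
    have "2 * pi * exp (-4) * (\<Sum>n\<in>A. (norm (p n))\<^sup>2) = (\<Sum>n\<in>A. 2 * pi * ((norm (p n))\<^sup>2 * exp (-4)))"
      by (simp add: sum_distrib_left mult_ac)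
    also have "\<dots> \<le> (\<Sum>n\<in>A. 2 * pi * ((norm (p n))\<^sup>2 * exp (- x) ^ (2 * n)))"
    proof (intro sum_mono mult_left_mono)
      fix n assume n: "n \<in> A"
      have "real n * x \<le> real n * d" using x by (intro mult_left_mono) auto
      then have "real n * x \<le> 2" using A(2)[OF n] by linarith
      moreover have "exp (- x) ^ (2 * n) = exp (- (2 * (real n * x)))"
        by (simp add: exp_of_nat_mult[symmetric] mult.assoc)
      ultimately show "exp (-4) \<le> exp (- x) ^ (2 * n)" by (simp add: mult.commute)
    qed auto
    also have "\<dots> \<le> Re (I x)"
      using sum_le_suminf[OF sums_summable[OF S] A(1)] sums_unique[OF S] by auto
    finally show ?thesis .
  qed
  have "Re (integral {d/2..d} I) = integral {d/2..d} (\<lambda>x. Re (I x))"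
    using integral_linear[OF Iint bounded_linear_Re] by (simp add: o_def)
  moreover have "integral {d/2..d} (\<lambda>x. 2 * pi * exp (-4) * (\<Sum>n\<in>A. (norm (p n))\<^sup>2)) \<le> integral {d/2..d} (\<lambda>x. Re (I x))"
    using integrable_linear[OF Iint bounded_linear_Re] lower by (intro integral_le) (auto simp: o_def)
  moreover have "integral {d/2..d} (\<lambda>x. 2 * pi * exp (-4) * (\<Sum>n\<in>A. (norm (p n))\<^sup>2)) =
    pi * exp (-4) * d * (\<Sum>n\<in>A. (norm (p n))\<^sup>2)"
    using d by simp
  ultimately show ?thesis unfolding eq[unfolded Q_def] by linarith
qed

section \<open>Distance between level curves and the boundary\<close>

context exterior_map
begin

text \<open>The Bloch bound says that ln |P - z| has x-derivative at most 48/x, so ln |P - z| - 48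
  ln x is nonincreasing on (0, 1]. It is compared with its value at x = 1, where \<kappa> is the
  distance from the curve |w| = e to the closure of D.\<close>

lemma P_distance_lower:
  obtains \<kappa> where "\<kappa> > 0" "\<And>s z. 0 < Re s \<Longrightarrow> Re s \<le> 1 \<Longrightarrow> z \<in> closure D \<Longrightarrow> \<kappa> * Re s ^ 48 \<le> norm (P s - z)"
proof -
  have "continuous_on (sphere 0 (exp 1)) \<Phi>"
    by (rule continuous_on_subset[OF holomorphic_on_imp_continuous_on[OF \<Phi>_hol]]) auto
  then have "compact (\<Phi> ` sphere 0 (exp 1))" by (intro compact_continuous_image) auto
  moreover have "closed (closure D)" by simp
  moreover have "\<Phi> ` sphere 0 (exp 1) \<inter> closure D = {}" using \<Phi>_ext by auto
  ultimately obtain \<kappa> where \<kappa>: "\<kappa> > 0" "\<And>x y. x \<in> \<Phi> ` sphere 0 (exp 1) \<Longrightarrow> y \<in> closure D \<Longrightarrow> \<kappa> \<le> dist x y"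
    using separate_compact_closed by metis
  show ?thesis
  proof (rule that[OF \<kappa>(1)])
    fix s z assume s: "0 < Re s" "Re s \<le> 1" and z: "z \<in> closure D"
    define y where "y = Im s"
    define m where "m x = ln (norm (P (Complex x y) - z))" for x
    have nz: "P (Complex x y) - z \<noteq> 0" if "x > 0" for x using P_ext[of "Complex x y"] z that by auto
    have dm: "(m has_real_derivative Re (deriv P (Complex x y) / (P (Complex x y) - z))) (at x)" if x: "x > 0" for x
    proof -
      have 1: "((\<lambda>x. Complex x y) has_vector_derivative 1) (at x)"
        unfolding Complex_eq by (auto intro!: derivative_eq_intros)
      have "(P has_field_derivative deriv P (Complex x y)) (at (Complex x y))"
        using x by (intro holomorphic_derivI[OF P_hol open_halfspace_Re_gt]) auto
      then have "((\<lambda>s. P s - z) has_derivative (\<lambda>h. deriv P (Complex x y) * h)) (at (Complex x y))"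
        unfolding has_field_derivative_def by (auto intro!: derivative_eq_intros)
      from has_vector_derivative_compose_linear[OF 1 this]
      have 2: "((\<lambda>x. P (Complex x y) - z) has_vector_derivative deriv P (Complex x y)) (at x)" by simp
      define w where "w = P (Complex x y) - z"
      have w: "w \<noteq> 0" using nz[OF x] by (simp add: w_def)
      have "(norm has_derivative (\<lambda>h. h \<bullet> sgn w)) (at w)"
        using has_derivative_norm[OF w] by simp
      then have "((\<lambda>w. ln (norm w)) has_derivative (\<lambda>h. (h \<bullet> sgn w) * (1 / norm w))) (at w)"
        using w by (auto intro!: derivative_eq_intros simp: field_simps)
      from has_vector_derivative_compose_linear[OF 2 this[unfolded w_def]]
      have "(m has_vector_derivative (deriv P (Complex x y) \<bullet> sgn w) * (1 / norm w)) (at x)"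
        unfolding m_def w_def .
      moreover have "(v \<bullet> sgn w) * (1 / norm w) = Re (v / w)" for v
      proof -
        have "Re (v / w) = (v \<bullet> w) / (norm w)\<^sup>2"
          by (subst complex_div_cnj) (simp add: inner_complex_def flip: of_real_power)
        then show ?thesis by (simp add: sgn_div_norm power2_eq_square divide_inverse)
      qed
      ultimately show ?thesis by (simp add: has_real_derivative_iff_has_vector_derivative w_def)
    qed
    have bl: "Re (deriv P (Complex x y) / (P (Complex x y) - z)) \<le> 48 / x" if x: "0 < x" "x \<le> 1" for x
    proof -
      have sub: "ball (Complex x y) x \<subseteq> {s. Re s > 0}"
      proof
        fix t assume "t \<in> ball (Complex x y) x"
        then have "\<bar>Re (Complex x y - t)\<bar> < x" using abs_Re_le_cmod[of "Complex x y - t"] by (simp add: dist_norm)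
        then show "t \<in> {s. Re s > 0}" by auto
      qed
      \<comment> \<open>Two points of this disc differ in height by less than 2 x <= 2, which is
        below the period 2 pi.\<close>
      have inj: "inj_on P (ball (Complex x y) x)"
      proof (rule inj_onI)
        fix t u assume t: "t \<in> ball (Complex x y) x" "u \<in> ball (Complex x y) x" "P t = P u"
        have "dist t u < x + x" using t(1,2) dist_triangle[of t u "Complex x y"]
          unfolding mem_ball dist_commute[of t "Complex x y"] by linarith
        moreover have "\<bar>Im t - Im u\<bar> \<le> dist t u" using abs_Im_le_cmod[of "t - u"] by (simp add: dist_norm)
        ultimately have "\<bar>Im t - Im u\<bar> < 2 * pi" using x pi_gt3 by linarith
        moreover have "Re t > 0" "Re u > 0" using t(1,2) sub by blast+
        ultimately show "t = u" using P_inj t(3) by blast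
      qed
      have "norm (deriv P (Complex x y) / (P (Complex x y) - z)) \<le> 48 / x"
        using x z sub P_ext by (intro log_derivative_bloch inj holomorphic_on_subset[OF P_hol sub]) auto
      then show ?thesis using complex_Re_le_cmod order_trans by blast
    qed
    have "m 1 - 48 * ln 1 \<le> m (Re s) - 48 * ln (Re s)"
    proof (rule DERIV_nonpos_imp_nonincreasing[OF s(2)])
      fix x assume x: "Re s \<le> x" "x \<le> 1"
      then have x0: "x > 0" using s by simp
      have "((\<lambda>x. m x - 48 * ln x) has_real_derivative Re (deriv P (Complex x y) / (P (Complex x y) - z)) - 48 * (1 / x)) (at x)"
        using x0 by (auto intro!: derivative_eq_intros dm)
      then show "\<exists>y. ((\<lambda>x. m x - 48 * ln x) has_real_derivative y) (at x) \<and> y \<le> 0"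
        using bl[OF x0 x(2)] by (intro exI conjI) auto
    qed
    moreover have "ln \<kappa> \<le> m 1"
    proof -
      have "P (Complex 1 y) \<in> \<Phi> ` sphere 0 (exp 1)" unfolding P_def by (intro imageI) (simp add: dist_norm)
      then have "\<kappa> \<le> norm (P (Complex 1 y) - z)" using \<kappa>(2)[OF _ z] by (simp add: dist_norm)
      then show ?thesis unfolding m_def using \<kappa>(1) nz[of 1] by simp
    qed
    ultimately have "ln \<kappa> + 48 * ln (Re s) \<le> m (Re s)" by simp
    moreover have "ln \<kappa> + 48 * ln (Re s) = ln (\<kappa> * Re s ^ 48)" using \<kappa>(1) s by (simp add: ln_mult ln_realpow)
    moreover have "m (Re s) = ln (norm (P s - z))" by (simp add: m_def y_def)
    ultimately have "ln (\<kappa> * Re s ^ 48) \<le> ln (norm (P s - z))" by simp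
    moreover have "0 < norm (P s - z)" "0 < \<kappa> * Re s ^ 48" using nz[OF s(1)] s \<kappa>(1) by (auto simp: y_def)
    ultimately show "\<kappa> * Re s ^ 48 \<le> norm (P s - z)" by simp
  qed
qed

end

locale patch = exterior_map + periodic_C1_curve +
  assumes D_connected: "connected D" and frontier_D: "frontier D = J"
begin

lemma closure_D: "closure D = D \<union> J"
  using closure_Un_frontier[of D] frontier_D by simp

lemma connected_avoids_closure:
  assumes "connected T" "T \<inter> J = {}" "w \<in> T" "w \<notin> closure D"
  shows "T \<inter> closure D = {}"
proof (rule ccontr)
  assume n: "T \<inter> closure D \<noteq> {}"
  then have "T \<inter> D \<noteq> {}" using assms(2) closure_D by blast
  moreover have "T - D \<noteq> {}" using assms(3,4) closure_subset by blast
  ultimately have "T \<inter> frontier D \<noteq> {}" using connected_Int_frontier[OF assms(1)] by blast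
  then show False using assms(2) frontier_D by simp
qed

text \<open>A quantitative lower bound for the Green function of the exterior domain, obtained by
  integrating the Harnack inequality along the normal from the nearest boundary point.\<close>
lemma P_distance_upper:
  obtains K where "K > 0" "\<And>s. 0 < Re s \<Longrightarrow> Re s \<le> 1 \<Longrightarrow> infdist (P s) J ^ 4 \<le> K * Re s"
proof -
  obtain R where R: "\<And>s. 0 < Re s \<Longrightarrow> Re s \<le> 1 \<Longrightarrow> norm (P s) \<le> R" using P_bounded[of 1] by auto
  obtain RJ where RJ: "RJ > 0" "\<And>w. w \<in> J \<Longrightarrow> norm w \<le> RJ"
    using compact_imp_bounded[OF J_compact] bounded_pos by metis
  obtain r0 where r0: "r0 > 0" "\<And>s t \<nu> r. norm \<nu> = 1 \<Longrightarrow> \<nu> \<bullet> g' t = 0 \<Longrightarrow> 0 < r \<Longrightarrow> r \<le> r0 \<Longrightarrow> r / 2 \<le> norm (g t + r *\<^sub>R \<nu> - g s)"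
    using normal_escape by blast
  define r1 where "r1 = min r0 1"
  have r1: "0 < r1" "r1 \<le> r0" "r1 \<le> 1" using r0 by (auto simp: r1_def)
  define R' where "R' = max R (RJ + 1)"
  define G where "G \<zeta> = ln (norm (\<phi> \<zeta>))" for \<zeta>
  \<comment> \<open>Exterior points at distance at least r1/2 from J inside a large disc: a compact
    set on which the Green function G has a positive minimum c1. The radius R' accommodates the
    values of P with Re s <= 1 and the far ends of the normal segments.\<close>
  define S where "S = {\<zeta>. r1 / 2 \<le> infdist \<zeta> J} \<inter> cball 0 R' \<inter> - D"
  have Jc: "closed J" using J_compact compact_imp_closed by blast
  have SD: "\<zeta> \<notin> closure D" if "\<zeta> \<in> S" for \<zeta>
  proof -
    have "\<zeta> \<notin> J" using that r1 by (auto simp: S_def)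
    then show ?thesis using that closure_D by (auto simp: S_def)
  qed
  have "compact S"
  proof -
    have "closed {\<zeta>. r1 / 2 \<le> infdist \<zeta> J}" by (intro closed_Collect_le continuous_intros)
    then have "closed ({\<zeta>. r1 / 2 \<le> infdist \<zeta> J} \<inter> - D)" using D_open by (intro closed_Int) auto
    then have "compact (cball 0 R' \<inter> ({\<zeta>. r1 / 2 \<le> infdist \<zeta> J} \<inter> - D))" by (intro compact_Int_closed) auto
    then show ?thesis unfolding S_def by (simp add: Int_ac)
  qed
  have Gpos: "G \<zeta> > 0" if "\<zeta> \<notin> closure D" for \<zeta> unfolding G_def by (rule ln_gt_zero[OF norm_\<phi>[OF that]])
  have \<phi>c: "continuous_on (- closure D) \<phi>" using \<phi>_hol by (rule holomorphic_on_imp_continuous_on)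
  have Gc: "continuous_on S G" unfolding G_def
    by (intro continuous_intros continuous_on_subset[OF \<phi>c]) (use SD norm_\<phi> in force)+
  obtain c1 where c1: "c1 > 0" "\<And>\<zeta>. \<zeta> \<in> S \<Longrightarrow> c1 \<le> G \<zeta>"
  proof (cases "S = {}")
    case True
    then show ?thesis using that[of 1] by auto
  next
    case False
    obtain x where "x \<in> S" "\<And>\<zeta>. \<zeta> \<in> S \<Longrightarrow> G x \<le> G \<zeta>" using continuous_attains_inf[OF \<open>compact S\<close> False Gc] by blast
    then show ?thesis using that[of "G x"] Gpos SD by blast
  qed
  \<comment> \<open>The summand 1 gives K * c1 >= 1 for points near J. The other summand covers
    points at distance at least r1, where c1 <= Re s is compared with the largest possible
    distance.\<close>
  define K where "K = (1 + (R' + RJ) ^ 4) / c1"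
  have R'0: "R' > 0" using RJ by (simp add: R'_def)
  have K: "K > 0" using c1 R'0 RJ by (simp add: K_def add_pos_nonneg)
  show ?thesis
  proof (rule that[OF K])
    fix s assume s: "0 < Re s" "Re s \<le> 1"
    define \<zeta> where "\<zeta> = P s"
    have \<zeta>: "\<zeta> \<notin> closure D" unfolding \<zeta>_def by (rule P_ext[OF s(1)])
    have Gs: "G \<zeta> = Re s"
    proof -
      have "\<phi> (\<Phi> (exp s)) = exp s" using s by (intro \<phi>_\<Phi>) simp
      then show ?thesis by (simp add: G_def \<zeta>_def P_def)
    qed
    have \<zeta>J: "\<zeta> \<notin> J" using \<zeta> closure_D by auto
    define d where "d = infdist \<zeta> J"
    have d: "d > 0" unfolding d_def using infdist_pos_not_in_closed[OF Jc J_nonempty \<zeta>J] .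
    have \<zeta>R: "norm \<zeta> \<le> R'" using R[OF s] by (simp add: \<zeta>_def R'_def)
    have "d ^ 4 \<le> K * Re s"
    proof (cases "d < r1")
      case False
      then have "\<zeta> \<in> S" using \<zeta>R \<zeta> closure_subset r1 unfolding S_def d_def by auto
      then have "c1 \<le> Re s" using c1(2) Gs by metis
      obtain t where "d = dist \<zeta> (g t)" using nearest_point d_def by metis
      then have "d \<le> R' + RJ" using \<zeta>R RJ(2)[of "g t"] J norm_triangle_ineq4[of \<zeta> "g t"] by (auto simp: dist_norm)
      then have "d ^ 4 \<le> (R' + RJ) ^ 4" using d by (intro power_mono) auto
      also have "\<dots> \<le> K * c1" using c1 by (simp add: K_def)
      also have "\<dots> \<le> K * Re s" using K \<open>c1 \<le> Re s\<close> by (intro mult_left_mono) auto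
      finally show ?thesis .
    next
      case True
      obtain t where t: "infdist \<zeta> J = dist \<zeta> (g t)" using nearest_point by metis
      define \<nu> where "\<nu> = (\<zeta> - g t) /\<^sub>R d"
      have dn: "norm (\<zeta> - g t) = d" using t by (simp add: d_def dist_norm)
      have \<nu>: "norm \<nu> = 1" "\<nu> \<bullet> g' t = 0"
        using dn d foot_point_orthogonal[OF t] by (auto simp: \<nu>_def)
      define l where "l r = g t + r *\<^sub>R \<nu>" for r
      have ld: "l d = \<zeta>" using d by (simp add: l_def \<nu>_def)
      have ball_J: "ball (l r) (r / 2) \<inter> J = {}" if "0 < r" "r \<le> r1" for r
      proof -
        have "r / 2 \<le> dist (l r) w" if wJ: "w \<in> J" for w
        proof -
          obtain u where "w = g u" using wJ J by blast
          then show ?thesis using r0(2)[OF \<nu>, of r u] \<open>0 < r\<close> \<open>r \<le> r1\<close> r1 by (simp add: l_def dist_norm)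
        qed
        then show ?thesis by force
      qed
      have l_ext: "l r \<notin> closure D" if r: "d \<le> r" "r \<le> r1" for r
      proof -
        have "continuous_on {d..r} l" unfolding l_def by (intro continuous_intros)
        then have "connected (l ` {d..r})" by (intro connected_continuous_image) auto
        moreover have "l ` {d..r} \<inter> J = {}"
        proof -
          have "l u \<notin> J" if "u \<in> {d..r}" for u
            using ball_J[of u] that r d centre_in_ball[of "l u" "u / 2"] by fastforce
          then show ?thesis by blast
        qed
        moreover have "\<zeta> \<in> l ` {d..r}" using ld r by force
        ultimately have "l ` {d..r} \<inter> closure D = {}" using \<zeta> by (rule connected_avoids_closure)
        moreover have "l r \<in> l ` {d..r}" using r by (intro imageI) auto
        ultimately show ?thesis by blast
      qed
      have ball_ext: "ball (l r) (r / 2) \<inter> closure D = {}" if r: "d \<le> r" "r \<le> r1" for r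
        by (rule connected_avoids_closure[OF connected_ball ball_J _ l_ext[OF r]]) (use r d in auto)
      define h where "h r = G (l r)" for r
      have hpos: "h r > 0" if "d \<le> r" "r \<le> r1" for r unfolding h_def by (rule Gpos[OF l_ext[OF that]])
      \<comment> \<open>The disc of radius r/2 about l r lies in the exterior, where a logarithm of
        \<phi> has positive real part. The half-plane estimate gives the factor 2/(r/2) = 4/r, hence
        the fourth power below.\<close>
      have dh: "\<exists>y. (h has_real_derivative y) (at r) \<and> y \<le> 4 * h r / r" if r: "d \<le> r" "r \<le> r1" for r
      proof -
        define W where "W = ball (l r) (r / 2)"
        have rp: "r > 0" using r d by simp
        have W: "W \<subseteq> - closure D" using ball_ext[OF r] by (auto simp: W_def)
        have "\<phi> holomorphic_on W" by (rule holomorphic_on_subset[OF \<phi>_hol W])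
        moreover have "contractible W" unfolding W_def by (intro convex_imp_contractible convex_ball)
        moreover have "\<phi> w \<noteq> 0" if "w \<in> W" for w using norm_\<phi>[of w] W that by force
        ultimately obtain L where L: "L holomorphic_on W" "\<And>w. w \<in> W \<Longrightarrow> \<phi> w = exp (L w)"
          using contractible_imp_holomorphic_log[of \<phi> W] by blast
        have GL: "G w = Re (L w)" if "w \<in> W" for w using L(2)[OF that] by (simp add: G_def)
        have lW: "l r \<in> W" using rp by (simp add: W_def)
        have bd: "norm (deriv L (l r)) \<le> 2 * Re (L (l r)) / (r / 2)"
        proof (rule half_plane_schwarz)
          show "L holomorphic_on ball (l r) (r / 2)" using L(1) by (simp add: W_def)
          show "0 < Re (L w)" if "w \<in> ball (l r) (r / 2)" for w
            using Gpos[of w] GL[of w] W that by (auto simp: W_def)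
        qed (use rp in auto)
        have dL: "(L has_derivative (\<lambda>h. deriv L (l r) * h)) (at (l r))"
          using holomorphic_derivI[OF L(1) _ lW] by (simp add: W_def has_field_derivative_def)
        have "(G has_derivative (\<lambda>h. Re (deriv L (l r) * h))) (at (l r))"
        proof (rule has_derivative_transform_within_open)
          show "((\<lambda>w. Re (L w)) has_derivative (\<lambda>h. Re (deriv L (l r) * h))) (at (l r))"
            by (rule bounded_linear.has_derivative[OF bounded_linear_Re dL])
          show "open W" by (simp add: W_def)
        qed (use lW GL in auto)
        moreover have "(l has_vector_derivative \<nu>) (at r)"
          unfolding l_def by (auto intro!: derivative_eq_intros)
        ultimately have "((\<lambda>r. G (l r)) has_vector_derivative Re (deriv L (l r) * \<nu>)) (at r)"
          using has_vector_derivative_compose_linear[of l \<nu> r UNIV G "\<lambda>h. Re (deriv L (l r) * h)"] by blast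
        then have "(h has_vector_derivative Re (deriv L (l r) * \<nu>)) (at r)"
          by (simp only: h_def[abs_def])
        then have "(h has_real_derivative Re (deriv L (l r) * \<nu>)) (at r)"
          by (simp add: has_real_derivative_iff_has_vector_derivative)
        moreover have "Re (deriv L (l r) * \<nu>) \<le> norm (deriv L (l r))"
          using complex_Re_le_cmod[of "deriv L (l r) * \<nu>"] \<nu>(1) by (simp add: norm_mult)
        moreover have "2 * Re (L (l r)) / (r / 2) = 4 * h r / r" using GL[OF lW] by (simp add: h_def)
        ultimately show ?thesis using bd by (intro exI[of _ "Re (deriv L (l r) * \<nu>)"] conjI) auto
      qed
      have "h r1 / r1 ^ 4 \<le> h d / d ^ 4"
      proof (rule DERIV_nonpos_imp_nonincreasing[where f = "\<lambda>r. h r / r ^ 4" and a = d and b = r1])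
        show "d \<le> r1" using True by simp
        fix r assume r: "d \<le> r" "r \<le> r1"
        then have rp: "r > 0" using d by simp
        obtain y where y: "(h has_real_derivative y) (at r)" "y \<le> 4 * h r / r" using dh[OF r] by blast
        have "((\<lambda>r. h r / r ^ 4) has_real_derivative (y * r ^ 4 - h r * (4 * r ^ 3)) / (r ^ 4 * r ^ 4)) (at r)"
          using rp by (auto intro!: derivative_eq_intros y(1))
        moreover have "(y * r ^ 4 - h r * (4 * r ^ 3)) / (r ^ 4 * r ^ 4) \<le> 0"
        proof -
          have "y * r \<le> 4 * h r" using y(2) rp by (simp add: field_simps)
          then have "(y * r) * r ^ 3 \<le> 4 * h r * r ^ 3" using rp by (intro mult_right_mono) auto
          then have "y * r ^ 4 - h r * (4 * r ^ 3) \<le> 0" by (simp add: power_Suc numeral_eq_Suc algebra_simps)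
          then show ?thesis using rp by (intro divide_nonpos_pos) auto
        qed
        ultimately show "\<exists>y. ((\<lambda>r. h r / r ^ 4) has_real_derivative y) (at r) \<and> y \<le> 0" by blast
      qed
      moreover have "c1 \<le> h r1"
      proof -
        have "r1 / 2 \<le> infdist (l r1) J"
        proof -
          obtain u where u: "infdist (l r1) J = dist (l r1) (g u)" using nearest_point by metis
          show ?thesis unfolding u using r0(2)[OF \<nu> r1(1,2), of u] by (simp add: l_def dist_norm)
        qed
        moreover have "norm (l r1) \<le> R'"
        proof -
          have "norm (l r1) \<le> norm (g t) + r1" unfolding l_def using norm_triangle_ineq[of "g t" "r1 *\<^sub>R \<nu>"] \<nu>(1) r1 by simp
          also have "\<dots> \<le> RJ + 1" using RJ(2)[of "g t"] J r1 by (intro add_mono) auto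
          finally show ?thesis by (simp add: R'_def)
        qed
        moreover have "l r1 \<notin> D" using l_ext[of r1] True closure_subset by auto
        ultimately show ?thesis unfolding h_def by (intro c1(2)) (simp add: S_def)
      qed
      ultimately have "c1 / r1 ^ 4 \<le> Re s / d ^ 4"
      proof -
        assume A: "h r1 / r1 ^ 4 \<le> h d / d ^ 4" and B: "c1 \<le> h r1"
        have "c1 / r1 ^ 4 \<le> h r1 / r1 ^ 4" using B r1 by (intro divide_right_mono) auto
        then show ?thesis using A Gs by (simp add: h_def ld)
      qed
      moreover have "c1 \<le> c1 / r1 ^ 4"
      proof -
        have "r1 ^ 4 \<le> 1" using r1 by (intro power_le_one) auto
        then show ?thesis using c1 r1 by (simp add: field_simps mult_left_le)
      qed
      ultimately have "c1 \<le> Re s / d ^ 4" by linarith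
      then have "d ^ 4 * c1 \<le> Re s" using d by (simp add: field_simps)
      also have "\<dots> \<le> K * c1 * Re s"
      proof -
        have "1 \<le> K * c1" using c1 R'0 RJ by (simp add: K_def)
        then show ?thesis using mult_right_mono[of 1 "K * c1" "Re s"] s by simp
      qed
      finally have "d ^ 4 * c1 \<le> (K * Re s) * c1" by (simp add: mult_ac)
      then show ?thesis using c1 by simp
    qed
    then show "infdist (P s) J ^ 4 \<le> K * Re s" by (simp add: d_def \<zeta>_def)
  qed
qed

end

section \<open>Dyadic block estimates\<close>

lemma set_integral_one:
  assumes "S \<in> fmeasurable lborel"
  shows "(LINT y:S|lborel. (1::complex)) = of_real (measure lborel S)"
proof -
  have "S \<in> sets lborel" "emeasure lborel S < \<infinity>" using assms by (auto simp: fmeasurable_def)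
  then have "integrable lborel (indicat_real S)" by (intro integrable_real_indicator) auto
  then have "(LINT y|lborel. indicat_real S y *\<^sub>R (1::complex)) = (LINT y|lborel. indicat_real S y) *\<^sub>R 1"
    by (intro integral_scaleR_left) auto
  then show ?thesis unfolding set_lebesgue_integral_def by (simp add: scaleR_conv_of_real)
qed

text \<open>Consecutive blocks tile the range, and their bounds form a geometric series of ratio
  \<rho>.\<close>

lemma dyadic_block_tail:
  fixes t :: "nat \<Rightarrow> real"
  assumes t: "\<And>n. t n \<ge> 0" and C: "C \<ge> 0" and \<rho>: "0 < \<rho>" "\<rho> < 1"
    and block: "\<And>k. (\<Sum>n\<in>{2^k..<2^Suc k}. t n) \<le> C * \<rho> ^ k"
  shows "(\<Sum>n\<in>{2^k..<M}. t n) \<le> C * \<rho> ^ k / (1 - \<rho>)"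
proof -
  have le: "(2::nat) ^ k \<le> 2 ^ (k + j)" for j by (intro power_increasing) auto
  have S: "(\<Sum>n\<in>{2^k..<2^(k+j)}. t n) \<le> C * \<rho> ^ k * (\<Sum>i<j. \<rho> ^ i)" for j
  proof (induction j)
    case (Suc j)
    have "(\<Sum>n\<in>{2^k..<2^(k+Suc j)}. t n) = (\<Sum>n\<in>{2^k..<2^(k+j)}. t n) + (\<Sum>n\<in>{2^(k+j)..<2^Suc (k+j)}. t n)"
      using le[of j] by (subst sum.atLeastLessThan_concat) auto
    also have "\<dots> \<le> C * \<rho> ^ k * (\<Sum>i<j. \<rho> ^ i) + C * \<rho> ^ (k + j)"
      by (intro add_mono Suc block)
    also have "\<dots> = C * \<rho> ^ k * (\<Sum>i<Suc j. \<rho> ^ i)" by (simp add: power_add algebra_simps)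
    finally show ?case .
  qed simp
  have "M < 2 ^ M" by (rule less_exp)
  also have "(2::nat) ^ M \<le> 2 ^ (k + M)" by (intro power_increasing) auto
  finally have "{2^k..<M} \<subseteq> {2^k..<2^(k+M)}" by auto
  then have "(\<Sum>n\<in>{2^k..<M}. t n) \<le> (\<Sum>n\<in>{2^k..<2^(k+M)}. t n)" using t by (intro sum_mono2) auto
  also have "\<dots> \<le> C * \<rho> ^ k * (\<Sum>i<M. \<rho> ^ i)" by (rule S)
  also have "\<dots> \<le> C * \<rho> ^ k * (1 / (1 - \<rho>))"
  proof (intro mult_left_mono)
    have "(\<Sum>i<M. \<rho> ^ i) \<le> (\<Sum>i. \<rho> ^ i)" using \<rho> by (intro sum_le_suminf summable_geometric) auto
    then show "(\<Sum>i<M. \<rho> ^ i) \<le> 1 / (1 - \<rho>)" using \<rho> by (simp add: suminf_geometric)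
  qed (use C \<rho> in auto)
  finally show ?thesis by simp
qed

context exterior_map
begin

lemma P_box:
  assumes "0 < x1"
  shows "box (Complex x1 0) (Complex x2 (2*pi)) \<subseteq> {s. Re s > 0}"
    and "inj_on P (box (Complex x1 0) (Complex x2 (2*pi)))"
    and "P holomorphic_on box (Complex x1 0) (Complex x2 (2*pi))"
    and "cbox (Complex x1 0) (Complex x2 (2*pi)) \<subseteq> {s. Re s > 0}"
proof -
  show 1: "box (Complex x1 0) (Complex x2 (2*pi)) \<subseteq> {s. Re s > 0}"
    and "cbox (Complex x1 0) (Complex x2 (2*pi)) \<subseteq> {s. Re s > 0}"
    using assms by (auto simp: in_box_complex_iff in_cbox_complex_iff)
  show "inj_on P (box (Complex x1 0) (Complex x2 (2*pi)))"
  proof (rule inj_onI)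
    fix s t assume st: "s \<in> box (Complex x1 0) (Complex x2 (2*pi))" "t \<in> box (Complex x1 0) (Complex x2 (2*pi))" "P s = P t"
    then have "\<bar>Im s - Im t\<bar> < 2 * pi" by (auto simp: in_box_complex_iff)
    moreover have "Re s > 0" "Re t > 0" using st 1 by blast+
    ultimately show "s = t" using P_inj st(3) by blast
  qed
  show "P holomorphic_on box (Complex x1 0) (Complex x2 (2*pi))"
    by (rule holomorphic_on_subset[OF P_hol 1])
qed

lemma P_box_image_fmeasurable:
  assumes "0 < x1"
  shows "P ` box (Complex x1 0) (Complex x2 (2*pi)) \<in> fmeasurable lborel"
proof -
  have "open (P ` box (Complex x1 0) (Complex x2 (2*pi)))"
    using open_mapping_thm3[OF P_box(3)[OF assms] open_box P_box(2)[OF assms]] .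
  moreover have "bounded (P ` box (Complex x1 0) (Complex x2 (2*pi)))"
  proof -
    have "compact (P ` cbox (Complex x1 0) (Complex x2 (2*pi)))"
      using P_box(4)[OF assms] P_hol
      by (intro compact_continuous_image holomorphic_on_imp_continuous_on) (auto intro: holomorphic_on_subset)
    then show ?thesis using box_subset_cbox by (meson bounded_subset compact_imp_bounded image_mono)
  qed
  ultimately show ?thesis using emeasure_bounded_finite by (auto simp: fmeasurable_def)
qed

lemma P_deriv_continuous: "continuous_on {s. Re s > 0} (deriv P)"
  by (intro holomorphic_on_imp_continuous_on holomorphic_deriv P_hol open_halfspace_Re_gt)

text \<open>The area theorem in the form used here: the Dirichlet integral of P over a rectangle of
  height 2 pi is the area of its one-to-one image.\<close>

lemma P_image_area:
  assumes "0 < x1"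
  shows "(LINT s:cbox (Complex x1 0) (Complex x2 (2*pi))|lborel. complex_of_real ((norm (deriv P s))\<^sup>2)) =
    of_real (measure lborel (P ` box (Complex x1 0) (Complex x2 (2*pi))))"
proof -
  let ?Q = "box (Complex x1 0) (Complex x2 (2*pi))"
  have c: "continuous_on (cbox (Complex x1 0) (Complex x2 (2*pi))) (\<lambda>s. complex_of_real ((norm (deriv P s))\<^sup>2))"
    by (intro continuous_intros continuous_on_subset[OF P_deriv_continuous P_box(4)[OF assms]])
  have "(LINT y:P ` ?Q|lborel. (1::complex)) = (LINT s:?Q|lborel. (norm (deriv P s))\<^sup>2 *\<^sub>R 1)"
    by (rule holomorphic_cov_integral[OF open_box P_box(3,2)[OF assms]]) simp
  also have "\<dots> = (LINT s:?Q|lborel. complex_of_real ((norm (deriv P s))\<^sup>2))"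
    by (simp add: scaleR_conv_of_real)
  also have "\<dots> = (LINT s:cbox (Complex x1 0) (Complex x2 (2*pi))|lborel. complex_of_real ((norm (deriv P s))\<^sup>2))"
    by (rule set_integral_box_eq_cbox[OF c])
  finally show ?thesis unfolding set_integral_one[OF P_box_image_fmeasurable[OF assms]] by simp
qed

text \<open>The left side is \<Phi>'(exp s). Differentiating the term \<open>Bc n\<close> exp ((1 -
  n) s) of P produces the factor 1 - n, which kills the term of c 0 at n = 1.\<close>

lemma exp_P_deriv_series:
  assumes "Re s > 0"
  shows "exp (- s) * deriv P s = (\<Sum>n. (of_real a * (1 - of_nat n) * Bc n) * exp (- s) ^ n)"
    and "norm q < 1 \<Longrightarrow> summable (\<lambda>n. (of_real a * (1 - of_nat n) * Bc n) * q ^ n)"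
proof -
  have S: "(\<lambda>n. (of_real a * (1 - of_nat n) * Bc n) * q ^ n) sums (of_real a * (B q - q * deriv B q))" if q: "norm q < 1" for q
  proof -
    have 1: "(\<lambda>n. Bc n * q ^ n) sums B q" unfolding B_def by (rule summable_sums[OF Bc_summable[OF q]])
    have "(B has_field_derivative (\<Sum>n. diffs Bc n * q ^ n)) (at q)"
      unfolding B_def by (rule termdiffs_strong'[OF Bc_summable q])
    then have dB: "deriv B q = (\<Sum>n. diffs Bc n * q ^ n)" by (rule DERIV_imp_deriv)
    obtain K :: complex where K: "norm q < norm K" "norm K < 1"
    proof -
      obtain x where "norm q < x" "x < 1" using dense[OF q] by blast
      then show ?thesis using that[of "of_real x"] norm_ge_zero[of q] by (auto simp: abs_of_pos)
    qed
    have "summable (\<lambda>n. diffs Bc n * q ^ n)"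
      by (rule termdiff_converges[of _ "norm K"]) (use K Bc_summable in auto)
    then have "(\<lambda>n. diffs Bc n * q ^ n) sums deriv B q" using dB by (simp add: summable_sums)
    then have "(\<lambda>n. q * (diffs Bc n * q ^ n)) sums (q * deriv B q)" by (rule sums_mult)
    then have "(\<lambda>n. of_nat (Suc n) * Bc (Suc n) * q ^ Suc n) sums (q * deriv B q)"
      by (simp add: diffs_def mult_ac)
    then have 2: "(\<lambda>n. of_nat n * Bc n * q ^ n) sums (q * deriv B q)"
      using sums_Suc_iff[of "\<lambda>n. of_nat n * Bc n * q ^ n" "q * deriv B q"] by simp
    have "(\<lambda>n. of_real a * (Bc n * q ^ n - of_nat n * Bc n * q ^ n)) sums (of_real a * (B q - q * deriv B q))"
      by (intro sums_mult sums_diff 1 2)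
    then show ?thesis by (simp add: algebra_simps)
  qed
  show "norm q < 1 \<Longrightarrow> summable (\<lambda>n. (of_real a * (1 - of_nat n) * Bc n) * q ^ n)" using S sums_summable by blast
  have "exp (- s) * deriv P s = exp (- s) * exp s * (of_real a * (B (exp (- s)) - exp (- s) * deriv B (exp (- s))))"
    unfolding DERIV_imp_deriv[OF P_deriv[OF assms]] by (simp only: mult.assoc mult.left_commute)
  also have "exp (- s) * exp s = 1" by (simp add: exp_minus)
  finally have "exp (- s) * deriv P s = of_real a * (B (exp (- s)) - exp (- s) * deriv B (exp (- s)))" by simp
  then show "exp (- s) * deriv P s = (\<Sum>n. (of_real a * (1 - of_nat n) * Bc n) * exp (- s) ^ n)"
    using S[of "exp (- s)"] assms by (simp add: sums_unique)
qed

text \<open>Bessel's inequality for \<Phi>'; the factor |exp (- s)| <= 1 is discarded so that the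
  right side becomes an area. The weight d m^2 dominates m because m >= 2^k = 1/d on the
  block.\<close>

lemma coefficient_block_area:
  assumes "d = 1 / 2 ^ k"
  shows "pi * exp (-4) * a\<^sup>2 * (\<Sum>n\<in>{2^k..<2^Suc k}. real n * (norm (c n))\<^sup>2) \<le>
    measure lborel (P ` box (Complex (d/2) 0) (Complex d (2*pi)))"
proof -
  have d: "d > 0" using assms by simp
  define p where "p n = of_real a * (1 - of_nat n) * Bc n" for n
  \<comment> \<open>The shift by one reflects that \<open>Bc (Suc m)\<close> is \<open>c m\<close>.
    The largest index is then 2^(k+1), which still satisfies n d <= 2.\<close>
  define A where "A = Suc ` {2^k..<2^Suc k}"
  have psuc: "(norm (p (Suc m)))\<^sup>2 = a\<^sup>2 * ((real m)\<^sup>2 * (norm (c m))\<^sup>2)" for m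
    by (simp add: p_def Bc_def norm_mult power_mult_distrib mult_ac)
  have "pi * exp (-4) * d * (\<Sum>n\<in>A. (norm (p n))\<^sup>2) \<le>
    Re (LINT s:cbox (Complex (d/2) 0) (Complex d (2*pi))|lborel. of_real ((norm (exp (- s) * deriv P s))\<^sup>2))"
  proof (rule bessel_block[OF _ d])
    show "summable (\<lambda>n. p n * q ^ n)" if "norm q < 1" for q
      unfolding p_def using exp_P_deriv_series(2)[of 1 q] that by simp
    show "finite A" by (simp add: A_def)
    show "real n * d \<le> 2" if "n \<in> A" for n
    proof -
      have "n \<le> 2 ^ Suc k" using that by (auto simp: A_def)
      then have "real n \<le> 2 ^ Suc k" by (metis of_nat_le_iff of_nat_numeral of_nat_power)
      then show ?thesis by (simp add: assms field_simps)
    qed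
    show "exp (- s) * deriv P s = (\<Sum>n. p n * exp (- s) ^ n)" if "Re s > 0" for s
      unfolding p_def by (rule exp_P_deriv_series(1)[OF that])
  qed
  also have "(\<Sum>n\<in>A. (norm (p n))\<^sup>2) = (\<Sum>m\<in>{2^k..<2^Suc k}. a\<^sup>2 * ((real m)\<^sup>2 * (norm (c m))\<^sup>2))"
    unfolding A_def by (subst sum.reindex) (auto simp: psuc)
  also have "pi * exp (-4) * d * \<dots> = pi * exp (-4) * a\<^sup>2 * (\<Sum>m\<in>{2^k..<2^Suc k}. d * (real m)\<^sup>2 * (norm (c m))\<^sup>2)"
    by (simp add: sum_distrib_left mult_ac)
  finally have 1: "pi * exp (-4) * a\<^sup>2 * (\<Sum>m\<in>{2^k..<2^Suc k}. d * (real m)\<^sup>2 * (norm (c m))\<^sup>2) \<le>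
    Re (LINT s:cbox (Complex (d/2) 0) (Complex d (2*pi))|lborel. of_real ((norm (exp (- s) * deriv P s))\<^sup>2))" .
  have 2: "(\<Sum>n\<in>{2^k..<2^Suc k}. real n * (norm (c n))\<^sup>2) \<le> (\<Sum>m\<in>{2^k..<2^Suc k}. d * (real m)\<^sup>2 * (norm (c m))\<^sup>2)"
  proof (intro sum_mono mult_right_mono)
    fix m :: nat assume "m \<in> {2^k..<2^Suc k}"
    then have "2 ^ k \<le> real m" by (metis atLeastLessThan_iff of_nat_le_iff of_nat_numeral of_nat_power)
    then have "1 \<le> d * real m" by (simp add: assms field_simps)
    then have "1 * real m \<le> (d * real m) * real m" by (intro mult_right_mono) auto
    then show "real m \<le> d * (real m)\<^sup>2" by (simp add: power2_eq_square mult.assoc)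
  qed auto
  have cont: "continuous_on (cbox (Complex (d/2) 0) (Complex d (2*pi))) (deriv P)"
    by (rule continuous_on_subset[OF P_deriv_continuous P_box(4)]) (use d in simp)
  have 3: "Re (LINT s:cbox (Complex (d/2) 0) (Complex d (2*pi))|lborel. of_real ((norm (exp (- s) * deriv P s))\<^sup>2)) \<le>
     Re (LINT s:cbox (Complex (d/2) 0) (Complex d (2*pi))|lborel. of_real ((norm (deriv P s))\<^sup>2))"
  proof -
    have i1: "set_integrable lborel (cbox (Complex (d/2) 0) (Complex d (2*pi))) (\<lambda>s. complex_of_real ((norm (exp (- s) * deriv P s))\<^sup>2))"
      and i2: "set_integrable lborel (cbox (Complex (d/2) 0) (Complex d (2*pi))) (\<lambda>s. complex_of_real ((norm (deriv P s))\<^sup>2))"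
      by (intro set_integrable_continuous_cbox continuous_intros cont)+
    show ?thesis
      unfolding set_lebesgue_integral_def
        integral_Re[OF i1[unfolded set_integrable_def], symmetric] integral_Re[OF i2[unfolded set_integrable_def], symmetric]
    proof (rule integral_mono)
      fix s
      show "Re (indicat_real (cbox (Complex (d / 2) 0) (Complex d (2 * pi))) s *\<^sub>R complex_of_real ((norm (exp (- s) * deriv P s))\<^sup>2))
         \<le> Re (indicat_real (cbox (Complex (d / 2) 0) (Complex d (2 * pi))) s *\<^sub>R complex_of_real ((norm (deriv P s))\<^sup>2))"
      proof (cases "s \<in> cbox (Complex (d / 2) 0) (Complex d (2 * pi))")
        case True
        then have "Re s > 0" using P_box(4)[of "d/2"] d by auto
        then have "norm (exp (- s) * deriv P s) \<le> norm (deriv P s)" by (simp add: norm_mult mult_left_le_one_le)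
        then have "(norm (exp (- s) * deriv P s))\<^sup>2 \<le> (norm (deriv P s))\<^sup>2" by (rule power_mono) simp
        then show ?thesis using True by (simp del: of_real_power)
      qed simp
    qed (use integrable_Re[OF i1[unfolded set_integrable_def]] integrable_Re[OF i2[unfolded set_integrable_def]] in auto)
  qed
  have "pi * exp (-4) * a\<^sup>2 * (\<Sum>n\<in>{2^k..<2^Suc k}. real n * (norm (c n))\<^sup>2) \<le>
    pi * exp (-4) * a\<^sup>2 * (\<Sum>m\<in>{2^k..<2^Suc k}. d * (real m)\<^sup>2 * (norm (c m))\<^sup>2)"
    using 2 by (intro mult_left_mono) auto
  moreover have "Re (LINT s:cbox (Complex (d/2) 0) (Complex d (2*pi))|lborel. of_real ((norm (deriv P s))\<^sup>2)) =
      measure lborel (P ` box (Complex (d/2) 0) (Complex d (2*pi)))"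
    using P_image_area[of "d/2" d] d by (simp only: Re_complex_of_real half_gt_zero_iff)
  ultimately show ?thesis using 1 3 by linarith
qed

text \<open>A change of variables turns the mean square of U over the strip into the integral of |z
  - y|^(-2) over the image of the strip. Exponent 2 is the borderline of integrability; the lower
  bound on the distance absorbs a small power and costs only the slow growth 2^(k/16).\<close>

lemma faber_block:
  obtains C where "C \<ge> 0" "\<And>k z. z \<in> closure D \<Longrightarrow>
    (\<Sum>n\<in>{2^k..<2^Suc k}. (norm (Fab z n))\<^sup>2 / real n) \<le> C * (2 powr (1/16)) ^ k"
proof -
  obtain \<kappa> where \<kappa>: "\<kappa> > 0" "\<And>s z. 0 < Re s \<Longrightarrow> Re s \<le> 1 \<Longrightarrow> z \<in> closure D \<Longrightarrow> \<kappa> * Re s ^ 48 \<le> norm (P s - z)"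
    using P_distance_lower by blast
  obtain R where R: "\<And>s. 0 < Re s \<Longrightarrow> Re s \<le> 1 \<Longrightarrow> norm (P s) \<le> R" using P_bounded[of 1] by auto
  \<comment> \<open>Here 768 = 48 * 16: the distance is at least a multiple of d^48, so its power -b
    costs d^(-1/16) = 2^(k/16).\<close>
  define b :: real where "b = 1 / 768"
  define q where "q = 2 - b"
  have q: "0 < q" "q < 2" by (auto simp: q_def b_def)
  obtain C where C: "C \<ge> 0"
    "\<And>z E. E \<in> sets borel \<Longrightarrow> emeasure lborel E < \<infinity> \<Longrightarrow>
       set_integrable lborel E (\<lambda>y. norm (z - y::complex) powr (-q))"
    "\<And>z E. E \<in> sets borel \<Longrightarrow> emeasure lborel E < \<infinity> \<Longrightarrow>
       (LINT y:E|lborel. norm (z - y::complex) powr (-q)) \<le> C + measure lborel E"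
    using singular_kernel[OF q] by blast
  define A0 where "A0 = measure lborel (cball (0::complex) R)"
  define C1 where "C1 = (\<kappa> powr (-b) * 2 powr (1/16) * (C + A0)) / (pi * exp (-4))"
  show ?thesis
  proof (rule that[of C1])
    show "C1 \<ge> 0" using C(1) by (simp add: C1_def A0_def)
    fix k z assume z: "z \<in> closure D"
    define d :: real where "d = 1 / 2 ^ k"
    have d: "0 < d" "d \<le> 1" by (auto simp: d_def)
    let ?Q = "box (Complex (d/2) 0) (Complex d (2*pi))"
    let ?cQ = "cbox (Complex (d/2) 0) (Complex d (2*pi))"
    have d2: "0 < d / 2" using d by simp
    have bes: "pi * exp (-4) * d * (\<Sum>n\<in>{2^k..<2^Suc k}. (norm (Fab z n))\<^sup>2) \<le>
      Re (LINT s:?cQ|lborel. of_real ((norm (U z (exp (- s))))\<^sup>2))"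
    proof (rule bessel_block[OF _ d(1)])
      show "summable (\<lambda>n. Fab z n * q ^ n)" if "norm q < 1" for q
        using Fab_sums[OF z that] by (rule sums_summable)
      show "real n * d \<le> 2" if "n \<in> {2^k..<2^Suc k}" for n
      proof -
        have "n \<le> 2 ^ Suc k" using that by auto
        then have "real n \<le> 2 ^ Suc k" by (metis of_nat_le_iff of_nat_numeral of_nat_power)
        then show ?thesis by (simp add: d_def field_simps)
      qed
      show "U z (exp (- s)) = (\<Sum>n. Fab z n * exp (- s) ^ n)" if "Re s > 0" for s
        using Fab_sums[OF z, of "exp (- s)"] that by (simp add: sums_unique)
    qed simp
    define h where "h y = complex_of_real (1 / (norm (z - y))\<^sup>2)" for y
    have [measurable]: "h \<in> borel_measurable borel" unfolding h_def by measurable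
    have Uc: "continuous_on ?cQ (\<lambda>s. complex_of_real ((norm (U z (exp (- s))))\<^sup>2))"
    proof -
      have "continuous_on ?cQ (\<lambda>s. U z (exp (- s)))"
        by (rule continuous_on_compose2[OF holomorphic_on_imp_continuous_on[OF U_hol[OF z]]])
           (use P_box(4)[OF d2, of d] in \<open>auto intro!: continuous_intros\<close>)
      then show ?thesis by (intro continuous_intros)
    qed
    have "(LINT s:?cQ|lborel. complex_of_real ((norm (U z (exp (- s))))\<^sup>2)) = (LINT s:?Q|lborel. complex_of_real ((norm (U z (exp (- s))))\<^sup>2))"
      by (rule set_integral_box_eq_cbox[OF Uc, symmetric])
    also have "\<dots> = (LINT s:?Q|lborel. (norm (deriv P s))\<^sup>2 *\<^sub>R h (P s))"
    proof (rule set_lebesgue_integral_cong)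
      show "\<forall>s. s \<in> ?Q \<longrightarrow> complex_of_real ((norm (U z (exp (- s))))\<^sup>2) = (norm (deriv P s))\<^sup>2 *\<^sub>R h (P s)"
      proof (intro allI impI)
        fix s assume "s \<in> ?Q"
        then have "Re s > 0" using P_box(1)[OF d2] by auto
        from P_log_deriv[OF z this] have nU: "norm (U z (exp (- s))) = norm (deriv P s) / norm (P s - z)"
          by (metis norm_divide)
        show "complex_of_real ((norm (U z (exp (- s))))\<^sup>2) = (norm (deriv P s))\<^sup>2 *\<^sub>R h (P s)"
          by (simp add: nU h_def scaleR_conv_of_real power_divide norm_minus_commute[of z "P s"])
      qed
    qed simp
    also have "\<dots> = (LINT y:P ` ?Q|lborel. h y)"
      by (rule holomorphic_cov_integral[OF open_box P_box(3,2)[OF d2], symmetric]) simp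
    finally have cov: "(LINT s:?cQ|lborel. complex_of_real ((norm (U z (exp (- s))))\<^sup>2)) = (LINT y:P ` ?Q|lborel. h y)" .
    define m where "m = \<kappa> * (d / 2) ^ 48"
    have m: "m > 0" using \<kappa> d by (simp add: m_def)
    define S where "S = P ` ?Q"
    have S: "S \<in> sets borel" "emeasure lborel S < \<infinity>"
      using P_box_image_fmeasurable[OF d2, of d] by (auto simp: S_def fmeasurable_def)
    have Sm: "measure lborel S \<le> A0" unfolding A0_def
    proof (rule measure_mono_fmeasurable)
      show "S \<subseteq> cball 0 R"
      proof
        fix y assume "y \<in> S"
        then obtain s where s: "s \<in> ?Q" "y = P s" by (auto simp: S_def)
        then have "0 < Re s" "Re s \<le> 1" using P_box(1)[OF d2] d by (auto simp: in_box_complex_iff)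
        then show "y \<in> cball 0 R" using R s by simp
      qed
      show "cball 0 R \<in> fmeasurable lborel" using emeasure_bounded_finite[OF bounded_cball] by (auto simp: fmeasurable_def)
    qed (use S in auto)
    have hb: "norm (h y) \<le> m powr (-b) * norm (z - y) powr (-q)" if yS: "y \<in> S" for y
    proof -
      obtain s where s: "s \<in> ?Q" "y = P s" using yS by (auto simp: S_def)
      then have s': "0 < Re s" "Re s \<le> 1" "d / 2 \<le> Re s" using P_box(1)[OF d2] d by (auto simp: in_box_complex_iff)
      have "m \<le> \<kappa> * Re s ^ 48" unfolding m_def using \<kappa> s' d by (intro mult_left_mono power_mono) auto
      also have "\<dots> \<le> norm (z - y)" using \<kappa>(2)[OF s'(1,2) z] s by (simp add: norm_minus_commute)
      finally have my: "m \<le> norm (z - y)" .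
      then have pos: "norm (z - y) > 0" using m by linarith
      have "norm (h y) = norm (z - y) powr (- 2)"
        using pos by (simp add: h_def powr_minus_divide norm_divide norm_power flip: powr_numeral)
      also have "\<dots> = norm (z - y) powr (- b) * norm (z - y) powr (- q)"
        by (simp add: q_def flip: powr_add)
      also have "norm (z - y) powr (- b) \<le> m powr (- b)"
        using my m by (intro powr_mono2') (auto simp: b_def)
      finally show ?thesis by (simp add: mult_right_mono)
    qed
    have bi: "set_integrable lborel S (\<lambda>y. m powr (-b) * norm (z - y) powr (-q))"
      using C(2)[OF S, of z] by (rule set_integrable_mult_right)
    have hi: "set_integrable lborel S h"
      by (rule set_integrable_bound[OF bi]) (use S hb in \<open>auto simp: set_borel_measurable_def\<close>)
    have "norm (LINT y:S|lborel. h y) \<le> (LINT y:S|lborel. norm (h y))"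
      by (rule set_integral_norm_bound[OF hi])
    also have "\<dots> \<le> (LINT y:S|lborel. m powr (-b) * norm (z - y) powr (-q))"
      by (rule set_integral_mono[OF set_integrable_norm[OF hi] bi hb])
    also have "\<dots> = m powr (-b) * (LINT y:S|lborel. norm (z - y) powr (-q))" by simp
    also have "\<dots> \<le> m powr (-b) * (C + A0)"
      using C(3)[OF S, of z] Sm by (intro mult_left_mono) auto
    also have "m powr (-b) = \<kappa> powr (-b) * 2 powr (1/16) * (2 powr (1/16)) ^ k"
    proof -
      have "d / 2 = 2 powr (- (real k + 1))"
      proof -
        have "2 powr (- (real k + 1)) = 1 / 2 powr (real (Suc k))"
          unfolding powr_minus_divide by (simp add: add.commute)
        also have "2 powr (real (Suc k)) = (2::real) ^ Suc k" by (rule powr_realpow) simp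
        finally show ?thesis by (simp add: d_def)
      qed
      then have "(d / 2) ^ 48 = 2 powr (- (real k + 1) * 48)"
        by (simp add: powr_power mult.commute)
      moreover have "- (real k + 1) * 48 * (- b) = (real k + 1) / 16" by (simp add: b_def field_simps)
      ultimately have "((d / 2) ^ 48) powr (-b) = 2 powr ((real k + 1) / 16)"
        by (simp only: powr_powr)
      also have "(real k + 1) / 16 = 1 / 16 + 1 / 16 * real k" by (simp add: field_simps)
      also have "2 powr (1 / 16 + 1 / 16 * real k) = 2 powr (1/16) * (2 powr (1/16)) ^ k"
        unfolding powr_add by (simp add: powr_power)
      finally show ?thesis unfolding m_def using \<kappa> d by (subst powr_mult) auto
    qed
    finally have up: "norm (LINT y:S|lborel. h y) \<le> \<kappa> powr (-b) * 2 powr (1/16) * (2 powr (1/16)) ^ k * (C + A0)" .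
    have "(\<Sum>n\<in>{2^k..<2^Suc k}. (norm (Fab z n))\<^sup>2 / real n) \<le> (\<Sum>n\<in>{2^k..<2^Suc k}. d * (norm (Fab z n))\<^sup>2)"
    proof (rule sum_mono)
      fix n :: nat assume "n \<in> {2^k..<2^Suc k}"
      then have n: "2 ^ k \<le> real n" by (metis atLeastLessThan_iff of_nat_le_iff of_nat_numeral of_nat_power)
      have k0: "(0::real) < 2 ^ k" by simp
      have n0: "0 < real n" using n k0 by linarith
      have "(norm (Fab z n))\<^sup>2 / real n \<le> (norm (Fab z n))\<^sup>2 / 2 ^ k"
        by (rule divide_left_mono[OF n]) (use mult_pos_pos[OF n0 k0] in auto)
      then show "(norm (Fab z n))\<^sup>2 / real n \<le> d * (norm (Fab z n))\<^sup>2" by (simp add: d_def)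
    qed
    also have "\<dots> = d * (\<Sum>n\<in>{2^k..<2^Suc k}. (norm (Fab z n))\<^sup>2)" by (simp add: sum_distrib_left)
    also have "\<dots> \<le> C1 * (2 powr (1/16)) ^ k"
    proof -
      have "pi * exp (-4) * (d * (\<Sum>n\<in>{2^k..<2^Suc k}. (norm (Fab z n))\<^sup>2)) \<le> norm (LINT y:S|lborel. h y)"
        using bes complex_Re_le_cmod[of "LINT y:S|lborel. h y"] unfolding cov S_def by (simp add: mult.assoc)
      also note up
      finally have "(d * (\<Sum>n\<in>{2^k..<2^Suc k}. (norm (Fab z n))\<^sup>2)) * (pi * exp (-4)) \<le>
          \<kappa> powr (-b) * 2 powr (1/16) * (2 powr (1/16)) ^ k * (C + A0)" by (simp only: mult.commute)
      then have "d * (\<Sum>n\<in>{2^k..<2^Suc k}. (norm (Fab z n))\<^sup>2) \<le>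
          (\<kappa> powr (-b) * 2 powr (1/16) * (2 powr (1/16)) ^ k * (C + A0)) / (pi * exp (-4))"
        by (subst pos_le_divide_eq) auto
      also have "\<dots> = C1 * (2 powr (1/16)) ^ k" by (simp add: C1_def)
      finally show ?thesis .
    qed
    finally show "(\<Sum>n\<in>{2^k..<2^Suc k}. (norm (Fab z n))\<^sup>2 / real n) \<le> C1 * (2 powr (1/16)) ^ k" .
  qed
qed

end

section \<open>Convergence of the Faber series on the closure\<close>

context patch
begin

text \<open>The image of the strip d/2 < Re s < d lies within r = (K d)^(1/4) of J, and such a
  neighbourhood has area O(r). For r > 1, outside the range of the linear bound, the area of a fixed
  disc takes its place.\<close>

lemma coefficient_block:
  obtains C where "C \<ge> 0" "\<And>k. (\<Sum>n\<in>{2^k..<2^Suc k}. real n * (norm (c n))\<^sup>2) \<le> C * (2 powr (-1/4)) ^ k"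
proof -
  obtain K where K: "K > 0" "\<And>s. 0 < Re s \<Longrightarrow> Re s \<le> 1 \<Longrightarrow> infdist (P s) J ^ 4 \<le> K * Re s"
    using P_distance_upper by blast
  obtain C0 where C0: "C0 \<ge> 0" "\<And>d. 0 < d \<Longrightarrow> d \<le> 1 \<Longrightarrow> measure lborel {z. infdist z J \<le> d} \<le> C0 * d"
    using neighbourhood_area by blast
  obtain R where R: "\<And>s. 0 < Re s \<Longrightarrow> Re s \<le> 1 \<Longrightarrow> norm (P s) \<le> R" using P_bounded[of 1] by auto
  define A0 where "A0 = measure lborel (cball (0::complex) R)"
  define C1 where "C1 = (C0 + A0) * K powr (1/4)"
  have A0: "A0 \<ge> 0" by (simp add: A0_def)
  have pa: "pi * exp (-4) * a\<^sup>2 > 0" using a_pos by simp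
  show ?thesis
  proof (rule that[of "C1 / (pi * exp (-4) * a\<^sup>2)"])
    show "C1 / (pi * exp (-4) * a\<^sup>2) \<ge> 0" using C0 A0 pa by (simp add: C1_def)
    fix k
    define d :: real where "d = 1 / 2 ^ k"
    have d: "0 < d" "d \<le> 1" by (auto simp: d_def)
    have d2: "0 < d / 2" using d by simp
    let ?Q = "box (Complex (d/2) 0) (Complex d (2*pi))"
    define r where "r = (K * d) powr (1/4)"
    have r: "r > 0" using K d by (simp add: r_def)
    have r4: "r ^ 4 = K * d" using K d by (simp add: r_def powr_power)
    have s01: "0 < Re s" "Re s \<le> 1" "Re s \<le> d" if "s \<in> ?Q" for s
      using that P_box(1)[OF d2] d by (auto simp: in_box_complex_iff)
    have near: "infdist (P s) J \<le> r" if s: "s \<in> ?Q" for s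
    proof -
      have "infdist (P s) J ^ 4 \<le> K * Re s" using K(2) s01[OF s] by blast
      also have "\<dots> \<le> K * d" using s01[OF s] K by (intro mult_left_mono) auto
      finally have "infdist (P s) J ^ 4 \<le> r ^ 4" by (simp only: r4)
      then show ?thesis by (rule power_le_imp_le_base[of _ 3, simplified]) (use r in auto)
    qed
    have "measure lborel (P ` ?Q) \<le> (C0 + A0) * r"
    proof (cases "r \<le> 1")
      case True
      have "measure lborel (P ` ?Q) \<le> measure lborel {z. infdist z J \<le> r}"
        by (rule measure_mono_fmeasurable) (use near neighbourhood_fmeasurable P_box_image_fmeasurable[OF d2, of d] in \<open>auto simp: fmeasurable_def\<close>)
      also have "\<dots> \<le> C0 * r" by (rule C0(2)[OF r True])
      also have "\<dots> \<le> (C0 + A0) * r" using A0 r by (intro mult_right_mono) auto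
      finally show ?thesis .
    next
      case False
      have "measure lborel (P ` ?Q) \<le> A0" unfolding A0_def
        by (rule measure_mono_fmeasurable)
           (use s01 R P_box_image_fmeasurable[OF d2, of d] emeasure_bounded_finite[OF bounded_cball] in \<open>auto simp: fmeasurable_def\<close>)
      also have "\<dots> \<le> (C0 + A0) * 1" using C0 by simp
      also have "\<dots> \<le> (C0 + A0) * r" using False C0 A0 by (intro mult_left_mono) auto
      finally show ?thesis .
    qed
    also have "r = K powr (1/4) * (2 powr (-1/4)) ^ k"
    proof -
      have "d = 2 powr (- real k)" by (simp add: d_def powr_minus_divide powr_realpow)
      then have "d powr (1/4) = 2 powr (- real k * (1/4))" by (simp only: powr_powr)
      also have "- real k * (1/4) = (-1/4) * real k" by simp
      also have "2 powr ((-1/4) * real k) = (2 powr (-1/4)) ^ k" by (simp add: powr_power)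
      finally have "d powr (1/4) = (2 powr (-1/4)) ^ k" .
      then show ?thesis unfolding r_def using K d by (subst powr_mult) auto
    qed
    finally have "measure lborel (P ` ?Q) \<le> C1 * (2 powr (-1/4)) ^ k" by (simp add: C1_def mult.assoc)
    then have "pi * exp (-4) * a\<^sup>2 * (\<Sum>n\<in>{2^k..<2^Suc k}. real n * (norm (c n))\<^sup>2) \<le> C1 * (2 powr (-1/4)) ^ k"
      using coefficient_block_area[OF d_def] by linarith
    then have "(\<Sum>n\<in>{2^k..<2^Suc k}. real n * (norm (c n))\<^sup>2) \<le> (C1 * (2 powr (-1/4)) ^ k) / (pi * exp (-4) * a\<^sup>2)"
      using pa by (subst pos_le_divide_eq) (auto simp only: mult.commute)
    then show "(\<Sum>n\<in>{2^k..<2^Suc k}. real n * (norm (c n))\<^sup>2) \<le> C1 / (pi * exp (-4) * a\<^sup>2) * (2 powr (-1/4)) ^ k"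
      by simp
  qed
qed

text \<open>The Cauchy--Schwarz inequality on dyadic blocks: the decay rate 1/4 of the coefficients beats
  the growth rate 1/16 of the Faber polynomials.\<close>
lemma faber_tail:
  obtains C \<rho> where "C \<ge> 0" "0 < \<rho>" "\<rho> < 1"
    "\<And>k M z. z \<in> closure D \<Longrightarrow> (\<Sum>n\<in>{2^k..<M}. norm (c n) * norm (Fab z n)) \<le> C * \<rho> ^ k"
proof -
  obtain C1 where C1: "C1 \<ge> 0" "\<And>k. (\<Sum>n\<in>{2^k..<2^Suc k}. real n * (norm (c n))\<^sup>2) \<le> C1 * (2 powr (-1/4)) ^ k"
    using coefficient_block by blast
  obtain C2 where C2: "C2 \<ge> 0" "\<And>k z. z \<in> closure D \<Longrightarrow>
    (\<Sum>n\<in>{2^k..<2^Suc k}. (norm (Fab z n))\<^sup>2 / real n) \<le> C2 * (2 powr (1/16)) ^ k"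
    using faber_block by blast
  \<comment> \<open>Cauchy--Schwarz takes the square root of the product of the two rates: half of
    -1/4 + 1/16 is -3/32.\<close>
  define \<rho> :: real where "\<rho> = 2 powr (-3/32)"
  have \<rho>: "0 < \<rho>" "\<rho> < 1" by (auto simp: \<rho>_def powr_less_one)
  have \<rho>2: "\<rho>\<^sup>2 = 2 powr (-1/4) * 2 powr (1/16)"
    unfolding \<rho>_def powr_add[symmetric] by (simp add: powr_power)
  have block: "(\<Sum>n\<in>{2^k..<2^Suc k}. norm (c n) * norm (Fab z n)) \<le> sqrt (C1 * C2) * \<rho> ^ k" if z: "z \<in> closure D" for k z
  proof (rule power2_le_imp_le)
    have "(\<Sum>n\<in>{2^k..<2^Suc k}. norm (c n) * norm (Fab z n)) =
      (\<Sum>n\<in>{2^k..<2^Suc k}. (sqrt (real n) * norm (c n)) * (norm (Fab z n) / sqrt (real n)))"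
    proof (rule sum.cong[OF refl])
      fix n :: nat assume "n \<in> {2^k..<2^Suc k}"
      then have "n > 0" by (metis atLeastLessThan_iff gr0I not_le zero_less_power zero_less_numeral)
      then show "norm (c n) * norm (Fab z n) = (sqrt (real n) * norm (c n)) * (norm (Fab z n) / sqrt (real n))" by simp
    qed
    then have "(\<Sum>n\<in>{2^k..<2^Suc k}. norm (c n) * norm (Fab z n))\<^sup>2 \<le>
      (\<Sum>n\<in>{2^k..<2^Suc k}. (sqrt (real n) * norm (c n))\<^sup>2) * (\<Sum>n\<in>{2^k..<2^Suc k}. (norm (Fab z n) / sqrt (real n))\<^sup>2)"
      by (simp only: Cauchy_Schwarz_ineq_sum)
    also have "\<dots> = (\<Sum>n\<in>{2^k..<2^Suc k}. real n * (norm (c n))\<^sup>2) * (\<Sum>n\<in>{2^k..<2^Suc k}. (norm (Fab z n))\<^sup>2 / real n)"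
      by (simp add: power_mult_distrib power_divide)
    also have "\<dots> \<le> (C1 * (2 powr (-1/4)) ^ k) * (C2 * (2 powr (1/16)) ^ k)"
      using C1 by (intro mult_mono C1 C2 z) (auto intro!: sum_nonneg)
    also have "\<dots> = (C1 * C2) * (\<rho> ^ k)\<^sup>2"
    proof -
      have "(\<rho> ^ k)\<^sup>2 = (2 powr (-1/4)) ^ k * (2 powr (1/16)) ^ k"
        using \<rho>2 by (metis power_commutes power_mult mult.commute power_mult_distrib)
      then show ?thesis by (simp only: mult.assoc mult.left_commute)
    qed
    also have "\<dots> = (sqrt (C1 * C2) * \<rho> ^ k)\<^sup>2" using C1 C2 by (simp add: power_mult_distrib)
    finally show "(\<Sum>n\<in>{2^k..<2^Suc k}. norm (c n) * norm (Fab z n))\<^sup>2 \<le> (sqrt (C1 * C2) * \<rho> ^ k)\<^sup>2" .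
    show "0 \<le> sqrt (C1 * C2) * \<rho> ^ k" using C1 C2 \<rho> by simp
  qed
  show ?thesis
  proof (rule that[of "sqrt (C1 * C2) / (1 - \<rho>)" \<rho>])
    show "0 \<le> sqrt (C1 * C2) / (1 - \<rho>)" using C1 C2 \<rho> by simp
    fix k M z assume z: "z \<in> closure D"
    have "(\<Sum>n\<in>{2^k..<M}. norm (c n) * norm (Fab z n)) \<le> sqrt (C1 * C2) * \<rho> ^ k / (1 - \<rho>)"
      by (rule dyadic_block_tail[OF _ _ \<rho> block[OF z]]) (use C1 C2 in auto)
    then show "(\<Sum>n\<in>{2^k..<M}. norm (c n) * norm (Fab z n)) \<le> sqrt (C1 * C2) / (1 - \<rho>) * \<rho> ^ k" by simp
  qed (use \<rho> in auto)
qed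

lemma faber_abs_summable:
  assumes z: "z \<in> closure D"
  shows "summable (\<lambda>n. norm (c n) * norm (Fab z n))"
proof -
  obtain C \<rho> where C: "C \<ge> 0" "0 < \<rho>" "\<rho> < 1"
    "\<And>k M z. z \<in> closure D \<Longrightarrow> (\<Sum>n\<in>{2^k..<M}. norm (c n) * norm (Fab z n)) \<le> C * \<rho> ^ k"
    using faber_tail by metis
  \<comment> \<open>Dyadic blocks start at n = 1, so the term n = 0 is split off.\<close>
  have "summable (\<lambda>n. norm (c (Suc n)) * norm (Fab z (Suc n)))"
  proof (rule bounded_imp_summable[where B = C])
    fix n
    have "(\<Sum>k\<le>n. norm (c (Suc k)) * norm (Fab z (Suc k))) = (\<Sum>n\<in>{2^0..<Suc (Suc n)}. norm (c n) * norm (Fab z n))"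
      unfolding power_0 One_nat_def sum.atLeast_Suc_lessThan_Suc_shift by (simp add: atLeast0LessThan lessThan_Suc_atMost)
    also have "\<dots> \<le> C * \<rho> ^ 0" by (rule C(4)[OF z])
    finally show "(\<Sum>k\<le>n. norm (c (Suc k)) * norm (Fab z (Suc k))) \<le> C" by simp
  qed auto
  then show ?thesis by (subst (asm) summable_Suc_iff)
qed

text \<open>The tail bound does not depend on z, so the partial sums are uniformly Cauchy up to and
  including the boundary.\<close>

theorem faber_series_uniform:
  "uniform_limit (closure D)
     (\<lambda>N z. of_real a * (\<Sum>n<N. cnj (c n) * poly (faber_poly \<Phi> n) z)) (faber_series \<Phi> a c) sequentially"
proof -
  obtain C \<rho> where C: "C \<ge> 0" "0 < \<rho>" "\<rho> < 1"
    "\<And>k M z. z \<in> closure D \<Longrightarrow> (\<Sum>n\<in>{2^k..<M}. norm (c n) * norm (Fab z n)) \<le> C * \<rho> ^ k"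
    using faber_tail by metis
  define f where "f N z = (\<Sum>n<N. cnj (c n) * poly (faber_poly \<Phi> n) z)" for N z
  have "uniformly_Cauchy_on (closure D) f"
  proof (rule uniformly_Cauchy_onI')
    fix e :: real assume e: "e > 0"
    have "(\<lambda>k. C * \<rho> ^ k) \<longlonglongrightarrow> C * 0" using C by (intro tendsto_mult tendsto_const LIMSEQ_power_zero) auto
    then have "\<forall>\<^sub>F k in sequentially. C * \<rho> ^ k < e" using e by (intro order_tendstoD(2)[of _ "0"]) auto
    then obtain k where k: "C * \<rho> ^ k < e" by (auto simp: eventually_sequentially)
    have "dist (f m z) (f n z) < e" if z: "z \<in> closure D" and mn: "2 ^ k \<le> m" "m < n" for z m n
    proof -
      have "f n z = f m z + (\<Sum>i\<in>{m..<n}. cnj (c i) * Fab z i)"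
      proof -
        have "f n z = f m z + (\<Sum>i\<in>{m..<n}. cnj (c i) * poly (faber_poly \<Phi> i) z)"
          unfolding f_def using mn sum.atLeastLessThan_concat[of 0 m n "\<lambda>i. cnj (c i) * poly (faber_poly \<Phi> i) z"]
          by (simp add: atLeast0LessThan)
        then show ?thesis by (simp add: faber_poly_Fab[OF z])
      qed
      then have "dist (f m z) (f n z) = norm (\<Sum>i\<in>{m..<n}. cnj (c i) * Fab z i)"
        by (simp add: dist_norm norm_minus_commute)
      also have "\<dots> \<le> (\<Sum>i\<in>{m..<n}. norm (c i) * norm (Fab z i))"
        by (rule order_trans[OF norm_sum]) (simp add: norm_mult)
      also have "\<dots> \<le> (\<Sum>i\<in>{2^k..<n}. norm (c i) * norm (Fab z i))" using mn by (intro sum_mono2) auto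
      also have "\<dots> \<le> C * \<rho> ^ k" by (rule C(4)[OF z])
      finally show ?thesis using k by linarith
    qed
    then show "\<exists>M. \<forall>x\<in>closure D. \<forall>m\<ge>M. \<forall>n>m. dist (f m x) (f n x) < e" by blast
  qed
  then have "uniformly_convergent_on (closure D) f" by (rule Cauchy_uniformly_convergent)
  then have "uniform_limit (closure D) f (\<lambda>z. lim (\<lambda>N. f N z)) sequentially"
    by (simp add: uniformly_convergent_uniform_limit_iff)
  moreover have "lim (\<lambda>N. f N z) = (\<Sum>n. cnj (c n) * poly (faber_poly \<Phi> n) z)" for z
    unfolding f_def suminf_eq_lim ..
  ultimately have "uniform_limit (closure D) f (\<lambda>z. \<Sum>n. cnj (c n) * poly (faber_poly \<Phi> n) z) sequentially" by simp
  from bounded_linear.uniform_limit[OF bounded_linear_mult_right this, of "of_real a"]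
  show ?thesis by (simp add: f_def[abs_def] faber_series_def[abs_def])
qed

lemma faber_series_Fab:
  assumes z: "z \<in> closure D"
  shows "faber_series \<Phi> a c z = of_real a * (\<Sum>n. cnj (c n) * Fab z n)"
  unfolding faber_series_def by (simp add: faber_poly_Fab[OF z])

end

section \<open>The Faber series as a Cauchy transform\<close>

text \<open>The squared positive part is a C^1 function vanishing on a half-line, from which
  cut-offs and bumps are composed. The error h^2 is at most |h|^(3/2) for |h| < 1.\<close>

lemma max_zero_square_deriv: "((\<lambda>t. (max 0 t)\<^sup>2) has_real_derivative 2 * max 0 t) (at t)"
  unfolding has_field_derivative_def
proof (rule has_derivative_from_bound[of _ 1 _ _ 1])
  show "bounded_linear ((*) (2 * max 0 t))" by (rule bounded_linear_mult_right)
  fix h :: real assume h: "norm h < 1"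
  have "\<bar>(max 0 (t + h))\<^sup>2 - (max 0 t)\<^sup>2 - 2 * max 0 t * h\<bar> \<le> h\<^sup>2"
  proof -
    consider "0 \<le> t" "0 \<le> t + h" | "0 \<le> t" "t + h < 0" | "t < 0" "0 \<le> t + h" | "t < 0" "t + h < 0" by linarith
    then show ?thesis
    proof cases
      case 1
      then show ?thesis by (simp add: power2_eq_square algebra_simps)
    next
      case 2
      have "0 \<le> (t + h)\<^sup>2" by simp
      then have "- (t * t) - 2 * (t * h) \<le> h * h" by (simp add: power2_eq_square algebra_simps)
      moreover have "t * h \<le> t * (- t)" using 2 by (intro mult_left_mono) auto
      then have "t * h \<le> - (t * t)" by simp
      then have "t * t + 2 * (t * h) \<le> h * h" using zero_le_square[of t] zero_le_square[of h] by linarith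
      ultimately have "\<bar>- (t * t) - 2 * (t * h)\<bar> \<le> h * h" by linarith
      then show ?thesis using 2 by (simp add: max_def power2_eq_square)
    next
      case 3
      then have "(t + h)\<^sup>2 \<le> h\<^sup>2" by (intro power_mono) auto
      then show ?thesis using 3 by (simp add: max_def)
    qed (auto simp: max_def)
  qed
  also have "h\<^sup>2 \<le> 1 * norm h powr (3/2)"
  proof -
    have "h\<^sup>2 = norm h * (sqrt (norm h) * sqrt (norm h))" by (simp add: power2_eq_square)
    also have "\<dots> \<le> norm h * (sqrt (norm h) * 1)" using h by (intro mult_left_mono) auto
    finally show ?thesis by (simp add: powr_three_half)
  qed
  finally show "norm ((max 0 (t + h))\<^sup>2 - (max 0 t)\<^sup>2 - 2 * max 0 t * h) \<le> 1 * norm h powr (3/2)" by simp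
qed simp

text \<open>With p the squared positive part, p (1 - p u) is 1 where u <= 0 and 0 where u >= 1. For
  u = |z|^2 - R^2 these regions contain |z| <= R and |z| >= R + 1, the latter because (R + 1)^2 -
  R^2 >= 1.\<close>

lemma cutoff_function:
  assumes R: "R \<ge> 0"
  obtains \<eta> \<eta>x \<eta>y :: "complex \<Rightarrow> real" where "C1_plane \<eta> \<eta>x \<eta>y"
    "\<And>z. norm z \<le> R \<Longrightarrow> \<eta> z = 1" "\<And>z. norm z \<le> R \<Longrightarrow> \<eta>x z = 0" "\<And>z. norm z \<le> R \<Longrightarrow> \<eta>y z = 0"
    "\<And>z. norm z \<ge> R + 1 \<Longrightarrow> \<eta> z = 0"
proof -
  define p where "p t = (max 0 t)\<^sup>2" for t :: real
  define u where "u z = z \<bullet> z - R\<^sup>2" for z :: complex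
  define \<eta> where "\<eta> z = p (1 - p (u z))" for z
  define w where "w z = 2 * max 0 (1 - p (u z)) * (- (2 * max 0 (u z))) * 2" for z
  have du: "(u has_derivative (\<lambda>h. z \<bullet> h + h \<bullet> z)) (at z)" for z
    unfolding u_def by (auto intro!: derivative_eq_intros)
  have dp: "(p has_field_derivative 2 * max 0 t) (at t)" for t
    unfolding p_def by (rule max_zero_square_deriv)
  have d1: "((\<lambda>z. p (u z)) has_derivative (\<lambda>h. (z \<bullet> h + h \<bullet> z) * (2 * max 0 (u z)))) (at z)" for z
    by (rule DERIV_compose_FDERIV[OF dp du])
  have d2: "((\<lambda>z. 1 - p (u z)) has_derivative (\<lambda>h. 0 - (z \<bullet> h + h \<bullet> z) * (2 * max 0 (u z)))) (at z)" for z
    by (intro has_derivative_diff has_derivative_const d1)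
  have d3: "(\<eta> has_derivative (\<lambda>h. (0 - (z \<bullet> h + h \<bullet> z) * (2 * max 0 (u z))) * (2 * max 0 (1 - p (u z))))) (at z)" for z
    unfolding \<eta>_def by (rule DERIV_compose_FDERIV[OF dp d2])
  have d: "(\<eta> has_derivative (\<lambda>h. Re h *\<^sub>R (w z * Re z) + Im h *\<^sub>R (w z * Im z))) (at z)" for z
    by (rule has_derivative_eq_rhs[OF d3]) (auto simp: fun_eq_iff w_def inner_complex_def algebra_simps)
  have pc: "continuous_on UNIV p" unfolding p_def by (intro continuous_intros)
  have uc: "continuous_on UNIV u" unfolding u_def by (intro continuous_intros)
  have puc: "continuous_on UNIV (\<lambda>z. p (u z))" by (rule continuous_on_compose2[OF pc uc]) auto
  have wc: "continuous_on UNIV w" unfolding w_def by (intro continuous_intros puc uc)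
  have nz: "z \<bullet> z = (norm z)\<^sup>2" for z :: complex by (simp add: power2_norm_eq_inner)
  have in_R: "u z \<le> 0" if "norm z \<le> R" for z
    using power_mono[OF that norm_ge_zero, of 2] by (simp add: u_def nz)
  have out_R: "u z \<ge> 1" if "norm z \<ge> R + 1" for z
  proof -
    have "(R + 1)\<^sup>2 \<le> (norm z)\<^sup>2" using that R by (intro power_mono) auto
    then show ?thesis using R by (simp add: u_def nz power2_eq_square algebra_simps)
  qed
  show ?thesis
  proof (rule that[of \<eta> "\<lambda>z. w z * Re z" "\<lambda>z. w z * Im z"])
    show "C1_plane \<eta> (\<lambda>z. w z * Re z) (\<lambda>z. w z * Im z)"
      unfolding C1_plane_def using d by (auto intro!: continuous_intros wc)
    show "\<eta> z = 1" "w z * Re z = 0" "w z * Im z = 0" if "norm z \<le> R" for z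
      using in_R[OF that] by (auto simp: \<eta>_def w_def p_def max_def)
    show "\<eta> z = 0" if "norm z \<ge> R + 1" for z
    proof -
      have "p (u z) \<ge> 1" using out_R[OF that] unfolding p_def by (simp add: max_def)
      then show ?thesis unfolding \<eta>_def by (subst p_def) (simp add: max_def)
    qed
  qed
qed

lemma bdd_density_indicator:
  assumes "S \<in> sets borel" "bounded S"
  shows "bdd_density (indicator S)"
proof -
  obtain R where R: "\<And>y. y \<in> S \<Longrightarrow> norm y \<le> R" using assms(2) bounded_iff by metis
  have "(indicator S y :: complex) = 0" if "norm y > R" for y using R[of y] that by (cases "y \<in> S") auto
  then have "\<forall>y. norm (indicator S y :: complex) \<le> 1 \<and> (norm y > R \<longrightarrow> (indicator S y :: complex) = 0)"
    by (auto simp: indicator_def)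
  moreover have "(indicator S :: complex \<Rightarrow> complex) \<in> borel_measurable borel" using assms(1) by measurable
  ultimately show ?thesis unfolding bdd_density_def by blast
qed

section \<open>The exterior half-strip and its boundary terms\<close>

context exterior_map
begin

text \<open>B q tends to 1 at q = 0, so |P s| is eventually at least half of a exp (Re s).\<close>

lemma P_far:
  obtains X where "X > 1" "\<And>s. Re s \<ge> X \<Longrightarrow> norm (P s) \<ge> M"
proof -
  have "isCont B 0"
    using holomorphic_on_imp_continuous_on[OF B_hol] continuous_on_interior by fastforce
  then obtain d where d: "d > 0" "\<And>q. dist q 0 < d \<Longrightarrow> dist (B q) (B 0) < 1/2"
    unfolding continuous_at_eps_delta by (metis half_gt_zero zero_less_one)
  define E where "E = 2 * \<bar>M\<bar> / a + 1 / d"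
  have E: "E \<ge> 1 / d" "E \<ge> 2 * \<bar>M\<bar> / a" "E > 0" using a_pos d by (auto simp: E_def add_nonneg_pos)
  define X where "X = max 2 (ln (E + 1))"
  have eX: "exp X > E"
  proof -
    have "E < exp (ln (E + 1))" using E by simp
    also have "\<dots> \<le> exp X" by (simp add: X_def)
    finally show ?thesis .
  qed
  show ?thesis
  proof (rule that[of X])
    show "X > 1" by (simp add: X_def)
    fix s assume s: "Re s \<ge> X"
    then have "exp X \<le> exp (Re s)" by simp
    with eX have es: "E < exp (Re s)" by linarith
    have "1 / d < exp (Re s)" using es E by linarith
    then have "exp (- Re s) < d" using d(1) by (simp add: exp_minus field_simps)
    then have "dist (B (exp (- s))) 1 < 1/2" using d(2)[of "exp (- s)"] by (simp add: B_0)
    then have "1/2 \<le> norm (B (exp (- s)))"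
      using norm_triangle_ineq2[of 1 "B (exp (- s))"] by (simp add: dist_norm norm_minus_commute)
    then have "a * exp (Re s) * (1/2) \<le> a * exp (Re s) * norm (B (exp (- s)))"
      using a_pos by (intro mult_left_mono) auto
    also have "\<dots> = norm (P s)" using P_B[of s] s a_pos by (simp add: X_def norm_mult)
    finally have "a * exp (Re s) * (1/2) \<le> norm (P s)" .
    moreover have "2 * \<bar>M\<bar> / a < exp (Re s)" using es E by linarith
    then have "\<bar>M\<bar> \<le> a * exp (Re s) * (1/2)" using a_pos by (simp add: field_simps)
    ultimately show "norm (P s) \<ge> M" by linarith
  qed
qed

text \<open>What is missing lies in the image of the slit, a null set, and the differentiable map
  \<Phi> preserves null sets.\<close>

lemma P_strip_image: "- closure D - P ` {s. 0 < Re s \<and> 0 < Im s \<and> Im s < 2 * pi} \<in> null_sets lebesgue"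
proof -
  have sub: "- closure D - P ` {s. 0 < Re s \<and> 0 < Im s \<and> Im s < 2 * pi} \<subseteq> \<Phi> ` (- cball 0 1 \<inter> - slit_plane 0)"
  proof
    fix y assume y: "y \<in> - closure D - P ` {s. 0 < Re s \<and> 0 < Im s \<and> Im s < 2 * pi}"
    then have n: "norm (\<phi> y) > 1" "\<Phi> (\<phi> y) = y" using norm_\<phi>[of y] \<Phi>_\<phi>[of y] by auto
    have "\<phi> y \<notin> slit_plane 0"
    proof
      assume "\<phi> y \<in> slit_plane 0"
      then obtain s where s: "\<phi> y = exp s" "0 < Im s" "Im s < 2 * pi" by (auto simp: slit_plane_def)
      then have "0 < Re s" using n(1) by simp
      moreover have "y = P s" using n(2) s by (simp add: P_def)
      ultimately show False using y s by blast
    qed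
    then show "y \<in> \<Phi> ` (- cball 0 1 \<inter> - slit_plane 0)" using n by (intro image_eqI[of _ _ "\<phi> y"]) auto
  qed
  have "negligible (- slit_plane 0)"
    using slit_plane_complement_null[of 0] by (simp add: negligible_iff_null_sets null_sets_completionI)
  then have "negligible (- cball 0 1 \<inter> - slit_plane 0)" by (rule negligible_subset) auto
  moreover have "\<Phi> differentiable_on (- cball 0 1 \<inter> - slit_plane 0)"
    using \<Phi>_hol holomorphic_on_imp_differentiable_on differentiable_on_subset by (metis inf_le1)
  ultimately have "negligible (\<Phi> ` (- cball 0 1 \<inter> - slit_plane 0))"
    by (intro negligible_differentiable_image_negligible) auto
  then have "negligible (- closure D - P ` {s. 0 < Re s \<and> 0 < Im s \<and> Im s < 2 * pi})"
    using sub by (rule negligible_subset)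
  then show ?thesis by (simp add: negligible_iff_null_sets)
qed

text \<open>Parseval's identity for exp (- s) P and exp (- s) U. The extra factor turns P, which
  starts with exp s, into a power series in exp (- s); it shifts both indices by one and is divided
  out at the end.\<close>

lemma boundary_mean:
  assumes z: "z \<in> closure D" and x: "x > 0"
  shows "(\<lambda>n. 2 * pi * (of_real a * (cnj (c n) * Fab z n * of_real (exp (- x) ^ (2 * n))))) sums
    integral {0..2*pi} (\<lambda>y. cnj (P (Complex x y)) * U z (exp (- Complex x y)))"
proof -
  define p where "p n = of_real a * Bc n" for n
  \<comment> \<open>The value q 0 = 0 annihilates the leading term a exp s of P, so the pairing
    starts with c 0 and \<open>Fab z 0\<close>.\<close>
  define q where "q n = (case n of 0 \<Rightarrow> 0 | Suc m \<Rightarrow> Fab z m)" for n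
  have ps: "(\<lambda>n. p n * w ^ n) sums (of_real a * B w)" if w: "norm w < 1" for w
    using sums_mult[OF summable_sums[OF Bc_summable[OF w]], of "of_real a"]
    by (simp add: p_def B_def mult.assoc)
  have qs: "(\<lambda>n. q n * w ^ n) sums (w * U z w)" if w: "norm w < 1" for w
  proof -
    have "(\<lambda>n. w * (Fab z n * w ^ n)) sums (w * U z w)" by (rule sums_mult[OF Fab_sums[OF z w]])
    then have "(\<lambda>n. q (Suc n) * w ^ Suc n) sums (w * U z w)" by (simp add: q_def mult_ac)
    then show ?thesis using sums_Suc_iff[of "\<lambda>n. q n * w ^ n" "w * U z w"] by (simp add: q_def)
  qed
  have S: "(\<lambda>n. 2 * pi * (cnj (p n) * q n * of_real (exp (- x) ^ (2 * n)))) sums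
     integral {0..2*pi} (\<lambda>y. cnj (\<Sum>n. p n * exp (- Complex x y) ^ n) * (\<Sum>n. q n * exp (- Complex x y) ^ n))"
  proof (rule parseval_exp)
    show "summable (\<lambda>n. norm (p n) * exp (- x) ^ n)"
      by (rule power_series_abs_summable[OF _ x]) (use ps sums_summable in blast)
    show "summable (\<lambda>n. norm (q n) * exp (- x) ^ n)"
      by (rule power_series_abs_summable[OF _ x]) (use qs sums_summable in blast)
  qed
  have e1: "cnj (\<Sum>n. p n * exp (- Complex x y) ^ n) * (\<Sum>n. q n * exp (- Complex x y) ^ n) =
     of_real (exp (- x) ^ 2) * (cnj (P (Complex x y)) * U z (exp (- Complex x y)))" for y
  proof -
    define s where "s = Complex x y"
    define w where "w = exp (- s)"
    have nw: "norm w < 1" using x by (simp add: w_def s_def)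
    have "(\<Sum>n. p n * w ^ n) = of_real a * B w" by (rule sums_unique[OF ps[OF nw], symmetric])
    also have "\<dots> = w * P s"
    proof -
      have "w * exp s = 1" by (simp add: w_def exp_minus)
      moreover have "w * P s = (w * exp s) * (of_real a * B w)"
        using P_B[of s] x by (simp add: w_def s_def)
      ultimately show ?thesis by simp
    qed
    finally have 1: "(\<Sum>n. p n * w ^ n) = w * P s" .
    have 2: "(\<Sum>n. q n * w ^ n) = w * U z w" by (rule sums_unique[OF qs[OF nw], symmetric])
    have 3: "cnj w * w = of_real (exp (- x) ^ 2)"
    proof -
      have "cnj w * w = of_real ((norm w)\<^sup>2)" by (simp only: complex_norm_square mult.commute)
      then show ?thesis by (simp add: w_def s_def)
    qed
    have "cnj (w * P s) * (w * U z w) = (cnj w * w) * (cnj (P s) * U z w)"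
      by (simp add: mult_ac)
    then show ?thesis unfolding s_def[symmetric] w_def[symmetric] 1 2 3 .
  qed
  have S': "(\<lambda>n. 2 * pi * (cnj (p (Suc n)) * q (Suc n) * of_real (exp (- x) ^ (2 * Suc n)))) sums
     (of_real (exp (- x) ^ 2) * integral {0..2*pi} (\<lambda>y. cnj (P (Complex x y)) * U z (exp (- Complex x y))))"
    using S unfolding e1 integral_mult_right
    by (subst sums_Suc_iff) (simp add: q_def)
  have T: "2 * pi * (cnj (p (Suc n)) * q (Suc n) * of_real (exp (- x) ^ (2 * Suc n))) =
    of_real (exp (- x) ^ 2) * (2 * pi * (of_real a * (cnj (c n) * Fab z n * of_real (exp (- x) ^ (2 * n)))))" for n
    by (simp add: p_def q_def Bc_def power_add power2_eq_square mult_ac)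
  have "(\<lambda>n. of_real (exp (- x) ^ 2) * (2 * pi * (of_real a * (cnj (c n) * Fab z n * of_real (exp (- x) ^ (2 * n)))))) sums
     (of_real (exp (- x) ^ 2) * integral {0..2*pi} (\<lambda>y. cnj (P (Complex x y)) * U z (exp (- Complex x y))))"
    using S' by (simp only: T)
  then show ?thesis by (subst (asm) sums_mult_iff) simp_all
qed

end

context patch
begin

text \<open>Cauchy--Pompeiu for a cut-off of cnj splits pi cnj z into the transform of the patch and
  an integral over the exterior. In the coordinate s the latter is a boundary term on Re s = x,
  which Parseval evaluates; as x tends to 0 it becomes pi times the Faber series.\<close>

theorem faber_series_cauchy_transform:
  assumes z: "z \<in> closure D"
  shows "faber_series \<Phi> a c z = cnj z - cauchy_transform (indicator D) z / of_real pi"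
proof -
  obtain R1 where R1: "\<And>w. w \<in> closure D \<Longrightarrow> norm w \<le> R1"
    using D_bounded bounded_closure bounded_iff by metis
  obtain R2 where R2: "\<And>s. 0 < Re s \<Longrightarrow> Re s \<le> 1 \<Longrightarrow> norm (P s) \<le> R2" using P_bounded[of 1] by auto
  define R where "R = max (max R1 R2) 0"
  have R: "R \<ge> 0" "\<And>w. w \<in> closure D \<Longrightarrow> norm w \<le> R" "\<And>s. 0 < Re s \<Longrightarrow> Re s \<le> 1 \<Longrightarrow> norm (P s) \<le> R"
    using R1 R2 unfolding R_def by (auto intro: max.coboundedI1 max.coboundedI2)
  obtain \<eta> \<eta>x \<eta>y where eta: "C1_plane \<eta> \<eta>x \<eta>y"
    "\<And>z. norm z \<le> R \<Longrightarrow> \<eta> z = (1::real)" "\<And>z. norm z \<le> R \<Longrightarrow> \<eta>x z = 0" "\<And>z. norm z \<le> R \<Longrightarrow> \<eta>y z = 0"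
    "\<And>z. norm z \<ge> R + 1 \<Longrightarrow> \<eta> z = 0"
    using cutoff_function[OF R(1)] by metis
  \<comment> \<open>The dbar derivative of cnj is 1. The cut-off gives compact support and changes
    nothing on D or at the points P s with 0 < Re s <= 1.\<close>
  define k where "k y = cnj y * of_real (\<eta> y)" for y
  define kx where "kx y = of_real (\<eta> y) + cnj y * of_real (\<eta>x y)" for y
  define ky where "ky y = - \<i> * of_real (\<eta> y) + cnj y * of_real (\<eta>y y)" for y
  have ec: "continuous_on UNIV \<eta>" "continuous_on UNIV \<eta>x" "continuous_on UNIV \<eta>y"
    using C1_plane_continuous[OF eta(1)] eta(1) by (auto simp: C1_plane_def)
  have kC: "C1_plane k kx ky"
    unfolding C1_plane_def
  proof (intro conjI allI)
    fix y
    have de: "(\<eta> has_derivative (\<lambda>h. Re h *\<^sub>R \<eta>x y + Im h *\<^sub>R \<eta>y y)) (at y)"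
      using eta(1) by (simp add: C1_plane_def)
    have 1: "((\<lambda>y. complex_of_real (\<eta> y)) has_derivative (\<lambda>h. complex_of_real (Re h *\<^sub>R \<eta>x y + Im h *\<^sub>R \<eta>y y))) (at y)"
      by (rule bounded_linear.has_derivative[OF bounded_linear_of_real de])
    have 2: "(cnj has_derivative cnj) (at y)" by (rule bounded_linear_imp_has_derivative[OF bounded_linear_cnj])
    have "(k has_derivative (\<lambda>h. cnj y * complex_of_real (Re h *\<^sub>R \<eta>x y + Im h *\<^sub>R \<eta>y y) + cnj h * complex_of_real (\<eta> y))) (at y)"
      unfolding k_def by (rule has_derivative_mult[OF 2 1])
    then show "(k has_derivative (\<lambda>h. Re h *\<^sub>R kx y + Im h *\<^sub>R ky y)) (at y)"
      by (rule has_derivative_eq_rhs)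
         (auto simp: fun_eq_iff kx_def ky_def complex_eq_iff algebra_simps)
  qed (auto simp: kx_def ky_def intro!: continuous_intros ec)
  have k0: "k y = 0" if "norm y \<ge> R + 1" for y using eta(5)[OF that] by (simp add: k_def)
  define Dk where "Dk y = (kx y + \<i> * ky y) / 2" for y
  have Dk1: "Dk y = 1" if "norm y \<le> R" for y
    using eta(2-4)[OF that] by (simp add: Dk_def kx_def ky_def)
  have kxy0: "kx y = 0" "ky y = 0" if "norm y > R + 1" for y using C1_plane_derivative_zero[OF kC k0 that] by auto
  have dD: "bdd_density Dk"
  proof (rule bdd_density_continuous)
    show "continuous_on UNIV Dk" unfolding Dk_def using kC by (auto simp: C1_plane_def intro!: continuous_intros)
    show "Dk y = 0" if "norm y > R + 1" for y using kxy0[OF that] by (simp add: Dk_def)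
  qed
  have [measurable]: "Dk \<in> borel_measurable borel" using dD by (rule bdd_density_measurable)
  define h where "h y = Dk y / (z - y)" for y
  have [measurable]: "h \<in> borel_measurable borel" unfolding h_def by measurable
  have hi: "integrable lborel h" unfolding h_def by (rule cauchy_transform_integrable[OF dD])
  have zR: "norm z \<le> R" using R(2)[OF z] .
  have pompeiu: "integral\<^sup>L lborel h = of_real pi * cnj z"
  proof -
    have "cauchy_transform (\<lambda>y. (kx y + \<i> * ky y) / 2) z = of_real pi * k z"
      by (rule cauchy_pompeiu_compact_support[OF kC k0])
    then have "cauchy_transform Dk z = of_real pi * k z" by (simp only: Dk_def[abs_def])
    then show ?thesis using eta(2)[OF zR] by (simp add: cauchy_transform_def h_def[abs_def] k_def)
  qed
  define U0 where "U0 = {s. 0 < Re s \<and> 0 < Im s \<and> Im s < 2 * pi}"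
  have oU: "open U0" unfolding U0_def
    by (intro open_Collect_conj open_Collect_less continuous_intros)
  have Usub: "U0 \<subseteq> {s. Re s > 0}" by (auto simp: U0_def)
  have Ph: "P holomorphic_on U0" by (rule holomorphic_on_subset[OF P_hol Usub])
  have Pi: "inj_on P U0"
  proof (rule inj_onI)
    fix s t assume st: "s \<in> U0" "t \<in> U0" "P s = P t"
    then have "\<bar>Im s - Im t\<bar> < 2 * pi" "Re s > 0" "Re t > 0" by (auto simp: U0_def)
    then show "s = t" using P_inj st(3) by blast
  qed
  have oPU: "open (P ` U0)" by (rule open_mapping_thm3[OF Ph oU Pi])
  have PUe: "P ` U0 \<inter> D = {}" using P_ext closure_subset by (force simp: U0_def)
  \<comment> \<open>Up to a null set the plane is the disjoint union of D and the image of the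
    half-strip: only J and the image of the slit are left out.\<close>
  have ae: "AE y in lborel. h y = indicator D y *\<^sub>R h y + indicator (P ` U0) y *\<^sub>R h y"
  proof -
    have "AE y in lebesgue. y \<notin> - closure D - P ` U0" unfolding U0_def by (rule AE_not_in[OF P_strip_image])
    then have 1: "AE y in lborel. y \<notin> - closure D - P ` U0" by (simp add: AE_completion_iff)
    have 2: "AE y in lborel. y \<notin> J" by (rule AE_not_in[OF J_null])
    show ?thesis using 1 2
    proof eventually_elim
      case (elim y)
      then have "y \<in> D \<or> y \<in> P ` U0" using closure_D by blast
      then show ?case using PUe by (auto simp: indicator_def)
    qed
  qed
  have i1: "integrable lborel (\<lambda>y. indicator D y *\<^sub>R h y)"
    using D_open by (intro integrable_mult_indicator hi) auto
  have i2: "integrable lborel (\<lambda>y. indicator (P ` U0) y *\<^sub>R h y)"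
    using oPU by (intro integrable_mult_indicator hi) auto
  have "integral\<^sup>L lborel h = (LINT y|lborel. indicator D y *\<^sub>R h y + indicator (P ` U0) y *\<^sub>R h y)"
    using i1 i2 by (intro integral_cong_AE ae) auto
  also have "\<dots> = (LINT y|lborel. indicator D y *\<^sub>R h y) + (LINT y:P ` U0|lborel. h y)"
    unfolding set_lebesgue_integral_def by (rule Bochner_Integration.integral_add[OF i1 i2])
  also have "(LINT y|lborel. indicator D y *\<^sub>R h y) = cauchy_transform (indicator D) z"
    unfolding cauchy_transform_def
  proof (rule Bochner_Integration.integral_cong[OF refl])
    fix y show "indicat_real D y *\<^sub>R h y = indicator D y / (z - y)"
      using Dk1[of y] R(2)[of y] closure_subset by (cases "y \<in> D") (auto simp: h_def)
  qed
  finally have split: "of_real pi * cnj z = cauchy_transform (indicator D) z + (LINT y:P ` U0|lborel. h y)"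
    unfolding pompeiu .
  define q where "q s = (norm (deriv P s))\<^sup>2 *\<^sub>R h (P s)" for s
  have his: "set_integrable lborel (P ` U0) h" using i2 by (simp add: set_integrable_def)
  have qi: "set_integrable lborel U0 q"
    using holomorphic_cov_integrable[OF oU Ph Pi, of h] his by (simp add: q_def[abs_def])
  have cov: "(LINT y:P ` U0|lborel. h y) = (LINT s:U0|lborel. q s)"
    using holomorphic_cov_integral[OF oU Ph Pi, of h] by (simp add: q_def[abs_def])
  define V where "V s = U z (exp (- s))" for s
  have Vh: "V holomorphic_on {s. Re s > 0}"
    unfolding V_def
    by (rule holomorphic_on_compose_gen[OF _ U_hol[OF z], unfolded o_def]) (auto intro!: holomorphic_intros)
  have V'c: "continuous_on {s. Re s > 0} (deriv V)"
    by (intro holomorphic_on_imp_continuous_on holomorphic_deriv Vh open_halfspace_Re_gt)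
  have Vc: "continuous_on {s. Re s > 0} V" by (rule holomorphic_on_imp_continuous_on[OF Vh])
  have Pc: "continuous_on {s. Re s > 0} P" by (rule holomorphic_on_imp_continuous_on[OF P_hol])
  define G where "G s = k (P s) * V s" for s
  define Gx where "Gx s = (Re (deriv P s) *\<^sub>R kx (P s) + Im (deriv P s) *\<^sub>R ky (P s)) * V s + k (P s) * deriv V s" for s
  define Gy where "Gy s = (Re (\<i> * deriv P s) *\<^sub>R kx (P s) + Im (\<i> * deriv P s) *\<^sub>R ky (P s)) * V s + k (P s) * (\<i> * deriv V s)" for s
  have kc: "continuous_on UNIV k" "continuous_on UNIV kx" "continuous_on UNIV ky"
    using C1_plane_continuous[OF kC] kC by (auto simp: C1_plane_def)
  have Gc: "continuous_on {s. Re s > 0} Gx" "continuous_on {s. Re s > 0} Gy"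
    unfolding Gx_def Gy_def
    by (intro continuous_intros V'c Vc P_deriv_continuous continuous_on_compose2[OF kc(1) Pc]
        continuous_on_compose2[OF kc(2) Pc] continuous_on_compose2[OF kc(3) Pc]; simp)+
  \<comment> \<open>V is holomorphic, so the two \<open>deriv V\<close> terms of Gx + \<i> Gy cancel
    and only the dbar derivative of k contributes.\<close>
  have qG: "q s = - (Gx s + \<i> * Gy s) / 2" if s: "Re s > 0" for s
  proof -
    have nz: "P s - z \<noteq> 0" using P_ext[OF s] z by auto
    have sq: "(complex_of_real (norm (deriv P s)))\<^sup>2 = deriv P s * cnj (deriv P s)"
      by (metis complex_norm_square of_real_power)
    have "q s = (deriv P s * cnj (deriv P s)) * (Dk (P s) / (z - P s))"
      unfolding q_def h_def scaleR_conv_of_real of_real_power sq ..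
    also have "\<dots> = - (cnj (deriv P s) * Dk (P s) * (deriv P s / (P s - z)))"
    proof -
      have alg: "(x * y) * (d / (- w)) = - (y * d * (x / w))" for x y d w :: complex
        by (simp add: divide_inverse algebra_simps)
      have e: "z - P s = - (P s - z)" by simp
      show ?thesis unfolding e by (rule alg)
    qed
    also have "deriv P s / (P s - z) = V s" unfolding V_def by (rule P_log_deriv[OF z s])
    also have "cnj (deriv P s) * Dk (P s) * V s = (Gx s + \<i> * Gy s) / 2"
    proof -
      have e1: "Gx s + \<i> * Gy s = ((Re (deriv P s) *\<^sub>R kx (P s) + Im (deriv P s) *\<^sub>R ky (P s))
          + \<i> * (Re (\<i> * deriv P s) *\<^sub>R kx (P s) + Im (\<i> * deriv P s) *\<^sub>R ky (P s))) * V s"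
        unfolding Gx_def Gy_def by (simp add: algebra_simps)
      have e2: "(Re (deriv P s) *\<^sub>R kx (P s) + Im (deriv P s) *\<^sub>R ky (P s))
          + \<i> * (Re (\<i> * deriv P s) *\<^sub>R kx (P s) + Im (\<i> * deriv P s) *\<^sub>R ky (P s)) = cnj (deriv P s) * (kx (P s) + \<i> * ky (P s))"
        by (simp add: complex_eq_iff algebra_simps)
      show ?thesis unfolding e1 e2 Dk_def by simp
    qed
    finally show ?thesis by (simp only: minus_divide_left)
  qed
  obtain X where X: "X > 1" "\<And>s. Re s \<ge> X \<Longrightarrow> norm (P s) \<ge> R + 2" using P_far[of "R + 2"] by blast
  have far: "G s = 0" "q s = 0" if "Re s \<ge> X" for s
  proof -
    have "norm (P s) > R + 1" using X(2)[OF that] by simp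
    then show "G s = 0" "q s = 0" using k0 kxy0 by (auto simp: G_def q_def h_def Dk_def)
  qed
  \<comment> \<open>The lines Re s = xs n approach the boundary. They stay within Re s <= 1, where
    |P s| <= R and hence k (P s) = cnj (P s).\<close>
  define xs where "xs n = 1 / (real n + 1)" for n
  have xs: "0 < xs n" "xs n \<le> 1" "xs n < X" for n
  proof -
    show "0 < xs n" "xs n \<le> 1" by (auto simp: xs_def)
    then show "xs n < X" using X(1) by linarith
  qed
  define E where "E n = box (Complex (xs n) 0) (Complex X (2 * pi))" for n
  have lim1: "(\<lambda>n. LINT s:E n|lborel. q s) \<longlonglongrightarrow> (LINT s:(\<Union>n. E n)|lborel. q s)"
  proof (rule set_integral_cont_up)
    show "incseq E" unfolding incseq_def
    proof (intro allI impI)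
      fix m n :: nat assume "m \<le> n"
      then have "xs n \<le> xs m" unfolding xs_def by (intro divide_left_mono) auto
      then show "E m \<subseteq> E n" unfolding E_def by (auto simp: in_box_complex_iff)
    qed
    show "set_integrable lborel (\<Union>n. E n) q"
    proof (rule set_integrable_subset[OF qi])
      show "(\<Union>n. E n) \<subseteq> U0" using xs(1) by (auto simp: E_def U0_def in_box_complex_iff) (meson less_trans)
    qed (auto simp: E_def)
  qed (auto simp: E_def)
  have EU: "(\<Union>n. E n) = U0 \<inter> {s. Re s < X}"
  proof (intro equalityI subsetI)
    fix s assume s: "s \<in> U0 \<inter> {s. Re s < X}"
    then have "Re s > 0" by (simp add: U0_def)
    then obtain n where n: "1 / real (Suc n) < Re s" using nat_approx_posE by blast
    then have "s \<in> E n" using s by (auto simp: E_def U0_def in_box_complex_iff xs_def add.commute)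
    then show "s \<in> (\<Union>n. E n)" by blast
  next
    fix s assume "s \<in> (\<Union>n. E n)"
    then obtain n where "s \<in> E n" by blast
    then show "s \<in> U0 \<inter> {s. Re s < X}" using xs(1)[of n] by (auto simp: E_def U0_def in_box_complex_iff)
  qed
  have lim2: "(LINT s:(\<Union>n. E n)|lborel. q s) = (LINT s:U0|lborel. q s)"
    unfolding set_lebesgue_integral_def EU
  proof (rule Bochner_Integration.integral_cong[OF refl])
    fix s show "indicat_real (U0 \<inter> {s. Re s < X}) s *\<^sub>R q s = indicat_real U0 s *\<^sub>R q s"
      using far(2)[of s] by (cases "Re s < X") (auto simp: indicator_def)
  qed
  have En: "(LINT s:E n|lborel. q s) = integral {0..2*pi} (\<lambda>y. cnj (P (Complex (xs n) y)) * U z (exp (- Complex (xs n) y))) / 2" for n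
  proof -
    define p1 where "p1 = Complex (xs n) 0"
    define p2 where "p2 = Complex X (2 * pi)"
    have csub: "cbox p1 p2 \<subseteq> {s. Re s > 0}" unfolding p1_def p2_def by (rule P_box(4)[OF xs(1)])
    have cG: "continuous_on (cbox p1 p2) Gx" "continuous_on (cbox p1 p2) Gy"
      using Gc continuous_on_subset[OF _ csub] by blast+
    have cq: "continuous_on (cbox p1 p2) (\<lambda>s. (- 1 / 2) * (Gx s + \<i> * Gy s))"
      by (intro continuous_intros cG)
    have "(LINT s:E n|lborel. q s) = (LINT s:box p1 p2|lborel. (- 1 / 2) * (Gx s + \<i> * Gy s))"
      unfolding E_def p1_def[symmetric] p2_def[symmetric]
    proof (rule set_lebesgue_integral_cong)
      show "\<forall>s. s \<in> box p1 p2 \<longrightarrow> q s = (- 1 / 2) * (Gx s + \<i> * Gy s)"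
      proof (intro allI impI)
        fix s assume "s \<in> box p1 p2"
        then have "Re s > 0" using csub box_subset_cbox by blast
        from qG[OF this] show "q s = (- 1 / 2) * (Gx s + \<i> * Gy s)" by (simp add: field_simps)
      qed
    qed simp
    also have "\<dots> = (LINT s:cbox p1 p2|lborel. (- 1 / 2) * (Gx s + \<i> * Gy s))"
      by (rule set_integral_box_eq_cbox[OF cq])
    also have "\<dots> = (- 1 / 2) * (LINT s:cbox p1 p2|lborel. Gx s + \<i> * Gy s)"
      by (rule set_integral_mult_right)
    also have "(LINT s:cbox p1 p2|lborel. Gx s + \<i> * Gy s) = - integral {0..2*pi} (\<lambda>y. G (Complex (xs n) y))"
      unfolding p1_def p2_def
    proof (rule cbox_periodic_dbar_integral)
      show "xs n \<le> X" "0 \<le> 2 * pi" using xs(3)[of n] by auto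
      show "continuous_on (cbox (Complex (xs n) 0) (Complex X (2 * pi))) Gx"
        "continuous_on (cbox (Complex (xs n) 0) (Complex X (2 * pi))) Gy"
        using cG by (auto simp: p1_def p2_def)
      fix x y assume x: "x \<in> {xs n..X}"
      then have x0: "x > 0" using xs(1)[of n] by auto
      have Pd: "(P has_derivative (\<lambda>h. deriv P (Complex x y) * h)) (at (Complex x y))"
        using holomorphic_derivI[OF P_hol open_halfspace_Re_gt, of "Complex x y"] x0
        by (simp add: has_field_derivative_def)
      have Vd: "(V has_derivative (\<lambda>h. deriv V (Complex x y) * h)) (at (Complex x y))"
        using holomorphic_derivI[OF Vh open_halfspace_Re_gt, of "Complex x y"] x0
        by (simp add: has_field_derivative_def)
      have kd: "(k has_derivative (\<lambda>h. Re h *\<^sub>R kx (P (Complex x y)) + Im h *\<^sub>R ky (P (Complex x y)))) (at (P (Complex x y)))"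
        using kC by (simp add: C1_plane_def)
      have Gd: "(G has_derivative (\<lambda>h. k (P (Complex x y)) * (deriv V (Complex x y) * h) +
          (Re (deriv P (Complex x y) * h) *\<^sub>R kx (P (Complex x y)) + Im (deriv P (Complex x y) * h) *\<^sub>R ky (P (Complex x y))) * V (Complex x y))) (at (Complex x y))"
        unfolding G_def by (rule has_derivative_mult[OF has_derivative_compose[OF Pd kd] Vd])
      have cx: "((\<lambda>x. Complex x y) has_vector_derivative 1) (at x within {xs n..X})"
        unfolding Complex_eq by (auto intro!: derivative_eq_intros)
      have cy: "((\<lambda>y. Complex x y) has_vector_derivative \<i>) (at y within {0..2 * pi})"
        unfolding Complex_eq by (auto intro!: derivative_eq_intros)
      show "((\<lambda>x. G (Complex x y)) has_vector_derivative Gx (Complex x y)) (at x within {xs n..X})"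
        using has_vector_derivative_compose_linear[OF cx Gd] by (simp add: Gx_def add.commute)
      show "((\<lambda>y. G (Complex x y)) has_vector_derivative Gy (Complex x y)) (at y within {0..2 * pi})"
        using has_vector_derivative_compose_linear[OF cy Gd] by (simp add: Gy_def add.commute mult.commute[of _ \<i>])
    next
      show "G (Complex X y) = 0" for y using far(1)[of "Complex X y"] by simp
      show "G (Complex x (2 * pi)) = G (Complex x 0)" for x
      proof -
        have e: "exp (Complex x (2 * pi)) = exp (Complex x 0)" by (simp add: exp_eq_polar)
        have e': "exp (- Complex x (2 * pi)) = exp (- Complex x 0)" by (simp only: exp_minus e)
        show ?thesis unfolding G_def V_def P_def e e' ..
      qed
    qed
    also have "integral {0..2*pi} (\<lambda>y. G (Complex (xs n) y)) = integral {0..2*pi} (\<lambda>y. cnj (P (Complex (xs n) y)) * U z (exp (- Complex (xs n) y)))"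
    proof (rule integral_cong)
      fix y
      have "norm (P (Complex (xs n) y)) \<le> R" using xs[of n] by (intro R(3)) auto
      then show "G (Complex (xs n) y) = cnj (P (Complex (xs n) y)) * U z (exp (- Complex (xs n) y))"
        using eta(2) by (simp add: G_def k_def V_def)
    qed
    finally show ?thesis by simp
  qed
  have Es: "(LINT s:E n|lborel. q s) = of_real pi * (of_real a * (\<Sum>m. cnj (c m) * Fab z m * of_real (exp (- xs n) ^ (2 * m))))" for n
  proof -
    define T where "T m = cnj (c m) * Fab z m * of_real (exp (- xs n) ^ (2 * m))" for m
    define b where "b = 2 * complex_of_real pi * of_real a"
    define L where "L = (LINT s:E n|lborel. q s)"
    have b: "b \<noteq> 0" using a_pos by (simp add: b_def)
    have "(\<lambda>m. 2 * pi * (of_real a * T m)) sums (2 * L)"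
      using boundary_mean[OF z xs(1)[of n]] unfolding L_def En T_def by simp
    then have "(\<lambda>m. b * T m) sums (b * (2 * L / b))" using b by (simp add: b_def mult.assoc)
    then have "T sums (2 * L / b)" using b by (subst (asm) sums_mult_iff) auto
    then have "(\<Sum>m. T m) = 2 * L / b" by (rule sums_unique[symmetric])
    then have "of_real pi * (of_real a * (\<Sum>m. T m)) = L" using b by (simp add: b_def)
    then show ?thesis by (simp only: L_def T_def)
  qed
  have xl: "xs \<longlonglongrightarrow> 0" unfolding xs_def by real_asymp
  \<comment> \<open>The Abel means tend to the sum itself; absolute summability of the Faber series
    supplies the majorant.\<close>
  have "(\<lambda>n. \<Sum>m. cnj (c m) * Fab z m * of_real (exp (- xs n) ^ (2 * m))) \<longlonglongrightarrow> (\<Sum>m. cnj (c m) * Fab z m)"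
  proof (rule tannerys_theorem[THEN conjunct2, THEN conjunct2])
    show "(\<lambda>n. cnj (c m) * Fab z m * of_real (exp (- xs n) ^ (2 * m))) \<longlonglongrightarrow> cnj (c m) * Fab z m" for m
      by (auto intro!: tendsto_eq_intros xl)
    show "summable (\<lambda>m. norm (c m) * norm (Fab z m))" by (rule faber_abs_summable[OF z])
    show "\<forall>\<^sub>F (m, n) in at_top \<times>\<^sub>F sequentially. norm (cnj (c m) * Fab z m * of_real (exp (- xs n) ^ (2 * m))) \<le> norm (c m) * norm (Fab z m)"
    proof (intro always_eventually allI, clarify)
      fix m n
      have "exp (- xs n) ^ (2 * m) \<le> 1" using xs(1)[of n] by (intro power_le_one) auto
      then show "norm (cnj (c m) * Fab z m * of_real (exp (- xs n) ^ (2 * m))) \<le> norm (c m) * norm (Fab z m)"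
        by (simp add: norm_mult norm_power mult_left_le)
    qed
  qed simp
  then have "(\<lambda>n. LINT s:E n|lborel. q s) \<longlonglongrightarrow> of_real pi * (of_real a * (\<Sum>m. cnj (c m) * Fab z m))"
    unfolding Es by (intro tendsto_mult tendsto_const)
  then have "(LINT s:U0|lborel. q s) = of_real pi * faber_series \<Phi> a c z"
    using LIMSEQ_unique[OF lim1] unfolding lim2 faber_series_Fab[OF z] by simp
  then have "of_real pi * cnj z = cauchy_transform (indicator D) z + of_real pi * faber_series \<Phi> a c z"
    using split cov by simp
  then show ?thesis by (simp add: field_simps)
qed

end

section \<open>The primitive along paths\<close>

context periodic_C1_curve
begin

text \<open>Turns chord length into parameter length. Parameters far apart modulo 1 are excluded by
  the separation of the curve from itself; for nearby ones the nonvanishing speed gives the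
  bound.\<close>

lemma local_bilipschitz:
  obtains K r where "K > 0" "r > 0"
    "\<And>w t. w \<in> J \<Longrightarrow> norm (w - g t) < r \<Longrightarrow> \<exists>s. w = g s \<and> \<bar>s - t\<bar> \<le> K * norm (w - g t)"
proof -
  obtain m M where m: "0 < m" "\<And>t. m \<le> norm (g' t)" using speed_bounds by metis
  obtain d0 where d0: "d0 > 0" "\<And>s t. \<bar>s - t\<bar> \<le> d0 \<Longrightarrow> norm (g s - g t - (s - t) *\<^sub>R g' t) \<le> m / 2 * \<bar>s - t\<bar>"
    using local_linear[of "m / 2"] m by auto
  define d where "d = min d0 (1/2)"
  have d: "0 < d" "d \<le> 1/2" "d \<le> d0" using d0 by (auto simp: d_def)
  obtain m2 where m2: "m2 > 0" "\<And>s u. d \<le> u \<Longrightarrow> u \<le> 1 - d \<Longrightarrow> m2 \<le> norm (g (s + u) - g s)"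
    using far_apart[OF d(1,2)] by blast
  have near: "\<bar>s - t\<bar> \<le> 2 / m * norm (g s - g t)" if "\<bar>s - t\<bar> \<le> d" for s t
  proof -
    have "m * \<bar>s - t\<bar> \<le> norm ((s - t) *\<^sub>R g' t)" using m(2)[of t] by (simp add: mult.commute mult_right_mono)
    also have "\<dots> \<le> norm (g s - g t) + norm (g s - g t - (s - t) *\<^sub>R g' t)"
      using norm_triangle_ineq4[of "g s - g t" "g s - g t - (s - t) *\<^sub>R g' t"] by simp
    also have "\<dots> \<le> norm (g s - g t) + m / 2 * \<bar>s - t\<bar>" using d0(2)[of s t] that d by simp
    finally have "m / 2 * \<bar>s - t\<bar> \<le> norm (g s - g t)" by simp
    then show ?thesis using m(1) by (simp add: field_simps)
  qed
  show ?thesis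
  proof (rule that[of "2 / m" m2])
    fix w t assume w: "w \<in> J" "norm (w - g t) < m2"
    obtain s0 where s0: "w = g s0" using w(1) J by blast
    define u where "u = frac (s0 - t)"
    have u: "0 \<le> u" "u < 1" by (auto simp: u_def frac_lt_1)
    have gs: "w = g (t + u)"
      using per_int[of "t + u" "\<lfloor>s0 - t\<rfloor>"] s0 by (simp add: u_def frac_def)
    have nd: "\<not> (d \<le> u \<and> u \<le> 1 - d)" using m2(2)[of u t] w(2) gs by auto
    show "\<exists>s. w = g s \<and> \<bar>s - t\<bar> \<le> 2 / m * norm (w - g t)"
    proof (cases "u \<le> d")
      case True
      then show ?thesis using near[of "t + u" t] u gs by (intro exI[of _ "t + u"]) auto
    next
      case False
      have "g (t + u) = g (t + u - 1)" using per[of "t + u - 1"] by simp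
      then show ?thesis using near[of "t + u - 1" t] u gs False nd by (intro exI[of _ "t + u - 1"]) auto
    qed
  qed (use m m2 in auto)
qed

end

context patch
begin

text \<open>Take the point of J on the segment that is nearest to z. A point before it outside the
  closure would force the segment to meet J even earlier.\<close>

lemma first_boundary_point:
  assumes z: "z \<in> closure D" and w: "w \<in> J"
  obtains \<zeta> where "\<zeta> \<in> closed_segment z w" "\<zeta> \<in> J" "closed_segment z \<zeta> \<subseteq> closure D"
proof (cases "z \<in> J")
  case True
  then show ?thesis using that[of z] closure_D by auto
next
  case False
  then have zD: "z \<in> D" using z closure_D by blast
  define S where "S = closed_segment z w \<inter> J"
  have S: "compact S" "S \<noteq> {}" unfolding S_def using J_compact w by (auto intro!: compact_Int)
  obtain \<zeta> where \<zeta>: "\<zeta> \<in> S" "\<And>x. x \<in> S \<Longrightarrow> dist z \<zeta> \<le> dist z x"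
    using distance_attains_inf[of S z] S compact_imp_closed by metis
  have "x \<in> closure D" if x: "x \<in> closed_segment z \<zeta>" for x
  proof (rule ccontr)
    assume nx: "x \<notin> closure D"
    have "closed_segment z x \<inter> J \<noteq> {}"
    proof
      assume "closed_segment z x \<inter> J = {}"
      from connected_avoids_closure[OF connected_segment(1) this ends_in_segment(2) nx]
      have "closed_segment z x \<inter> closure D = {}" .
      then show False using z ends_in_segment(1)[of z x] by blast
    qed
    then obtain y where y: "y \<in> closed_segment z x" "y \<in> J" by blast
    have "closed_segment z \<zeta> \<subseteq> closed_segment z w" using \<zeta>(1) by (auto simp: S_def subset_closed_segment)
    then have "y \<in> closed_segment z w" using y(1) x by (meson ends_in_segment(1) subset_closed_segment subsetD)
    then have le: "dist z \<zeta> \<le> dist z y" using \<zeta>(2) y(2) by (auto simp: S_def)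
    have "dist z y \<le> dist z x" using y(1) by (metis dist_commute dist_in_closed_segment)
    moreover obtain u where u: "0 \<le> u" "u \<le> 1" "x = (1 - u) *\<^sub>R z + u *\<^sub>R \<zeta>" using x by (auto simp: closed_segment_def)
    have "z - x = u *\<^sub>R (z - \<zeta>)" unfolding u(3) by (simp add: algebra_simps)
    then have "dist z x = u * dist z \<zeta>" using u(1) by (simp add: dist_norm)
    moreover have "dist z \<zeta> > 0" using \<zeta>(1) False by (auto simp: S_def)
    ultimately have "u \<ge> 1" using le by (metis mult_le_cancel_right1 order_trans not_le)
    then have "x = \<zeta>" using u by simp
    then show False using nx \<zeta>(1) closure_D by (auto simp: S_def)
  qed
  then show ?thesis using that[of \<zeta>] \<zeta>(1) by (auto simp: S_def)
qed

text \<open>The closure of the domain is locally quasiconvex: walk straight towards the target until the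
  boundary is hit and then follow the boundary.\<close>
lemma local_mean_value:
  obtains K where "K > 0" "\<And>w. w \<in> closure D \<Longrightarrow> \<exists>r>0. \<forall>z\<in>closure D. norm (z - w) < r \<longrightarrow>
    (\<forall>f f' A e. (\<forall>\<zeta>. (f has_field_derivative f' \<zeta>) (at \<zeta>)) \<longrightarrow>
      (\<forall>\<zeta>\<in>closure D. norm (\<zeta> - w) \<le> K * norm (z - w) \<longrightarrow> norm (f' \<zeta> - A) \<le> e) \<longrightarrow>
      norm (f z - f w - A * (z - w)) \<le> K * e * norm (z - w))"
proof -
  obtain L r where L: "L > 0" "r > 0"
    "\<And>w t. w \<in> J \<Longrightarrow> norm (w - g t) < r \<Longrightarrow> \<exists>s. w = g s \<and> \<bar>s - t\<bar> \<le> L * norm (w - g t)"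
    using local_bilipschitz by metis
  obtain m M where M: "0 < m" "m \<le> M" "\<And>t. norm (g' t) \<le> M" using speed_bounds by metis
  have M0: "M > 0" using M by linarith
  \<comment> \<open>The straight piece contributes at most |z - w| and the boundary arc at most M L
    |z - w|. The same K bounds how far the walk strays from w.\<close>
  define K where "K = 1 + M * L"
  have K: "K \<ge> 1" using M0 L by (simp add: K_def)
  have seg: "norm (f x - f y - A * (x - y)) \<le> e * norm (x - y)"
    if f: "\<And>\<zeta>. (f has_field_derivative f' \<zeta>) (at \<zeta>)"
    and e: "\<And>\<zeta>. \<zeta> \<in> closed_segment x y \<Longrightarrow> norm (f' \<zeta> - A) \<le> e"
    for f f' :: "complex \<Rightarrow> complex" and x y A e
  proof -
    have "norm ((f x - A * x) - (f y - A * y)) \<le> e * norm (x - y)"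
    proof (rule field_differentiable_bound[of "closed_segment x y"])
      show "((\<lambda>x. f x - A * x) has_field_derivative f' \<zeta> - A) (at \<zeta> within closed_segment x y)" for \<zeta>
        using f[of \<zeta>] by (auto intro!: derivative_eq_intros intro: has_field_derivative_at_within)
    qed (use e in auto)
    then show ?thesis by (simp add: algebra_simps)
  qed
  show ?thesis
  proof (rule that[of K])
    show "K > 0" using K by simp
    fix w assume w: "w \<in> closure D"
    show "\<exists>r>0. \<forall>z\<in>closure D. norm (z - w) < r \<longrightarrow>
    (\<forall>f f' A e. (\<forall>\<zeta>. (f has_field_derivative f' \<zeta>) (at \<zeta>)) \<longrightarrow>
      (\<forall>\<zeta>\<in>closure D. norm (\<zeta> - w) \<le> K * norm (z - w) \<longrightarrow> norm (f' \<zeta> - A) \<le> e) \<longrightarrow>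
      norm (f z - f w - A * (z - w)) \<le> K * e * norm (z - w))"
    proof (cases "w \<in> D")
      case True
      then obtain r where r: "r > 0" "ball w r \<subseteq> D" using D_open openE by blast
      show ?thesis
      proof (intro exI[of _ r] conjI r(1) ballI impI allI)
        fix z f f' A e
        assume z: "z \<in> closure D" "norm (z - w) < r"
          and f: "\<forall>\<zeta>. (f has_field_derivative f' \<zeta>) (at \<zeta>)"
          and e: "\<forall>\<zeta>\<in>closure D. norm (\<zeta> - w) \<le> K * norm (z - w) \<longrightarrow> norm (f' \<zeta> - A) \<le> e"
        have zw: "norm (z - w) \<le> K * norm (z - w)" using mult_right_mono[OF K, of "norm (z - w)"] by simp
        have b: "norm (f' \<zeta> - A) \<le> e" if \<zeta>: "\<zeta> \<in> closed_segment z w" for \<zeta>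
        proof -
          have "norm (\<zeta> - w) \<le> norm (z - w)" using segment_bound(2)[OF \<zeta>] by (simp add: norm_minus_commute)
          moreover have "\<zeta> \<in> D"
          proof -
            have "closed_segment z w \<subseteq> ball w r" using z(2) r(1)
              by (intro closed_segment_subset convex_ball) (auto simp: dist_norm norm_minus_commute)
            then show ?thesis using \<zeta> r(2) by blast
          qed
          ultimately show ?thesis using e zw closure_subset by (meson order_trans subsetD)
        qed
        have "norm (f z - f w - A * (z - w)) \<le> e * norm (z - w)" using f b by (intro seg) auto
        also have "\<dots> \<le> K * e * norm (z - w)"
        proof (rule mult_right_mono)
          have "0 \<le> e" using b[of z] norm_ge_zero order_trans by (metis ends_in_segment(1))
          then show "e \<le> K * e" using mult_right_mono[OF K, of e] by simp
        qed simp
        finally show "norm (f z - f w - A * (z - w)) \<le> K * e * norm (z - w)" .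
      qed
    next
      case False
      then have wJ: "w \<in> J" using w closure_D by blast
      then obtain t where t: "w = g t" using J by blast
      show ?thesis
      proof (intro exI[of _ r] conjI L(2) ballI impI allI)
        fix z f f' A e
        assume z: "z \<in> closure D" "norm (z - w) < r"
          and f: "\<forall>\<zeta>. (f has_field_derivative f' \<zeta>) (at \<zeta>)"
          and e: "\<forall>\<zeta>\<in>closure D. norm (\<zeta> - w) \<le> K * norm (z - w) \<longrightarrow> norm (f' \<zeta> - A) \<le> e"
        obtain \<zeta> where \<zeta>: "\<zeta> \<in> closed_segment z w" "\<zeta> \<in> J" "closed_segment z \<zeta> \<subseteq> closure D"
          using first_boundary_point[OF z(1) wJ] by blast
        have d: "norm (\<zeta> - w) \<le> norm (z - w)" "norm (z - \<zeta>) \<le> norm (z - w)"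
          using segment_bound[OF \<zeta>(1)] by (auto simp: norm_minus_commute)
        have zw: "norm (z - w) \<le> K * norm (z - w)" using mult_right_mono[OF K, of "norm (z - w)"] by simp
        have e0: "0 \<le> e" using e z(1) zw norm_ge_zero order_trans by (metis (no_types))
        have 1: "norm (f z - f \<zeta> - A * (z - \<zeta>)) \<le> e * norm (z - \<zeta>)"
        proof (rule seg)
          show "norm (f' x - A) \<le> e" if x: "x \<in> closed_segment z \<zeta>" for x
          proof -
            have "x \<in> closed_segment z w" using x \<zeta>(1) by (meson ends_in_segment(1) subset_closed_segment subsetD)
            then have "norm (x - w) \<le> norm (z - w)" using segment_bound(2) by (metis norm_minus_commute)
            then show ?thesis using e zw x \<zeta>(3) by (meson order_trans subsetD)
          qed
        qed (use f in auto)
        obtain s where s: "\<zeta> = g s" "\<bar>s - t\<bar> \<le> L * norm (\<zeta> - w)"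
          using L(3)[OF \<zeta>(2), of t] d z(2) t by auto
        have st: "\<bar>s - t\<bar> \<le> L * norm (z - w)" using s(2) d(1) L(1) by (meson mult_left_mono order_trans less_imp_le)
        have arc: "norm ((f (g y) - A * g y) - (f (g x) - A * g x)) \<le> e * M * (y - x)"
          if xy: "x < y" "{x..y} \<subseteq> {min s t..max s t}" for x y
        proof -
          define q where "q u = f (g u) - A * g u" for u
          have dq: "(q has_derivative (\<lambda>h. h *\<^sub>R ((f' (g u) - A) * g' u))) (at u)" for u
          proof -
            have "((\<lambda>x. f x - A * x) has_field_derivative f' (g u) - A) (at (g u))"
              using f by (auto intro!: derivative_eq_intros)
            then have "((\<lambda>x. f x - A * x) has_derivative (\<lambda>h. (f' (g u) - A) * h)) (at (g u))"
              by (simp add: has_field_derivative_def)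
            from has_vector_derivative_compose_linear[OF der[of u] this]
            show ?thesis unfolding q_def has_vector_derivative_def .
          qed
          have qc: "continuous_on {x..y} q"
            using dq has_derivative_continuous by (intro continuous_at_imp_continuous_on) blast
          obtain u where u: "u \<in> {x<..<y}" "norm (q y - q x) \<le> norm ((y - x) *\<^sub>R ((f' (g u) - A) * g' u))"
            using mvt_general[OF xy(1) qc, of "\<lambda>u h. h *\<^sub>R ((f' (g u) - A) * g' u)"] dq by blast
          have "u \<in> {x..y}" using u(1) by auto
          then have "u \<in> {min s t..max s t}" using xy(2) by blast
          then have "\<bar>u - t\<bar> \<le> \<bar>s - t\<bar>" by auto
          then have "norm (g u - w) \<le> M * \<bar>s - t\<bar>" using curve_lipschitz[OF M(3), of u t] M0 t
            by (meson mult_left_mono order_trans less_imp_le)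
          also have "\<dots> \<le> M * (L * norm (z - w))" using st M0 by (intro mult_left_mono) auto
          also have "\<dots> \<le> K * norm (z - w)" by (simp add: K_def distrib_right mult.assoc)
          finally have "norm (f' (g u) - A) \<le> e" using e closure_D J by blast
          then have "norm ((f' (g u) - A) * g' u) \<le> e * M" unfolding norm_mult using M e0 by (intro mult_mono) auto
          then have "(y - x) * norm ((f' (g u) - A) * g' u) \<le> (y - x) * (e * M)" using xy(1) by (intro mult_left_mono) auto
          moreover have "norm ((y - x) *\<^sub>R ((f' (g u) - A) * g' u)) = (y - x) * norm ((f' (g u) - A) * g' u)"
            using xy(1) by simp
          ultimately show ?thesis using u(2) unfolding q_def by (simp only: mult.commute[of _ "y - x"])
        qed
        have 2: "norm (f \<zeta> - f w - A * (\<zeta> - w)) \<le> e * M * \<bar>s - t\<bar>"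
        proof -
          have eq: "f \<zeta> - f w - A * (\<zeta> - w) = (f (g s) - A * g s) - (f (g t) - A * g t)"
            using s(1) t by (simp add: algebra_simps)
          show ?thesis unfolding eq
            using arc[of s t] arc[of t s] by (cases s t rule: linorder_cases) (auto simp: norm_minus_commute)
        qed
        have "f z - f w - A * (z - w) = (f z - f \<zeta> - A * (z - \<zeta>)) + (f \<zeta> - f w - A * (\<zeta> - w))"
          by (simp add: algebra_simps)
        then have "norm (f z - f w - A * (z - w)) \<le> norm (f z - f \<zeta> - A * (z - \<zeta>)) + norm (f \<zeta> - f w - A * (\<zeta> - w))"
          using norm_triangle_ineq by metis
        also have "\<dots> \<le> e * norm (z - w) + e * M * (L * norm (z - w))"
        proof (rule add_mono)
          show "norm (f z - f \<zeta> - A * (z - \<zeta>)) \<le> e * norm (z - w)"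
            using 1 mult_left_mono[OF d(2) e0] by linarith
          show "norm (f \<zeta> - f w - A * (\<zeta> - w)) \<le> e * M * (L * norm (z - w))"
            using 2 mult_left_mono[OF st, of "e * M"] e0 M0 by simp
        qed
        also have "\<dots> = K * e * norm (z - w)" by (simp add: K_def algebra_simps)
        finally show "norm (f z - f w - A * (z - w)) \<le> K * e * norm (z - w)" .
      qed
    qed
  qed
qed

section \<open>Limits of primitives on the closure\<close>

lemma closure_D_connected: "connected (closure D)"
  by (rule connected_imp_connected_closure[OF D_connected])

text \<open>Termwise differentiation on a closed set that need not be convex: the local mean value
  inequality plays the role of the one on segments. It yields derivatives within the closure also at
  boundary points, where the boundary condition is evaluated.\<close>

lemma uniform_limit_has_primitive:
  fixes p q :: "nat \<Rightarrow> complex \<Rightarrow> complex"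
  assumes q: "\<And>n \<zeta>. (q n has_field_derivative p n \<zeta>) (at \<zeta>)"
    and u: "uniform_limit (closure D) p F sequentially" and z0: "z0 \<in> closure D" and q0: "\<And>n. q n z0 = 0"
  obtains H where "H z0 = 0" "\<And>z. z \<in> closure D \<Longrightarrow> (H has_field_derivative F z) (at z within closure D)"
proof -
  obtain K where K: "K > 0" "\<And>w. w \<in> closure D \<Longrightarrow> \<exists>r>0. \<forall>z\<in>closure D. norm (z - w) < r \<longrightarrow>
    (\<forall>f f' A e. (\<forall>\<zeta>. (f has_field_derivative f' \<zeta>) (at \<zeta>)) \<longrightarrow>
      (\<forall>\<zeta>\<in>closure D. norm (\<zeta> - w) \<le> K * norm (z - w) \<longrightarrow> norm (f' \<zeta> - A) \<le> e) \<longrightarrow>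
      norm (f z - f w - A * (z - w)) \<le> K * e * norm (z - w))"
    using local_mean_value by blast
  have ucl: "\<exists>N. \<forall>n\<ge>N. \<forall>\<zeta>\<in>closure D. norm (p n \<zeta> - F \<zeta>) < e" if "e > 0" for e
    using uniform_limitD[OF u that] by (auto simp: eventually_sequentially dist_norm)
  \<comment> \<open>The differences q n z - q n w are Cauchy because the derivatives are uniformly
    Cauchy, so of two nearby points either both or none carry convergence.\<close>
  have step: "Cauchy (\<lambda>n. q n z) \<longleftrightarrow> Cauchy (\<lambda>n. q n w)"
    if r: "r > 0" "\<forall>z\<in>closure D. norm (z - w) < r \<longrightarrow>
    (\<forall>f f' A e. (\<forall>\<zeta>. (f has_field_derivative f' \<zeta>) (at \<zeta>)) \<longrightarrow>
      (\<forall>\<zeta>\<in>closure D. norm (\<zeta> - w) \<le> K * norm (z - w) \<longrightarrow> norm (f' \<zeta> - A) \<le> e) \<longrightarrow>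
      norm (f z - f w - A * (z - w)) \<le> K * e * norm (z - w))"
    and z: "z \<in> closure D" "norm (z - w) < r" for z w r
  proof -
    have "Cauchy (\<lambda>n. q n z - q n w)"
    proof (rule CauchyI)
      fix e :: real assume e: "e > 0"
      define e' where "e' = e / (2 * K * (r + 1))"
      have e': "e' > 0" using e K(1) r(1) by (simp add: e'_def)
      obtain N where N: "\<And>n \<zeta>. n \<ge> N \<Longrightarrow> \<zeta> \<in> closure D \<Longrightarrow> norm (p n \<zeta> - F \<zeta>) < e' / 2"
        using ucl[of "e' / 2"] e' by auto
      have "norm ((q m z - q m w) - (q n z - q n w)) < e" if mn: "m \<ge> N" "n \<ge> N" for m n
      proof -
        have dd: "\<forall>\<zeta>. ((\<lambda>x. q m x - q n x) has_field_derivative (p m \<zeta> - p n \<zeta>)) (at \<zeta>)"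
          using q by (auto intro!: derivative_eq_intros)
        have "norm (p m \<zeta> - p n \<zeta> - 0) \<le> e'" if "\<zeta> \<in> closure D" for \<zeta>
          using N[OF mn(1) that] N[OF mn(2) that] norm_triangle_ineq4[of "p m \<zeta> - F \<zeta>" "p n \<zeta> - F \<zeta>"] by simp
        then have "norm ((q m z - q n z) - (q m w - q n w) - 0 * (z - w)) \<le> K * e' * norm (z - w)"
          using r(2)[rule_format, OF z, where f = "\<lambda>x. q m x - q n x" and f' = "\<lambda>\<zeta>. p m \<zeta> - p n \<zeta>" and A = 0] dd by blast
        also have "\<dots> \<le> K * e' * r" using z(2) K(1) e' by (intro mult_left_mono) auto
        also have "\<dots> < e"
        proof -
          have "K * e' * r < K * e' * (2 * (r + 1))" using K(1) e' r(1) by (intro mult_strict_left_mono) auto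
          also have "\<dots> = e" using K(1) r(1) by (simp add: e'_def)
          finally show ?thesis .
        qed
        finally show ?thesis by (simp add: algebra_simps)
      qed
      then show "\<exists>M. \<forall>m\<ge>M. \<forall>n\<ge>M. norm ((q m z - q m w) - (q n z - q n w)) < e" by blast
    qed
    then have C: "convergent (\<lambda>n. q n z - q n w)" by (simp add: Cauchy_convergent_iff)
    have "convergent (\<lambda>n. q n z) \<longleftrightarrow> convergent (\<lambda>n. q n w)"
    proof
      assume "convergent (\<lambda>n. q n z)"
      from convergent_diff[OF this C] show "convergent (\<lambda>n. q n w)" by simp
    next
      assume "convergent (\<lambda>n. q n w)"
      from convergent_add[OF C this] show "convergent (\<lambda>n. q n z)" by simp
    qed
    then show ?thesis by (simp add: Cauchy_convergent_iff)
  qed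
  have conv: "convergent (\<lambda>n. q n z)" if z: "z \<in> closure D" for z
  proof -
    have "Cauchy (\<lambda>n. q n z)"
    \<comment> \<open>Convergence spreads from z0 over the connected closure.\<close>
    proof (rule connected_induction_simple[OF closure_D_connected, where P = "\<lambda>z. Cauchy (\<lambda>n. q n z)" and a = z0 and b = z])
      show "Cauchy (\<lambda>n. q n z0)" by (simp add: q0 Cauchy_convergent_iff convergent_const)
      fix w assume w: "w \<in> closure D"
      then obtain r where r: "r > 0" "\<forall>z\<in>closure D. norm (z - w) < r \<longrightarrow>
    (\<forall>f f' A e. (\<forall>\<zeta>. (f has_field_derivative f' \<zeta>) (at \<zeta>)) \<longrightarrow>
      (\<forall>\<zeta>\<in>closure D. norm (\<zeta> - w) \<le> K * norm (z - w) \<longrightarrow> norm (f' \<zeta> - A) \<le> e) \<longrightarrow>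
      norm (f z - f w - A * (z - w)) \<le> K * e * norm (z - w))"
        using K(2) by blast
      show "\<exists>T. openin (top_of_set (closure D)) T \<and> w \<in> T \<and> (\<forall>x\<in>T. \<forall>y\<in>T. Cauchy (\<lambda>n. q n x) \<longrightarrow> Cauchy (\<lambda>n. q n y))"
      proof (intro exI[of _ "closure D \<inter> ball w r"] conjI ballI impI)
        fix x y assume "x \<in> closure D \<inter> ball w r" "y \<in> closure D \<inter> ball w r" "Cauchy (\<lambda>n. q n x)"
        then show "Cauchy (\<lambda>n. q n y)" using step[OF r, of x] step[OF r, of y]
          by (auto simp: dist_norm norm_minus_commute)
      qed (use w r in auto)
    qed (use z z0 in auto)
    then show ?thesis by (simp add: Cauchy_convergent_iff)
  qed
  define H where "H z = lim (\<lambda>n. q n z)" for z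
  have Hl: "(\<lambda>n. q n z) \<longlonglongrightarrow> H z" if "z \<in> closure D" for z
    unfolding H_def using conv[OF that] by (simp add: convergent_LIMSEQ_iff)
  have Fc: "continuous_on (closure D) F"
  proof (rule uniform_limit_theorem[OF _ u])
    have "continuous_on (closure D) (p n)" for n
    proof -
      have "q n holomorphic_on UNIV" using q by (auto simp: holomorphic_on_open)
      then have "deriv (q n) holomorphic_on UNIV" by (rule holomorphic_deriv) simp
      moreover have "deriv (q n) = p n" by (rule HOL.ext) (rule DERIV_imp_deriv[OF q])
      ultimately show ?thesis using holomorphic_on_imp_continuous_on holomorphic_on_subset by (metis subset_UNIV)
    qed
    then show "\<forall>\<^sub>F n in sequentially. continuous_on (closure D) (p n)" by simp
  qed simp
  show ?thesis
  proof (rule that[of H])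
    show "H z0 = 0" unfolding H_def by (simp add: q0)
    fix w assume w: "w \<in> closure D"
    obtain r where r: "r > 0" "\<forall>z\<in>closure D. norm (z - w) < r \<longrightarrow>
    (\<forall>f f' A e. (\<forall>\<zeta>. (f has_field_derivative f' \<zeta>) (at \<zeta>)) \<longrightarrow>
      (\<forall>\<zeta>\<in>closure D. norm (\<zeta> - w) \<le> K * norm (z - w) \<longrightarrow> norm (f' \<zeta> - A) \<le> e) \<longrightarrow>
      norm (f z - f w - A * (z - w)) \<le> K * e * norm (z - w))"
      using K(2)[OF w] by blast
    have "(H has_derivative (\<lambda>h. F w * h)) (at w within closure D)"
      unfolding has_derivative_within_alt
    proof (intro conjI bounded_linear_mult_right allI impI)
      fix e :: real assume e: "e > 0"
      \<comment> \<open>Three errors of size e' are added: p n against F at \<zeta>, the oscillation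
        of F, and p n against F at w.\<close>
      define e' where "e' = e / (3 * K)"
      have e': "e' > 0" using e K(1) by (simp add: e'_def)
      obtain d where d: "d > 0" "\<And>\<zeta>. \<zeta> \<in> closure D \<Longrightarrow> dist \<zeta> w < d \<Longrightarrow> dist (F \<zeta>) (F w) < e'"
        using Fc w e' unfolding continuous_on_iff by meson
      show "\<exists>d>0. \<forall>y\<in>closure D. norm (y - w) < d \<longrightarrow> norm (H y - H w - F w * (y - w)) \<le> e * norm (y - w)"
      proof (intro exI[of _ "min r (d / K)"] conjI ballI impI)
        show "0 < min r (d / K)" using r d K(1) by simp
        fix z assume z: "z \<in> closure D" "norm (z - w) < min r (d / K)"
        obtain N where N: "\<And>n \<zeta>. n \<ge> N \<Longrightarrow> \<zeta> \<in> closure D \<Longrightarrow> norm (p n \<zeta> - F \<zeta>) < e'"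
          using ucl[OF e'] by blast
        have "norm (q n z - q n w - p n w * (z - w)) \<le> K * (3 * e') * norm (z - w)" if n: "n \<ge> N" for n
        proof -
          have "norm (p n \<zeta> - p n w) \<le> 3 * e'" if \<zeta>: "\<zeta> \<in> closure D" "norm (\<zeta> - w) \<le> K * norm (z - w)" for \<zeta>
          proof -
            have "K * norm (z - w) < d" using z(2) K(1) by (simp add: field_simps)
            then have "norm (F \<zeta> - F w) < e'" using d(2)[OF \<zeta>(1)] \<zeta>(2) by (simp add: dist_norm)
            moreover have "p n \<zeta> - p n w = (p n \<zeta> - F \<zeta>) + (F \<zeta> - F w) - (p n w - F w)" by simp
            ultimately show ?thesis using N[OF n \<zeta>(1)] N[OF n w]
              by (smt (verit) norm_triangle_ineq norm_triangle_ineq4)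
          qed
          moreover have "norm (z - w) < r" using z(2) by simp
          ultimately show ?thesis
            using r(2)[rule_format, OF z(1), where f = "q n" and f' = "p n" and A = "p n w" and e = "3 * e'"] q by blast
        qed
        then have ev: "\<forall>\<^sub>F n in sequentially. norm (q n z - q n w - p n w * (z - w)) \<le> K * (3 * e') * norm (z - w)"
          by (auto simp: eventually_sequentially)
        have "(\<lambda>n. norm (q n z - q n w - p n w * (z - w))) \<longlonglongrightarrow> norm (H z - H w - F w * (z - w))"
          by (intro tendsto_intros Hl z(1) w tendsto_uniform_limitI[OF u])
        from tendsto_upperbound[OF this ev] have "norm (H z - H w - F w * (z - w)) \<le> K * (3 * e') * norm (z - w)" by simp
        also have "K * (3 * e') = e" using K(1) by (simp add: e'_def)
        finally show "norm (H z - H w - F w * (z - w)) \<le> e * norm (z - w)" .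
      qed
    qed
    then show "(H has_field_derivative F w) (at w within closure D)" by (simp add: has_field_derivative_def)
  qed
qed

text \<open>Guarantees that the choice in \<open>path_primitive\<close> has a witness. For a
  boundary endpoint one goes straight until J is first met and then runs along the parametrized
  curve.\<close>

lemma valid_path_in_closure:
  assumes z0: "z0 \<in> D" and z: "z \<in> closure D"
  obtains p where "valid_path p" "path_image p \<subseteq> closure D" "pathstart p = z0" "pathfinish p = z"
proof (cases "z \<in> D")
  case True
  obtain p where "polynomial_function p" "path_image p \<subseteq> D" "pathstart p = z0" "pathfinish p = z"
    using connected_open_polynomial_connected[OF D_open D_connected z0 True] by metis
  then show ?thesis using that[of p] valid_path_polynomial_function closure_subset by blast
next
  case False
  then have zJ: "z \<in> J" using z closure_D by blast
  obtain \<zeta> where \<zeta>: "\<zeta> \<in> J" "closed_segment z0 \<zeta> \<subseteq> closure D"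
    using first_boundary_point[OF subsetD[OF closure_subset z0] zJ] by metis
  obtain s t where st: "\<zeta> = g s" "z = g t" using \<zeta>(1) zJ J by blast
  define p where "p u = g (s + u * (t - s))" for u
  have dp: "(p has_vector_derivative (t - s) *\<^sub>R g' (s + u * (t - s))) (at u)" for u
  proof -
    have "((\<lambda>u. s + u * (t - s)) has_vector_derivative (t - s)) (at u)"
      unfolding has_vector_derivative_def by (auto intro!: derivative_eq_intros simp: mult.commute)
    from vector_diff_chain_at[OF this der] show ?thesis by (simp add: p_def[abs_def] o_def)
  qed
  have "p C1_differentiable_on {0..1}"
    unfolding C1_differentiable_on_def
    by (intro exI[of _ "\<lambda>u. (t - s) *\<^sub>R g' (s + u * (t - s))"] conjI ballI dp continuous_intros
        continuous_on_compose2[OF g'_cont]) auto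
  then have vp: "valid_path p" unfolding valid_path_def by (rule C1_differentiable_imp_piecewise)
  have pi: "path_image p \<subseteq> J" using J by (auto simp: path_image_def p_def)
  have ps: "pathstart p = \<zeta>" "pathfinish p = z" using st by (auto simp: pathstart_def pathfinish_def p_def)
  show ?thesis
  proof (rule that[of "linepath z0 \<zeta> +++ p"])
    show "valid_path (linepath z0 \<zeta> +++ p)" using vp ps by (intro valid_path_join) auto
    show "path_image (linepath z0 \<zeta> +++ p) \<subseteq> closure D"
      using path_image_join_subset[of "linepath z0 \<zeta>" p] \<zeta>(2) pi closure_D by auto
  qed (use ps in auto)
qed

text \<open>Once a primitive on the closure exists, the contour integral depends only on the
  endpoints, whichever path the choice operator selects.\<close>

theorem path_primitive_faber_series:
  assumes z0: "z0 \<in> D"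
  obtains H where "\<And>z. z \<in> closure D \<Longrightarrow> path_primitive D z0 (faber_series \<Phi> a c) z = H z"
    "\<And>z. z \<in> closure D \<Longrightarrow> (H has_field_derivative faber_series \<Phi> a c z) (at z within closure D)"
proof -
  define p where "p N z = of_real a * (\<Sum>n<N. cnj (c n) * poly (faber_poly \<Phi> n) z)" for N z
  have "\<exists>q. (\<forall>\<zeta>. (q has_field_derivative p N \<zeta>) (at \<zeta>)) \<and> q z0 = 0" for N
  proof -
    have "poly r holomorphic_on UNIV" for r
      unfolding holomorphic_on_def field_differentiable_def using poly_DERIV has_field_derivative_at_within by blast
    then have "p N holomorphic_on UNIV" unfolding p_def by (intro holomorphic_intros)
    then obtain q where q: "\<And>\<zeta>. (q has_field_derivative p N \<zeta>) (at \<zeta>)"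
      using holomorphic_convex_primitive'[of UNIV "p N"] by auto
    have "((\<lambda>\<zeta>. q \<zeta> - q z0) has_field_derivative p N \<zeta>) (at \<zeta>)" for \<zeta>
      using q[of \<zeta>] by (auto intro!: derivative_eq_intros)
    then show ?thesis by (intro exI[of _ "\<lambda>\<zeta>. q \<zeta> - q z0"]) auto
  qed
  then obtain q where q: "\<And>N \<zeta>. (q N has_field_derivative p N \<zeta>) (at \<zeta>)" "\<And>N. q N z0 = 0" by metis
  have u: "uniform_limit (closure D) p (faber_series \<Phi> a c) sequentially"
    using faber_series_uniform by (simp add: p_def[abs_def])
  have z0c: "z0 \<in> closure D" using z0 closure_subset by blast
  obtain H where H: "H z0 = 0" "\<And>z. z \<in> closure D \<Longrightarrow> (H has_field_derivative faber_series \<Phi> a c z) (at z within closure D)"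
    using uniform_limit_has_primitive[OF q(1) u z0c q(2)] by blast
  show ?thesis
  proof (rule that[OF _ H(2)])
    fix z assume z: "z \<in> closure D"
    define pth where "pth = (SOME p. valid_path p \<and> path_image p \<subseteq> closure D \<and> pathstart p = z0 \<and> pathfinish p = z)"
    have "\<exists>p. valid_path p \<and> path_image p \<subseteq> closure D \<and> pathstart p = z0 \<and> pathfinish p = z"
      using valid_path_in_closure[OF z0 z] by blast
    from someI_ex[OF this] have pth: "valid_path pth" "path_image pth \<subseteq> closure D" "pathstart pth = z0" "pathfinish pth = z"
      unfolding pth_def by blast+
    have "(faber_series \<Phi> a c has_contour_integral H (pathfinish pth) - H (pathstart pth)) pth"
      by (rule contour_integral_primitive[OF H(2) pth(1,2)])
    then have "contour_integral pth (faber_series \<Phi> a c) = H z"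
      using pth(3,4) H(1) by (simp add: contour_integral_unique)
    then show "path_primitive D z0 (faber_series \<Phi> a c) z = H z"
      unfolding path_primitive_def pth_def .
  qed
qed

end

section \<open>The stream function in the rotating frame\<close>

lemma stream_function_has_derivative:
  assumes "S \<in> sets borel" "bounded S"
  shows "(stream_function (indicator S) has_derivative
    (\<lambda>h. Re (h * cauchy_transform (indicator S) z) / (2 * pi))) (at z)"
proof -
  have eq: "(\<lambda>y. complex_of_real (indicator S y)) = indicator S" by (auto simp: indicator_def)
  have "((\<lambda>z. LINT y|lborel. ln (norm (z - y)) * indicator S y) has_derivative
    (\<lambda>h. Re (h * cauchy_transform (indicator S) z))) (at z)"
    using log_potential_has_derivative[of "indicator S" z] bdd_density_indicator[OF assms] unfolding eq by blast
  then have "((\<lambda>z. 1 / (2 * pi) * (LINT y|lborel. ln (norm (z - y)) * indicator S y)) has_derivative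
    (\<lambda>h. 1 / (2 * pi) * Re (h * cauchy_transform (indicator S) z))) (at z)"
    by (rule has_derivative_mult_right)
  then show ?thesis unfolding stream_function_def[abs_def] by simp
qed

text \<open>The derivative Re (h W)/(2 pi) means that the gradient, as a complex number, is cnj W/(2
  pi); the perpendicular gradient multiplies it by \<i>.\<close>

lemma velocity_indicator:
  assumes "S \<in> sets borel" "bounded S"
  shows "velocity (indicator S) z = \<i> * cnj (cauchy_transform (indicator S) z) / of_real (2 * pi)"
  unfolding velocity_def perp_gradient_def
    frechet_derivative_at[OF stream_function_has_derivative[OF assms], symmetric]
  by (simp add: complex_eq_iff)

lemma rotation_integral:
  fixes h :: "complex \<Rightarrow> complex"
  assumes D: "open D" and u: "norm u = 1" and h: "h \<in> borel_measurable borel"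
  shows "(LINT y:(\<lambda>z. u * z) ` D|lborel. h y) = (LINT x:D|lborel. h (u * x))"
proof -
  have u0: "u \<noteq> 0" using u by auto
  have d: "deriv (\<lambda>z. u * z) = (\<lambda>z. u)" by (rule HOL.ext) (auto intro!: DERIV_imp_deriv derivative_eq_intros)
  have "(LINT y:(\<lambda>z. u * z) ` D|lborel. h y) = (LINT s:D|lborel. (norm (deriv (\<lambda>z. u * z) s))\<^sup>2 *\<^sub>R h (u * s))"
    by (rule holomorphic_cov_integral[OF D _ _ h]) (auto intro!: holomorphic_intros inj_onI simp: u0)
  then show ?thesis using u by (simp add: d)
qed

lemma cauchy_transform_indicator:
  "cauchy_transform (indicator S) z = (LINT y:S|lborel. 1 / (z - y))"
  unfolding cauchy_transform_def set_lebesgue_integral_def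
  by (rule Bochner_Integration.integral_cong) (auto simp: indicator_def)

lemma cauchy_transform_rotation:
  assumes D: "open D" and u: "norm u = 1"
  shows "cauchy_transform (indicator ((\<lambda>z. u * z) ` D)) (u * x) = cnj u * cauchy_transform (indicator D) x"
proof -
  have u0: "u \<noteq> 0" using u by auto
  have iu: "1 / u = cnj u" using complex_div_cnj[of 1 u] u by simp
  have "cauchy_transform (indicator ((\<lambda>z. u * z) ` D)) (u * x) = (LINT y:D|lborel. 1 / (u * x - u * y))"
    unfolding cauchy_transform_indicator by (rule rotation_integral[OF D u]) measurable
  also have "\<dots> = (LINT y:D|lborel. cnj u * (1 / (x - y)))"
  proof -
    have "1 / (u * x - u * y) = cnj u * (1 / (x - y))" for y
      unfolding iu[symmetric] by (simp flip: right_diff_distrib)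
    then show ?thesis by simp
  qed
  also have "\<dots> = cnj u * (LINT y:D|lborel. 1 / (x - y))" by (rule set_integral_mult_right)
  finally show ?thesis by (simp only: cauchy_transform_indicator)
qed

text \<open>In the frame that rotates with the patch the velocity \<open>v - \<i> \<Omega> z\<close> is the perpendicular
  gradient of \<open>\<psi> - \<Omega> \<bar>z\<bar>\<^sup>2 / 2\<close>.\<close>

definition relative_stream :: "complex set \<Rightarrow> real \<Rightarrow> complex \<Rightarrow> real" where
  "relative_stream D \<Omega> z = stream_function (indicator D) z - \<Omega> / 2 * (norm z)\<^sup>2"

definition relative_velocity :: "complex set \<Rightarrow> real \<Rightarrow> complex \<Rightarrow> complex" where
  "relative_velocity D \<Omega> z = \<i> * cnj (cauchy_transform (indicator D) z / of_real (2 * pi) - of_real \<Omega> * cnj z)"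

lemma norm_square_has_derivative:
  "((\<lambda>z::complex. (norm z)\<^sup>2) has_derivative (\<lambda>h. 2 * Re (h * cnj z))) (at z)"
proof -
  have "((\<lambda>z::complex. z \<bullet> z) has_derivative (\<lambda>h. z \<bullet> h + h \<bullet> z)) (at z)"
    by (auto intro!: derivative_eq_intros)
  moreover have "(\<lambda>h. z \<bullet> h + h \<bullet> z) = (\<lambda>h. 2 * Re (h * cnj z))"
    by (rule HOL.ext) (simp add: inner_complex_def mult.commute)
  ultimately show ?thesis by (simp add: power2_norm_eq_inner)
qed

text \<open>The relative velocity is - \<partial>\<Psi>/\<partial>y + \<i>
  \<partial>\<Psi>/\<partial>x, so both partial derivatives are read off from it; their continuity
  is that of the Cauchy transform.\<close>

lemma C1_plane_relative_stream:
  assumes "S \<in> sets borel" "bounded S"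
  shows "C1_plane (relative_stream S \<Omega>) (\<lambda>z. Im (relative_velocity S \<Omega> z)) (\<lambda>z. - Re (relative_velocity S \<Omega> z))"
  unfolding C1_plane_def
proof (intro conjI allI)
  have c: "continuous_on UNIV (relative_velocity S \<Omega>)" unfolding relative_velocity_def
    by (intro continuous_intros cauchy_transform_continuous bdd_density_indicator assms) auto
  show "continuous_on UNIV (\<lambda>z. Im (relative_velocity S \<Omega> z))" "continuous_on UNIV (\<lambda>z. - Re (relative_velocity S \<Omega> z))"
    by (intro continuous_intros c)+
  fix z
  have "(relative_stream S \<Omega> has_derivative (\<lambda>h. Re (h * cauchy_transform (indicator S) z) / (2 * pi) - \<Omega> / 2 * (2 * Re (h * cnj z)))) (at z)"
    unfolding relative_stream_def[abs_def]
    by (intro has_derivative_diff has_derivative_mult_right stream_function_has_derivative[OF assms] norm_square_has_derivative)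
  moreover have "(\<lambda>h. Re (h * cauchy_transform (indicator S) z) / (2 * pi) - \<Omega> / 2 * (2 * Re (h * cnj z))) =
     (\<lambda>h. Re h *\<^sub>R Im (relative_velocity S \<Omega> z) + Im h *\<^sub>R - Re (relative_velocity S \<Omega> z))"
    by (rule HOL.ext) (simp add: relative_velocity_def right_diff_distrib diff_divide_distrib distrib_left)
  ultimately show "(relative_stream S \<Omega> has_derivative
     (\<lambda>h. Re h *\<^sub>R Im (relative_velocity S \<Omega> z) + Im h *\<^sub>R - Re (relative_velocity S \<Omega> z))) (at z)" by simp
qed

context patch
begin

text \<open>The sum Re H - |z|^2/2 + 2 \<psi> has derivative zero in D: the Faber series is cnj z -
  W/pi with W the Cauchy transform of the patch, and 2 \<psi> has derivative Re (h W)/pi. Continuity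
  carries the constant to the closure.\<close>

theorem path_primitive_stream:
  assumes z0: "z0 \<in> D"
  shows "\<And>z. z \<in> D \<Longrightarrow> (path_primitive D z0 (faber_series \<Phi> a c) has_field_derivative faber_series \<Phi> a c z) (at z)"
    and "\<exists>C. \<forall>z\<in>closure D. (2 * \<Omega> - 1) / 2 * (norm z)\<^sup>2 + Re (path_primitive D z0 (faber_series \<Phi> a c) z) = C - 2 * relative_stream D \<Omega> z"
proof -
  obtain H where H: "\<And>z. z \<in> closure D \<Longrightarrow> path_primitive D z0 (faber_series \<Phi> a c) z = H z"
    "\<And>z. z \<in> closure D \<Longrightarrow> (H has_field_derivative faber_series \<Phi> a c z) (at z within closure D)"
    using path_primitive_faber_series[OF z0] by metis
  have DD: "D \<subseteq> interior (closure D)" by (intro interior_maximal closure_subset D_open)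
  have Hd: "(H has_field_derivative faber_series \<Phi> a c z) (at z)" if "z \<in> D" for z
    using H(2)[of z] that DD closure_subset[of D] by (metis at_within_interior subsetD)
  show "(path_primitive D z0 (faber_series \<Phi> a c) has_field_derivative faber_series \<Phi> a c z) (at z)" if z: "z \<in> D" for z
  proof (rule has_field_derivative_transform_within_open[OF Hd[OF z] D_open z])
    show "H x = path_primitive D z0 (faber_series \<Phi> a c) x" if "x \<in> D" for x
      using H(1)[of x] that closure_subset[of D] by auto
  qed
  have Db: "D \<in> sets borel" using D_open by simp
  define L where "L z = Re (H z) - (norm z)\<^sup>2 / 2 + 2 * stream_function (indicator D) z" for z
  have Ld: "(L has_derivative (\<lambda>h. 0)) (at z)" if z: "z \<in> D" for z
  proof -
    have "(H has_derivative (\<lambda>h. faber_series \<Phi> a c z * h)) (at z)" using Hd[OF z] by (simp add: has_field_derivative_def)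
    moreover have "((\<lambda>z::complex. (norm z)\<^sup>2 / 2) has_derivative (\<lambda>h. (2 * Re (h * cnj z)) / 2)) (at z)"
      by (rule bounded_linear.has_derivative[OF bounded_linear_divide norm_square_has_derivative])
    ultimately have "(L has_derivative (\<lambda>h. Re (faber_series \<Phi> a c z * h) - (2 * Re (h * cnj z)) / 2
        + 2 * (Re (h * cauchy_transform (indicator D) z) / (2 * pi)))) (at z)"
      unfolding L_def[abs_def]
      by (intro has_derivative_add has_derivative_diff has_derivative_Re has_derivative_mult_right
          stream_function_has_derivative Db D_bounded)
    moreover have "(\<lambda>h. Re (faber_series \<Phi> a c z * h) - (2 * Re (h * cnj z)) / 2
        + 2 * (Re (h * cauchy_transform (indicator D) z) / (2 * pi))) = (\<lambda>h. 0)"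
    proof (rule HOL.ext)
      fix h
      have zc: "z \<in> closure D" using z closure_subset by blast
      have "faber_series \<Phi> a c z * h - h * cnj z + h * cauchy_transform (indicator D) z / of_real pi = 0"
        unfolding faber_series_cauchy_transform[OF zc] by (simp add: mult.commute[of _ h] right_diff_distrib)
      then have "Re (faber_series \<Phi> a c z * h - h * cnj z + h * cauchy_transform (indicator D) z / of_real pi) = 0"
        by (simp only: zero_complex.simps)
      then have "Re (faber_series \<Phi> a c z * h) - Re (h * cnj z) + Re (h * cauchy_transform (indicator D) z) / pi = 0"
        unfolding plus_complex.simps minus_complex.simps Re_divide_of_real .
      moreover have "p - (2 * q) / 2 + 2 * (r / (2 * pi)) = p - q + r / pi" for p q r by simp
      ultimately show "Re (faber_series \<Phi> a c z * h) - (2 * Re (h * cnj z)) / 2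
        + 2 * (Re (h * cauchy_transform (indicator D) z) / (2 * pi)) = 0" by (simp only: )
    qed
    ultimately show ?thesis by simp
  qed
  have "continuous_on D L" using Ld has_derivative_continuous by (intro continuous_at_imp_continuous_on) blast
  then have "L constant_on D"
    using Ld by (intro has_derivative_zero_connected_constant_on[OF D_connected D_open finite.emptyI])
      (auto intro: has_derivative_at_withinI)
  then obtain C where C: "\<And>z. z \<in> D \<Longrightarrow> L z = C" by (auto simp: constant_on_def)
  have "continuous_on (closure D) L"
  proof -
    have "continuous_on (closure D) H" by (rule DERIV_continuous_on[OF H(2)])
    moreover have "continuous_on (closure D) (stream_function (indicator D))"
      using stream_function_has_derivative[OF Db D_bounded] has_derivative_continuous
      by (intro continuous_at_imp_continuous_on) blast
    ultimately show ?thesis unfolding L_def[abs_def] by (intro continuous_intros) auto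
  qed
  then have LC: "L z = C" if "z \<in> closure D" for z
    using continuous_constant_on_closure[of D L C z] C that by auto
  show "\<exists>C. \<forall>z\<in>closure D. (2 * \<Omega> - 1) / 2 * (norm z)\<^sup>2 + Re (path_primitive D z0 (faber_series \<Phi> a c) z) = C - 2 * relative_stream D \<Omega> z"
  proof (intro exI[of _ C] ballI)
    fix z assume z: "z \<in> closure D"
    show "(2 * \<Omega> - 1) / 2 * (norm z)\<^sup>2 + Re (path_primitive D z0 (faber_series \<Phi> a c) z) = C - 2 * relative_stream D \<Omega> z"
      using LC[OF z] unfolding H(1)[OF z] relative_stream_def L_def by (simp add: field_simps)
  qed
qed

end

section \<open>The weak vorticity equation of a rotating patch\<close>

text \<open>In the rotating frame the patch is a fixed set S, so a continuous function is integrated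
  over a bounded slab; compact support in time makes the double integral absolutely
  convergent.\<close>

lemma slab_fubini:
  fixes h :: "real \<times> complex \<Rightarrow> real"
  assumes h: "continuous_on UNIV h" and T: "\<And>t x. \<bar>t\<bar> > T \<Longrightarrow> h (t, x) = 0"
    and S: "S \<in> sets borel" "bounded S"
  shows "integrable lborel (\<lambda>t. LINT x:S|lborel. h (t, x))"
    and "set_integrable lborel S (\<lambda>x. h (t, x))"
    and "(LINT t|lborel. (LINT x:S|lborel. h (t, x))) = (LINT x:S|lborel. (LINT t|lborel. h (t, x)))"
proof -
  have hm [measurable]: "h \<in> borel_measurable borel" by (rule borel_measurable_continuous_onI[OF h])
  have fin: "emeasure lborel S < \<infinity>" by (rule emeasure_bounded_finite[OF S(2)])
  define k where "k p = indicat_real S (snd p) * h p" for p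
  have "compact ({-T..T} \<times> closure S)" using S(2) by (intro compact_Times) auto
  then have "bounded (h ` ({-T..T} \<times> closure S))"
    by (intro compact_imp_bounded compact_continuous_image continuous_on_subset[OF h]) auto
  then obtain B where B: "\<And>p. p \<in> {-T..T} \<times> closure S \<Longrightarrow> norm (h p) \<le> B" by (auto simp: bounded_iff)
  have cS: "x \<in> closure S" if "x \<in> S" for x using that closure_subset by blast
  have km: "k \<in> borel_measurable (lborel \<Otimes>\<^sub>M lborel)"
  proof -
    have "snd \<in> borel_measurable (borel :: (real \<times> complex) measure)"
      by (intro borel_measurable_continuous_onI continuous_intros)
    then have "k \<in> borel_measurable (borel :: (real \<times> complex) measure)"
      unfolding k_def[abs_def] using S(1) by measurable
    then show ?thesis by (simp add: lborel_prod)
  qed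
  have ki: "integrable (lborel \<Otimes>\<^sub>M lborel) k"
  proof (rule integrableI_bounded_set[where A = "{-T..T} \<times> S" and B = B])
    show "{-T..T} \<times> S \<in> sets (lborel \<Otimes>\<^sub>M lborel)" using S(1) by (intro pair_measureI) auto
    have "emeasure (lborel \<Otimes>\<^sub>M lborel) ({-T..T} \<times> S) = emeasure lborel {-T..T} * emeasure lborel S"
      using S(1) by (intro lborel.emeasure_pair_measure_Times) auto
    also have "\<dots> < \<infinity>" using fin by (simp add: ennreal_mult_less_top emeasure_lborel_Icc_eq)
    finally show "emeasure (lborel \<Otimes>\<^sub>M lborel) ({-T..T} \<times> S) < \<infinity>" .
    have "norm (k p) \<le> B" if "p \<in> {-T..T} \<times> S" for p
    proof -
      have "p \<in> {-T..T} \<times> closure S" using that cS by auto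
      then show ?thesis using that B[of p] by (auto simp: k_def)
    qed
    then show "AE p in lborel \<Otimes>\<^sub>M lborel. p \<in> {-T..T} \<times> S \<longrightarrow> norm (k p) \<le> B" by simp
    have "k p = 0" if "p \<notin> {-T..T} \<times> S" for p
    proof (cases p)
      case (Pair t x)
      show ?thesis
      proof (cases "x \<in> S")
        case True
        then have "\<bar>t\<bar> > T" using that Pair by auto
        then show ?thesis using T Pair by (simp add: k_def)
      qed (simp add: k_def Pair)
    qed
    then show "AE p in lborel \<Otimes>\<^sub>M lborel. p \<notin> {-T..T} \<times> S \<longrightarrow> k p = 0" by simp
  qed (rule km)
  have ks: "(LINT x:S|lborel. h (t, x)) = (LINT x|lborel. k (t, x))" for t
    by (simp add: set_lebesgue_integral_def k_def)
  show "integrable lborel (\<lambda>t. LINT x:S|lborel. h (t, x))"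
    unfolding ks by (rule lborel_pair.integrable_fst'[OF ki])
  have kc: "integrable (lborel \<Otimes>\<^sub>M lborel) (case_prod (\<lambda>t x. k (t, x)))" using ki by simp
  have "(LINT t|lborel. (LINT x:S|lborel. h (t, x))) = (LINT x|lborel. LINT t|lborel. k (t, x))"
    unfolding ks by (rule lborel_pair.Fubini_integral[OF kc, symmetric])
  also have "\<dots> = (LINT x:S|lborel. (LINT t|lborel. h (t, x)))"
    unfolding set_lebesgue_integral_def k_def by simp
  finally show "(LINT t|lborel. (LINT x:S|lborel. h (t, x))) = (LINT x:S|lborel. (LINT t|lborel. h (t, x)))" .
  have htx: "continuous_on UNIV (\<lambda>x. h (t, x))" by (rule continuous_on_compose2[OF h]) (auto intro!: continuous_intros)
  then have [measurable]: "(\<lambda>x. h (t, x)) \<in> borel_measurable borel" by (rule borel_measurable_continuous_onI)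
  show "set_integrable lborel S (\<lambda>x. h (t, x))" unfolding set_integrable_def
  proof (rule integrableI_bounded_set[where A = S and B = "max B 0"])
    have "norm (h (t, x)) \<le> max B 0" if "x \<in> S" for x
      using B[of "(t, x)"] T[of t x] cS[OF that] by (cases "\<bar>t\<bar> \<le> T") (auto simp: le_max_iff_disj abs_le_iff)
    then show "AE x in lborel. x \<in> S \<longrightarrow> norm (indicat_real S x *\<^sub>R h (t, x)) \<le> max B 0" by auto
  qed (use S fin in auto)
qed

lemma time_derivative_integral_zero:
  fixes F f :: "real \<Rightarrow> real"
  assumes F: "\<And>t. (F has_vector_derivative f t) (at t)" and f: "continuous_on UNIV f"
    and T: "\<And>t. \<bar>t\<bar> > T \<Longrightarrow> F t = 0" "\<And>t. \<bar>t\<bar> > T \<Longrightarrow> f t = 0"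
  shows "(LINT t|lborel. f t) = 0"
proof -
  define A where "A = \<bar>T\<bar> + 1"
  have "(LINT t|lborel. f t) = (LINT t|lborel. indicator {-A..A} t *\<^sub>R f t)"
  proof (rule Bochner_Integration.integral_cong[OF refl])
    fix t show "f t = indicator {-A..A} t *\<^sub>R f t"
      using T(2)[of t] by (cases "t \<in> {-A..A}") (auto simp: A_def)
  qed
  also have "\<dots> = F A - F (-A)"
    by (rule integral_FTC_atLeastAtMost)
      (auto simp: A_def intro: has_vector_derivative_at_within F continuous_on_subset[OF f])
  also have "\<dots> = 0" using T(1)[of A] T(1)[of "-A"] by (simp add: A_def)
  finally show ?thesis .
qed

lemma test_function_support:
  fixes \<phi> :: "real \<times> complex \<Rightarrow> real"
  assumes "compact (closure {p. \<phi> p \<noteq> 0})" and \<phi>': "\<And>p. (\<phi> has_derivative blinfun_apply (\<phi>' p)) (at p)"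
  obtains T where "\<And>t x. \<bar>t\<bar> > T \<Longrightarrow> \<phi> (t, x) = 0" "\<And>t x. \<bar>t\<bar> > T \<Longrightarrow> \<phi>' (t, x) = 0"
    "\<And>t x. norm x > T \<Longrightarrow> \<phi> (t, x) = 0"
proof -
  obtain T where T: "\<And>p. \<phi> p \<noteq> 0 \<Longrightarrow> norm p \<le> T"
    using compact_imp_bounded[OF assms(1)] closure_subset[of "{p. \<phi> p \<noteq> 0}"] unfolding bounded_iff by blast
  have z: "\<phi> (t, x) = 0" if "\<bar>t\<bar> > T \<or> norm x > T" for t :: real and x
    using T[of "(t, x)"] that norm_fst_le[of t x] norm_snd_le[of x t] by force
  show ?thesis
  proof (rule that[of T])
    fix t :: real and x assume t: "\<bar>t\<bar> > T"
    have o: "open {p::real \<times> complex. \<bar>fst p\<bar> > T}" by (intro open_Collect_less continuous_intros)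
    have "(\<phi> has_derivative (\<lambda>h. 0)) (at (t, x))"
      by (rule has_derivative_transform_within_open[OF has_derivative_const[of 0] o]) (use t z in auto)
    then have "blinfun_apply (\<phi>' (t, x)) = (\<lambda>h. 0)" using \<phi>'[of "(t, x)"] has_derivative_unique by blast
    then show "\<phi>' (t, x) = 0" by (intro blinfun_eqI) simp
  qed (use z in auto)
qed

definition rotation :: "real \<Rightarrow> real \<Rightarrow> complex \<Rightarrow> complex" where
  "rotation \<Omega> t x = exp (\<i> * of_real (\<Omega> * t)) * x"

lemma rotation_cis: "rotation \<Omega> t x = cis (\<Omega> * t) * x"
  by (simp add: rotation_def cis_conv_exp)

text \<open>In the rotating frame the time derivative of the test function integrates to zero, and what
  remains is the transport by the relative velocity.\<close>
lemma rotating_weak_form: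
  fixes \<phi> :: "real \<times> complex \<Rightarrow> real" and \<Omega> :: real
  assumes D: "open D" "bounded D"
    and \<phi>': "\<And>p. (\<phi> has_derivative blinfun_apply (\<phi>' p)) (at p)" "continuous_on UNIV \<phi>'"
    and supp: "compact (closure {p. \<phi> p \<noteq> 0})"
  defines "\<omega> \<equiv> \<lambda>t. indicator ((\<lambda>z. cis (\<Omega> * t) * z) ` D)"
  shows "(LINT t|lborel. LINT z|lborel. \<omega> t z * frechet_derivative \<phi> (at (t, z)) (1, velocity (\<omega> t) z))
    = (LINT t|lborel. (LINT x:D|lborel. \<phi>' (t, rotation \<Omega> t x) (0, rotation \<Omega> t (relative_velocity D \<Omega> x))))"
proof -
  obtain T where T: "\<And>t x. \<bar>t\<bar> > T \<Longrightarrow> \<phi> (t, x) = 0" "\<And>t x. \<bar>t\<bar> > T \<Longrightarrow> \<phi>' (t, x) = 0"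
    "\<And>t x. norm x > T \<Longrightarrow> \<phi> (t, x) = 0"
    using test_function_support[OF supp \<phi>'(1)] by metis
  define R where "R = rotation \<Omega>"
  define X where "X = relative_velocity D \<Omega>"
  have Ds: "D \<in> sets borel" using D by simp
  \<comment> \<open>h1 is the derivative of the test function along the rigid rotation, h2 the
    contribution of the velocity relative to it.\<close>
  define h1 where "h1 p = \<phi>' (fst p, R (fst p) (snd p)) (1, R (fst p) (\<i> * of_real \<Omega> * snd p))" for p
  define h2 where "h2 p = \<phi>' (fst p, R (fst p) (snd p)) (0, R (fst p) (X (snd p)))" for p
  have Xc: "continuous_on UNIV X" unfolding X_def relative_velocity_def
    by (intro continuous_intros cauchy_transform_continuous bdd_density_indicator Ds D) auto
  have Rc: "continuous_on UNIV (\<lambda>p. R (fst p) (f (snd p)))" if "continuous_on UNIV f" for f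
    unfolding R_def rotation_def by (intro continuous_intros continuous_on_compose2[OF that]) auto
  have hc: "continuous_on UNIV h1" "continuous_on UNIV h2"
    unfolding h1_def[abs_def] h2_def[abs_def]
    by (intro blinfun.continuous_on continuous_on_compose2[OF \<phi>'(2)] continuous_on_Pair
        continuous_on_fst continuous_on_const continuous_on_id Rc Xc Rc[of "\<lambda>x. x"]; auto intro!: continuous_intros Rc)+
  have hT: "h1 (t, x) = 0" "h2 (t, x) = 0" if "\<bar>t\<bar> > T" for t x using T(2)[OF that] by (simp_all add: h1_def h2_def)
  have inner: "(LINT z|lborel. \<omega> t z * frechet_derivative \<phi> (at (t, z)) (1, velocity (\<omega> t) z)) =
    (LINT x:D|lborel. h1 (t, x) + h2 (t, x))" for t
  proof -
    define u where "u = cis (\<Omega> * t)"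
    have u: "norm u = 1" "cnj u * u = 1" "u \<noteq> 0" by (auto simp: u_def cis_cnj cis_mult)
    define S where "S = (\<lambda>z. u * z) ` D"
    have S: "open S" "bounded S"
    proof -
      show "open S" unfolding S_def using D(1) u(3) by (intro open_mapping_thm3[where S=D]) (auto intro!: holomorphic_intros inj_onI)
      show "bounded S" unfolding S_def using bounded_scaling[of D] D(2) bounded_linear_image[OF D(2) bounded_linear_mult_right[of u]] by simp
    qed
    have Sb: "S \<in> sets borel" using S by simp
    have \<omega>: "\<omega> t = indicator S" by (simp add: \<omega>_def S_def u_def)
    have vc: "continuous_on UNIV (velocity (indicator S))"
      unfolding velocity_indicator[OF Sb S(2), abs_def]
      by (intro continuous_intros cauchy_transform_continuous bdd_density_indicator Sb S) auto
    define h where "h y = complex_of_real (\<phi>' (t, y) (1, velocity (indicator S) y))" for y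
    have "continuous_on UNIV h" unfolding h_def
      by (intro continuous_intros blinfun.continuous_on continuous_on_compose2[OF \<phi>'(2)] vc) auto
    then have hm: "h \<in> borel_measurable borel" by (rule borel_measurable_continuous_onI)
    have fd: "frechet_derivative \<phi> (at p) = blinfun_apply (\<phi>' p)" for p
      using frechet_derivative_at[OF \<phi>'(1)] by simp
    have "complex_of_real (LINT z|lborel. \<omega> t z * frechet_derivative \<phi> (at (t, z)) (1, velocity (\<omega> t) z))
        = (LINT y:S|lborel. h y)"
      unfolding \<omega> fd set_lebesgue_integral_def h_def
      by (subst integral_complex_of_real[symmetric]) (auto intro!: Bochner_Integration.integral_cong simp: indicator_def)
    also have "\<dots> = (LINT x:D|lborel. h (u * x))" unfolding S_def by (rule rotation_integral[OF D(1) u(1) hm])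
    also have "\<dots> = (LINT x:D|lborel. complex_of_real (h1 (t, x) + h2 (t, x)))"
    proof -
      have "h (u * x) = complex_of_real (h1 (t, x) + h2 (t, x))" for x
      proof -
        \<comment> \<open>The velocity field rotates with the patch; splitting off the rigid part
          leaves X.\<close>
        have "velocity (indicator S) (u * x) = u * (\<i> * cnj (cauchy_transform (indicator D) x) / of_real (2 * pi))"
          unfolding velocity_indicator[OF Sb S(2)] unfolding S_def cauchy_transform_rotation[OF D(1) u(1)] by simp
        also have "\<i> * cnj (cauchy_transform (indicator D) x) / of_real (2 * pi) = \<i> * of_real \<Omega> * x + X x"
          unfolding X_def relative_velocity_def by (simp add: right_diff_distrib)
        finally have v: "(1, velocity (indicator S) (u * x)) = (1, u * (\<i> * of_real \<Omega> * x)) + (0::real, u * X x)"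
          by (simp add: distrib_left)
        show ?thesis unfolding h_def v blinfun.add_right h1_def h2_def R_def rotation_cis by (simp add: u_def)
      qed
      then show ?thesis by simp
    qed
    also have "\<dots> = complex_of_real (LINT x:D|lborel. h1 (t, x) + h2 (t, x))"
      unfolding set_lebesgue_integral_def by (subst integral_complex_of_real[symmetric]) (simp add: scaleR_conv_of_real)
    finally show ?thesis by (simp only: of_real_eq_iff)
  qed
  \<comment> \<open>For fixed x, h1 (t, x) is the time derivative of \<phi> (t, R t x), which has
    compact support in t.\<close>
  have zero: "(LINT t|lborel. h1 (t, x)) = 0" for x
  proof (rule time_derivative_integral_zero[where F = "\<lambda>t. \<phi> (t, R t x)" and T = T])
    fix t
    have "((\<lambda>t. R t x) has_vector_derivative R t (\<i> * of_real \<Omega> * x)) (at t)"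
    proof -
      have "((\<lambda>z. exp (\<i> * (of_real \<Omega> * z)) * x) has_field_derivative exp (\<i> * (of_real \<Omega> * of_real t)) * (\<i> * of_real \<Omega> * x)) (at (of_real t))"
        by (auto intro!: derivative_eq_intros)
      from has_vector_derivative_real_field[OF this] show ?thesis
        unfolding R_def rotation_def by simp
    qed
    then have "((\<lambda>t. (t, R t x)) has_vector_derivative (1, R t (\<i> * of_real \<Omega> * x))) (at t)"
      by (intro has_vector_derivative_Pair) (auto intro!: derivative_eq_intros)
    from has_vector_derivative_compose_linear[OF this \<phi>'(1)]
    show "((\<lambda>t. \<phi> (t, R t x)) has_vector_derivative h1 (t, x)) (at t)" by (simp add: h1_def)
  next
    show "continuous_on UNIV (\<lambda>t. h1 (t, x))"
      by (rule continuous_on_compose2[OF hc(1)]) (auto intro!: continuous_intros)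
  qed (use T hT in auto)
  note f1 = slab_fubini[OF hc(1) hT(1) Ds D(2)] and f2 = slab_fubini[OF hc(2) hT(2) Ds D(2)]
  have "(LINT t|lborel. LINT z|lborel. \<omega> t z * frechet_derivative \<phi> (at (t, z)) (1, velocity (\<omega> t) z))
    = (LINT t|lborel. (LINT x:D|lborel. h1 (t, x)) + (LINT x:D|lborel. h2 (t, x)))"
    unfolding inner using f1(2) f2(2) by (subst set_integral_add(2)) auto
  also have "\<dots> = (LINT t|lborel. (LINT x:D|lborel. h1 (t, x))) + (LINT t|lborel. (LINT x:D|lborel. h2 (t, x)))"
    by (rule Bochner_Integration.integral_add[OF f1(1) f2(1)])
  also have "(LINT t|lborel. (LINT x:D|lborel. h1 (t, x))) = 0"
  proof -
    have "(LINT t|lborel. (LINT x:D|lborel. h1 (t, x))) = (LINT x:D|lborel. (LINT t|lborel. h1 (t, x)))"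
      by (rule f1(3))
    then show ?thesis by (simp add: zero)
  qed
  finally show ?thesis by (simp add: h2_def R_def X_def)
qed

text \<open>The choice is the squared positive part of 1 - t^2. On [-1/2, 1/2] it is at least
  (3/4)^2 = 9/16, so its integral is positive.\<close>

lemma bump_function:
  obtains \<tau> \<tau>' :: "real \<Rightarrow> real" where "\<And>t. (\<tau> has_real_derivative \<tau>' t) (at t)" "continuous_on UNIV \<tau>'"
    "\<And>t. \<bar>t\<bar> > 1 \<Longrightarrow> \<tau> t = 0" "(LINT t|lborel. \<tau> t) \<noteq> 0"
proof -
  define \<tau> where "\<tau> t = (max 0 (1 - t\<^sup>2))\<^sup>2" for t :: real
  have d: "(\<tau> has_real_derivative 2 * max 0 (1 - t\<^sup>2) * (- (2 * t))) (at t)" for t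
  proof -
    have "((\<lambda>t. 1 - t\<^sup>2) has_real_derivative - (2 * t)) (at t)" by (auto intro!: derivative_eq_intros)
    from DERIV_chain2[OF max_zero_square_deriv this] show ?thesis unfolding \<tau>_def .
  qed
  have s: "\<tau> t = 0" if "\<bar>t\<bar> > 1" for t
  proof -
    have "1 \<le> t\<^sup>2" using that power_mono[of 1 "\<bar>t\<bar>" 2] by simp
    then show ?thesis by (simp add: \<tau>_def)
  qed
  have tc: "continuous_on UNIV \<tau>" unfolding \<tau>_def by (intro continuous_intros)
  have bnd: "norm (\<tau> t) \<le> 1" for t
  proof -
    have "max 0 (1 - t\<^sup>2) \<le> 1" by simp
    then have "(max 0 (1 - t\<^sup>2))\<^sup>2 \<le> 1" by (intro power_le_one) auto
    then show ?thesis by (simp add: \<tau>_def)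
  qed
  have i: "integrable lborel \<tau>"
  proof (rule integrableI_bounded_set[where A = "{-1..1}" and B = 1])
    show "\<tau> \<in> borel_measurable lborel" using borel_measurable_continuous_onI[OF tc] by simp
    have "\<tau> t = 0" if "t \<notin> {-1..1}" for t using s[of t] that by auto
    then show "AE x in lborel. x \<notin> {-1..1} \<longrightarrow> \<tau> x = 0" by simp
  qed (use bnd in \<open>auto simp: emeasure_lborel_Icc_eq\<close>)
  have "(LINT t|lborel. 9 / 16 * indicator {-(1/2)..1/2::real} t) \<le> (LINT t|lborel. \<tau> t)"
  proof (rule integral_mono[OF _ i])
    have "integrable lborel (indicat_real {-(1/2)..1/2::real})"
      by (intro integrable_real_indicator) (auto simp: emeasure_lborel_Icc_eq)
    then show "integrable lborel (\<lambda>t::real. 9 / 16 * indicat_real {-(1/2)..1/2} t)" by (rule integrable_mult_right)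
    fix t :: real
    show "9 / 16 * indicat_real {-(1/2)..1/2} t \<le> \<tau> t"
    proof (cases "t \<in> {-(1/2)..1/2}")
      case True
      then have "t\<^sup>2 \<le> (1/2)\<^sup>2" by (intro power2_le_iff_abs_le[THEN iffD2]) auto
      then have "3 / 4 \<le> 1 - t\<^sup>2" by (simp add: power_one_over)
      then have "3 / 4 \<le> max 0 (1 - t\<^sup>2)" by (rule max.coboundedI2)
      then have "(3 / 4)\<^sup>2 \<le> \<tau> t" unfolding \<tau>_def by (rule power_mono) simp
      then show ?thesis using True by (simp add: power2_eq_square)
    qed (simp add: \<tau>_def)
  qed
  moreover have "(LINT t|lborel. 9 / 16 * indicat_real {-(1/2)..1/2::real} t) = 9 / 16" by simp
  ultimately have "(LINT t|lborel. \<tau> t) \<noteq> 0" by linarith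
  moreover have "continuous_on UNIV (\<lambda>t::real. 2 * max 0 (1 - t\<^sup>2) * (- (2 * t)))" by (intro continuous_intros)
  ultimately show ?thesis using that[OF d _ s] by blast
qed

text \<open>The weak form of div X = 0 in D together with tangency of X to the boundary.\<close>

definition weakly_stationary :: "complex set \<Rightarrow> (complex \<Rightarrow> complex) \<Rightarrow> bool" where
  "weakly_stationary D X \<longleftrightarrow> (\<forall>\<eta> \<eta>x \<eta>y R. C1_plane \<eta> \<eta>x \<eta>y \<longrightarrow> (\<forall>z. norm z > R \<longrightarrow> \<eta> z = (0::real)) \<longrightarrow>
     (LINT x:D|lborel. \<eta>x x * Re (X x) + \<eta>y x * Im (X x)) = 0)"

section \<open>Equivalence of rotation and stationarity in the rotating frame\<close>

lemma rotation_linear: "rotation \<Omega> t h = Re h *\<^sub>R rotation \<Omega> t 1 + Im h *\<^sub>R rotation \<Omega> t \<i>"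
  unfolding rotation_def by (subst complex_eq[of h]) (simp add: scaleR_conv_of_real distrib_left mult.left_commute)

lemma rotation_inverse: "rotation \<Omega> (- t) (rotation \<Omega> t x) = x"
  unfolding rotation_def by (simp add: exp_minus)

lemma rotation_has_derivative: "((\<lambda>x. rotation \<Omega> t x) has_derivative rotation \<Omega> t) (at x)"
  unfolding rotation_def by (intro has_derivative_mult_right has_derivative_ident)

text \<open>For fixed t the test function seen in the rotating frame is an admissible \<eta>, so the
  inner integral vanishes at each time separately.\<close>

lemma weakly_stationary_imp_rotating:
  assumes D: "open D" "bounded D" and w: "weakly_stationary D (relative_velocity D \<Omega>)"
  shows "rotating_patch D \<Omega>"
  unfolding rotating_patch_def euler_weak_solution_def
proof (intro allI impI)
  fix \<phi> :: "real \<times> complex \<Rightarrow> real" assume "C1_test_function \<phi>"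
  then obtain \<phi>' where \<phi>': "\<And>p. (\<phi> has_derivative blinfun_apply (\<phi>' p)) (at p)" "continuous_on UNIV \<phi>'"
    and supp: "compact (closure {p. \<phi> p \<noteq> 0})" unfolding C1_test_function_def by blast
  obtain T where T: "\<And>t x. norm x > T \<Longrightarrow> \<phi> (t, x) = 0"
    using test_function_support[OF supp \<phi>'(1)] by metis
  define R where "R = rotation \<Omega>"
  have zero: "(LINT x:D|lborel. \<phi>' (t, R t x) (0, R t (relative_velocity D \<Omega> x))) = 0" for t
  proof -
    define A where "A h x = \<phi>' (t, R t x) (0, R t h)" for h x
    have lin: "A h x = Re h * A 1 x + Im h * A \<i> x" for h x
    proof -
      have "(0, R t h) = Re h *\<^sub>R (0::real, R t 1) + Im h *\<^sub>R (0, R t \<i>)"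
        using rotation_linear[of \<Omega> t h] by (simp add: R_def)
      then show ?thesis unfolding A_def by (simp only: blinfun.add_right blinfun.scaleR_right real_scaleR_def)
    qed
    have "C1_plane (\<lambda>x. \<phi> (t, R t x)) (A 1) (A \<i>)" unfolding C1_plane_def
    proof (intro conjI allI)
      fix x
      have "((\<lambda>x. (t, R t x)) has_derivative (\<lambda>h. (0, R t h))) (at x)"
        unfolding R_def by (intro has_derivative_Pair has_derivative_const rotation_has_derivative)
      from has_derivative_compose[OF this \<phi>'(1)]
      have "((\<lambda>x. \<phi> (t, R t x)) has_derivative (\<lambda>h. A h x)) (at x)" by (simp add: A_def)
      moreover have "(\<lambda>h. A h x) = (\<lambda>h. Re h *\<^sub>R A 1 x + Im h *\<^sub>R A \<i> x)"
      proof (rule HOL.ext)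
        fix h show "A h x = Re h *\<^sub>R A 1 x + Im h *\<^sub>R A \<i> x" using lin[of h x] by simp
      qed
      ultimately show "((\<lambda>x. \<phi> (t, R t x)) has_derivative (\<lambda>h. Re h *\<^sub>R A 1 x + Im h *\<^sub>R A \<i> x)) (at x)" by simp
    next
      have "continuous_on UNIV (\<lambda>x. (t, R t x))" unfolding R_def rotation_def by (intro continuous_intros)
      then have "continuous_on UNIV (A h)" for h unfolding A_def
        by (intro blinfun.continuous_on continuous_on_const continuous_on_compose2[OF \<phi>'(2)]) auto
      then show "continuous_on UNIV (A 1)" "continuous_on UNIV (A \<i>)" by auto
    qed
    moreover have "\<phi> (t, R t x) = 0" if "norm x > T" for x
      using T[of "R t x" t] that by (simp add: R_def rotation_cis norm_mult)
    ultimately have "(LINT x:D|lborel. A 1 x * Re (relative_velocity D \<Omega> x) + A \<i> x * Im (relative_velocity D \<Omega> x)) = 0"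
      using w unfolding weakly_stationary_def by blast
    moreover have "\<phi>' (t, R t x) (0, R t (relative_velocity D \<Omega> x)) =
        A 1 x * Re (relative_velocity D \<Omega> x) + A \<i> x * Im (relative_velocity D \<Omega> x)" for x
      using lin[of "relative_velocity D \<Omega> x" x] unfolding A_def by (simp add: mult.commute)
    ultimately show ?thesis by simp
  qed
  show "(LINT t|lborel. LINT z|lborel. indicat_real ((\<lambda>z. cis (\<Omega> * t) * z) ` D) z *
      frechet_derivative \<phi> (at (t, z)) (1, velocity (indicat_real ((\<lambda>z. cis (\<Omega> * t) * z) ` D)) z)) = 0"
    unfolding rotating_weak_form[OF D \<phi>' supp] using zero unfolding R_def by simp
qed

text \<open>Test with \<tau>(t) \<eta>(exp (- \<i> \<Omega> t) x), which separates in the rotating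
  frame; the nonzero integral of \<tau> can then be cancelled.\<close>

lemma rotating_imp_weakly_stationary:
  assumes D: "open D" "bounded D" and w: "rotating_patch D \<Omega>"
  shows "weakly_stationary D (relative_velocity D \<Omega>)"
  unfolding weakly_stationary_def
proof (intro allI impI)
  fix \<eta> \<eta>x \<eta>y :: "complex \<Rightarrow> real" and R0 :: real
  assume C: "C1_plane \<eta> \<eta>x \<eta>y" and R0: "\<forall>z. norm z > R0 \<longrightarrow> \<eta> z = 0"
  obtain \<tau> \<tau>' where \<tau>: "\<And>t. (\<tau> has_real_derivative \<tau>' t) (at t)" "continuous_on UNIV \<tau>'"
    "\<And>t. \<bar>t\<bar> > 1 \<Longrightarrow> \<tau> t = 0" "(LINT t|lborel. \<tau> t) \<noteq> 0"
    using bump_function by metis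
  define X where "X = relative_velocity D \<Omega>"
  define Q where "Q t = rotation \<Omega> (- t)" for t
  define \<phi> where "\<phi> p = \<tau> (fst p) * \<eta> (Q (fst p) (snd p))" for p
  \<comment> \<open>The total derivative of \<phi>: the spatial increment is rotated back after
    subtracting the rigid motion of the point.\<close>
  define L where "L p h = \<tau>' (fst p) * fst h * \<eta> (Q (fst p) (snd p)) + \<tau> (fst p) *
    (Re (Q (fst p) (snd h - fst h *\<^sub>R (\<i> * of_real \<Omega> * snd p))) * \<eta>x (Q (fst p) (snd p))
     + Im (Q (fst p) (snd h - fst h *\<^sub>R (\<i> * of_real \<Omega> * snd p))) * \<eta>y (Q (fst p) (snd p)))" for p h
  have \<tau>c: "continuous_on UNIV \<tau>" using \<tau>(1) by (intro DERIV_continuous_on) (blast intro: has_field_derivative_at_within)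
  have \<phi>d: "(\<phi> has_derivative L p) (at p)" for p
  proof -
    have "((\<lambda>z. exp (\<i> * (of_real \<Omega> * - z))) has_field_derivative exp (\<i> * (of_real \<Omega> * - of_real (fst p))) * (- (\<i> * of_real \<Omega>))) (at (of_real (fst p)))"
      by (auto intro!: derivative_eq_intros)
    from has_vector_derivative_real_field[OF this]
    have "((\<lambda>t. exp (\<i> * (of_real \<Omega> * - of_real t))) has_derivative
        (\<lambda>s. s *\<^sub>R (exp (\<i> * (of_real \<Omega> * - of_real (fst p))) * (- (\<i> * of_real \<Omega>))))) (at (fst p))"
      by (simp add: has_vector_derivative_def)
    from has_derivative_compose[OF has_derivative_fst[OF has_derivative_ident] this]
    have "((\<lambda>p. exp (\<i> * (of_real \<Omega> * - of_real (fst p)))) has_derivative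
        (\<lambda>h. fst h *\<^sub>R (exp (\<i> * (of_real \<Omega> * - of_real (fst p))) * (- (\<i> * of_real \<Omega>))))) (at p)" .
    from has_derivative_mult[OF this has_derivative_snd[OF has_derivative_ident]]
    have "((\<lambda>p. Q (fst p) (snd p)) has_derivative (\<lambda>h. exp (\<i> * (of_real \<Omega> * - of_real (fst p))) * snd h +
        fst h *\<^sub>R (exp (\<i> * (of_real \<Omega> * - of_real (fst p))) * (- (\<i> * of_real \<Omega>))) * snd p)) (at p)"
      by (simp add: Q_def rotation_def)
    moreover have "(\<lambda>h. exp (\<i> * (of_real \<Omega> * - of_real (fst p))) * snd h +
        fst h *\<^sub>R (exp (\<i> * (of_real \<Omega> * - of_real (fst p))) * (- (\<i> * of_real \<Omega>))) * snd p) =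
      (\<lambda>h. Q (fst p) (snd h - fst h *\<^sub>R (\<i> * of_real \<Omega> * snd p)))"
      by (rule HOL.ext) (simp add: Q_def rotation_def scaleR_conv_of_real right_diff_distrib mult.left_commute)
    ultimately have Qd: "((\<lambda>p. Q (fst p) (snd p)) has_derivative
      (\<lambda>h. Q (fst p) (snd h - fst h *\<^sub>R (\<i> * of_real \<Omega> * snd p)))) (at p)" by simp
    have ed: "(\<eta> has_derivative (\<lambda>h. Re h *\<^sub>R \<eta>x z + Im h *\<^sub>R \<eta>y z)) (at z)" for z
      using C by (simp add: C1_plane_def)
    have td: "((\<lambda>p. \<tau> (fst p)) has_derivative (\<lambda>h. \<tau>' (fst p) * fst h)) (at p)"
      using has_derivative_compose[OF has_derivative_fst[OF has_derivative_ident] \<tau>(1)[unfolded has_field_derivative_def]] .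
    from has_derivative_mult[OF td has_derivative_compose[OF Qd ed]]
    show ?thesis unfolding \<phi>_def[abs_def] L_def[abs_def] by (simp add: add.commute)
  qed
  have Lb: "blinfun_apply (Blinfun (L p)) = L p" for p
    by (rule bounded_linear_Blinfun_apply[OF has_derivative_bounded_linear[OF \<phi>d]])
  have Qc: "continuous_on UNIV (\<lambda>p. Q (fst p) (f p))" if "continuous_on UNIV f" for f :: "real \<times> complex \<Rightarrow> complex"
    unfolding Q_def rotation_def by (intro continuous_intros that)
  have ec: "continuous_on UNIV \<eta>" "continuous_on UNIV \<eta>x" "continuous_on UNIV \<eta>y"
    using C C1_plane_continuous[OF C] by (auto simp: C1_plane_def)
  have Lc: "continuous_on UNIV (\<lambda>p. Blinfun (L p))"
  proof (rule continuous_on_blinfun_componentwise)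
    fix i :: "real \<times> complex"
    show "continuous_on UNIV (\<lambda>p. blinfun_apply (Blinfun (L p)) i)"
      unfolding Lb L_def
      by (intro continuous_intros Qc continuous_on_compose2[OF \<tau>(2)] continuous_on_compose2[OF \<tau>c]
        continuous_on_compose2[OF ec(1) Qc] continuous_on_compose2[OF ec(2) Qc] continuous_on_compose2[OF ec(3) Qc]) auto
  qed
  have supp: "compact (closure {p. \<phi> p \<noteq> 0})"
  proof -
    have "{p. \<phi> p \<noteq> 0} \<subseteq> {-1..1} \<times> cball 0 R0"
    proof
      fix p assume "p \<in> {p. \<phi> p \<noteq> 0}"
      then have "\<tau> (fst p) \<noteq> 0" "\<eta> (Q (fst p) (snd p)) \<noteq> 0" by (auto simp: \<phi>_def)
      moreover have "norm (Q (fst p) (snd p)) = norm (snd p)" by (simp add: Q_def rotation_cis norm_mult)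
      ultimately have "\<not> \<bar>fst p\<bar> > 1" "\<not> norm (snd p) > R0" using \<tau>(3) R0 by metis+
      then show "p \<in> {-1..1} \<times> cball 0 R0" by (cases p) auto
    qed
    moreover have "bounded ({-1..1::real} \<times> cball (0::complex) R0)" by (intro bounded_Times) auto
    ultimately show ?thesis using bounded_subset by (simp add: compact_closure)
  qed
  have tf: "C1_test_function \<phi>" unfolding C1_test_function_def
    by (intro conjI exI[of _ "\<lambda>p. Blinfun (L p)"] allI Lc supp) (simp add: Lb \<phi>d)
  have d: "\<And>p. (\<phi> has_derivative blinfun_apply (Blinfun (L p))) (at p)" by (simp add: Lb \<phi>d)
  have "(LINT t|lborel. (LINT x:D|lborel. Blinfun (L (t, rotation \<Omega> t x)) (0, rotation \<Omega> t (X x)))) = 0"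
    using w tf unfolding rotating_patch_def euler_weak_solution_def X_def
    by (subst rotating_weak_form[OF D d Lc supp, symmetric]) blast
  moreover have "Blinfun (L (t, rotation \<Omega> t x)) (0, rotation \<Omega> t (X x)) = \<tau> t * (\<eta>x x * Re (X x) + \<eta>y x * Im (X x))" for t x
    unfolding Lb L_def by (simp add: Q_def rotation_inverse mult.commute)
  ultimately have "(LINT t|lborel. \<tau> t * (LINT x:D|lborel. \<eta>x x * Re (X x) + \<eta>y x * Im (X x))) = 0"
    by (simp add: set_integral_mult_right)
  then have "(LINT t|lborel. \<tau> t) * (LINT x:D|lborel. \<eta>x x * Re (X x) + \<eta>y x * Im (X x)) = 0" by simp
  then show "(LINT x:D|lborel. \<eta>x x * Re (relative_velocity D \<Omega> x) + \<eta>y x * Im (relative_velocity D \<Omega> x)) = 0"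
    using \<tau>(4) by (simp add: X_def)
qed

section \<open>Weak stationarity and the boundary condition\<close>

lemma C1_plane_lipschitz:
  fixes f :: "complex \<Rightarrow> real"
  assumes C: "C1_plane f fx fy"
  obtains L where "L \<ge> 0" "\<And>x y. norm x \<le> R \<Longrightarrow> norm y \<le> R \<Longrightarrow> \<bar>f x - f y\<bar> \<le> L * norm (x - y)"
proof -
  have "bounded (fx ` cball 0 R)" "bounded (fy ` cball 0 R)"
    using C unfolding C1_plane_def
    by (auto intro!: compact_imp_bounded compact_continuous_image intro: continuous_on_subset)
  then obtain A B where AB: "\<And>x. x \<in> cball 0 R \<Longrightarrow> norm (fx x) \<le> A" "\<And>x. x \<in> cball 0 R \<Longrightarrow> norm (fy x) \<le> B"
    unfolding bounded_iff by blast
  have "norm (f x - f y) \<le> (\<bar>A\<bar> + \<bar>B\<bar>) * norm (x - y)" if "norm x \<le> R" "norm y \<le> R" for x y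
  proof (rule differentiable_bound[where S = "cball 0 R" and f' = "\<lambda>z h. Re h *\<^sub>R fx z + Im h *\<^sub>R fy z"])
    show "(f has_derivative (\<lambda>h. Re h *\<^sub>R fx z + Im h *\<^sub>R fy z)) (at z within cball 0 R)" for z
      using C unfolding C1_plane_def by (auto intro: has_derivative_at_withinI)
    fix z assume z: "z \<in> cball (0::complex) R"
    show "onorm (\<lambda>h. Re h *\<^sub>R fx z + Im h *\<^sub>R fy z) \<le> \<bar>A\<bar> + \<bar>B\<bar>"
    proof (rule onorm_le)
      fix h
      have "norm (Re h *\<^sub>R fx z + Im h *\<^sub>R fy z) \<le> \<bar>Re h\<bar> * norm (fx z) + \<bar>Im h\<bar> * norm (fy z)"
        using norm_triangle_ineq[of "Re h *\<^sub>R fx z" "Im h *\<^sub>R fy z"] by (simp add: abs_mult)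
      also have "\<dots> \<le> norm h * \<bar>A\<bar> + norm h * \<bar>B\<bar>"
        using AB(1)[OF z] AB(2)[OF z] by (intro add_mono mult_mono abs_Re_le_cmod abs_Im_le_cmod) auto
      finally show "norm (Re h *\<^sub>R fx z + Im h *\<^sub>R fy z) \<le> (\<bar>A\<bar> + \<bar>B\<bar>) * norm h"
        by (simp add: distrib_left mult.commute[of _ "norm h"])
    qed
  qed (use that in auto)
  then show ?thesis using that[of "\<bar>A\<bar> + \<bar>B\<bar>"] by auto
qed

lemma difference_quotient_limit:
  fixes f :: "complex \<Rightarrow> real"
  assumes f: "(f has_derivative f') (at x)" and s: "s \<longlonglongrightarrow> 0" "\<And>n::nat. s n > 0"
  shows "(\<lambda>n. (f (x + s n *\<^sub>R e) - f x) / s n) \<longlonglongrightarrow> f' e"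
proof -
  have "((\<lambda>t. x + t *\<^sub>R e) has_vector_derivative e) (at 0)" by (auto intro!: derivative_eq_intros)
  from has_vector_derivative_compose_linear[OF this, of f f'] f
  have "((\<lambda>t. f (x + t *\<^sub>R e)) has_real_derivative f' e) (at 0)"
    by (simp add: has_real_derivative_iff_has_vector_derivative)
  then have "((\<lambda>t. (f (x + t *\<^sub>R e) - f x) / t) \<longlongrightarrow> f' e) (at 0)" by (simp add: DERIV_def)
  moreover have "filterlim s (at 0) sequentially"
    unfolding filterlim_at using s by (auto intro!: always_eventually simp: less_imp_neq[symmetric])
  ultimately show ?thesis by (rule filterlim_compose)
qed

lemma lborel_integral_shift:
  fixes f :: "complex \<Rightarrow> real"
  assumes f: "integrable lborel f"
  shows "integrable lborel (\<lambda>x. f (x + c))" "(LINT x|lborel. f (x + c)) = (LINT x|lborel. f x)"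
proof -
  have [measurable]: "f \<in> borel_measurable borel" using borel_measurable_integrable[OF f] by simp
  have m: "(+) c \<in> measurable lborel borel" by simp
  have "integrable (distr lborel borel ((+) c)) f" using f by (simp add: lborel_distr_plus)
  then have "integrable lborel (\<lambda>x. f (c + x))" using integrable_distr_eq[OF m, of f] by simp
  then show "integrable lborel (\<lambda>x. f (x + c))" by (simp add: add.commute)
  have "(LINT x|lborel. f x) = (LINT x|distr lborel borel ((+) c). f x)" by (simp add: lborel_distr_plus)
  also have "\<dots> = (LINT x|lborel. f (c + x))" by (rule integral_distr[OF m]) simp
  finally show "(LINT x|lborel. f (x + c)) = (LINT x|lborel. f x)" by (simp add: add.commute)
qed

lemma C1_plane_mult:
  fixes f g :: "complex \<Rightarrow> real"
  assumes "C1_plane f fx fy" "C1_plane g gx gy"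
  shows "C1_plane (\<lambda>z. f z * g z) (\<lambda>z. f z * gx z + fx z * g z) (\<lambda>z. f z * gy z + fy z * g z)"
  unfolding C1_plane_def
proof (intro conjI allI)
  have c: "continuous_on UNIV f" "continuous_on UNIV g" using assms C1_plane_continuous by blast+
  show "continuous_on UNIV (\<lambda>z. f z * gx z + fx z * g z)" "continuous_on UNIV (\<lambda>z. f z * gy z + fy z * g z)"
    using assms c unfolding C1_plane_def by (auto intro!: continuous_intros)
  fix z
  have "(f has_derivative (\<lambda>h. Re h *\<^sub>R fx z + Im h *\<^sub>R fy z)) (at z)" "(g has_derivative (\<lambda>h. Re h *\<^sub>R gx z + Im h *\<^sub>R gy z)) (at z)"
    using assms unfolding C1_plane_def by auto
  from has_derivative_mult[OF this]
  show "((\<lambda>z. f z * g z) has_derivative (\<lambda>h. Re h *\<^sub>R (f z * gx z + fx z * g z) + Im h *\<^sub>R (f z * gy z + fy z * g z))) (at z)"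
    by (rule has_derivative_eq_rhs) (auto simp: algebra_simps)
qed

lemma C1_plane_of_real:
  assumes "C1_plane f fx fy"
  shows "C1_plane (\<lambda>z. complex_of_real (f z)) (\<lambda>z. of_real (fx z)) (\<lambda>z. of_real (fy z))"
  unfolding C1_plane_def
proof (intro conjI allI)
  show "continuous_on UNIV (\<lambda>z. complex_of_real (fx z))" "continuous_on UNIV (\<lambda>z. complex_of_real (fy z))"
    using assms unfolding C1_plane_def by (auto intro!: continuous_intros)
  fix z
  have "(f has_derivative (\<lambda>h. Re h *\<^sub>R fx z + Im h *\<^sub>R fy z)) (at z)" using assms unfolding C1_plane_def by auto
  from has_derivative_of_real[OF this]
  show "((\<lambda>z. complex_of_real (f z)) has_derivative (\<lambda>h. Re h *\<^sub>R of_real (fx z) + Im h *\<^sub>R of_real (fy z))) (at z)"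
    by (rule has_derivative_eq_rhs) (simp add: scaleR_conv_of_real)
qed

text \<open>A smooth substitute for ln |y - z|; its gradient is dominated by that of the logarithm
  and tends to it as e tends to 0.\<close>

lemma C1_plane_log:
  assumes e: "e > (0::real)"
  shows "C1_plane (\<lambda>y. ln ((norm (y - z))\<^sup>2 + e) / 2) (\<lambda>y. Re (y - z) / ((norm (y - z))\<^sup>2 + e)) (\<lambda>y. Im (y - z) / ((norm (y - z))\<^sup>2 + e))"
  unfolding C1_plane_def
proof (intro conjI allI)
  have pos: "(norm (y - z))\<^sup>2 + e > 0" for y using e by (simp add: add_nonneg_pos)
  then have nz: "(norm (y - z))\<^sup>2 + e \<noteq> 0" for y by (metis less_irrefl)
  show "continuous_on UNIV (\<lambda>y. Re (y - z) / ((norm (y - z))\<^sup>2 + e))" "continuous_on UNIV (\<lambda>y. Im (y - z) / ((norm (y - z))\<^sup>2 + e))"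
    using nz by (auto intro!: continuous_intros)
  fix y
  have "((\<lambda>y. y - z) has_derivative (\<lambda>h. h)) (at y)" by (auto intro!: derivative_eq_intros)
  from has_derivative_compose[OF this norm_square_has_derivative]
  have "((\<lambda>y. (norm (y - z))\<^sup>2 + e) has_derivative (\<lambda>h. 2 * Re (h * cnj (y - z)))) (at y)"
    by (rule has_derivative_add_const)
  from has_derivative_compose[OF this DERIV_ln[OF pos, unfolded has_field_derivative_def]]
  have "((\<lambda>y. ln ((norm (y - z))\<^sup>2 + e)) has_derivative (\<lambda>h. inverse ((norm (y - z))\<^sup>2 + e) * (2 * Re (h * cnj (y - z))))) (at y)" .
  from bounded_linear.has_derivative[OF bounded_linear_divide this, of 2]
  show "((\<lambda>y. ln ((norm (y - z))\<^sup>2 + e) / 2) has_derivative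
    (\<lambda>h. Re h *\<^sub>R (Re (y - z) / ((norm (y - z))\<^sup>2 + e)) + Im h *\<^sub>R (Im (y - z) / ((norm (y - z))\<^sup>2 + e)))) (at y)"
  proof (rule has_derivative_eq_rhs)
    have 1: "Re (h * cnj w) = Re h * Re w + Im h * Im w" for h w by simp
    have 2: "inverse q * (2 * (a * b + c * d)) / 2 = a *\<^sub>R (b / q) + c *\<^sub>R (d / q)" for a b c d q :: real
      by (simp add: inverse_eq_divide add_divide_distrib)
    show "(\<lambda>h. inverse ((norm (y - z))\<^sup>2 + e) * (2 * Re (h * cnj (y - z))) / 2) =
      (\<lambda>h. Re h *\<^sub>R (Re (y - z) / ((norm (y - z))\<^sup>2 + e)) + Im h *\<^sub>R (Im (y - z) / ((norm (y - z))\<^sup>2 + e)))"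
      unfolding 1 2 ..
  qed
qed

text \<open>Im (f' h) = 0 for h = 1 and h = \<i> forces f' = 0.\<close>

lemma real_holomorphic_constant:
  assumes f: "f holomorphic_on S" and S: "open S" "connected S" and r: "\<And>z. z \<in> S \<Longrightarrow> Im (f z) = 0"
  shows "f constant_on S"
proof (rule has_field_derivative_0_imp_constant_on[OF _ S(2,1)])
  fix z assume z: "z \<in> S"
  have d: "(f has_field_derivative deriv f z) (at z)" by (rule holomorphic_derivI[OF f S(1) z])
  then have "(f has_derivative (\<lambda>h. deriv f z * h)) (at z)" by (simp add: has_field_derivative_def)
  then have "((\<lambda>z. Im (f z)) has_derivative (\<lambda>h. Im (deriv f z * h))) (at z)" by (rule has_derivative_Im)
  moreover have "((\<lambda>z. Im (f z)) has_derivative (\<lambda>h. 0)) (at z)"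
    by (rule has_derivative_transform_within_open[OF has_derivative_const[of 0] S(1) z]) (simp add: r)
  ultimately have "(\<lambda>h. Im (deriv f z * h)) = (\<lambda>h. 0)" by (rule has_derivative_unique)
  then have "Im (deriv f z * 1) = 0" "Im (deriv f z * \<i>) = 0" by metis+
  then have "deriv f z = 0" by (simp add: complex_eq_iff)
  then show "(f has_field_derivative 0) (at z)" using d by simp
qed

lemma bdd_density_diff:
  assumes "bdd_density f" "bdd_density g"
  shows "bdd_density (\<lambda>y. f y - g y)"
proof -
  obtain M R M' R' where M: "\<And>y. norm (f y) \<le> M" "\<And>y. norm y > R \<Longrightarrow> f y = 0"
    "\<And>y. norm (g y) \<le> M'" "\<And>y. norm y > R' \<Longrightarrow> g y = 0"
    using assms unfolding bdd_density_def by metis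
  have "norm (f y - g y) \<le> M + M'" for y using norm_triangle_ineq4[of "f y" "g y"] M(1,3)[of y] by linarith
  moreover have "f y - g y = 0" if "norm y > max R R'" for y using M(2,4)[of y] that by simp
  moreover have "(\<lambda>y. f y - g y) \<in> borel_measurable borel"
    using assms[THEN bdd_density_measurable] by measurable
  ultimately show ?thesis unfolding bdd_density_def by blast
qed

lemma bdd_density_restrict:
  assumes X: "continuous_on UNIV X" and S: "S \<in> sets borel" "bounded S"
  shows "bdd_density (\<lambda>y. indicator S y * X y)"
proof -
  obtain R where R: "\<And>y. y \<in> S \<Longrightarrow> norm y \<le> R" using S(2) bounded_iff by metis
  have "bounded (X ` closure S)" using S(2)
    by (intro compact_imp_bounded compact_continuous_image continuous_on_subset[OF X]) auto
  then obtain M where M: "\<And>y. y \<in> S \<Longrightarrow> norm (X y) \<le> M" unfolding bounded_iff using closure_subset[of S] by blast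
  have "norm (indicator S y * X y) \<le> max M 0" for y using M[of y] by (cases "y \<in> S") auto
  moreover have "indicator S y * X y = 0" if "norm y > R" for y using R[of y] that by (cases "y \<in> S") auto
  moreover have "(\<lambda>y. indicator S y * X y) \<in> borel_measurable borel"
    using S(1) borel_measurable_continuous_onI[OF X] by measurable
  ultimately show ?thesis unfolding bdd_density_def by blast
qed

section \<open>Boundary values of the relative stream function\<close>

context patch
begin

lemma D_borel: "D \<in> sets borel"
  using D_open by simp

lemma boundary_between:
  assumes "x \<in> D" "y \<notin> D"
  obtains \<zeta> where "\<zeta> \<in> closed_segment x y" "\<zeta> \<in> J"
proof -
  have "closed_segment x y \<inter> frontier D \<noteq> {}"
    by (rule connected_Int_frontier) (use assms in auto)
  then show ?thesis using that frontier_D by blast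
qed

text \<open>Extended by zero, the stream function relative to its boundary value is Lipschitz continuous.
  For Lipschitz functions the bilinear form \<open>\<integral> \<partial>\<^sub>1 \<eta> \<partial>\<^sub>2 k\<close> is symmetric in the two
  directions, because it is a limit of integrals of products of differences which are symmetric by
  translation invariance.\<close>
theorem constant_imp_weakly_stationary:
  assumes \<mu>: "\<And>z. z \<in> J \<Longrightarrow> relative_stream D \<Omega> z = \<mu>"
  shows "weakly_stationary D (relative_velocity D \<Omega>)"
  unfolding weakly_stationary_def
proof (intro allI impI)
  fix \<eta> \<eta>x \<eta>y :: "complex \<Rightarrow> real" and R0 :: real
  assume C: "C1_plane \<eta> \<eta>x \<eta>y"
  define X where "X = relative_velocity D \<Omega>"
  define \<Psi> where "\<Psi> = relative_stream D \<Omega>"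
  have \<Psi>: "C1_plane \<Psi> (\<lambda>z. Im (X z)) (\<lambda>z. - Re (X z))"
    unfolding \<Psi>_def X_def by (rule C1_plane_relative_stream[OF D_borel D_bounded])
  obtain R where R: "R \<ge> 0" "\<And>y. y \<in> D \<Longrightarrow> norm y \<le> R" using D_bounded bounded_pos by (metis less_imp_le)
  define k where "k z = indicat_real D z * (\<Psi> z - \<mu>)" for z
  obtain L1 where L1: "L1 \<ge> 0" "\<And>x y. norm x \<le> R + 2 \<Longrightarrow> norm y \<le> R + 2 \<Longrightarrow> \<bar>\<eta> x - \<eta> y\<bar> \<le> L1 * norm (x - y)"
    using C1_plane_lipschitz[OF C] by metis
  obtain L2 where L2: "L2 \<ge> 0" "\<And>x y. norm x \<le> R + 2 \<Longrightarrow> norm y \<le> R + 2 \<Longrightarrow> \<bar>\<Psi> x - \<Psi> y\<bar> \<le> L2 * norm (x - y)"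
    using C1_plane_lipschitz[OF \<Psi>] by metis
  \<comment> \<open>The segment from x to y meets J, where \<Psi> = \<mu>; so k y = 0 may be
    replaced by the value of \<Psi> - \<mu> at that point.\<close>
  have k_out: "\<bar>k x - k y\<bar> \<le> L2 * norm (x - y)" if xy: "norm x \<le> R + 2" "norm y \<le> R + 2" "x \<in> D" "y \<notin> D" for x y
  proof -
    obtain \<zeta> where \<zeta>: "\<zeta> \<in> closed_segment x y" "\<zeta> \<in> J" using boundary_between[OF xy(3,4)] by blast
    have "closed_segment x y \<subseteq> cball 0 (R + 2)" using xy(1,2) by (intro closed_segment_subset) auto
    then have n: "norm \<zeta> \<le> R + 2" using \<zeta>(1) by auto
    have "k x - k y = \<Psi> x - \<Psi> \<zeta>" using xy(3,4) \<mu>[OF \<zeta>(2)] by (simp add: k_def \<Psi>_def)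
    then have "\<bar>k x - k y\<bar> \<le> L2 * norm (x - \<zeta>)" using L2(2)[OF xy(1) n] by simp
    also have "\<dots> \<le> L2 * norm (x - y)" using segment_bound(1)[OF \<zeta>(1)] L2(1)
      by (intro mult_left_mono) (auto simp: norm_minus_commute)
    finally show ?thesis .
  qed
  have k_lip: "\<bar>k x - k y\<bar> \<le> L2 * norm (x - y)" if xy: "norm x \<le> R + 2" "norm y \<le> R + 2" for x y
  proof -
    consider "x \<in> D" "y \<in> D" | "x \<in> D" "y \<notin> D" | "x \<notin> D" "y \<in> D" | "x \<notin> D" "y \<notin> D" by blast
    then show ?thesis
    proof cases
      case 1
      then show ?thesis using L2(2)[OF xy] by (simp add: k_def)
    next
      case 2
      then show ?thesis using k_out[OF xy] by simp
    next
      case 3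
      then show ?thesis using k_out[OF xy(2,1)] by (simp add: norm_minus_commute abs_minus_commute)
    next
      case 4
      then show ?thesis using L2(1) by (simp add: k_def)
    qed
  qed
  have \<eta>c: "continuous_on UNIV \<eta>" and \<Psi>c: "continuous_on UNIV \<Psi>" using C1_plane_continuous C \<Psi> by blast+
  have km [measurable]: "k \<in> borel_measurable borel"
    unfolding k_def using D_borel borel_measurable_continuous_onI[OF \<Psi>c] by measurable
  have sm [measurable]: "(\<lambda>x. \<eta> (x + c)) \<in> borel_measurable borel" for c
    by (intro borel_measurable_continuous_onI continuous_on_compose2[OF \<eta>c] continuous_intros) auto
  have fin: "emeasure lborel D < \<infinity>" by (rule emeasure_bounded_finite[OF D_bounded])
  have prod: "integrable lborel (\<lambda>x. \<eta> (x + c) * k x)" for c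
  proof -
    define f where "f x = \<eta> (x + c) * (\<Psi> x - \<mu>)" for x
    have "continuous_on UNIV f" unfolding f_def
      by (intro continuous_intros \<Psi>c continuous_on_compose2[OF \<eta>c]) auto
    then have "bounded (f ` closure D)" using D_bounded
      by (intro compact_imp_bounded compact_continuous_image) (auto intro: continuous_on_subset)
    then obtain M where M: "\<And>x. x \<in> D \<Longrightarrow> norm (f x) \<le> M" unfolding bounded_iff using closure_subset[of D] by blast
    show ?thesis
    proof (rule integrableI_bounded_set[where A = D and B = M])
      show "(\<lambda>x. \<eta> (x + c) * k x) \<in> borel_measurable lborel" by simp
      show "AE x in lborel. x \<in> D \<longrightarrow> norm (\<eta> (x + c) * k x) \<le> M" using M by (auto simp: f_def k_def)
      show "AE x in lborel. x \<notin> D \<longrightarrow> \<eta> (x + c) * k x = 0" by (simp add: k_def)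
    qed (use fin D_borel in auto)
  qed
  \<comment> \<open>The correlation of \<eta> and k. By translation invariance an integrated product
    of differences depends only on c at p - q, p, - q and 0.\<close>
  define c where "c v = (LINT x|lborel. \<eta> (x + v) * k x)" for v
  have shift: "has_bochner_integral lborel (\<lambda>x. \<eta> (x + p) * k (x + q)) (c (p - q))" for p q
  proof -
    have eq: "x + q + (p - q) = x + p" for x :: complex by simp
    show ?thesis using lborel_integral_shift[OF prod[of "p - q"], of q]
      unfolding eq c_def by (simp add: has_bochner_integral_iff)
  qed
  have dd: "(LINT x|lborel. (\<eta> (x + p) - \<eta> x) * (k (x + q) - k x)) = c (p - q) - c p - c (- q) + c 0" for p q
  proof -
    have "has_bochner_integral lborel (\<lambda>x. \<eta> (x + p) * k (x + q) - \<eta> (x + p) * k (x + 0) - \<eta> (x + 0) * k (x + q) + \<eta> (x + 0) * k (x + 0))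
      (c (p - q) - c (p - 0) - c (0 - q) + c (0 - 0))"
      by (intro has_bochner_integral_add has_bochner_integral_diff shift)
    then have "has_bochner_integral lborel (\<lambda>x. (\<eta> (x + p) - \<eta> x) * (k (x + q) - k x)) (c (p - q) - c p - c (- q) + c 0)"
      by (simp add: algebra_simps)
    then show ?thesis by (rule has_bochner_integral_integral_eq)
  qed
  define s where "s n = 1 / (real n + 1)" for n
  have s: "s n > 0" "s n \<le> 1" for n by (auto simp: s_def)
  have sl: "s \<longlonglongrightarrow> 0" unfolding s_def by real_asymp
  have limit: "(\<lambda>n. LINT x|lborel. ((\<eta> (x + s n *\<^sub>R d) - \<eta> x) / s n) * ((k (x + s n *\<^sub>R e) - k x) / s n))
      \<longlonglongrightarrow> (LINT x|lborel. (Re d * \<eta>x x + Im d * \<eta>y x) * (indicat_real D x * (Re e * Im (X x) - Im e * Re (X x))))"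
    if de: "norm d = 1" "norm e = 1" for d e
  \<comment> \<open>Both quotients are bounded by Lipschitz constants. For |x| > R + 1 the points x
    and x + s n e lie outside D because s n <= 1, so the quotient of k is zero.\<close>
  proof (rule integral_dominated_convergence[where w = "\<lambda>x. indicator (cball 0 (R + 1)) x * (L1 * L2)"])
    have "\<eta>x \<in> borel_measurable borel" "\<eta>y \<in> borel_measurable borel" "X \<in> borel_measurable borel"
    proof -
      show "\<eta>x \<in> borel_measurable borel" "\<eta>y \<in> borel_measurable borel" using C by (auto simp: C1_plane_def intro: borel_measurable_continuous_onI)
      have "continuous_on UNIV (\<lambda>z. Im (X z))" "continuous_on UNIV (\<lambda>z. - Re (X z))"
        using \<Psi> unfolding C1_plane_def by blast+
      from this[THEN borel_measurable_continuous_onI] show "X \<in> borel_measurable borel" by (simp add: borel_measurable_complex_iff)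
    qed
    then show "(\<lambda>x. (Re d * \<eta>x x + Im d * \<eta>y x) * (indicat_real D x * (Re e * Im (X x) - Im e * Re (X x)))) \<in> borel_measurable lborel"
      using D_borel by measurable
    have "(\<lambda>x. k (x + p)) \<in> borel_measurable borel" for p by measurable
    moreover have "\<eta> \<in> borel_measurable borel" by (rule borel_measurable_continuous_onI[OF \<eta>c])
    ultimately show "(\<lambda>x. (\<eta> (x + s n *\<^sub>R d) - \<eta> x) / s n * ((k (x + s n *\<^sub>R e) - k x) / s n)) \<in> borel_measurable lborel" for n
      by simp
    have "integrable lborel (indicat_real (cball (0::complex) (R + 1)))"
      by (intro integrable_real_indicator emeasure_bounded_finite) auto
    then show "integrable lborel (\<lambda>x::complex. indicat_real (cball 0 (R + 1)) x * (L1 * L2))" by (intro integrable_mult_left)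
    have ae: "AE x in lborel. x \<notin> J" using J_null by (rule AE_not_in)
    have \<eta>d: "(\<eta> has_derivative (\<lambda>h. Re h *\<^sub>R \<eta>x x + Im h *\<^sub>R \<eta>y x)) (at x)" for x using C by (simp add: C1_plane_def)
    have \<Psi>d: "(\<Psi> has_derivative (\<lambda>h. Re h *\<^sub>R Im (X x) + Im h *\<^sub>R - Re (X x))) (at x)" for x using \<Psi> by (simp add: C1_plane_def)
    have "(\<lambda>n. (\<eta> (x + s n *\<^sub>R d) - \<eta> x) / s n * ((k (x + s n *\<^sub>R e) - k x) / s n))
        \<longlonglongrightarrow> (Re d * \<eta>x x + Im d * \<eta>y x) * (indicat_real D x * (Re e * Im (X x) - Im e * Re (X x)))"
      if x: "x \<notin> J" for x
    proof (rule tendsto_mult)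
      show "(\<lambda>n. (\<eta> (x + s n *\<^sub>R d) - \<eta> x) / s n) \<longlonglongrightarrow> Re d * \<eta>x x + Im d * \<eta>y x"
        using difference_quotient_limit[OF \<eta>d sl s(1), of x d] by simp
      \<comment> \<open>A point off J lies in D or outside its closure, so k is locally \<Psi> -
        \<mu> or 0. The remaining set J is null.\<close>
      have kd: "(k has_derivative (\<lambda>h. indicat_real D x * (Re h *\<^sub>R Im (X x) + Im h *\<^sub>R - Re (X x)))) (at x)"
      proof (cases "x \<in> D")
        case True
        have "((\<lambda>z. \<Psi> z - \<mu>) has_derivative (\<lambda>h. Re h *\<^sub>R Im (X x) + Im h *\<^sub>R - Re (X x))) (at x)"
          using has_derivative_diff[OF \<Psi>d has_derivative_const[of \<mu>]] by simp
        then have "(k has_derivative (\<lambda>h. Re h *\<^sub>R Im (X x) + Im h *\<^sub>R - Re (X x))) (at x)"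
          by (rule has_derivative_transform_within_open[OF _ D_open True]) (simp add: k_def)
        then show ?thesis using True by simp
      next
        case False
        then have "x \<in> - closure D" using x closure_D by blast
        then have "(k has_derivative (\<lambda>h. 0)) (at x)"
          by (rule has_derivative_transform_within_open[OF has_derivative_const[of 0] open_Compl[OF closed_closure]])
            (use closure_subset[of D] in \<open>auto simp: k_def indicator_def\<close>)
        then show ?thesis using False by simp
      qed
      show "(\<lambda>n. (k (x + s n *\<^sub>R e) - k x) / s n) \<longlonglongrightarrow> indicat_real D x * (Re e * Im (X x) - Im e * Re (X x))"
        using difference_quotient_limit[OF kd sl s(1), of e] by simp
    qed
    then show "AE x in lborel. (\<lambda>n. (\<eta> (x + s n *\<^sub>R d) - \<eta> x) / s n * ((k (x + s n *\<^sub>R e) - k x) / s n))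
        \<longlonglongrightarrow> (Re d * \<eta>x x + Im d * \<eta>y x) * (indicat_real D x * (Re e * Im (X x) - Im e * Re (X x)))"
      using ae by (rule eventually_mono[rotated]) blast
    show "AE x in lborel. norm ((\<eta> (x + s n *\<^sub>R d) - \<eta> x) / s n * ((k (x + s n *\<^sub>R e) - k x) / s n))
       \<le> indicat_real (cball 0 (R + 1)) x * (L1 * L2)" for n
    proof (rule AE_I2)
      fix x :: complex
      have nd: "norm (s n *\<^sub>R d) = s n" "norm (s n *\<^sub>R e) = s n" using de s(1)[of n] by simp_all
      show "norm ((\<eta> (x + s n *\<^sub>R d) - \<eta> x) / s n * ((k (x + s n *\<^sub>R e) - k x) / s n))
       \<le> indicat_real (cball 0 (R + 1)) x * (L1 * L2)"
      proof (cases "norm x \<le> R + 1")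
        case True
        have n: "norm (x + s n *\<^sub>R d) \<le> R + 2" "norm (x + s n *\<^sub>R e) \<le> R + 2" "norm x \<le> R + 2"
          using True nd s(2)[of n] norm_triangle_ineq[of x "s n *\<^sub>R d"] norm_triangle_ineq[of x "s n *\<^sub>R e"] by linarith+
        have "\<bar>\<eta> (x + s n *\<^sub>R d) - \<eta> x\<bar> \<le> L1 * s n" "\<bar>k (x + s n *\<^sub>R e) - k x\<bar> \<le> L2 * s n"
          using L1(2)[OF n(1,3)] k_lip[OF n(2,3)] nd by simp_all
        then have "\<bar>\<eta> (x + s n *\<^sub>R d) - \<eta> x\<bar> / s n \<le> L1" "\<bar>k (x + s n *\<^sub>R e) - k x\<bar> / s n \<le> L2"
          using s(1)[of n] by (simp_all add: pos_divide_le_eq)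
        then have "(\<bar>\<eta> (x + s n *\<^sub>R d) - \<eta> x\<bar> / s n) * (\<bar>k (x + s n *\<^sub>R e) - k x\<bar> / s n) \<le> L1 * L2"
          using L1(1) s(1)[of n] by (intro mult_mono) auto
        then show ?thesis using True s(1)[of n] by (simp add: abs_mult)
      next
        case False
        have "x \<notin> D" using R(2)[of x] False by auto
        moreover have "norm (x + s n *\<^sub>R e) > R"
          using norm_triangle_ineq4[of "x + s n *\<^sub>R e" "s n *\<^sub>R e"] nd s(2)[of n] False by simp
        then have "x + s n *\<^sub>R e \<notin> D" using R(2) by force
        ultimately show ?thesis using False by (simp add: k_def)
      qed
    qed
  qed
  have lim1: "(\<lambda>n. LINT x|lborel. ((\<eta> (x + s n *\<^sub>R 1) - \<eta> x) / s n) * ((k (x + s n *\<^sub>R \<i>) - k x) / s n))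
      \<longlonglongrightarrow> (LINT x|lborel. indicat_real D x * - (\<eta>x x * Re (X x)))"
    using limit[of 1 \<i>] by (simp add: mult.left_commute)
  \<comment> \<open>The directions (- \<i>, - 1) have the same p - q as (1, \<i>) and exchange p
    with - q. The two integrals therefore agree for every n, and comparing their limits gives the
    identity.\<close>
  have lim2: "(\<lambda>n. LINT x|lborel. ((\<eta> (x + s n *\<^sub>R - \<i>) - \<eta> x) / s n) * ((k (x + s n *\<^sub>R - 1) - k x) / s n))
      \<longlonglongrightarrow> (LINT x|lborel. indicat_real D x * (\<eta>y x * Im (X x)))"
    using limit[of "- \<i>" "- 1"] by (simp add: mult.left_commute)
  have pull: "(LINT x|lborel. ((\<eta> (x + p) - \<eta> x) / r) * ((k (x + q) - k x) / r)) =
      (c (p - q) - c p - c (- q) + c 0) / (r * r)" for p q r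
    unfolding dd[symmetric] times_divide_times_eq by (rule integral_divide_zero)
  have eq: "(LINT x|lborel. ((\<eta> (x + s n *\<^sub>R 1) - \<eta> x) / s n) * ((k (x + s n *\<^sub>R \<i>) - k x) / s n)) =
      (LINT x|lborel. ((\<eta> (x + s n *\<^sub>R - \<i>) - \<eta> x) / s n) * ((k (x + s n *\<^sub>R - 1) - k x) / s n))" for n
    unfolding pull by (simp add: add.commute)
  have fin_eq: "(LINT x|lborel. indicat_real D x * - (\<eta>x x * Re (X x))) = (LINT x|lborel. indicat_real D x * (\<eta>y x * Im (X x)))"
    using LIMSEQ_unique[OF lim1] lim2 unfolding eq by blast
  have ii: "integrable lborel (\<lambda>x. indicat_real D x * f x)" if "continuous_on UNIV f" for f
  proof -
    have "set_integrable lborel D f"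
    proof (rule set_integrable_subset)
      show "set_integrable lborel (closure D) f"
        unfolding set_integrable_def using D_bounded by (intro borel_integrable_compact continuous_on_subset[OF that]) auto
    qed (use D_borel closure_subset in auto)
    then show ?thesis by (simp add: set_integrable_def)
  qed
  have cc: "continuous_on UNIV (\<lambda>x. \<eta>x x * Re (X x))" "continuous_on UNIV (\<lambda>x. \<eta>y x * Im (X x))"
  proof -
    have "continuous_on UNIV (\<lambda>x. - Re (X x))" using \<Psi> unfolding C1_plane_def by blast
    from continuous_on_minus[OF this] have "continuous_on UNIV (\<lambda>x. Re (X x))" by simp
    then show "continuous_on UNIV (\<lambda>x. \<eta>x x * Re (X x))" using C unfolding C1_plane_def by (intro continuous_on_mult) simp_all
    show "continuous_on UNIV (\<lambda>x. \<eta>y x * Im (X x))" using C \<Psi> unfolding C1_plane_def by (intro continuous_on_mult) simp_all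
  qed
  have "(LINT x:D|lborel. \<eta>x x * Re (X x) + \<eta>y x * Im (X x)) =
    (LINT x|lborel. indicat_real D x * (\<eta>x x * Re (X x))) + (LINT x|lborel. indicat_real D x * (\<eta>y x * Im (X x)))"
    unfolding set_lebesgue_integral_def real_scaleR_def distrib_left
    by (rule Bochner_Integration.integral_add[OF ii[OF cc(1)] ii[OF cc(2)]])
  also have "\<dots> = 0" unfolding fin_eq[symmetric] by simp
  finally show "(LINT x:D|lborel. \<eta>x x * Re (relative_velocity D \<Omega> x) + \<eta>y x * Im (relative_velocity D \<Omega> x)) = 0"
    by (simp add: X_def)
qed

text \<open>Testing with a truncated regularised logarithm centred at z gives - Re (X cnj (z - y)) /
  (|z - y|^2 + s n) on D. Dominated convergence as s n tends to 0 leaves the real part of the Cauchy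
  kernel, for z anywhere in the plane.\<close>

lemma real_cauchy_transform:
  assumes X: "continuous_on UNIV X" and w: "weakly_stationary D X"
  shows "Re (cauchy_transform (\<lambda>y. indicator D y * X y) z) = 0"
proof -
  obtain R where R: "R \<ge> 0" "\<And>y. y \<in> D \<Longrightarrow> norm y \<le> R" using D_bounded bounded_pos by (metis less_imp_le)
  obtain \<eta> \<eta>x \<eta>y where eta: "C1_plane \<eta> \<eta>x \<eta>y"
    "\<And>z. norm z \<le> R \<Longrightarrow> \<eta> z = (1::real)" "\<And>z. norm z \<le> R \<Longrightarrow> \<eta>x z = 0" "\<And>z. norm z \<le> R \<Longrightarrow> \<eta>y z = 0"
    "\<And>z. norm z \<ge> R + 1 \<Longrightarrow> \<eta> z = 0"
    using cutoff_function[OF R(1)] by metis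
  define f where "f y = indicator D y * X y" for y
  have fb: "bdd_density f" unfolding f_def by (rule bdd_density_restrict[OF X D_borel D_bounded])
  have fi: "integrable lborel (\<lambda>y. f y / (z - y))" by (rule cauchy_transform_integrable[OF fb])
  have [measurable]: "f \<in> borel_measurable borel" by (rule bdd_density_measurable[OF fb])
  define s where "s n = 1 / (real n + 1)" for n
  have s: "s n > 0" for n by (auto simp: s_def)
  have sl: "s \<longlonglongrightarrow> 0" unfolding s_def by real_asymp
  define r where "r n y = Re (f y * cnj (z - y)) / ((norm (z - y))\<^sup>2 + s n)" for n y
  have zero: "(LINT y|lborel. r n y) = 0" for n
  proof -
    \<comment> \<open>The cut-off \<eta> is 1 on D with vanishing gradient there, so it gives
      compact support without altering the integrand.\<close>
    define l where "l y = ln ((norm (y - z))\<^sup>2 + s n) / 2" for y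
    define q where "q y = (norm (y - z))\<^sup>2 + s n" for y
    have l: "C1_plane l (\<lambda>y. Re (y - z) / q y) (\<lambda>y. Im (y - z) / q y)"
      unfolding l_def q_def by (rule C1_plane_log[OF s])
    have "\<forall>y. norm y > R + 1 \<longrightarrow> l y * \<eta> y = 0" using eta(5) by simp
    then have "(LINT y:D|lborel. (l y * \<eta>x y + Re (y - z) / q y * \<eta> y) * Re (X y) + (l y * \<eta>y y + Im (y - z) / q y * \<eta> y) * Im (X y)) = 0"
      using w C1_plane_mult[OF l eta(1)] unfolding weakly_stationary_def by blast
    moreover have "indicat_real D y *\<^sub>R ((l y * \<eta>x y + Re (y - z) / q y * \<eta> y) * Re (X y) + (l y * \<eta>y y + Im (y - z) / q y * \<eta> y) * Im (X y))
       = - r n y" for y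
    proof (cases "y \<in> D")
      case True
      have "q y = (norm (z - y))\<^sup>2 + s n" by (simp add: q_def norm_minus_commute)
      moreover have "Re (X y * cnj (z - y)) = - (Re (y - z) * Re (X y) + Im (y - z) * Im (X y))" by (simp add: algebra_simps)
      ultimately show ?thesis using True R(2)[OF True] eta(2-4) by (simp add: r_def f_def add_divide_distrib minus_divide_left)
    qed (simp add: r_def f_def)
    ultimately show ?thesis unfolding set_lebesgue_integral_def by simp
  qed
  have "(\<lambda>n. LINT y|lborel. r n y) \<longlonglongrightarrow> (LINT y|lborel. Re (f y / (z - y)))"
  proof (rule integral_dominated_convergence[where w = "\<lambda>y. norm (f y / (z - y))"])
    show "(\<lambda>y. Re (f y / (z - y))) \<in> borel_measurable lborel" by measurable
    have [measurable]: "(\<lambda>y. cnj (z - y)) \<in> borel_measurable borel"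
      by (intro borel_measurable_continuous_onI continuous_intros)
    show "r n \<in> borel_measurable lborel" for n unfolding r_def by simp
    show "integrable lborel (\<lambda>y. norm (f y / (z - y)))" using fi by (rule integrable_norm)
    have eq: "f y / (z - y) = f y * cnj (z - y) / of_real ((norm (z - y))\<^sup>2)" for y
      using complex_div_cnj[of "f y" "z - y"] by simp
    have "(\<lambda>n. r n y) \<longlonglongrightarrow> Re (f y / (z - y))" for y
    proof (cases "y = z")
      case False
      have "(\<lambda>n. r n y) \<longlonglongrightarrow> Re (f y * cnj (z - y)) / ((norm (z - y))\<^sup>2 + 0)"
        unfolding r_def using False by (intro tendsto_intros sl) auto
      then show ?thesis unfolding eq[of y] Re_divide_of_real by simp
    qed (simp add: r_def)
    then show "AE y in lborel. (\<lambda>n. r n y) \<longlonglongrightarrow> Re (f y / (z - y))" by simp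
    have "norm (r n y) \<le> norm (f y / (z - y))" for n y
    proof (cases "y = z")
      case False
      have "\<bar>Re (f y * cnj (z - y))\<bar> \<le> norm (f y * cnj (z - y))" by (rule abs_Re_le_cmod)
      then have "norm (r n y) \<le> norm (f y * cnj (z - y)) / (norm (z - y))\<^sup>2"
        using s[of n] False unfolding r_def real_norm_def abs_divide by (intro frac_le) auto
      also have "\<dots> = norm (f y / (z - y))" unfolding eq[of y] norm_divide norm_of_real by simp
      finally show ?thesis .
    qed (simp add: r_def)
    then show "AE y in lborel. norm (r n y) \<le> norm (f y / (z - y))" for n by simp
  qed
  then have "(LINT y|lborel. Re (f y / (z - y))) = 0" unfolding zero using LIMSEQ_unique tendsto_const by blast
  moreover have "(LINT y|lborel. Re (f y / (z - y))) = Re (cauchy_transform f z)"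
    unfolding cauchy_transform_def by (rule integral_Re[OF fi])
  ultimately show ?thesis by (simp add: f_def[abs_def])
qed

lemma exterior_connected: "connected (- closure D)"
proof -
  have "connected (- cball (0::complex) 1)" by (intro connected_complement_bounded_convex) auto
  moreover have "continuous_on (- cball 0 1) \<Phi>" using ext by (auto simp: exterior_conformal_map_def holomorphic_on_imp_continuous_on)
  ultimately show ?thesis using connected_continuous_image \<Phi>_image by metis
qed

text \<open>By the Cauchy--Pompeiu formula the Cauchy transform of \<open>\<nabla>\<^sup>\<bottom>\<Psi>\<close> over the patch differs from
  a multiple of \<open>\<Psi>\<close> by a function that is holomorphic in the patch; it is holomorphic outside as
  well. As weak stationarity makes it real up to a constant factor, both functions are constant.\<close>
theorem weakly_stationary_imp_constant:
  assumes w: "weakly_stationary D (relative_velocity D \<Omega>)"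
  obtains \<mu> where "\<And>z. z \<in> J \<Longrightarrow> relative_stream D \<Omega> z = \<mu>"
proof -
  define X where "X = relative_velocity D \<Omega>"
  define \<Psi> where "\<Psi> = relative_stream D \<Omega>"
  have \<Psi>: "C1_plane \<Psi> (\<lambda>z. Im (X z)) (\<lambda>z. - Re (X z))"
    unfolding \<Psi>_def X_def by (rule C1_plane_relative_stream[OF D_borel D_bounded])
  have Xc: "continuous_on UNIV X" unfolding X_def relative_velocity_def
    by (intro continuous_intros cauchy_transform_continuous bdd_density_indicator D_borel D_bounded) auto
  obtain R where R: "R \<ge> 0" "\<And>y. y \<in> D \<Longrightarrow> norm y \<le> R" using D_bounded bounded_pos by (metis less_imp_le)
  obtain \<eta> \<eta>x \<eta>y where eta: "C1_plane \<eta> \<eta>x \<eta>y"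
    "\<And>z. norm z \<le> R \<Longrightarrow> \<eta> z = (1::real)" "\<And>z. norm z \<le> R \<Longrightarrow> \<eta>x z = 0" "\<And>z. norm z \<le> R \<Longrightarrow> \<eta>y z = 0"
    "\<And>z. norm z \<ge> R + 1 \<Longrightarrow> \<eta> z = 0"
    using cutoff_function[OF R(1)] by metis
  define f where "f y = indicator D y * X y" for y
  have fb: "bdd_density f" unfolding f_def by (rule bdd_density_restrict[OF Xc D_borel D_bounded])
  \<comment> \<open>Weak stationarity makes the transform of f purely imaginary, so this
    normalisation is real.\<close>
  define K where "K z = cauchy_transform f z / (2 * of_real pi * \<i>)" for z
  have Kreal: "Im (K z) = 0" for z
  proof -
    have "K z = - \<i> * (cauchy_transform f z / of_real (2 * pi))" by (simp add: K_def field_simps)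
    moreover have "Re (cauchy_transform f z) = 0"
      unfolding f_def by (rule real_cauchy_transform[OF Xc w[folded X_def]])
    ultimately show ?thesis by simp
  qed
  have Kc: "continuous_on S K" for S unfolding K_def
    by (intro continuous_intros cauchy_transform_continuous fb) auto
  have f_out: "f y = 0" if "y \<in> - closure D" for y using that closure_subset[of D] by (auto simp: f_def indicator_def)
  have "K holomorphic_on (- closure D)" unfolding K_def
    by (intro holomorphic_intros cauchy_transform_holomorphic[OF fb] f_out) auto
  then have "K constant_on (- closure D)"
    using Kreal exterior_connected by (intro real_holomorphic_constant) auto
  then obtain c1 where c1: "\<And>z. z \<in> - closure D \<Longrightarrow> K z = c1" by (auto simp: constant_on_def)
  \<comment> \<open>Every boundary point is a limit of exterior points, by the Jordan curve theorem,
    so continuity carries the exterior constant to J.\<close>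
  have KJ: "K z = c1" if "z \<in> J" for z
  proof -
    have "z \<in> closure (- closure D)"
      using jordan_domain[OF D_open D_connected D_bounded D_nonempty frontier_D] that by blast
    then show ?thesis using continuous_constant_on_closure[OF Kc c1] by blast
  qed
  define k where "k z = complex_of_real (\<Psi> z * \<eta> z)" for z
  define kx where "kx z = complex_of_real (\<Psi> z * \<eta>x z + Im (X z) * \<eta> z)" for z
  define ky where "ky z = complex_of_real (\<Psi> z * \<eta>y z + - Re (X z) * \<eta> z)" for z
  have k: "C1_plane k kx ky" unfolding k_def kx_def ky_def by (rule C1_plane_of_real[OF C1_plane_mult[OF \<Psi> eta(1)]])
  have k0: "k z = 0" if "norm z \<ge> R + 1" for z using eta(5)[OF that] by (simp add: k_def)
  define p where "p y = (kx y + \<i> * ky y) / 2" for y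
  have pc: "continuous_on UNIV p" using k unfolding p_def C1_plane_def by (auto intro!: continuous_intros)
  have p0: "p y = 0" if "norm y > R + 1" for y
    using C1_plane_derivative_zero[OF k k0 that] by (simp add: p_def)
  have pb: "bdd_density (\<lambda>y. 2 * \<i> * p y)"
    by (rule bdd_density_continuous[where R = "R + 1"]) (auto intro!: continuous_intros pc simp: p0)
  \<comment> \<open>Here p is the dbar derivative of k, and on D it equals - \<i> X / 2. Subtracting
    2 \<i> p makes G vanish on D, so its transform is holomorphic there.\<close>
  define G where "G y = f y - 2 * \<i> * p y" for y
  have Gb: "bdd_density G" unfolding G_def by (rule bdd_density_diff[OF fb pb])
  have G0: "G y = 0" if y: "y \<in> D" for y
  proof -
    have "p y = - \<i> * X y / 2" using eta(2-4)[OF R(2)[OF y]] by (simp add: p_def kx_def ky_def complex_eq_iff)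
    then show ?thesis using y by (simp add: G_def f_def)
  qed
  have CG: "cauchy_transform G z = cauchy_transform f z - 2 * \<i> * of_real pi * k z" for z
  proof -
    have "cauchy_transform G z = (LINT y|lborel. f y / (z - y) - 2 * \<i> * p y / (z - y))"
      unfolding cauchy_transform_def G_def by (simp only: diff_divide_distrib)
    also have "\<dots> = cauchy_transform f z - (LINT y|lborel. 2 * \<i> * p y / (z - y))"
      unfolding cauchy_transform_def
      by (rule Bochner_Integration.integral_diff[OF cauchy_transform_integrable[OF fb] cauchy_transform_integrable[OF pb]])
    also have "(LINT y|lborel. 2 * \<i> * p y / (z - y)) = 2 * \<i> * cauchy_transform p z"
      unfolding cauchy_transform_def by (simp only: times_divide_eq_right[symmetric] integral_mult_right_zero)
    also have "cauchy_transform p z = of_real pi * k z"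
      unfolding p_def by (rule cauchy_pompeiu_compact_support[OF k k0])
    finally show ?thesis by (simp add: mult.assoc)
  qed
  define M where "M z = cauchy_transform G z / (2 * of_real pi * \<i>)" for z
  have MK: "M z = K z - k z" for z unfolding M_def CG K_def by (simp add: diff_divide_distrib)
  have "M holomorphic_on D" unfolding M_def
    by (intro holomorphic_intros cauchy_transform_holomorphic[OF Gb D_open] G0) auto
  then have "M constant_on D"
    using D_open D_connected by (rule real_holomorphic_constant) (simp add: MK Kreal k_def)
  then obtain c2 where c2: "\<And>z. z \<in> D \<Longrightarrow> M z = c2" by (auto simp: constant_on_def)
  define N where "N z = K z - of_real (\<Psi> z)" for z
  have ND: "N z = c2" if "z \<in> D" for z
    using c2[OF that] eta(2)[OF R(2)[OF that]] by (simp add: MK N_def k_def)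
  have Nc: "continuous_on (closure D) N" unfolding N_def
    by (intro continuous_intros Kc continuous_on_subset[OF C1_plane_continuous[OF \<Psi>]]) auto
  have NJ: "N z = c2" if "z \<in> J" for z
    using continuous_constant_on_closure[OF Nc ND] that closure_D by blast
  show ?thesis
  proof (rule that[of "Re (c1 - c2)"])
    fix z assume z: "z \<in> J"
    \<comment> \<open>On J both constants are available: K = c1 from outside and K - \<Psi> = c2
      from inside.\<close>
    have "complex_of_real (\<Psi> z) = c1 - c2" using KJ[OF z] NJ[OF z] unfolding N_def by (simp add: diff_eq_eq add.commute)
    then show "relative_stream D \<Omega> z = Re (c1 - c2)" unfolding \<Psi>_def by (metis Re_complex_of_real)
  qed
qed

end

lemma hoelder_imp_uniform:
  fixes f :: "real \<Rightarrow> complex"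
  assumes \<alpha>: "\<alpha> > 0" and C: "\<And>s t. norm (f s - f t) \<le> C * \<bar>s - t\<bar> powr \<alpha>" and e: "e > 0"
  shows "\<exists>d>0. \<forall>s t. \<bar>s - t\<bar> < d \<longrightarrow> norm (f s - f t) < e"
proof -
  \<comment> \<open>Solves (|C| + 1) d^\<alpha> = e; the added 1 avoids a zero denominator and makes
    the final inequality strict.\<close>
  define d where "d = (e / (\<bar>C\<bar> + 1)) powr (1 / \<alpha>)"
  have d: "d > 0" using e by (simp add: d_def)
  have "norm (f s - f t) < e" if "\<bar>s - t\<bar> < d" for s t
  proof -
    have "\<bar>s - t\<bar> powr \<alpha> \<le> d powr \<alpha>" using that \<alpha> by (intro powr_mono2) auto
    also have "\<dots> = e / (\<bar>C\<bar> + 1)" using e \<alpha> by (simp add: d_def powr_powr)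
    finally have le: "\<bar>s - t\<bar> powr \<alpha> \<le> e / (\<bar>C\<bar> + 1)" .
    have "norm (f s - f t) \<le> \<bar>C\<bar> * \<bar>s - t\<bar> powr \<alpha>"
      using C[of s t] mult_right_mono[OF abs_ge_self[of C], of "\<bar>s - t\<bar> powr \<alpha>"] by simp
    also have "\<dots> \<le> \<bar>C\<bar> * (e / (\<bar>C\<bar> + 1))" using le by (intro mult_left_mono) auto
    also have "\<dots> < e" using e by (simp add: field_simps)
    finally show ?thesis .
  qed
  then show ?thesis using d by blast
qed

theorem theorem4p2p1:
  fixes D :: "complex set" and \<alpha> :: real
    and \<Phi> :: "complex \<Rightarrow> complex" and a :: real and c :: "nat \<Rightarrow> complex"
    and z0 :: complex and \<Omega> :: real
    and F H :: "complex \<Rightarrow> complex"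
  assumes "open D" and "connected D" and "simply_connected D" and "bounded D"
    and "0 < \<alpha>" and "\<alpha> < 1"
    and "C1_holder_jordan_curve \<alpha> (frontier D)"
    and "exterior_conformal_map D \<Phi> a c"
    and "z0 \<in> D"
    and "F = faber_series \<Phi> a c"
    and "H = path_primitive D z0 F"
  shows "(\<forall>z\<in>D. (H has_field_derivative F z) (at z)) \<and>
    (rotating_patch D \<Omega> \<longleftrightarrow>
      (\<exists>\<mu>::real. \<forall>z\<in>frontier D. (2 * \<Omega> - 1) / 2 * (norm z)\<^sup>2 + Re (H z) = \<mu>))"
proof -
  obtain g g' C where g: "\<And>t. (g has_vector_derivative g' t) (at t)" "\<And>t. g' t \<noteq> 0"
    "\<And>s t. norm (g' s - g' t) \<le> C * \<bar>s - t\<bar> powr \<alpha>"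
    "\<And>t. g (t + 1) = g t" "inj_on g {0..<1}" "range g = frontier D"
    using assms(7) unfolding C1_holder_jordan_curve_def by auto
  interpret patch D \<Phi> a c g g' "frontier D"
  proof
    show "D \<noteq> {}" using assms(9) by blast
    show "\<exists>d>0. \<forall>s t. \<bar>s - t\<bar> < d \<longrightarrow> norm (g' s - g' t) < e" if "e > 0" for e
      by (rule hoelder_imp_uniform[OF assms(5) g(3) that])
  qed (use assms g in auto)
  have H: "H = path_primitive D z0 (faber_series \<Phi> a c)" using assms by simp
  \<comment> \<open>The boundary expression is affine in the relative stream function with slope -2,
    so one is constant on the boundary exactly when the other is.\<close>
  obtain C where C: "\<And>z. z \<in> closure D \<Longrightarrow> (2 * \<Omega> - 1) / 2 * (norm z)\<^sup>2 + Re (H z) = C - 2 * relative_stream D \<Omega> z"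
    using path_primitive_stream(2)[OF assms(9), of \<Omega>] unfolding H by blast
  have cl: "z \<in> closure D" if "z \<in> frontier D" for z using that by (simp add: frontier_def)
  have "rotating_patch D \<Omega> \<longleftrightarrow> (\<exists>\<mu>. \<forall>z\<in>frontier D. relative_stream D \<Omega> z = \<mu>)"
    using rotating_imp_weakly_stationary[OF assms(1,4)] weakly_stationary_imp_rotating[OF assms(1,4)]
      weakly_stationary_imp_constant constant_imp_weakly_stationary by metis
  also have "\<dots> \<longleftrightarrow> (\<exists>\<mu>. \<forall>z\<in>frontier D. (2 * \<Omega> - 1) / 2 * (norm z)\<^sup>2 + Re (H z) = \<mu>)"
  proof
    assume "\<exists>\<mu>. \<forall>z\<in>frontier D. relative_stream D \<Omega> z = \<mu>"
    then obtain \<mu> where "\<And>z. z \<in> frontier D \<Longrightarrow> relative_stream D \<Omega> z = \<mu>" by blast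
    then show "\<exists>\<mu>. \<forall>z\<in>frontier D. (2 * \<Omega> - 1) / 2 * (norm z)\<^sup>2 + Re (H z) = \<mu>"
      using C cl by (intro exI[of _ "C - 2 * \<mu>"]) simp
  next
    assume "\<exists>\<mu>. \<forall>z\<in>frontier D. (2 * \<Omega> - 1) / 2 * (norm z)\<^sup>2 + Re (H z) = \<mu>"
    then obtain \<mu> where "\<And>z. z \<in> frontier D \<Longrightarrow> (2 * \<Omega> - 1) / 2 * (norm z)\<^sup>2 + Re (H z) = \<mu>" by blast
    then have "relative_stream D \<Omega> z = (C - \<mu>) / 2" if "z \<in> frontier D" for z
      using C[OF cl[OF that]] that by fastforce
    then show "\<exists>\<mu>. \<forall>z\<in>frontier D. relative_stream D \<Omega> z = \<mu>" by blast
  qed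
  finally show ?thesis using path_primitive_stream(1)[OF assms(9)] H assms(10) by simp
qed

end
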